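(* Let $U\subseteq\mathbb{R}^3$ be a domain and let $f:U\to\mathbb{R}$ be a function of class $C^{2,\alpha}$. Suppose that a regular level set $f^{-1}(c)$ of $f$ has a connected component in $U$ diffeomorphic to the sphere $\mathbb{S}^2$. Then any vector field $u$ in $U$ satisfying $$\operatorname{curl} u = f u,\qquad \operatorname{div} u=0$$ in $U$ is identically zero.
   Context: A domain is a connected open set. $C^{k,\alpha}$ denotes the usual Hölder class, $0<\alpha<1$. A level set $f^{-1}(c)$ is regular if $\nabla f$ does not vanish at any of its points. No a priori regularity assumption is made on $u$: if $f$ is of class $C^{k,\alpha}$, any solution $u$ is automatically of class $C^{k+1,\alpha}$. *)

theory Defs
  imports "HOL-Analysis.Analysis"
begin

section \<open>Differentiability classes on open sets\<close>

definition pderiv_at :: "'a::euclidean_space \<Rightarrow> ('a \<Rightarrow> 'b::real_normed_vector) \<Rightarrow> 'a \<Rightarrow> 'b" where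
  "pderiv_at e g x = frechet_derivative g (at x) e"

primrec Ck_on :: "nat \<Rightarrow> 'a::euclidean_space set \<Rightarrow> ('a \<Rightarrow> 'b::real_normed_vector) \<Rightarrow> bool" where
  "Ck_on 0 U g \<longleftrightarrow> continuous_on U g"
| "Ck_on (Suc k) U g \<longleftrightarrow>
     (\<forall>x\<in>U. g differentiable (at x)) \<and> (\<forall>e\<in>Basis. Ck_on k U (pderiv_at e g))"

definition smooth_on :: "'a::euclidean_space set \<Rightarrow> ('a \<Rightarrow> 'b::real_normed_vector) \<Rightarrow> bool" where
  "smooth_on U g \<longleftrightarrow> (\<forall>k. Ck_on k U g)"

text \<open>
  The class \<open>C\<^sup>k\<^sup>,\<^sup>\<alpha>\<close> on an open set is the local one: the partial derivatives of order \<open>k\<close> are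
  uniformly Hoelder continuous on each compact subset, with no condition at the boundary or at
  infinity. This is the class for which interior elliptic regularity raises \<open>k\<close> by one.
\<close>

definition Holder_cont_on :: "real \<Rightarrow> 'a::metric_space set \<Rightarrow> ('a \<Rightarrow> 'b::real_normed_vector) \<Rightarrow> bool" where
  "Holder_cont_on \<alpha> K g \<longleftrightarrow> (\<exists>C. \<forall>x\<in>K. \<forall>y\<in>K. norm (g x - g y) \<le> C * dist x y powr \<alpha>)"

primrec Ck_Holder_on ::
    "nat \<Rightarrow> real \<Rightarrow> 'a::euclidean_space set \<Rightarrow> ('a \<Rightarrow> 'b::real_normed_vector) \<Rightarrow> bool" where
  "Ck_Holder_on 0 \<alpha> U g \<longleftrightarrow> (\<forall>K. compact K \<and> K \<subseteq> U \<longrightarrow> Holder_cont_on \<alpha> K g)"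
| "Ck_Holder_on (Suc k) \<alpha> U g \<longleftrightarrow>
     (\<forall>x\<in>U. g differentiable (at x)) \<and> (\<forall>e\<in>Basis. Ck_Holder_on k \<alpha> U (pderiv_at e g))"

section \<open>Vector calculus in three-dimensional space\<close>

definition grad :: "(real^3 \<Rightarrow> real) \<Rightarrow> real^3 \<Rightarrow> real^3" where
  "grad g x = (\<chi> i. pderiv_at (axis i 1) g x)"

definition curl :: "(real^3 \<Rightarrow> real^3) \<Rightarrow> real^3 \<Rightarrow> real^3" where
  "curl v x =
    (let d = (\<lambda>i j. pderiv_at (axis i 1) v x $ j)
     in vector [d 2 3 - d 3 2, d 3 1 - d 1 3, d 1 2 - d 2 1])"

section \<open>Curl and divergence of locally integrable fields\<close>

definition test_function :: "'a::euclidean_space set \<Rightarrow> ('a \<Rightarrow> 'b::real_normed_vector) \<Rightarrow> bool" where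
  "test_function U \<phi> \<longleftrightarrow> smooth_on UNIV \<phi> \<and> (\<exists>K. compact K \<and> K \<subseteq> U \<and> (\<forall>x. x \<notin> K \<longrightarrow> \<phi> x = 0))"

definition locally_integrable_on ::
    "('a::euclidean_space \<Rightarrow> 'b::euclidean_space) \<Rightarrow> 'a set \<Rightarrow> bool" where
  "locally_integrable_on u U \<longleftrightarrow> (\<forall>K. compact K \<and> K \<subseteq> U \<longrightarrow> u absolutely_integrable_on K)"

text \<open>
  The differential equations are imposed in the sense of distributions, so that no regularity of
  the field is assumed. The signs come from the identities
  \<open>div (u \<times> \<phi>) = curl u \<bullet> \<phi> - u \<bullet> curl \<phi>\<close> and \<open>div (\<phi> u) = \<phi> div u + u \<bullet> grad \<phi>\<close>.
\<close>

definition has_curl_on ::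
    "(real^3 \<Rightarrow> real^3) \<Rightarrow> (real^3 \<Rightarrow> real^3) \<Rightarrow> (real^3) set \<Rightarrow> bool" where
  "has_curl_on u w U \<longleftrightarrow>
     (\<forall>\<phi>. test_function U \<phi> \<longrightarrow>
        (LINT x:U|lebesgue. u x \<bullet> curl \<phi> x) = (LINT x:U|lebesgue. w x \<bullet> \<phi> x))"

definition has_div_on ::
    "(real^3 \<Rightarrow> real^3) \<Rightarrow> (real^3 \<Rightarrow> real) \<Rightarrow> (real^3) set \<Rightarrow> bool" where
  "has_div_on u g U \<longleftrightarrow>
     (\<forall>\<phi>. test_function U \<phi> \<longrightarrow>
        (LINT x:U|lebesgue. u x \<bullet> grad \<phi> x) = - (LINT x:U|lebesgue. g x * \<phi> x))"

section \<open>Level sets and diffeomorphisms of subsets of Euclidean space\<close>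

definition level_set :: "'a set \<Rightarrow> ('a \<Rightarrow> 'b) \<Rightarrow> 'b \<Rightarrow> 'a set" where
  "level_set U f c = {x\<in>U. f x = c}"

definition regular_level_set :: "(real^3) set \<Rightarrow> (real^3 \<Rightarrow> real) \<Rightarrow> real \<Rightarrow> bool" where
  "regular_level_set U f c \<longleftrightarrow> (\<forall>x\<in>level_set U f c. grad f x \<noteq> 0)"

text \<open>A map on an arbitrary subset is of class \<open>C\<^sup>k\<close> if it locally extends to a \<open>C\<^sup>k\<close> map on an open
  set; for an embedded \<open>C\<^sup>k\<close> submanifold this is the intrinsic notion.\<close>

definition Ck_map :: "nat \<Rightarrow> 'a::euclidean_space set \<Rightarrow> ('a \<Rightarrow> 'b::real_normed_vector) \<Rightarrow> bool" where
  "Ck_map k S g \<longleftrightarrow>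
     (\<forall>x\<in>S. \<exists>W G. open W \<and> x \<in> W \<and> Ck_on k W G \<and> (\<forall>y\<in>S \<inter> W. G y = g y))"

definition Ck_diffeomorphic ::
    "nat \<Rightarrow> 'a::euclidean_space set \<Rightarrow> 'b::euclidean_space set \<Rightarrow> bool" where
  "Ck_diffeomorphic k S T \<longleftrightarrow>
     (\<exists>g h. Ck_map k S g \<and> Ck_map k T h \<and> homeomorphism S T g h)"

end

theory Submission
  imports Defs
begin

text \<open>Where the solution is continuous, testing the equation shows \<open>u \<bullet> grad f = 0\<close>, so \<open>u\<close> is tangent to the
 level sets. As \<open>curl u = f u\<close> is tangent as well, \<open>u\<close> restricts to a closed one-form on each level set. Near the
 spherical component the level sets are spheres, so there \<open>u\<close> is the gradient of a function \<open>P\<^sub>s\<close> along the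
 level set \<open>s\<close>, and testing \<open>div u = 0\<close> with a cutoff of \<open>P\<^sub>s\<close> supported in ever thinner shells gives
 \<open>\<integral> |u|\<^sup>2 = 0\<close> in a neighbourhood of the sphere. A Carleman inequality for the first-order system propagates
 the zero to all of \<open>U\<close>. Continuity comes from iterating the Newtonian potential representation of \<open>u\<close>.\<close>

text \<open>The obstacle is regularity. The field is only locally integrable at first and only
  continuous after the potential estimates, and the collar of the sphere, built from a function of
  class two, is only of class one. So the field itself is never differentiated: its equations act
  through test functions, pointwise identities are stated for mollified fields, and closedness of a
  pulled-back form means uniform approximation by fields with almost symmetric Jacobians. The
  potential on one level set is found on the punctured space, after pulling the form back by radial
  projection; that a sphere has no periods becomes the fact that two slit spaces overlap in a
  connected set. No regularity of the potential in the level is available. Each thin shell therefore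
  uses the potential of one frozen level, and the error is paid for by uniform continuity of the
  integrand. Unique continuation is run on the first-order system itself: the weight
  \<open>exp (\<tau> / |x|^2)\<close> splits the conjugated operator into an antisymmetric and a
  symmetric part with positive commutator, and the term \<open>f u\<close> is absorbed for large
  \<tau>.\<close>

abbreviation Lebesgue_integral :: "('a::euclidean_space => 'b::{banach,second_countable_topology}) => 'b" (binder "LI " 10) where
 "Lebesgue_integral F == integral\<^sup>L lborel F"

notation (input) scaleR (infixr "*^" 75)

section \<open>Convolutions\<close>

lemma lborel_reflect:
 fixes a :: "'a::euclidean_space"
 shows "lborel = distr lborel borel (%x. a - x)"
 using lborel_affine[of "-1" a] by (simp add: density_1)

lemma integral_reflect:
 fixes F :: "'a::euclidean_space => 'b::euclidean_space"
 assumes [measurable]: "F \<in> borel_measurable borel"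
 shows "(LI x. F (a - x)) = (LI x. F x)"
proof -
 have "(LI x. F x) = (\<integral>x. F x \<partial>distr lborel borel (%x. a - x))"
  using lborel_reflect[of a] by simp
 also have "\<dots> = (LI x. F (a - x))"
  by (rule integral_distr) auto
 finally show ?thesis ..
qed

lemma integrable_reflect:
 fixes F :: "'a::euclidean_space => 'b::euclidean_space"
 assumes "integrable lborel F"
 shows "integrable lborel (%x. F (a - x))"
proof -
 have "integrable (distr lborel borel (%x. a - x)) F"
  using assms lborel_reflect[of a] by simp
 then show ?thesis
  using integrable_distr_eq[of "%x. a - x" lborel borel F] assms by simp
qed

lemma nn_integral_reflect:
 fixes F :: "'a::euclidean_space => ennreal"
 assumes [measurable]: "F \<in> borel_measurable borel"
 shows "(\<integral>\<^sup>+x. F (a - x) \<partial>lborel) = (\<integral>\<^sup>+x. F x \<partial>lborel)"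
proof -
 have "(\<integral>\<^sup>+x. F x \<partial>lborel) = (\<integral>\<^sup>+x. F x \<partial>distr lborel borel (%x. a - x))"
  using lborel_reflect[of a] by simp
 also have "\<dots> = (\<integral>\<^sup>+x. F (a - x) \<partial>lborel)"
  by (rule nn_integral_distr) auto
 finally show ?thesis ..
qed

lemma uniformly_continuous_UNIV_D:
 assumes "uniformly_continuous_on UNIV k" "e > 0"
 shows "\<exists>d>0. \<forall>x y. dist y x < d --> dist (k y) (k x) < e"
 using assms by (simp add: uniformly_continuous_on_def)

lemma continuous_compact_support:
 fixes k :: "'a::euclidean_space => 'b::euclidean_space"
 assumes k: "continuous_on UNIV k" and K: "compact K" "!!x. x \<notin> K ==> k x = 0"
 shows "uniformly_continuous_on UNIV k" and "\<exists>B\<ge>0. \<forall>x. norm (k x) <= B" and "integrable lborel k"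
proof -
 obtain r where r: "r > 0" "!!x. x \<in> K ==> norm x <= r"
  using compact_imp_bounded[OF K(1)] unfolding bounded_pos by auto
 have z: "k x = 0" if "norm x > r" for x
  using that r K(2) by force
 have uc: "uniformly_continuous_on (cball 0 (r+2)) k"
  by (rule compact_uniformly_continuous) (auto intro: continuous_on_subset[OF k])
 show "uniformly_continuous_on UNIV k"
  unfolding uniformly_continuous_on_def
 proof (intro allI impI)
  fix e :: real assume "e > 0"
  then obtain d where d: "d > 0" "!!x y. x \<in> cball 0 (r+2) ==> y \<in> cball 0 (r+2) ==> dist y x < d ==> dist (k y) (k x) < e"
   using uc unfolding uniformly_continuous_on_def by metis
  have "dist (k y) (k x) < e" if "dist y x < min d 1" for x y
  proof (cases "norm x <= r + 1")
   case True
   then have "norm y <= r + 2"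
    using that norm_triangle_ineq[of x "y - x"] by (simp add: dist_norm)
   then show ?thesis using d(2)[of x y] True that by auto
  next
   case False
   then have "norm y > r"
    using that norm_triangle_ineq[of y "x - y"] by (simp add: dist_norm norm_minus_commute)
   then show ?thesis using False z \<open>e > 0\<close> by auto
  qed
  then show "\<exists>d>0. \<forall>x\<in>UNIV. \<forall>x'\<in>UNIV. dist x' x < d --> dist (k x') (k x) < e"
   using d(1) by (intro exI[of _ "min d 1"]) auto
 qed
 have "compact (k ` cball 0 r)"
  by (rule compact_continuous_image) (auto intro: continuous_on_subset[OF k])
 then obtain B where "B > 0" "!!x. x \<in> cball 0 r ==> norm (k x) <= B"
  using compact_imp_bounded bounded_pos by (metis imageI)
 then have B: "B > 0" "norm (k x) <= B" for x
  using z[of x] by (cases "norm x <= r"; auto)+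
 then show "\<exists>B\<ge>0. \<forall>x. norm (k x) <= B" by (intro exI[of _ B]) auto
 have [measurable]: "k \<in> borel_measurable borel"
  using k by (simp add: borel_measurable_continuous_onI)
 have "integrable lborel (%x. indicator (cball 0 r) x *^ k x)"
  using borel_integrable_compact[of "cball 0 r" k] continuous_on_subset[OF k] by auto
 moreover have "(%x. indicator (cball 0 r) x *^ k x) = k"
  using z by (auto simp: indicator_def fun_eq_iff)
 ultimately show "integrable lborel k" by simp
qed

lemma integrable_bounded_scaleR:
 fixes g :: "'a => 'b::euclidean_space"
 assumes g: "integrable M g" and [measurable]: "k \<in> borel_measurable M" and B: "!!x. \<bar>k x\<bar> <= (B::real)"
 shows "integrable M (%x. k x *^ g x)"
proof (rule Bochner_Integration.integrable_bound[where f="%x. B *^ g x"])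
 have "\<bar>k x\<bar> * norm (g x) <= \<bar>B\<bar> * norm (g x)" for x
  using B[of x] by (intro mult_right_mono) auto
 then show "AE x in M. norm (k x *^ g x) <= norm (B *^ g x)"
  by auto
qed (use g in auto)

definition conv :: "('a::euclidean_space => real) => ('a => 'b::euclidean_space) => 'a => 'b" where
 "conv k g x = (LI z. k (x - z) *^ g z)"

lemma conv_reflect:
 assumes [measurable]: "k \<in> borel_measurable borel" "g \<in> borel_measurable borel"
 shows "conv k g x = (LI z. k z *^ g (x - z))"
 unfolding conv_def using integral_reflect[of "%z. k z *^ g (x - z)" x] by simp

lemma conv_integrable:
 fixes g :: "'a::euclidean_space => 'b::euclidean_space"
 assumes "integrable lborel g" "continuous_on UNIV k" "compact K" "!!x. x \<notin> K ==> k x = 0"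
 shows "integrable lborel (%z. k (x - z) *^ g z)"
proof -
 have [measurable]: "k \<in> borel_measurable borel"
  using assms(2) by (simp add: borel_measurable_continuous_onI)
 obtain B where "!!x. norm (k x) <= B"
  using continuous_compact_support(2)[OF assms(2-4)] by auto
 then have B: "\<bar>k (x - z)\<bar> <= B" for z by (simp add: real_norm_def[symmetric] del: real_norm_def)
 show ?thesis by (rule integrable_bounded_scaleR[where B=B]) (use assms(1) B in auto)
qed

text \<open>A kernel of mass one turns \<open>c\<close> into \<open>LI z. k (x - z) *^ c\<close>, so
  the difference is an average of \<open>g z - c\<close> over the ball of radius \<open>r\<close>.
  The free constant makes one estimate serve for limits (\<open>c\<close> the value at the point),
  for bounds (\<open>c = 0\<close>) and for cutoffs (\<open>c = 1\<close>).\<close>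

lemma conv_uniform:
 assumes g: "integrable lborel (%z. k (x - z) *^ g z)"
  and k: "integrable lborel k" "(LI z. k z) = 1" "!!z. k z >= 0" "!!z. norm z > r ==> k z = 0"
  and e: "!!z. dist x z <= r ==> norm (g z - c) <= e"
 shows "norm (conv k g x - c) <= e"
proof -
 have ik: "integrable lborel (%z. k (x - z))" by (rule integrable_reflect) fact
 have i1: "(LI z. k (x - z)) = 1"
  using k by (subst integral_reflect) auto
 have "conv k g x - c = (LI z. k (x - z) *^ g z) - (LI z. k (x - z) *^ c)"
  using ik i1 by (simp add: conv_def)
 also have "\<dots> = (LI z. k (x - z) *^ g z - k (x - z) *^ c)"
  using g ik by (subst Bochner_Integration.integral_diff) auto
 also have "norm \<dots> <= (LI z. k (x - z) * e)"
 proof (rule Bochner_Integration.integral_norm_bound_integral)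
  show "norm (k (x - z) *^ g z - k (x - z) *^ c) <= k (x - z) * e" for z
  proof (cases "dist x z <= r")
   case True
   then show ?thesis using e[OF True] k(3)[of "x - z"]
    by (simp flip: scaleR_diff_right add: mult_left_mono)
  next
   case False
   then show ?thesis using k(4)[of "x - z"] by (simp add: dist_norm)
  qed
 qed (use g ik in auto)
 also have "\<dots> = e" using ik i1 by simp
 finally show ?thesis .
qed

lemma conv_has_derivative:
 fixes g :: "'a::euclidean_space => 'b::euclidean_space"
 assumes g: "integrable lborel g"
  and k: "!!x. (k has_derivative (%h. k' x \<bullet> h)) (at x)"
  and k': "continuous_on UNIV k'" and K: "compact K" "!!x. x \<notin> K ==> k x = 0" "!!x. x \<notin> K ==> k' x = 0"
 shows "(conv k g has_derivative (%h. conv (%y. k' y \<bullet> h) g x)) (at x)"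
proof -
 have kc: "continuous_on UNIV k"
  by (rule continuous_at_imp_continuous_on) (use k has_derivative_continuous in blast)
 have ih: "integrable lborel (%z. (k' (x - z) \<bullet> h) *^ g z)" for x h
  by (rule conv_integrable[OF g _ K(1)]) (use K(3) k' in "auto intro!: continuous_intros")
 have i0: "integrable lborel (%z. k (x - z) *^ g z)" for x
  by (rule conv_integrable[OF g kc K(1) K(2)])
 obtain B where B: "!!x. norm (k' x) <= B"
  using continuous_compact_support(2)[OF k' K(1) K(3)] by auto
 have lin: "linear (%h. conv (%y. k' y \<bullet> h) g x)"
 proof
  show "conv (%y. k' y \<bullet> (a + b)) g x = conv (%y. k' y \<bullet> a) g x + conv (%y. k' y \<bullet> b) g x" for a b
   unfolding conv_def by (simp add: inner_add_right scaleR_add_left Bochner_Integration.integral_add ih)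
  show "conv (%y. k' y \<bullet> (r *^ a)) g x = r *^ conv (%y. k' y \<bullet> a) g x" for a r
   unfolding conv_def by (simp flip: integral_scaleR_right)
 qed
 let ?G = "\<integral>z. norm (g z) \<partial>lborel"
 have "\<exists>d>0. \<forall>h. norm h < d --> norm (conv k g (x + h) - conv k g x - conv (%y. k' y \<bullet> h) g x) <= e * norm h"
  if "e > 0" for e
 proof -
  \<comment> \<open>One is added to the mass of \<open>g\<close> so that the quotient makes sense
    when \<open>g\<close> vanishes almost everywhere.\<close>
  define e' where "e' = e / (?G + 1)"
  have G: "?G >= 0" by simp
  have e': "e' > 0" unfolding e'_def using G \<open>e > 0\<close> by (intro divide_pos_pos add_nonneg_pos) auto
  have "?G + 1 ~= 0" using G by linarith
  then have "e' * (?G + 1) = e" unfolding e'_def by simp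
  then have e'G: "e' * ?G <= e" using e' unfolding distrib_left by linarith
  obtain d where d: "d > 0" "!!y y'. dist y' y < d ==> dist (k' y') (k' y) < e'"
   using uniformly_continuous_UNIV_D[OF continuous_compact_support(1)[OF k' K(1) K(3)] e'] by blast
  have est: "\<bar>k (y + h) - k y - k' y \<bullet> h\<bar> <= e' * norm h" if h: "norm h < d" for y h
  proof -
   \<comment> \<open>The mean value inequality for \<open>k\<close> minus its linear part at
     \<open>y\<close>. Uniform continuity of \<open>k'\<close> makes the derivative of this
     difference small uniformly in \<open>y\<close>.\<close>
   have "norm ((%w. k w - k' y \<bullet> w) (y + h) - (%w. k w - k' y \<bullet> w) y) <= e' * norm ((y + h) - y)"
   proof (rule differentiable_bound[where S="ball y d" and f'="%w v. k' w \<bullet> v - k' y \<bullet> v"])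
    fix w assume w: "w \<in> ball y d"
    show "((%w. k w - k' y \<bullet> w) has_derivative (%v. k' w \<bullet> v - k' y \<bullet> v)) (at w within ball y d)"
     by (rule has_derivative_diff[OF has_derivative_at_withinI[OF k] bounded_linear_imp_has_derivative[OF bounded_linear_inner_right]])
    show "onorm (%v. k' w \<bullet> v - k' y \<bullet> v) <= e'"
    proof (rule onorm_bound)
     fix v
     have "norm (k' w \<bullet> v - k' y \<bullet> v) = \<bar>(k' w - k' y) \<bullet> v\<bar>" by (simp add: inner_diff_left)
     also have "\<dots> <= norm (k' w - k' y) * norm v" by (rule Cauchy_Schwarz_ineq2)
     also have "\<dots> <= e' * norm v"
      using d(2)[of w y] w by (intro mult_right_mono) (auto simp: dist_norm norm_minus_commute)
     finally show "norm (k' w \<bullet> v - k' y \<bullet> v) <= e' * norm v" .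
    qed (use e' in auto)
   qed (use d h in "auto simp: dist_norm")
   then show ?thesis by (simp add: inner_add_right algebra_simps)
  qed
  have "norm (conv k g (x + h) - conv k g x - conv (%y. k' y \<bullet> h) g x) <= e * norm h" if h: "norm h < d" for h
  proof -
   have "conv k g (x + h) - conv k g x - conv (%y. k' y \<bullet> h) g x
    = (LI z. k (x + h - z) *^ g z - k (x - z) *^ g z - (k' (x - z) \<bullet> h) *^ g z)"
    unfolding conv_def by (simp add: Bochner_Integration.integral_diff i0 ih)
   also have "norm \<dots> <= (LI z. (e' * norm h) * norm (g z))"
   proof (rule Bochner_Integration.integral_norm_bound_integral)
    fix z
    have "norm (k (x + h - z) *^ g z - k (x - z) *^ g z - (k' (x - z) \<bullet> h) *^ g z)
     = \<bar>k ((x - z) + h) - k (x - z) - k' (x - z) \<bullet> h\<bar> * norm (g z)"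
     by (simp add: scaleR_diff_left[symmetric] add_diff_eq diff_add_eq add.commute)
    also have "\<dots> <= (e' * norm h) * norm (g z)"
     by (intro mult_right_mono est h) auto
    finally show "norm (k (x + h - z) *^ g z - k (x - z) *^ g z - (k' (x - z) \<bullet> h) *^ g z) <= (e' * norm h) * norm (g z)" .
   qed (use g i0 ih in "auto intro!: Bochner_Integration.integrable_diff")
   also have "\<dots> = (e' * ?G) * norm h" by simp
   also have "\<dots> <= e * norm h" using e'G by (rule mult_right_mono) auto
   finally show ?thesis .
  qed
  then show ?thesis using d(1) by blast
 qed
 then show ?thesis
  unfolding has_derivative_at_alt
  using lin by (auto simp: linear_conv_bounded_linear) (metis add.commute diff_add_cancel)
qed

lemma conv_continuous:
 fixes g :: "'a::euclidean_space => 'b::euclidean_space"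
 assumes g: "integrable lborel g" and k: "continuous_on UNIV k" and B: "!!x. \<bar>k x\<bar> <= B"
 shows "continuous_on UNIV (conv k g)"
proof -
 have [measurable]: "k \<in> borel_measurable borel" "g \<in> borel_measurable borel"
  using k g by (auto simp: borel_measurable_continuous_onI)
 have kc: "isCont k y" for y using k continuous_on_eq_continuous_at by blast
 have "isCont (conv k g) x" for x
  unfolding continuous_at_sequentially comp_def
 proof (intro allI impI)
  fix X assume X: "X \<longlonglongrightarrow> x"
  show "(%n. conv k g (X n)) \<longlonglongrightarrow> conv k g x"
   unfolding conv_def
  proof (rule integral_dominated_convergence[where w="%z. B * norm (g z)"])
   show "AE z in lborel. (%n. k (X n - z) *^ g z) \<longlonglongrightarrow> k (x - z) *^ g z"
    by (intro always_eventually allI tendsto_scaleR isCont_tendsto_compose[OF kc] tendsto_diff X tendsto_const)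
   show "AE z in lborel. norm (k (X n - z) *^ g z) <= B * norm (g z)" for n
    using B by (auto intro!: mult_right_mono)
  qed (use g in auto)
 qed
 then show ?thesis by (simp add: continuous_at_imp_continuous_on)
qed

section \<open>Smooth functions with compact support\<close>

lemma pderiv_at_eq: "(g has_derivative D) (at x) ==> pderiv_at e g x = D e"
 unfolding pderiv_at_def using frechet_derivative_at by metis

lemma Ck_on_SucI:
 assumes "!!x. (g has_derivative D x) (at x)" "!!e. e \<in> Basis ==> Ck_on k UNIV (%x. D x e)"
 shows "Ck_on (Suc k) UNIV g"
proof -
 have "pderiv_at e g = (%x. D x e)" for e
  using pderiv_at_eq[OF assms(1)] by auto
 then show ?thesis using assms by (auto simp: differentiable_def)
qed

lemma Ck_on_lower: "Ck_on (Suc k) U g ==> Ck_on k U g"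
proof (induction k arbitrary: g)
 case 0
 then show ?case
  using differentiable_imp_continuous_within by (auto intro!: continuous_at_imp_continuous_on)
next
 case (Suc k)
 then show ?case by (metis Ck_on.simps(2))
qed

lemma Ck_on_const: "Ck_on k UNIV (%x. c)"
proof (induction k arbitrary: c)
 case (Suc k)
 show ?case by (rule Ck_on_SucI[where D="%x h. 0"]) (use Suc in auto)
qed auto

lemma Ck_on_add: "Ck_on k UNIV f ==> Ck_on k UNIV g ==> Ck_on k UNIV (%x. f x + g x)"
proof (induction k arbitrary: f g)
 case 0 then show ?case by (auto intro: continuous_intros)
next
 case (Suc k)
 show ?case
 proof (rule Ck_on_SucI)
  show "((%x. f x + g x) has_derivative (%e. pderiv_at e f x + pderiv_at e g x)) (at x)" for x
   unfolding pderiv_at_def using Suc.prems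
   by (auto intro!: derivative_eq_intros simp: frechet_derivative_works[symmetric])
 qed (use Suc in auto)
qed

lemma Ck_on_scaleR:
 fixes f :: "'a::euclidean_space => real" and g :: "'a => 'b::real_normed_vector"
 shows "Ck_on k UNIV f ==> Ck_on k UNIV g ==> Ck_on k UNIV (%x. f x *^ g x)"
proof (induction k arbitrary: f g)
 case 0 then show ?case by (auto intro: continuous_intros)
next
 case (Suc k)
 have l: "Ck_on k UNIV f" "Ck_on k UNIV g" using Suc.prems Ck_on_lower by blast+
 show ?case
 proof (rule Ck_on_SucI)
  show "((%x. f x *^ g x) has_derivative (%e. f x *^ pderiv_at e g x + pderiv_at e f x *^ g x)) (at x)" for x
   unfolding pderiv_at_def using Suc.prems
   by (auto intro!: derivative_eq_intros simp: frechet_derivative_works[symmetric])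
 qed (use Suc l in "auto intro!: Ck_on_add")
qed

text \<open>Derivatives of \<open>exp (- 1 / t)\<close> stay in the span of these functions, so the
  exponent \<open>n\<close> lets an induction on the order of differentiability close.\<close>

definition expfun :: "nat => real => real" where
 "expfun n t = (if t > 0 then exp (- (1 / t)) / t ^ n else 0)"

text \<open>The exponential series dominates its term of order \<open>n + 2\<close>. The remaining
  power \<open>t^2\<close> is what the derivative at 0 requires: the difference quotient is then of
  order \<open>t\<close>.\<close>

lemma expfun_bound: "expfun n t <= fact (n + 2) * t\<^sup>2"
proof (cases "t > 0")
 case True
 have *: "x ^ m / fact m <= exp x" if "x >= 0" for x :: real and m
 proof -
  have "(\<Sum>i\<in>{m}. x ^ i /\<^sub>R fact i) <= exp x"
   unfolding exp_def using that
   by (intro sum_le_suminf summable_exp_generic) auto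
  then show ?thesis by (simp add: divide_inverse mult.commute)
 qed
 have "(1/t) ^ (n+2) / fact (n+2) <= exp (1/t)" by (rule *) (use True in auto)
 then have "1 <= (fact (n+2) * t ^ (n+2)) * exp (1/t)"
  using True by (simp add: power_divide pos_divide_le_eq del: fact_Suc power_Suc add_2_eq_Suc') (simp add: mult.commute mult.left_commute)
 then have "exp (- (1/t)) <= fact (n+2) * t ^ (n+2)"
  by (simp add: exp_minus divide_simps mult_ac)
 then have "exp (- (1/t)) <= (fact (n+2) * t^2) * t ^ n"
  by (simp only: power_add mult_ac)
 then show ?thesis
  using True by (simp add: expfun_def pos_divide_le_eq del: fact_Suc)
qed (simp add: expfun_def)

lemma expfun_nonneg: "expfun n t >= 0" by (simp add: expfun_def)

lemma expfun_has_derivative: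
 "(expfun n has_real_derivative (expfun (n + 2) t - n * expfun (n + 1) t)) (at t)"
proof -
 consider "t > 0" | "t < 0" | "t = 0" by linarith
 then show ?thesis
 proof cases
  case 1
  have "((%t. exp (- (1 / t)) / t ^ n) has_real_derivative
   (exp (- (1/t)) * (1 / t^2) * t^n - exp (- (1/t)) * (n * t ^ (n - 1))) / (t^n * t^n)) (at t)"
   using 1 by (auto intro!: derivative_eq_intros simp: power2_eq_square)
  moreover have "(exp (- (1/t)) * (1 / t^2) * t^n - exp (- (1/t)) * (n * t ^ (n - 1))) / (t^n * t^n)
   = expfun (n + 2) t - n * expfun (n + 1) t"
  proof (cases n)
   case 0
   then show ?thesis using 1 by (simp add: expfun_def power2_eq_square)
  next
   case (Suc m)
   have "t > 0" "t ^ m > 0" using 1 by auto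
   then show ?thesis unfolding Suc
    by (simp add: expfun_def power2_eq_square field_simps)
  qed
  ultimately have "((%t. exp (- (1 / t)) / t ^ n) has_real_derivative (expfun (n + 2) t - n * expfun (n + 1) t)) (at t)"
   by simp
  moreover have "\<forall>\<^sub>F s in nhds t. exp (- (1 / s)) / s ^ n = expfun n s"
   unfolding eventually_nhds using 1 by (intro exI[of _ "{0<..}"]) (simp add: expfun_def)
  ultimately show ?thesis using DERIV_cong_ev[OF refl _ refl, THEN iffD1] by fast
 next
  case 2
  have "((%t. 0) has_real_derivative (expfun (n + 2) t - n * expfun (n + 1) t)) (at t)"
   using 2 by (auto simp: expfun_def)
  moreover have "\<forall>\<^sub>F s in nhds t. 0 = expfun n s"
   unfolding eventually_nhds using 2 by (intro exI[of _ "{..<0}"]) (simp add: expfun_def)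
  ultimately show ?thesis using DERIV_cong_ev[OF refl _ refl, THEN iffD1] by fast
 next
  case 3
  have "(%h. (expfun n (0 + h) - expfun n 0) / h) \<midarrow>0\<rightarrow> 0"
  proof (rule Lim_null_comparison)
   show "\<forall>\<^sub>F h in at 0. norm ((expfun n (0 + h) - expfun n 0) / h) <= fact (n+2) * \<bar>h\<bar>"
   proof (intro always_eventually allI)
    fix h :: real
    have "expfun n h <= fact (n + 2) * \<bar>h\<bar> * \<bar>h\<bar>"
     using expfun_bound[of n h] by (simp add: power2_eq_square mult.assoc)
    then show "norm ((expfun n (0 + h) - expfun n 0) / h) <= fact (n+2) * \<bar>h\<bar>"
     using expfun_nonneg[of n h] by (cases "h = 0") (auto simp: divide_le_eq expfun_def)
   qed
   show "(%h::real. fact (n+2) * \<bar>h\<bar>) \<midarrow>0\<rightarrow> 0"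
    by (auto intro!: tendsto_eq_intros)
  qed
  then show ?thesis using 3 by (simp add: DERIV_def expfun_def)
 qed
qed

lemma expfun_radial_Ck:
 fixes a :: real
 shows "Ck_on k UNIV (%x::'a::euclidean_space. expfun n (1 - a * (x \<bullet> x)))"
proof (induction k arbitrary: n)
 case 0
 have "continuous_on UNIV (expfun n)"
  by (rule DERIV_continuous_on, rule has_field_derivative_at_within, rule expfun_has_derivative)
 moreover have "continuous_on UNIV (%x::'a. 1 - a * (x \<bullet> x))"
  by (intro continuous_intros)
 ultimately show ?case using continuous_on_compose2 by fastforce
next
 case (Suc k)
 have lin: "Ck_on k UNIV (%x::'a. (- 2 * a) * (x \<bullet> e))" for k e
 proof (cases k)
  case (Suc m)
  show ?thesis unfolding Suc
   by (rule Ck_on_SucI[where D="%x h. (- 2 * a) * (h \<bullet> e)"])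
     (auto intro!: derivative_eq_intros Ck_on_const)
 qed (auto intro!: continuous_intros)
 let ?E = "%x::'a. expfun (n + 2) (1 - a * (x \<bullet> x)) + (- real n) *^ expfun (n + 1) (1 - a * (x \<bullet> x))"
 show ?case
 proof (rule Ck_on_SucI)
  show "((%x. expfun n (1 - a * (x \<bullet> x))) has_derivative (%h. ?E x *^ ((- 2 * a) * (x \<bullet> h)))) (at x)" for x :: 'a
   by (rule has_derivative_eq_rhs, rule DERIV_compose_FDERIV[OF expfun_has_derivative])
     (auto intro!: derivative_eq_intros simp: algebra_simps inner_commute)
  show "Ck_on k UNIV (%x. ?E x *^ ((- 2 * a) * (x \<bullet> e)))" for e
   by (intro Ck_on_scaleR Ck_on_add Suc Ck_on_const lin)
 qed
qed

text \<open>A zero integral would force \<open>b = 0\<close> almost everywhere; the zero set is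
  closed, and a closed set of full measure is the whole space.\<close>

lemma integral_continuous_pos:
 fixes b :: "'a::euclidean_space => real"
 assumes bc: "continuous_on UNIV b" and bi: "integrable lborel b" and bn: "!!x. b x >= 0" and a: "b a > 0"
 shows "(LI x. b x) > 0"
proof -
 have "(LI x. b x) ~= 0"
 proof
  assume "(LI x. b x) = 0"
  then have "AE x in lborel. b x = 0"
   using integral_nonneg_eq_0_iff_AE[OF bi] bn by auto
  moreover have "open {x. b x ~= 0}"
   using open_Collect_neq[OF bc continuous_on_const[of _ 0]] by simp
  ultimately have "AE x in lborel. x \<in> - {x. b x ~= 0}" by auto
  then have "\<forall>x. b x = 0"
   using mem_closed_if_AE_lebesgue[of "- {x. b x ~= 0}"] \<open>open {x. b x ~= 0}\<close> by (auto simp: AE_completion)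
  then show False using a by simp
 qed
 then show ?thesis using bn by (metis Bochner_Integration.integral_nonneg less_eq_real_def)
qed

text \<open>The distributional hypotheses speak of smooth test functions, so a truly smooth
  mollifier is used to reach test functions of class one. After that, kernels of class two do the
  work.\<close>

lemma smooth_mollifier:
 assumes "e > 0"
 obtains k :: "'a::euclidean_space => real"
 where "smooth_on UNIV k" "!!x. k x >= 0" "!!x. norm x > e ==> k x = 0" "integrable lborel k"
  "(LI x. k x) = 1"
proof -
 define b where "b x = expfun 0 (1 - (1/e\<^sup>2) * (x \<bullet> x))" for x :: 'a
 have sm: "Ck_on k UNIV b" for k unfolding b_def by (rule expfun_radial_Ck)
 have bc: "continuous_on UNIV b" using sm[of 0] by simp
 have b0: "b x = 0" if "norm x > e" for x
 proof -
  have "e\<^sup>2 < x \<bullet> x" using that assms by (simp add: dot_square_norm power_strict_mono)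
  then show ?thesis using assms by (auto simp: b_def expfun_def field_simps)
 qed
 have bn: "b x >= 0" for x by (simp add: b_def expfun_nonneg)
 have bi: "integrable lborel b"
  by (rule continuous_compact_support(3)[OF bc, of "cball 0 e"]) (auto simp: b0)
 have I: "(LI x. b x) > 0"
  by (rule integral_continuous_pos[OF bc bi bn, of 0]) (simp add: b_def expfun_def)
 define c where "c = inverse (LI x. b x)"
 show ?thesis
 proof (rule that)
  show "smooth_on UNIV (%x. c *^ b x)"
   unfolding smooth_on_def by (intro allI Ck_on_scaleR Ck_on_const sm)
 qed (use I bn b0 bi in "auto simp: c_def")
qed

text \<open>Induction over the kernel: each partial derivative of the convolution is the convolution
  with a partial derivative of the kernel, again smooth and zero off \<open>K\<close>.\<close>

lemma conv_Ck:
 fixes g :: "'a::euclidean_space => 'b::euclidean_space"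
 assumes g: "integrable lborel g" and "smooth_on UNIV \<rho>" and K: "compact K" "!!x. x \<notin> K ==> \<rho> x = 0"
 shows "Ck_on k UNIV (conv \<rho> g)"
 using assms(2,4)
proof (induction k arbitrary: \<rho>)
 case (0 \<rho>)
 then have c: "continuous_on UNIV \<rho>" using Ck_on.simps(1) unfolding smooth_on_def by blast
 obtain B where "!!x. norm (\<rho> x) <= B"
  using continuous_compact_support(2)[OF c K(1) 0(2)] by auto
 then show ?case using conv_continuous[OF g c] by auto
next
 case (Suc k \<rho>)
 define \<rho>' where "\<rho>' x = (\<Sum>e\<in>Basis. pderiv_at e \<rho> x *^ e)" for x
 have sm: "smooth_on UNIV (pderiv_at e \<rho>)" if "e \<in> Basis" for e
  using Suc.prems(1) that unfolding smooth_on_def by (metis Ck_on.simps(2))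
 have d1: "\<rho> differentiable at x" for x
  using Suc.prems(1) Ck_on.simps(2) unfolding smooth_on_def by blast
 have dr: "(\<rho> has_derivative (%h. \<rho>' x \<bullet> h)) (at x)" for x
 proof -
  have f: "(\<rho> has_derivative frechet_derivative \<rho> (at x)) (at x)"
   using d1 frechet_derivative_works by blast
  have "frechet_derivative \<rho> (at x) h = \<rho>' x \<bullet> h" for h
  proof -
   have "linear (frechet_derivative \<rho> (at x))" using f has_derivative_linear by blast
   then have "frechet_derivative \<rho> (at x) h = (\<Sum>e\<in>Basis. (h \<bullet> e) * frechet_derivative \<rho> (at x) e)"
    by (subst euclidean_representation[of h, symmetric], subst linear_sum, simp, subst linear_cmul) auto
   then show ?thesis
    by (simp add: \<rho>'_def inner_sum_left pderiv_at_def inner_sum_right inner_commute[of _ h] mult.commute[of "h \<bullet> _"])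
  qed
  then show ?thesis using f by (metis (no_types, lifting) ext)
 qed
 have z: "pderiv_at e \<rho> x = 0" if "x \<notin> K" for x e
 proof -
  have "\<forall>\<^sub>F y in nhds x. y \<in> - K" using K(1) that compact_imp_closed eventually_nhds
   by (metis ComplI open_Compl)
  then have "\<forall>\<^sub>F y in nhds x. \<rho> y = (%y. 0) y" by eventually_elim (use Suc.prems in auto)
  moreover have "\<rho> x = 0" using Suc.prems that by auto
  ultimately have "(\<rho> has_derivative (%h. 0)) (at x)"
   using has_derivative_transform_eventually[of "%y. 0" "%h. 0" x UNIV \<rho>] 
   by (simp add: eventually_at_filter eventually_mono)
  then show ?thesis using pderiv_at_eq by blast
 qed
 have pc: "continuous_on UNIV (pderiv_at e \<rho>)" if "e \<in> Basis" for e
  using sm[OF that] Ck_on.simps(1) unfolding smooth_on_def by blast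
 have c': "continuous_on UNIV \<rho>'" unfolding \<rho>'_def by (intro continuous_intros pc)
 have z': "\<rho>' x = 0" if "x \<notin> K" for x using z[OF that] by (simp add: \<rho>'_def)
 show ?case
 proof (rule Ck_on_SucI)
  show "(conv \<rho> g has_derivative (%h. conv (%y. \<rho>' y \<bullet> h) g x)) (at x)" for x
   by (rule conv_has_derivative[OF g dr c' K(1) Suc.prems(2) z'])
  fix e :: 'a assume e: "e \<in> Basis"
  have "(%y. \<rho>' y \<bullet> e) = pderiv_at e \<rho>"
   using e by (auto simp: \<rho>'_def inner_sum_left inner_Basis if_distrib sum.delta cong: if_cong)
  then show "Ck_on k UNIV (conv (%y. \<rho>' y \<bullet> e) g)"
   using Suc.IH[OF sm[OF e] z] by simp
 qed
qed


section \<open>The weak equations with scalar test functions\<close>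

lemma compact_continuous_bound:
 fixes f :: "'a::topological_space => 'b::real_normed_vector"
 assumes "compact K" "continuous_on K f"
 shows "\<exists>B\<ge>0. \<forall>x\<in>K. norm (f x) <= B"
proof -
 have "bounded (f ` K)" by (rule compact_imp_bounded[OF compact_continuous_image[OF assms(2,1)]])
 then obtain B where "B > 0" "\<forall>y\<in>f ` K. norm y <= B" unfolding bounded_pos by blast
 then show ?thesis by (intro exI[of _ B]) auto
qed

lemma bounded_bilinear_cross3: "bounded_bilinear cross3"
 using bilinear_cross bilinear_conv_bounded_bilinear by blast

lemma norm_cross3_le: "norm (cross3 a b) <= norm a * norm b"
proof (rule power2_le_imp_le)
 show "(norm (cross3 a b))\<^sup>2 <= (norm a * norm b)\<^sup>2"
  using norm_cross_dot[of a b] zero_le_power2[of "a \<bullet> b"] by linarith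
qed auto

lemma borel_measurable_bilinear:
 fixes u :: "'a => 'b::euclidean_space" and k :: "'a => 'c::euclidean_space"
  and prd :: "'b => 'c => 'd::euclidean_space"
 assumes "bounded_bilinear prd" "u \<in> borel_measurable M" "k \<in> borel_measurable M"
 shows "(%x. prd (u x) (k x)) \<in> borel_measurable M"
proof -
 interpret bounded_bilinear prd by fact
 have "continuous_on UNIV (%p::'b \<times> 'c. prd (fst p) (snd p))"
  by (intro continuous_on continuous_intros)
 from borel_measurable_continuous_Pair[OF assms(2,3) this] show ?thesis by simp
qed

text \<open>The field need only be integrable on the compact set that carries the continuous factor.
  The product is any bounded bilinear map, so that scalar multiples, inner, cross and matrix
  products are all covered.\<close>

lemma integrable_bilinear_compact_support:
 fixes u :: "'a::euclidean_space => 'b::euclidean_space" and k :: "'a => 'c::euclidean_space"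
  and prd :: "'c => 'b => 'd::euclidean_space"
 assumes prd: "bounded_bilinear prd" and u [measurable]: "u \<in> borel_measurable borel"
  and k: "continuous_on UNIV k" and K: "compact K" "!!x. x \<notin> K ==> k x = 0"
  and i: "integrable lborel (%x. indicator K x *^ u x)"
 shows "integrable lborel (%x. prd (k x) (u x))"
proof -
 interpret bounded_bilinear prd by fact
 obtain C where C: "C >= 0" "!!a b. norm (prd a b) <= norm a * norm b * C" using nonneg_bounded by blast
 obtain B where B: "B >= 0" "!!x. norm (k x) <= B" using continuous_compact_support(2)[OF k K] by auto
 have [measurable]: "k \<in> borel_measurable borel" using k by (simp add: borel_measurable_continuous_onI)
 have "continuous_on UNIV (%p::'c \<times> 'b. prd (fst p) (snd p))"
  by (intro continuous_on continuous_intros)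
 then have [measurable]: "(%x. prd (k x) (u x)) \<in> borel_measurable borel"
  using borel_measurable_continuous_Pair[of k borel u prd] by simp
 show ?thesis
 proof (rule Bochner_Integration.integrable_bound[where f="%x. (B * C) *^ (indicator K x *^ u x)"])
  have "norm (prd (k x) (u x)) <= norm ((B * C) *^ (indicator K x *^ u x))" for x
  proof (cases "x \<in> K")
   case True
   have "norm (k x) * norm (u x) * C <= B * norm (u x) * C"
    by (intro mult_right_mono B C) auto
   then show ?thesis using True C(2)[of "k x" "u x"] B(1) C(1) by (simp add: abs_mult mult_ac)
  qed (use K in "auto simp: zero_left")
  then show "AE x in lborel. norm (prd (k x) (u x)) <= norm ((B * C) *^ (indicator K x *^ u x))" by simp
 next
  show "integrable lborel (%x. (B * C) *^ (indicator K x *^ u x))"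
   using i by (rule integrable_scaleR_right)
 qed auto
qed

text \<open>Used for the supports of derivatives and, with \<open>K\<close> the complement of a
  ball, for functions that vanish near a point.\<close>

lemma vanishing_derivative:
 assumes "closed K" "!!x. x \<notin> K ==> k x = 0" "(k has_derivative D) (at x)" "x \<notin> K"
 shows "D = (%h. 0)"
proof -
 have "((%y. 0) has_derivative D) (at x)"
  by (rule has_derivative_transform_within_open[OF assms(3), of "- K"]) (use assms in auto)
 then show ?thesis using has_derivative_unique has_derivative_const by blast
qed

text \<open>The test function travels together with its gradient. Class one is forced by the tests
  used later: products with \<open>f\<close> and partial derivatives of functions of class
  two.\<close>

definition C1_test :: "'a::euclidean_space set => ('a => real) => ('a => 'a) => bool" where
 "C1_test U \<phi> g \<longleftrightarrow> (\<forall>x. (\<phi> has_derivative (%h. g x \<bullet> h)) (at x)) \<and> continuous_on UNIV g \<and>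
   (\<exists>K. compact K \<and> K \<subseteq> U \<and> (\<forall>x. x \<notin> K --> \<phi> x = 0))"

lemma C1_testE:
 assumes "C1_test U \<phi> g"
 obtains K where "compact K" "K \<subseteq> U" "!!x. x \<notin> K ==> \<phi> x = 0" "!!x. x \<notin> K ==> g x = 0"
  "continuous_on UNIV \<phi>" "continuous_on UNIV g" "!!x. (\<phi> has_derivative (%h. g x \<bullet> h)) (at x)"
proof -
 from assms obtain K where K: "compact K" "K \<subseteq> U" "!!x. x \<notin> K ==> \<phi> x = 0"
  and g: "continuous_on UNIV g" "!!x. (\<phi> has_derivative (%h. g x \<bullet> h)) (at x)"
  unfolding C1_test_def by auto
 have "g x = 0" if "x \<notin> K" for x
 proof -
  have "(%h. g x \<bullet> h) = (%h. 0)"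
   by (rule vanishing_derivative[OF compact_imp_closed[OF K(1)] K(3) g(2) that])
  then have "g x \<bullet> g x = 0" by metis
  then show ?thesis by simp
 qed
 moreover have "continuous_on UNIV \<phi>"
  by (rule continuous_at_imp_continuous_on) (use g has_derivative_continuous in blast)
 ultimately show ?thesis using that K g by blast
qed

lemma continuous_on_cutoff:
 fixes f :: "'a::euclidean_space => 'b::real_normed_vector"
 assumes "open U" "continuous_on U f" "continuous_on UNIV \<phi>" "compact K" "K \<subseteq> U" "!!x. x \<notin> K ==> \<phi> x = 0"
 shows "continuous_on UNIV (%x. \<phi> x *^ f x)"
proof -
 have "continuous_on U (%x. \<phi> x *^ f x)"
  by (intro continuous_intros assms continuous_on_subset[OF assms(3)]) auto
 moreover have "continuous_on (- K) (%x. \<phi> x *^ f x)"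
  by (rule continuous_on_eq[of _ "%x. 0"]) (use assms in auto)
 ultimately have "continuous_on (U \<union> - K) (%x. \<phi> x *^ f x)"
  using assms by (intro continuous_on_open_Un) (auto intro: compact_imp_closed)
 moreover have "U \<union> - K = UNIV" using assms(5) by auto
 ultimately show ?thesis by simp
qed

text \<open>\<open>f\<close> is controlled on \<open>U\<close> only; off the support of
  \<open>\<phi>\<close> the product is zero on an open set, so the two descriptions glue.\<close>

lemma C1_test_mult:
 assumes \<phi>: "C1_test U \<phi> g" and U: "open U" and f: "!!x. x \<in> U ==> (f has_derivative (%h. f' x \<bullet> h)) (at x)"
  and f': "continuous_on U f'"
 shows "C1_test U (%x. \<phi> x * f x) (%x. \<phi> x *^ f' x + f x *^ g x)"
proof -
 obtain K where K: "compact K" "K \<subseteq> U" "!!x. x \<notin> K ==> \<phi> x = 0" "!!x. x \<notin> K ==> g x = 0"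
  and c: "continuous_on UNIV \<phi>" "continuous_on UNIV g" and d: "!!x. (\<phi> has_derivative (%h. g x \<bullet> h)) (at x)"
  using C1_testE[OF \<phi>] by blast
 have fc: "continuous_on U f"
  by (rule continuous_at_imp_continuous_on) (use f has_derivative_continuous in blast)
 have "((%x. \<phi> x * f x) has_derivative (%h. (\<phi> x *^ f' x + f x *^ g x) \<bullet> h)) (at x)" for x
 proof (cases "x \<in> U")
  case True
  show ?thesis
   by (rule has_derivative_eq_rhs, rule has_derivative_mult[OF d f[OF True]])
     (simp add: inner_add_left fun_eq_iff)
 next
  case False
  then have "x \<notin> K" using K by auto
  have "((%x. 0::real) has_derivative (%h. 0)) (at x)" by simp
  then have "((%x. \<phi> x * f x) has_derivative (%h. 0)) (at x)"
   by (rule has_derivative_transform_within_open[of _ _ _ _ "- K"])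
     (use K \<open>x \<notin> K\<close> in "auto intro: compact_imp_closed")
  then show ?thesis using K \<open>x \<notin> K\<close> by simp
 qed
 moreover have "continuous_on UNIV (%x. \<phi> x *^ f' x + f x *^ g x)"
 proof -
  have "continuous_on UNIV (%x. f x *^ g x)"
  proof -
   have "continuous_on U (%x. f x *^ g x)"
    by (intro continuous_intros fc continuous_on_subset[OF c(2)]) auto
   moreover have "continuous_on (- K) (%x. f x *^ g x)"
    by (rule continuous_on_eq[of _ "%x. 0"]) (use K in auto)
   ultimately have "continuous_on (U \<union> - K) (%x. f x *^ g x)"
    using U K by (intro continuous_on_open_Un) (auto intro: compact_imp_closed)
   moreover have "U \<union> - K = UNIV" using K by auto
   ultimately show ?thesis by simp
  qed
  then show ?thesis
   by (intro continuous_on_add continuous_on_cutoff[OF U f' c(1) K(1,2)] K(3))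
 qed
 ultimately show ?thesis unfolding C1_test_def using K by (metis mult_zero_left)
qed

text \<open>The vector equation comes from the test fields \<open>\<phi> e\<close> with constant
  \<open>e\<close>, since \<open>u \<bullet> curl (\<phi> e) = e \<bullet> (u \<times> grad
  \<phi>)\<close>; scalar test functions then suffice. The field is a Borel function on the whole
  space, so that it can be integrated against \<open>lborel\<close>.\<close>

definition weak_beltrami :: "(real^3) set => (real^3 => real) => (real^3 => real^3) => bool" where
 "weak_beltrami U f u \<longleftrightarrow> u \<in> borel_measurable borel \<and>
   (\<forall>K. compact K \<and> K \<subseteq> U --> integrable lborel (%x. indicator K x *^ u x)) \<and>
   (\<forall>\<phi> g. C1_test U \<phi> g -->
    (LI x. cross3 (u x) (g x)) = (LI x. (\<phi> x * f x) *^ u x) \<and>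
    (LI x. u x \<bullet> g x) = 0)"

lemma curl_scaleR_const:
 assumes "(\<phi> has_derivative (%h. G \<bullet> h)) (at x)"
 shows "curl (%x. \<phi> x *^ e) x = cross3 G e"
proof -
 have "((%x. \<phi> x *^ e) has_derivative (%h. (G \<bullet> h) *^ e)) (at x)"
  using assms by (rule has_derivative_scaleR_left)
 then show ?thesis
  by (simp add: curl_def Let_def pderiv_at_eq cross3_def inner_axis algebra_simps)
qed

lemma grad_eq: "(\<phi> has_derivative (%h. G \<bullet> h)) (at x) ==> grad \<phi> x = G"
 by (simp add: grad_def pderiv_at_eq inner_axis vec_eq_iff)

text \<open>\<open>u\<close> is Lebesgue measurable only on compact parts of \<open>U\<close> and
  arbitrary elsewhere. An exhaustion by compact sets makes its extension by zero measurable, and the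
  Borel version is chosen component by component.\<close>

lemma borel_representative:
 fixes u :: "real^3 => real^3"
 assumes U: "open U" and u: "locally_integrable_on u U"
 obtains v where "v \<in> borel_measurable borel" "AE x in lebesgue. indicator U x *^ u x = v x"
  "(%x. indicator U x *^ u x) \<in> borel_measurable lebesgue"
proof -
 obtain C where C: "!!n. compact (C n)" "!!n. C n \<subseteq> U" "!!n. C n \<subseteq> interior (C (Suc n))" "\<Union>(range C) = U"
  using open_Union_compact_subsets[OF U] by metis
 have "(%x. indicator (C n) x *^ u x) \<in> borel_measurable lebesgue" for n
  using u C(1,2)[of n] unfolding locally_integrable_on_def set_integrable_def
  by (intro borel_measurable_integrable) blast
 moreover have "(%n. indicator (C n) x *^ u x) \<longlonglongrightarrow> indicator U x *^ u x" for x
 proof (cases "x \<in> U")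
  case True
  then obtain N where "x \<in> C N" using C(4) by auto
  moreover have "C n \<subseteq> C m" if "n <= m" for n m
   using that by (rule lift_Suc_mono_le[rotated]) (use C(3) interior_subset in blast)
  ultimately have "\<forall>\<^sub>F n in sequentially. indicator (C n) x *^ u x = indicator U x *^ u x"
   using True by (auto simp: eventually_sequentially indicator_def)
  then show ?thesis by (rule tendsto_eventually)
 next
  case False
  then have "x \<notin> C n" for n using C(2) by auto
  then show ?thesis using False by simp
 qed
 ultimately have m: "(%x. indicator U x *^ u x) \<in> borel_measurable lebesgue"
  by (rule borel_measurable_LIMSEQ_metric)
 have "\<exists>w. w \<in> borel_measurable lborel \<and> (AE x in lborel. (indicator U x *^ u x) \<bullet> b = w x)" for b
 proof -
  have "(%x. (indicator U x *^ u x) \<bullet> b) \<in> borel_measurable lebesgue"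
   by (rule borel_measurable_inner[OF m borel_measurable_const])
  from completion_ex_borel_measurable_real[OF this] show ?thesis by blast
 qed
 then have "\<forall>b. \<exists>w. w \<in> borel_measurable lborel \<and> (AE x in lborel. (indicator U x *^ u x) \<bullet> b = w x)"
  by (rule allI)
 from choice[OF this] obtain w where w: "!!b. w b \<in> borel_measurable lborel" "!!b. AE x in lborel. (indicator U x *^ u x) \<bullet> b = w b x"
  by blast
 define v where "v x = (\<Sum>b\<in>Basis. w b x *^ b)" for x
 have [measurable]: "w b \<in> borel_measurable borel" for b using w(1) by simp
 have "v \<in> borel_measurable borel" unfolding v_def by measurable
 moreover have "AE x in lborel. \<forall>b\<in>Basis. (indicator U x *^ u x) \<bullet> b = w b x"
  using w(2) by (subst AE_finite_all) auto
 then have "AE x in lborel. indicator U x *^ u x = v x"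
 proof eventually_elim
  case (elim x)
  then show ?case unfolding v_def using euclidean_representation[of "indicator U x *^ u x"] by auto
 qed
 then have "AE x in lebesgue. indicator U x *^ u x = v x" by (rule AE_completion)
 ultimately show ?thesis using that m by blast
qed

text \<open>The supports stay in one compact subset of \<open>U\<close> and the bounds are uniform,
  which is what dominated convergence against a locally integrable field requires.\<close>

lemma C1_test_smooth_approximation:
 fixes \<phi> :: "'a::euclidean_space => real"
 assumes \<phi>: "C1_test U \<phi> g" and U: "open U"
 shows "\<exists>\<Phi> G K B. (\<forall>n::nat. test_function U (\<Phi> n)) \<and> (\<forall>n x. (\<Phi> n has_derivative (%h. G n x \<bullet> h)) (at x)) \<and>
  (\<forall>n. continuous_on UNIV (G n)) \<and> (\<forall>x. (%n. \<Phi> n x) \<longlonglongrightarrow> \<phi> x) \<and> (\<forall>x. (%n. G n x) \<longlonglongrightarrow> g x) \<and>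
  compact K \<and> K \<subseteq> U \<and> (\<forall>n x. x \<notin> K --> \<Phi> n x = 0) \<and> (\<forall>n x. \<bar>\<Phi> n x\<bar> <= B) \<and> (\<forall>n x. norm (G n x) <= B)"
proof -
 obtain K where K: "compact K" "K \<subseteq> U" "!!x. x \<notin> K ==> \<phi> x = 0" "!!x. x \<notin> K ==> g x = 0"
  and c: "continuous_on UNIV \<phi>" "continuous_on UNIV g" and d: "!!x. (\<phi> has_derivative (%h. g x \<bullet> h)) (at x)"
  using C1_testE[OF \<phi>] by blast
 obtain \<delta> where \<delta>: "\<delta> > 0" "(\<Union>x\<in>K. cball x \<delta>) \<subseteq> U"
  using compact_subset_open_imp_cball_epsilon_subset[OF K(1) U K(2)] by auto
 define K' where "K' = {x + y |x y. x \<in> K \<and> y \<in> cball 0 \<delta>}"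
 have K': "compact K'" unfolding K'_def by (intro compact_sums K) auto
 have K'U: "K' \<subseteq> U"
 proof
  fix z assume "z \<in> K'"
  then obtain x y where "z = x + y" "x \<in> K" "y \<in> cball 0 \<delta>" unfolding K'_def by auto
  then have "z \<in> cball x \<delta>" by (simp add: dist_norm)
  then show "z \<in> U" using \<delta>(2) \<open>x \<in> K\<close> by blast
 qed
 define e where "e n = \<delta> / real (Suc n)" for n
 have e: "e n > 0" "e n <= \<delta>" for n using \<delta>(1) by (auto simp: e_def divide_le_eq mult_le_cancel_left1)
 have e0: "e \<longlonglongrightarrow> 0" unfolding e_def
  by (rule LIMSEQ_Suc[OF lim_const_over_n])
 have "\<exists>k. smooth_on UNIV k \<and> (\<forall>x::'a. k x >= 0) \<and> (\<forall>x. norm x > e n --> k x = 0) \<and> integrable lborel k \<and> (LI x. k x) = (1::real)" for n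
  using smooth_mollifier[OF e(1)[of n]] by metis
 then obtain \<rho> :: "nat => 'a => real" where \<rho>: "!!n. smooth_on UNIV (\<rho> n)" "!!n x. \<rho> n x >= 0" "!!n x. norm x > e n ==> \<rho> n x = 0"
   "!!n. integrable lborel (\<rho> n)" "!!n. (LI x. \<rho> n x) = 1"
  by metis
 have \<rho>c: "continuous_on UNIV (\<rho> n)" for n using \<rho>(1)[of n] Ck_on.simps(1) unfolding smooth_on_def by blast
 have \<rho>0: "\<rho> n x = 0" if "x \<notin> cball 0 \<delta>" for n x
  using \<rho>(3)[of n x] that e(2)[of n] by auto
 have [measurable]: "\<rho> n \<in> borel_measurable borel" "\<phi> \<in> borel_measurable borel" "g \<in> borel_measurable borel" for n
  using \<rho>(4)[of n] c by (auto simp: borel_measurable_continuous_onI)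
 have i\<phi>: "integrable lborel \<phi>" and ig: "integrable lborel g"
  using continuous_compact_support(3) c K by blast+
 define \<Phi> where "\<Phi> n = conv (\<rho> n) \<phi>" for n
 define G where "G n = conv (\<rho> n) g" for n
 have int\<phi>: "integrable lborel (%z. \<rho> n (x - z) *^ \<phi> z)" for n x
  by (rule conv_integrable[OF i\<phi> \<rho>c compact_cball \<rho>0])
 have intg: "integrable lborel (%z. \<rho> n (x - z) *^ g z)" for n x
  by (rule conv_integrable[OF ig \<rho>c compact_cball \<rho>0])
 have z: "\<Phi> n x = 0" if "x \<notin> K'" for n x
 proof -
  have "\<rho> n (x - z) *^ \<phi> z = 0" for z
  proof (rule ccontr)
   assume "\<rho> n (x - z) *^ \<phi> z ~= 0"
   then have "\<phi> z ~= 0" "\<rho> n (x - z) ~= 0" by simp_all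
   then have "z \<in> K" "x - z \<in> cball 0 \<delta>" using K(3) \<rho>0 by blast+
   then have "z + (x - z) \<in> K'" unfolding K'_def by blast
   then show False using that by simp
  qed
  then have "(%z. \<rho> n (x - z) *^ \<phi> z) = (%z. 0)" by (rule ext)
  then show ?thesis unfolding \<Phi>_def conv_def by simp
 qed
 have Ck: "smooth_on UNIV (\<Phi> n)" for n
  unfolding smooth_on_def
 proof
  show "Ck_on k UNIV (\<Phi> n)" for k
   unfolding \<Phi>_def
  proof (rule conv_Ck[where K="cball 0 \<delta>"])
   show "!!x. x \<notin> cball 0 \<delta> ==> \<rho> n x = 0" by (rule \<rho>0)
  qed (use i\<phi> \<rho>(1) in auto)
 qed
 have der: "(\<Phi> n has_derivative (%h. G n x \<bullet> h)) (at x)" for n x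
 proof -
  \<comment> \<open>Convolution is symmetric, so the derivative may fall on \<open>\<phi>\<close>
    instead of the mollifier; this identifies the gradient as the mollified
    \<open>g\<close>.\<close>
  have "\<Phi> n = conv \<phi> (\<rho> n)"
   unfolding \<Phi>_def by (rule ext, subst conv_reflect) (auto simp: conv_def mult.commute)
  moreover have "(conv \<phi> (\<rho> n) has_derivative (%h. conv (%y. g y \<bullet> h) (\<rho> n) x)) (at x)"
   by (rule conv_has_derivative[OF \<rho>(4) d c(2) K(1,3,4)])
  moreover have "conv (%y. g y \<bullet> h) (\<rho> n) x = G n x \<bullet> h" for h
  proof -
   have "conv (%y. g y \<bullet> h) (\<rho> n) x = (LI z. (g z \<bullet> h) *^ \<rho> n (x - z))"
    by (rule conv_reflect) auto
   also have "\<dots> = (LI z. (\<rho> n (x - z) *^ g z) \<bullet> h)" by (simp add: mult.commute)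
   also have "\<dots> = G n x \<bullet> h" unfolding G_def conv_def by (rule integral_inner_left) (use intg in auto)
   finally show ?thesis .
  qed
  ultimately show ?thesis by simp
 qed
 have Gc: "continuous_on UNIV (G n)" for n
 proof -
  obtain B where "!!x. norm (\<rho> n x) <= B"
   using continuous_compact_support(2)[OF \<rho>c _ \<rho>0] compact_cball by metis
  then show ?thesis unfolding G_def using conv_continuous[OF ig \<rho>c] by auto
 qed
 obtain B1 B2 where B: "!!x. norm (\<phi> x) <= B1" "!!x. norm (g x) <= B2" "B1 >= 0" "B2 >= 0"
  using continuous_compact_support(2)[OF c(1) K(1,3)] continuous_compact_support(2)[OF c(2) K(1,4)] by metis
 have lim: "(%n. conv (\<rho> n) F x) \<longlonglongrightarrow> F x"
  if F: "continuous_on UNIV F" "!!n. integrable lborel (%z. \<rho> n (x - z) *^ F z)"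
  for F :: "'a => 'c::euclidean_space" and x
 proof (rule metric_LIMSEQ_I)
  fix r :: real assume "r > 0"
  moreover have "isCont F x" using F continuous_on_eq_continuous_at by blast
  ultimately obtain d where d: "d > 0" "!!y. dist y x < d ==> dist (F y) (F x) < r/2"
   unfolding continuous_at_eps_delta by (metis half_gt_zero)
  obtain N where N: "!!n. n >= N ==> e n < d"
   using order_tendstoD(2)[OF e0 d(1)] by (auto simp: eventually_sequentially)
  have "norm (conv (\<rho> n) F x - F x) <= r/2" if "n >= N" for n
  proof (rule conv_uniform[OF F(2) \<rho>(4,5,2,3)])
   show "norm (F z - F x) <= r/2" if "dist x z <= e n" for z
    using d(2)[of z] N[OF \<open>n >= N\<close>] that by (simp add: dist_commute dist_norm less_imp_le norm_minus_commute)
  qed auto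
  then show "\<exists>no. \<forall>n\<ge>no. dist (conv (\<rho> n) F x) (F x) < r"
   using \<open>r > 0\<close> by (intro exI[of _ N]) (force simp: dist_norm)
 qed
 have b: "norm (conv (\<rho> n) F x - 0) <= b"
  if F: "integrable lborel (%z. \<rho> n (x - z) *^ F z)" "!!z. norm (F z) <= b"
  for F :: "'a => 'c::euclidean_space" and x n b
  by (rule conv_uniform[OF F(1) \<rho>(4,5,2,3)]) (use F in auto)
 show ?thesis
 proof (intro exI conjI allI impI)
  show "test_function U (\<Phi> n)" for n
   unfolding test_function_def using Ck K' K'U z by blast
  show "\<bar>\<Phi> n x\<bar> <= max B1 B2" for n x
   using b[OF int\<phi> B(1), of n x] by (simp add: \<Phi>_def)
  show "norm (G n x) <= max B1 B2" for n x
   using b[OF intg B(2), of n x] by (simp add: G_def)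
  show "(%n. \<Phi> n x) \<longlonglongrightarrow> \<phi> x" "(%n. G n x) \<longlonglongrightarrow> g x" for x
   unfolding \<Phi>_def G_def using lim[OF c(1) int\<phi>] lim[OF c(2) intg] by auto
 qed (use der Gc K' K'U z in auto)
qed

text \<open>Passage from smooth tests and the completed measure to tests of class one and a Borel
  field.\<close>

lemma weak_beltramiI:
 fixes u :: "real^3 => real^3"
 assumes U: "open U" and f: "continuous_on U f" and u: "locally_integrable_on u U"
  and curl: "has_curl_on u (%x. f x *^ u x) U" and div: "has_div_on u (%x. 0) U"
 obtains v where "weak_beltrami U f v" "AE x in lebesgue. x \<in> U --> u x = v x"
proof -
 obtain v where v[measurable]: "v \<in> borel_measurable borel"
  and AE: "AE x in lebesgue. indicator U x *^ u x = v x"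
  and m[measurable]: "(%x. indicator U x *^ u x) \<in> borel_measurable lebesgue"
  using borel_representative[OF U u] by blast
 have [measurable]: "v \<in> borel_measurable lebesgue" using v by (intro measurable_completion) simp
 have iv: "integrable lborel (%x. indicator K x *^ v x)" if K: "compact K" "K \<subseteq> U" for K
 proof -
  have [measurable]: "K \<in> sets borel" using K(1) by (rule borel_compact)
  have "integrable lebesgue (%x. indicator K x *^ u x)"
   using u K unfolding locally_integrable_on_def set_integrable_def by auto
  moreover have "AE x in lebesgue. indicator K x *^ u x = indicator K x *^ v x"
   using AE by eventually_elim (use K in "auto simp: indicator_def split: if_splits")
  moreover have "(%x. indicator K x *^ v x) \<in> borel_measurable lebesgue"
   using K by (intro measurable_completion) simp
  ultimately have "integrable lebesgue (%x. indicator K x *^ v x)"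
   using integrable_cong_AE_imp by blast
  then show ?thesis by (subst (asm) integrable_completion) auto
 qed
 \<comment> \<open>Stated for an arbitrary bilinear product, one transfer serves the curl and the
   divergence integrals.\<close>
 have tr: "(LINT x:U|lebesgue. prd (u x) (k x)) = (LI x. prd (v x) (k x))"
  if k: "continuous_on UNIV k" and prd: "bounded_bilinear prd"
  for k :: "real^3 => 'c::euclidean_space" and prd :: "real^3 => 'c => 'd::euclidean_space"
 proof -
  interpret bounded_bilinear prd by fact
  have pc: "continuous_on UNIV (%p::(real^3) \<times> 'c. prd (fst p) (snd p))"
   by (intro continuous_on continuous_intros)
  have [measurable]: "k \<in> borel_measurable borel" using k by (simp add: borel_measurable_continuous_onI)
  have [measurable]: "k \<in> borel_measurable lebesgue" by (intro measurable_completion) simp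
  have [measurable]: "(%x. prd (indicator U x *^ u x) (k x)) \<in> borel_measurable lebesgue"
   using borel_measurable_continuous_Pair[OF m \<open>k \<in> borel_measurable lebesgue\<close> pc] by simp
  have vk[measurable]: "(%x. prd (v x) (k x)) \<in> borel_measurable borel"
   using borel_measurable_continuous_Pair[OF v _ pc] by simp
  have "(LINT x:U|lebesgue. prd (u x) (k x)) = (\<integral>x. prd (indicator U x *^ u x) (k x) \<partial>lebesgue)"
   unfolding set_lebesgue_integral_def by (simp add: scaleR_left)
  also have "\<dots> = (\<integral>x. prd (v x) (k x) \<partial>lebesgue)"
  proof (rule integral_cong_AE)
   show "(%x. prd (v x) (k x)) \<in> borel_measurable lebesgue"
    using vk by (intro measurable_completion) simp
  qed (use AE in auto)
  also have "\<dots> = (LI x. prd (v x) (k x))"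
   by (rule integral_completion) simp
  finally show ?thesis .
 qed
 have "(LI x. cross3 (v x) (g x)) = (LI x. (\<phi> x * f x) *^ v x) \<and> (LI x. v x \<bullet> g x) = 0"
  if \<phi>: "C1_test U \<phi> g" for \<phi> g
 proof -
  obtain \<Phi> G K B where *: "(\<forall>n::nat. test_function U (\<Phi> n)) \<and> (\<forall>n x. (\<Phi> n has_derivative (%h. G n x \<bullet> h)) (at x)) \<and>
  (\<forall>n. continuous_on UNIV (G n)) \<and> (\<forall>x. (%n. \<Phi> n x) \<longlonglongrightarrow> \<phi> x) \<and> (\<forall>x. (%n. G n x) \<longlonglongrightarrow> g x) \<and>
  compact K \<and> K \<subseteq> U \<and> (\<forall>n x. x \<notin> K --> \<Phi> n x = 0) \<and> (\<forall>n x. \<bar>\<Phi> n x\<bar> <= B) \<and> (\<forall>n x. norm (G n x) <= B)"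
   using C1_test_smooth_approximation[OF \<phi> U] by (elim exE)
  have T: "!!n. test_function U (\<Phi> n)" "!!n x. (\<Phi> n has_derivative (%h. G n x \<bullet> h)) (at x)"
   and Gc: "!!n. continuous_on UNIV (G n)"
   and lim: "!!x. (%n. \<Phi> n x) \<longlonglongrightarrow> \<phi> x" "!!x. (%n. G n x) \<longlonglongrightarrow> g x"
   and K: "compact K" "K \<subseteq> U" "!!n x. x \<notin> K ==> \<Phi> n x = 0"
   and B: "!!n x. \<bar>\<Phi> n x\<bar> <= B" "!!n x. norm (G n x) <= B"
   using * by blast+
  have G0: "G n x = 0" if "x \<notin> K" for n x
  proof -
   have "(%h. G n x \<bullet> h) = (%h. 0)"
    by (rule vanishing_derivative[OF compact_imp_closed[OF K(1)] K(3) T(2) that])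
   then have "G n x \<bullet> G n x = 0" by metis
   then show ?thesis by simp
  qed
  have \<Phi>c: "continuous_on UNIV (\<Phi> n)" for n
   by (rule continuous_at_imp_continuous_on) (use T(2) has_derivative_continuous in blast)
  have fc: "continuous_on UNIV (%x. \<Phi> n x * f x)" for n
   using continuous_on_cutoff[OF U f \<Phi>c K(1,2,3)] by simp
  have [measurable]: "(%x. \<Phi> n x * f x) \<in> borel_measurable borel" "G n \<in> borel_measurable borel" for n
   using fc Gc by (simp_all add: borel_measurable_continuous_onI)
  have i1: "integrable lborel (%x. cross3 (v x) (G n x))" for n
   using integrable_bilinear_compact_support[OF bounded_bilinear.flip[OF bounded_bilinear_cross3] v Gc K(1) G0 iv[OF K(1,2)]] .
  have i2: "integrable lborel (%x. (\<Phi> n x * f x) *^ v x)" for n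
   by (rule integrable_bilinear_compact_support[OF bounded_bilinear_scaleR v fc K(1) _ iv[OF K(1,2)]]) (use K in auto)
  have i3: "integrable lborel (%x. v x \<bullet> G n x)" for n
   using integrable_bilinear_compact_support[OF bounded_bilinear.flip[OF bounded_bilinear_inner] v Gc K(1) G0 iv[OF K(1,2)]] .
  \<comment> \<open>Testing with \<open>\<Phi> n\<close> times every constant vector
    \<open>e\<close> recovers the vector identity.\<close>
  have n1: "(LI x. cross3 (v x) (G n x)) = (LI x. (\<Phi> n x * f x) *^ v x)" for n
  proof (rule vector_eq_ldot[THEN iffD1], rule allI)
   fix e :: "real^3"
   have sm: "smooth_on UNIV (%x. \<Phi> n x *^ e)"
    using T(1)[of n] Ck_on_scaleR Ck_on_const unfolding test_function_def smooth_on_def by blast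
   have "test_function U (%x. \<Phi> n x *^ e)"
    unfolding test_function_def using sm K by (metis scale_zero_left)
   then have "(LINT x:U|lebesgue. u x \<bullet> curl (%x. \<Phi> n x *^ e) x) = (LINT x:U|lebesgue. (f x *^ u x) \<bullet> (\<Phi> n x *^ e))"
    using curl unfolding has_curl_on_def by blast
   then have "(LINT x:U|lebesgue. u x \<bullet> cross3 (G n x) e) = (LINT x:U|lebesgue. u x \<bullet> ((\<Phi> n x * f x) *^ e))"
    by (simp add: curl_scaleR_const[OF T(2)] mult_ac)
   then have "(LI x. v x \<bullet> cross3 (G n x) e) = (LI x. v x \<bullet> ((\<Phi> n x * f x) *^ e))"
    by (subst (asm) (1 2) tr) (auto intro!: continuous_intros fc Gc bounded_bilinear_inner continuous_on_cross)
   moreover have "v x \<bullet> cross3 (G n x) e = e \<bullet> cross3 (v x) (G n x)" for x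
    by (metis cross_triple inner_commute)
   moreover have "v x \<bullet> ((\<Phi> n x * f x) *^ e) = e \<bullet> ((\<Phi> n x * f x) *^ v x)" for x
    by (simp add: inner_commute)
   ultimately have "(LI x. e \<bullet> cross3 (v x) (G n x)) = (LI x. e \<bullet> ((\<Phi> n x * f x) *^ v x))"
    by (simp only:)
   also have "(LI x. e \<bullet> cross3 (v x) (G n x)) = e \<bullet> (LI x. cross3 (v x) (G n x))"
    by (rule integral_inner_right) (rule i1)
   also have "(LI x. e \<bullet> ((\<Phi> n x * f x) *^ v x)) = e \<bullet> (LI x. (\<Phi> n x * f x) *^ v x)"
    by (rule integral_inner_right) (rule i2)
   finally show "e \<bullet> (LI x. cross3 (v x) (G n x)) = e \<bullet> (LI x. (\<Phi> n x * f x) *^ v x)" .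
  qed
  have n2: "(LI x. v x \<bullet> G n x) = 0" for n
  proof -
   have "(LINT x:U|lebesgue. u x \<bullet> grad (\<Phi> n) x) = - (LINT x:U|lebesgue. 0 * \<Phi> n x)"
    using div T(1) unfolding has_div_on_def by blast
   then have "(LINT x:U|lebesgue. u x \<bullet> G n x) = 0"
    by (simp add: grad_eq[OF T(2)])
   then show ?thesis by (subst (asm) tr) (auto intro!: Gc bounded_bilinear_inner)
  qed
  let ?w = "%x. B * norm (indicator K x *^ v x)"
  have w: "integrable lborel ?w" by (intro integrable_mult_right integrable_norm iv[OF K(1,2)])
  obtain Bf where Bf: "!!x. x \<in> K ==> \<bar>f x\<bar> <= Bf"
   using compact_continuous_bound[OF K(1) continuous_on_subset[OF f K(2)]] by auto
  have wf: "integrable lborel (%x. \<bar>Bf\<bar> * ?w x)" using w by (rule integrable_mult_right)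
  have B0: "B >= 0" using B(1)[of 0 undefined] by linarith
  have g[measurable]: "g \<in> borel_measurable borel" 
   using \<phi> by (simp add: C1_test_def borel_measurable_continuous_onI)
  have [measurable]: "(%x. \<phi> x * f x) \<in> borel_measurable borel"
   by (rule borel_measurable_LIMSEQ_real[where u="%n x. \<Phi> n x * f x"]) (auto intro!: tendsto_intros lim)
  have mc: "(%x. cross3 (v x) (h x)) \<in> borel_measurable borel" if "h \<in> borel_measurable borel" for h
   by (rule borel_measurable_bilinear[OF bounded_bilinear_cross3 v that])
  have "(%n. \<integral>x. cross3 (v x) (G n x) \<partial>lborel) \<longlonglongrightarrow> (LI x. cross3 (v x) (g x))"
  proof (rule integral_dominated_convergence[where w="?w"])
   show "AE x in lborel. (%n. cross3 (v x) (G n x)) \<longlonglongrightarrow> cross3 (v x) (g x)"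
    by (intro always_eventually allI bounded_bilinear.tendsto[OF bounded_bilinear_cross3] tendsto_const lim)
   have "norm (cross3 (v x) (G n x)) <= ?w x" for n x
   proof (cases "x \<in> K")
    case True
    have "norm (v x) * norm (G n x) <= norm (v x) * B" by (intro mult_left_mono B) auto
    then show ?thesis using norm_cross3_le[of "v x" "G n x"] True by (simp add: mult.commute)
   qed (use G0 in auto)
   then show "AE x in lborel. norm (cross3 (v x) (G n x)) <= ?w x" for n by simp
  qed (use w mc in auto)
  moreover have "(%n. \<integral>x. (\<Phi> n x * f x) *^ v x \<partial>lborel) \<longlonglongrightarrow> (LI x. (\<phi> x * f x) *^ v x)"
  proof (rule integral_dominated_convergence[where w="%x. \<bar>Bf\<bar> * ?w x"])
   show "AE x in lborel. (%n. (\<Phi> n x * f x) *^ v x) \<longlonglongrightarrow> (\<phi> x * f x) *^ v x"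
    by (intro always_eventually allI tendsto_intros lim)
   have "norm ((\<Phi> n x * f x) *^ v x) <= \<bar>Bf\<bar> * ?w x" for n x
   proof (cases "x \<in> K")
    case True
    have "\<bar>\<Phi> n x\<bar> * \<bar>f x\<bar> <= B * \<bar>Bf\<bar>" by (intro mult_mono B) (use Bf[OF True] B0 in auto)
    then have "\<bar>\<Phi> n x\<bar> * \<bar>f x\<bar> * norm (v x) <= B * \<bar>Bf\<bar> * norm (v x)" by (rule mult_right_mono) auto
    then show ?thesis using True by (simp add: abs_mult mult_ac)
   qed (use K in auto)
   then show "AE x in lborel. norm ((\<Phi> n x * f x) *^ v x) <= \<bar>Bf\<bar> * ?w x" for n by simp
  qed (use wf in auto)
  moreover have "(%n. \<integral>x. v x \<bullet> G n x \<partial>lborel) \<longlonglongrightarrow> (LI x. v x \<bullet> g x)"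
  proof (rule integral_dominated_convergence[where w="?w"])
   show "AE x in lborel. (%n. v x \<bullet> G n x) \<longlonglongrightarrow> v x \<bullet> g x"
    by (intro always_eventually allI tendsto_intros lim)
   have "norm (v x \<bullet> G n x) <= ?w x" for n x
   proof (cases "x \<in> K")
    case True
    have "norm (v x) * norm (G n x) <= norm (v x) * B" by (intro mult_left_mono B) auto
    then show ?thesis using Cauchy_Schwarz_ineq2[of "v x" "G n x"] True by (simp add: mult.commute)
   qed (use G0 in auto)
   then show "AE x in lborel. norm (v x \<bullet> G n x) <= ?w x" for n by simp
  qed (use w in auto)
  ultimately have a: "(%n. \<integral>x. (\<Phi> n x * f x) *^ v x \<partial>lborel) \<longlonglongrightarrow> (LI x. cross3 (v x) (g x))"
   and b: "(%n. \<integral>x. (\<Phi> n x * f x) *^ v x \<partial>lborel) \<longlonglongrightarrow> (LI x. (\<phi> x * f x) *^ v x)"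
   and c: "(%n::nat. 0) \<longlonglongrightarrow> (LI x. v x \<bullet> g x)"
   unfolding n1 n2 by simp_all
  show ?thesis using LIMSEQ_unique[OF a b] LIMSEQ_unique[OF c tendsto_const] by simp
 qed
 then have "weak_beltrami U f v" unfolding weak_beltrami_def using v iv by blast
 moreover have "AE x in lebesgue. x \<in> U --> u x = v x" using AE by eventually_elim auto
 ultimately show ?thesis using that by blast
qed


section \<open>Functions of class two\<close>

text \<open>Symmetry of the Hessian is a clause, so it is inherited along with class two: radial
  profiles, products and convolutions, from which all the functions below are built, preserve
  it.\<close>

definition C2_fun :: "(real^3 => real) => (real^3 => real^3) => (real^3 => real^3^3) => bool" where
 "C2_fun \<phi> g H \<longleftrightarrow> (\<forall>x. (\<phi> has_derivative (%h. g x \<bullet> h)) (at x)) \<and>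
   (\<forall>x. (g has_derivative (%h. H x *v h)) (at x)) \<and> continuous_on UNIV H \<and> (\<forall>x. transpose (H x) = H x)"

lemma C2_funD:
 assumes "C2_fun \<phi> g H"
 shows "(\<phi> has_derivative (%h. g x \<bullet> h)) (at x)" "(g has_derivative (%h. H x *v h)) (at x)"
  "continuous_on UNIV H" "transpose (H x) = H x" "continuous_on UNIV g" "continuous_on UNIV \<phi>"
proof -
 show d: "(\<phi> has_derivative (%h. g x \<bullet> h)) (at x)" "(g has_derivative (%h. H x *v h)) (at x)"
  "continuous_on UNIV H" "transpose (H x) = H x" for x using assms unfolding C2_fun_def by blast+
 show "continuous_on UNIV g"
  by (rule continuous_at_imp_continuous_on) (use d(2) has_derivative_continuous in blast)
 show "continuous_on UNIV \<phi>"
  by (rule continuous_at_imp_continuous_on) (use d(1) has_derivative_continuous in blast)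
qed

definition outer :: "real^3 => real^3 => real^3^3" where
 "outer a b = (\<chi> i j. a $ i * b $ j)"

lemma outer_mult_vec: "outer a b *v h = (b \<bullet> h) *^ a"
 by (simp add: outer_def vec_eq_iff matrix_vector_mult_def inner_vec_def sum_distrib_left sum_distrib_right mult_ac)

lemma transpose_outer: "transpose (outer a b) = outer b a"
 by (simp add: outer_def transpose_def vec_eq_iff mult.commute)

lemma trace_outer: "trace (outer a b) = a \<bullet> b"
 by (simp add: outer_def trace_def inner_vec_def)

lemma continuous_on_outer:
 "continuous_on S a ==> continuous_on S b ==> continuous_on S (%x. outer (a x) (b x))"
 unfolding outer_def by (intro continuous_intros)

lemma transpose_add: "transpose (A + B) = transpose A + transpose (B::real^'n^'m)"
 by (simp add: transpose_def vec_eq_iff)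

lemma transpose_scaleR: "transpose (c *^ A) = c *^ transpose (A::real^'n^'m)"
 by (simp add: transpose_def vec_eq_iff)

lemma trace_scaleR: "trace (c *^ A) = c * trace (A::real^'n^'n)"
 by (simp add: trace_def sum_distrib_left)

lemma C2_fun_mult:
 assumes 1: "C2_fun \<phi> g H" and 2: "C2_fun \<psi> k J"
 shows "C2_fun (%x. \<phi> x * \<psi> x) (%x. \<phi> x *^ k x + \<psi> x *^ g x)
  (%x. \<phi> x *^ J x + \<psi> x *^ H x + outer (k x) (g x) + outer (g x) (k x))"
 unfolding C2_fun_def
proof (intro conjI allI)
 note d1 = C2_funD[OF 1] and d2 = C2_funD[OF 2]
 show "((%x. \<phi> x * \<psi> x) has_derivative (%h. (\<phi> x *^ k x + \<psi> x *^ g x) \<bullet> h)) (at x)" for x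
  by (rule has_derivative_eq_rhs, rule has_derivative_mult[OF d1(1) d2(1)])
    (simp add: inner_add_left fun_eq_iff)
 show "((%x. \<phi> x *^ k x + \<psi> x *^ g x) has_derivative
   (%h. (\<phi> x *^ J x + \<psi> x *^ H x + outer (k x) (g x) + outer (g x) (k x)) *v h)) (at x)" for x
  by (rule has_derivative_eq_rhs, rule has_derivative_add[OF has_derivative_scaleR[OF d1(1) d2(2)] has_derivative_scaleR[OF d2(1) d1(2)]])
    (simp add: fun_eq_iff matrix_vector_mult_add_rdistrib outer_mult_vec scaleR_matrix_vector_assoc[symmetric] algebra_simps)
 show "continuous_on UNIV (%x. \<phi> x *^ J x + \<psi> x *^ H x + outer (k x) (g x) + outer (g x) (k x))"
  by (intro continuous_on_add continuous_on_scaleR continuous_on_outer d1 d2)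
 show "transpose (\<phi> x *^ J x + \<psi> x *^ H x + outer (k x) (g x) + outer (g x) (k x))
  = \<phi> x *^ J x + \<psi> x *^ H x + outer (k x) (g x) + outer (g x) (k x)" for x
  by (simp add: transpose_add transpose_scaleR transpose_outer d1(4) d2(4))
qed

text \<open>In the variable \<open>s = |x - a|^2\<close> the centre is not singular, so class two of
  the profile on \<open>s \<ge> 0\<close> is enough.\<close>

lemma C2_fun_radial:
 assumes n: "!!s. s >= 0 ==> (\<nu> has_real_derivative \<nu>' s) (at s)"
  and n1: "!!s. s >= 0 ==> (\<nu>' has_real_derivative \<nu>'' s) (at s)" and n2: "continuous_on {0..} \<nu>''"
 shows "C2_fun (%x. \<nu> ((x - a) \<bullet> (x - a))) (%x. (2 * \<nu>' ((x - a) \<bullet> (x - a))) *^ (x - a))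
  (%x. (4 * \<nu>'' ((x - a) \<bullet> (x - a))) *^ outer (x - a) (x - a) + (2 * \<nu>' ((x - a) \<bullet> (x - a))) *^ mat 1)"
 unfolding C2_fun_def
proof (intro conjI allI)
 let ?s = "%x::real^3. (x - a) \<bullet> (x - a)"
 have s: "(?s has_derivative (%h. 2 * ((x - a) \<bullet> h))) (at x)" for x
  by (auto intro!: derivative_eq_intros simp: inner_commute)
 have c1: "((%x. \<nu>' (?s x)) has_derivative (%h. \<nu>'' (?s x) * (2 * ((x - a) \<bullet> h)))) (at x)" for x
  by (rule DERIV_compose_FDERIV[OF n1 s, THEN has_derivative_eq_rhs]) (auto simp: mult_ac)
 show "((%x. \<nu> (?s x)) has_derivative (%h. ((2 * \<nu>' (?s x)) *^ (x - a)) \<bullet> h)) (at x)" for x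
  by (rule DERIV_compose_FDERIV[OF n s, THEN has_derivative_eq_rhs]) (auto simp: mult_ac)
 have l: "((%x. x - a) has_derivative (%h. h)) (at x)" for x by (auto intro!: derivative_eq_intros)
 show "((%x. (2 * \<nu>' (?s x)) *^ (x - a)) has_derivative
   (%h. ((4 * \<nu>'' (?s x)) *^ outer (x - a) (x - a) + (2 * \<nu>' (?s x)) *^ mat 1) *v h)) (at x)" for x
  by (rule has_derivative_eq_rhs, rule has_derivative_scaleR[OF has_derivative_mult_right[OF c1] l])
    (simp add: fun_eq_iff matrix_vector_mult_add_rdistrib outer_mult_vec scaleR_matrix_vector_assoc[symmetric])
 have sc: "continuous_on UNIV ?s" by (intro continuous_intros)
 have "continuous_on UNIV (%x. \<nu>'' (?s x))"
  by (rule continuous_on_compose2[OF n2 sc]) auto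
 moreover have "continuous_on UNIV (%x. \<nu>' (?s x))"
  by (rule continuous_at_imp_continuous_on) (use c1 has_derivative_continuous in blast)
 ultimately show "continuous_on UNIV (%x. (4 * \<nu>'' (?s x)) *^ outer (x - a) (x - a) + (2 * \<nu>' (?s x)) *^ mat 1)"
  by (intro continuous_on_add continuous_on_scaleR continuous_on_outer continuous_on_mult continuous_on_const continuous_on_diff continuous_on_id)
qed (simp add: transpose_add transpose_scaleR transpose_outer transpose_mat)

lemma trace_radial: "trace (b *^ outer y y + c *^ mat 1) = b * (y \<bullet> y) + 3 * c"
 by (simp add: trace_add trace_scaleR trace_outer trace_I)

lemma DERIV_glue:
 fixes f g :: "real => real"
 assumes f: "(f has_real_derivative D) (at a)" and g: "(g has_real_derivative D) (at a)" and eq: "f a = g a"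
 shows "((%s. if a <= s then f s else g s) has_real_derivative D) (at a)"
proof -
 let ?F = "%s. if a <= s then f s else g s"
 have "((%y. (?F y - ?F a) / (y - a)) \<longlongrightarrow> D) (at_left a)"
 proof (rule Lim_transform_eventually)
  show "((%y. (g y - g a) / (y - a)) \<longlongrightarrow> D) (at_left a)"
   using g unfolding has_field_derivative_iff by (auto simp: filterlim_at_split)
  show "\<forall>\<^sub>F y in at_left a. (g y - g a) / (y - a) = (?F y - ?F a) / (y - a)"
   unfolding eventually_at_filter by (rule always_eventually) (use eq in auto)
 qed
 moreover have "((%y. (?F y - ?F a) / (y - a)) \<longlongrightarrow> D) (at_right a)"
 proof (rule Lim_transform_eventually)
  show "((%y. (f y - f a) / (y - a)) \<longlongrightarrow> D) (at_right a)"
   using f unfolding has_field_derivative_iff by (auto simp: filterlim_at_split)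
  show "\<forall>\<^sub>F y in at_right a. (f y - f a) / (y - a) = (?F y - ?F a) / (y - a)"
   unfolding eventually_at_filter by (rule always_eventually) auto
 qed
 ultimately show ?thesis unfolding has_field_derivative_iff filterlim_at_split by blast
qed

lemma DERIV_glue_all:
 fixes f g :: "real => real"
 assumes f: "!!s. s >= a ==> (f has_real_derivative f' s) (at s)"
  and g: "!!s. s <= a ==> (g has_real_derivative g' s) (at s)"
  and eq: "f a = g a" "f' a = g' a"
 shows "((%s. if a <= s then f s else g s) has_real_derivative (if a <= s then f' s else g' s)) (at s)"
proof -
 consider "s < a" | "s = a" | "s > a" by linarith
 then show ?thesis
 proof cases
  case 1
  have "((%s. if a <= s then f s else g s) has_real_derivative g' s) (at s)"
   by (rule has_field_derivative_transform_within_open[OF g, of s "{..<a}"]) (use 1 in auto)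
  then show ?thesis using 1 by simp
 next
  case 2
  then show ?thesis using DERIV_glue[of f "f' a" a g] f[of a] g[of a] eq by simp
 next
  case 3
  have "((%s. if a <= s then f s else g s) has_real_derivative f' s) (at s)"
   by (rule has_field_derivative_transform_within_open[OF f, of s "{a<..}"]) (use 3 in auto)
  then show ?thesis using 3 by simp
 qed
qed

lemma continuous_on_glue:
 fixes f g :: "real => real"
 assumes f: "continuous_on {a..} f" and g: "continuous_on {..a} g" and eq: "f a = g a"
 shows "continuous_on UNIV (%s. if a <= s then f s else g s)"
proof -
 have "continuous_on ({a..} \<union> {..a}) (%s. if a <= s then f s else g s)"
  by (rule continuous_on_If) (use f g eq in auto)
 moreover have "{a..} \<union> {..a} = (UNIV :: real set)" by auto
 ultimately show ?thesis by simp
qed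

text \<open>The Newtonian profile \<open>s \<mapsto> s\<^bsup>-1/2\<^esup>\<close> in the variable \<open>s = |y|\<^sup>2\<close>, continued below \<open>s = d\<^sup>2\<close> by its
  Taylor polynomial of degree two.\<close>

definition newton :: "real => real => real" where
 "newton d s = (if d\<^sup>2 <= s then s powr (-1/2) else (15/8 - 5/4 * (s/d\<^sup>2) + 3/8 * (s/d\<^sup>2)\<^sup>2) / d)"

definition newton1 :: "real => real => real" where
 "newton1 d s = (if d\<^sup>2 <= s then (-1/2) * s powr (-3/2) else (-5/4 + 3/4 * (s/d\<^sup>2)) / d^3)"

definition newton2 :: "real => real => real" where
 "newton2 d s = (if d\<^sup>2 <= s then 3/4 * s powr (-5/2) else 3/4 / d^5)"

text \<open>Minus the Laplacian of the profile. Outside radius \<open>d\<close> the Newtonian kernel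
  is harmonic; inside, the Taylor polynomial leaves a nonnegative bump that is continuous across
  \<open>s = d^2\<close>.\<close>

definition newton_lap :: "real => real => real" where
 "newton_lap d s = (if d\<^sup>2 <= s then 0 else 15/2 * (1 - s/d\<^sup>2) / d^3)"

lemma powr_half_square:
 assumes "d > (0::real)"
 shows "(d\<^sup>2) powr (- (1/2)) = 1/d" "(d\<^sup>2) powr (- (3/2)) = 1/d^3" "(d\<^sup>2) powr (- (5/2)) = 1/d^5"
proof -
 have *: "(d\<^sup>2) powr (- (real n / 2)) = 1 / d^n" for n
 proof -
  have "(d\<^sup>2) powr (- (real n / 2)) = (d powr 2) powr (- (real n / 2))" using assms by simp
  also have "\<dots> = d powr (- real n)" by (simp add: powr_powr del: powr_numeral)
  also have "\<dots> = 1 / d^n" using assms by (simp add: powr_minus powr_realpow divide_inverse)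
  finally show ?thesis .
 qed
 show "(d\<^sup>2) powr (- (1/2)) = 1/d" "(d\<^sup>2) powr (- (3/2)) = 1/d^3" "(d\<^sup>2) powr (- (5/2)) = 1/d^5"
  using *[of 1] *[of 3] *[of 5] by simp_all
qed

lemma newton_derivative:
 assumes d: "d > 0"
 shows "(newton d has_real_derivative newton1 d s) (at s)"
proof -
 have "d\<^sup>2 > 0" using d by simp
 have "((%s. if d\<^sup>2 <= s then s powr (-1/2) else (15/8 - 5/4 * (s/d\<^sup>2) + 3/8 * (s/d\<^sup>2)\<^sup>2) / d) has_real_derivative
  (if d\<^sup>2 <= s then (-1/2) * s powr (-3/2) else (-5/4 + 3/4 * (s/d\<^sup>2)) / d^3)) (at s)"
 proof (rule DERIV_glue_all)
  fix s assume "d\<^sup>2 <= s"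
  then have "s > 0" using \<open>d\<^sup>2 > 0\<close> by linarith
  then show "((%s. s powr (-1/2)) has_real_derivative (-1/2) * s powr (-3/2)) (at s)"
   by (auto intro!: derivative_eq_intros)
 next
  fix s
  show "((%s. (15/8 - 5/4 * (s/d\<^sup>2) + 3/8 * (s/d\<^sup>2)\<^sup>2) / d) has_real_derivative (-5/4 + 3/4 * (s/d\<^sup>2)) / d^3) (at s)"
   using d by (auto intro!: derivative_eq_intros simp: field_simps power2_eq_square power3_eq_cube)
 qed (use d in "auto simp: powr_half_square")
 then show ?thesis unfolding newton_def[abs_def] newton1_def .
qed

lemma newton1_derivative:
 assumes d: "d > 0"
 shows "(newton1 d has_real_derivative newton2 d s) (at s)"
proof -
 have "d\<^sup>2 > 0" using d by simp
 have "((%s. if d\<^sup>2 <= s then (-1/2) * s powr (-3/2) else (-5/4 + 3/4 * (s/d\<^sup>2)) / d^3) has_real_derivative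
  (if d\<^sup>2 <= s then 3/4 * s powr (-5/2) else 3/4 / d^5)) (at s)"
 proof (rule DERIV_glue_all)
  fix s assume "d\<^sup>2 <= s"
  then have "s > 0" using \<open>d\<^sup>2 > 0\<close> by linarith
  then show "((%s. (-1/2) * s powr (-3/2)) has_real_derivative 3/4 * s powr (-5/2)) (at s)"
   by (auto intro!: derivative_eq_intros)
 next
  fix s
  show "((%s. (-5/4 + 3/4 * (s/d\<^sup>2)) / d^3) has_real_derivative 3/4 / d^5) (at s)"
   using d by (auto intro!: derivative_eq_intros simp: field_simps eval_nat_numeral)
 qed (use d in "auto simp: powr_half_square")
 then show ?thesis unfolding newton1_def[abs_def] newton2_def .
qed

lemma newton2_continuous: "d > 0 ==> continuous_on S (newton2 d)"
proof -
 assume d: "d > 0"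
 then have "d\<^sup>2 > 0" by simp
 have "continuous_on UNIV (%s. if d\<^sup>2 <= s then 3/4 * s powr (-5/2) else 3/4 / d^5)"
 proof (rule continuous_on_glue)
  show "continuous_on {d\<^sup>2..} (%s. 3/4 * s powr (-5/2))"
   using \<open>d\<^sup>2 > 0\<close> by (intro continuous_intros) auto
 qed (use d in "auto simp: powr_half_square")
 then show ?thesis unfolding newton2_def[abs_def] using continuous_on_subset by blast
qed

lemma newton_laplacian:
 assumes d: "d > 0"
 shows "4 * newton2 d s * s + 6 * newton1 d s = - newton_lap d s"
proof (cases "d\<^sup>2 <= s")
 case True
 then have "s > 0" using d by (smt (verit) zero_less_power2)
 have "s powr (- (5/2)) * s = s powr (- (5/2)) * s powr 1" using \<open>s > 0\<close> by simp
 also have "\<dots> = s powr (- (3/2))" unfolding powr_add[symmetric] by simp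
 finally show ?thesis using True by (simp add: newton1_def newton2_def newton_lap_def)
next
 case False
 then show ?thesis using d
  by (simp add: newton1_def newton2_def newton_lap_def field_simps eval_nat_numeral)
qed

text \<open>The bound \<open>2 / norm x\<close> is independent of \<open>d\<close> and dominates the
  passage of \<open>d\<close> to 0; the bound \<open>2 / d\<close> gives integrability for fixed
  \<open>d\<close>.\<close>

lemma newton_bounds:
 assumes d: "d > 0"
 shows "0 <= newton d ((x::real^3) \<bullet> x)" "newton d (x \<bullet> x) <= 2 / d" "x ~= 0 ==> newton d (x \<bullet> x) <= 2 / norm x"
  "d <= norm x ==> newton d (x \<bullet> x) = 1 / norm x"
proof -
 have far: "newton d (x \<bullet> x) = 1 / norm x" if "d\<^sup>2 <= x \<bullet> x"
 proof -
  have "x ~= 0" using that d by auto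
  then show ?thesis using that powr_half_square(1)[of "norm x"]
   by (simp add: newton_def dot_square_norm)
 qed
 have near: "0 <= newton d (x \<bullet> x)" "newton d (x \<bullet> x) <= 2 / d" if "x \<bullet> x < d\<^sup>2"
 proof -
  define s where "s = x \<bullet> x / d\<^sup>2"
  have s: "0 <= s" "s < 1" using that d by (auto simp: s_def)
  have "s\<^sup>2 <= s" using s by (simp add: power2_eq_square mult_left_le_one_le)
  then have "0 <= 15/8 - 5/4 * s + 3/8 * s\<^sup>2" "15/8 - 5/4 * s + 3/8 * s\<^sup>2 <= 2" using s zero_le_power2[of s] by linarith+
  then show "0 <= newton d (x \<bullet> x)" "newton d (x \<bullet> x) <= 2 / d"
   using that d by (auto simp: newton_def s_def[symmetric] divide_right_mono)
 qed
 have iff: "d\<^sup>2 <= x \<bullet> x \<longleftrightarrow> d <= norm x"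
  using d by (simp add: dot_square_norm power_mono_iff)
 show "d <= norm x ==> newton d (x \<bullet> x) = 1 / norm x" using far iff by simp
 show "0 <= newton d (x \<bullet> x)" using far near by (cases "d\<^sup>2 <= x \<bullet> x") auto
 show "newton d (x \<bullet> x) <= 2 / d"
 proof (cases "d <= norm x")
  case True
  then have "1 / norm x <= 1 / d" using d by (simp add: frac_le)
  also have "\<dots> <= 2 / d" using d by (simp add: divide_right_mono)
  finally show ?thesis using far iff True by simp
 qed (use near iff in auto)
 show "newton d (x \<bullet> x) <= 2 / norm x" if "x ~= 0"
 proof (cases "d <= norm x")
  case True
  then show ?thesis using far iff by (simp add: divide_right_mono)
 next
  case False
  then have "2 / d <= 2 / norm x" using that by (simp add: frac_le)
  then show ?thesis using near iff False by linarith
 qed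
qed

lemma C2_fun_newton:
 assumes "d > 0"
 shows "C2_fun (%y. newton d ((y - x) \<bullet> (y - x))) (%y. (2 * newton1 d ((y - x) \<bullet> (y - x))) *^ (y - x))
  (%y. (4 * newton2 d ((y - x) \<bullet> (y - x))) *^ outer (y - x) (y - x) + (2 * newton1 d ((y - x) \<bullet> (y - x))) *^ mat 1)"
proof (rule C2_fun_radial[where \<nu>="newton d" and \<nu>'="newton1 d" and \<nu>''="newton2 d"])
 show "(newton d has_real_derivative newton1 d s) (at s)" "(newton1 d has_real_derivative newton2 d s) (at s)" for s
  using newton_derivative[OF assms] newton1_derivative[OF assms] by auto
 show "continuous_on {0..} (newton2 d)" by (rule newton2_continuous[OF assms])
qed

section \<open>Compactly supported kernels of class two\<close>

definition pos_part :: "real => real" where "pos_part t = max 0 t"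

lemma pos_part_power_derivative:
 "n > 0 ==> ((%t. pos_part t ^ Suc n) has_real_derivative real (Suc n) * pos_part t ^ n) (at t)"
proof -
 assume n: "n > 0"
 have "((%t. if 0 <= t then t ^ Suc n else 0) has_real_derivative (if 0 <= t then real (Suc n) * t ^ n else 0)) (at t)"
 proof (rule DERIV_glue_all)
  show "((%t. t ^ Suc n) has_real_derivative real (Suc n) * s ^ n) (at s)" for s :: real
   using DERIV_pow[of "Suc n" s] by simp
 qed (use n in auto)
 moreover have "(%t. if 0 <= t then t ^ Suc n else 0) = (%t::real. pos_part t ^ Suc n)"
  by (auto simp: pos_part_def fun_eq_iff max_def)
 moreover have "(if 0 <= t then real (Suc n) * t ^ n else 0) = real (Suc n) * pos_part t ^ n"
  using n by (auto simp: pos_part_def max_def)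
 ultimately show ?thesis by simp
qed

text \<open>The third power of the positive part is the smallest integer power whose profile is of
  class two across the boundary of the ball.\<close>

lemma C2_kernel:
 assumes "r > 0"
 obtains k :: "real^3 => real" and g H where "C2_fun k g H" "!!x. k x >= 0" "!!x. norm x > r ==> k x = 0"
  "integrable lborel k" "(LI x. k x) = 1"
proof -
 define \<nu> where "\<nu> c s = c * pos_part (r\<^sup>2 - s) ^ 3" for c s
 define \<nu>1 where "\<nu>1 c s = c * (- 3 * pos_part (r\<^sup>2 - s) ^ 2)" for c s
 define \<nu>2 where "\<nu>2 c s = c * (6 * pos_part (r\<^sup>2 - s))" for c s
 have n: "(\<nu> c has_real_derivative \<nu>1 c s) (at s)" for c s
 proof -
  have "((%s. pos_part (r\<^sup>2 - s) ^ 3) has_real_derivative (3 * pos_part (r\<^sup>2 - s) ^ 2) * (0 - 1)) (at s)"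
  proof -
   have "((%t. pos_part t ^ 3) has_real_derivative 3 * pos_part (r\<^sup>2 - s) ^ 2) (at (r\<^sup>2 - s))"
    using pos_part_power_derivative[of 2 "r\<^sup>2 - s"] by (simp add: eval_nat_numeral)
   moreover have "((%s. r\<^sup>2 - s) has_real_derivative (0 - 1)) (at s)" by (intro derivative_intros)
   ultimately show ?thesis by (rule DERIV_chain2)
  qed
  from DERIV_cmult[OF this, of c] show ?thesis unfolding \<nu>_def[abs_def] \<nu>1_def by simp
 qed
 have n1: "(\<nu>1 c has_real_derivative \<nu>2 c s) (at s)" for c s
 proof -
  have "((%s. pos_part (r\<^sup>2 - s) ^ 2) has_real_derivative (2 * pos_part (r\<^sup>2 - s)) * (0 - 1)) (at s)"
  proof -
   have "((%t. pos_part t ^ 2) has_real_derivative 2 * pos_part (r\<^sup>2 - s)) (at (r\<^sup>2 - s))"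
    using pos_part_power_derivative[of 1 "r\<^sup>2 - s"] by (simp add: eval_nat_numeral)
   moreover have "((%s. r\<^sup>2 - s) has_real_derivative (0 - 1)) (at s)" by (intro derivative_intros)
   ultimately show ?thesis by (rule DERIV_chain2)
  qed
  from DERIV_cmult[OF this, of "- 3 * c"] show ?thesis unfolding \<nu>1_def[abs_def] \<nu>2_def by (simp add: mult_ac)
 qed
 have n2: "continuous_on {0..} (\<nu>2 c)" for c
  unfolding \<nu>2_def[abs_def] pos_part_def by (intro continuous_intros)
 have C2: "\<exists>g H. C2_fun (%x. \<nu> c (x \<bullet> x)) g H" for c
  using C2_fun_radial[where a=0 and \<nu>="\<nu> c" and \<nu>'="\<nu>1 c" and \<nu>''="\<nu>2 c", OF n n1 n2] by auto
 define b where "b x = \<nu> 1 (x \<bullet> x)" for x :: "real^3"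
 have z: "b x = 0" if "norm x > r" for x
 proof -
  have "r\<^sup>2 < x \<bullet> x" using that assms by (simp add: dot_square_norm power_strict_mono)
  then show ?thesis by (simp add: b_def \<nu>_def pos_part_def)
 qed
 have pos: "b x >= 0" for x by (simp add: b_def \<nu>_def pos_part_def)
 have bc: "continuous_on UNIV b"
  using C2[of 1] C2_funD(6) unfolding b_def[symmetric] by blast
 have bi: "integrable lborel b"
  by (rule continuous_compact_support(3)[OF bc, of "cball 0 r"]) (auto simp: z)
 have "(LI x. b x) > 0"
  by (rule integral_continuous_pos[OF bc bi pos, of 0]) (use assms in "simp add: b_def \<nu>_def pos_part_def")
 then obtain c where c: "c > 0" "c * (LI x. b x) = 1"
  by (metis divide_pos_pos nonzero_divide_eq_eq order_less_irrefl zero_less_one)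
 obtain g H where gH: "C2_fun (%x. \<nu> c (x \<bullet> x)) g H" using C2 by blast
 moreover have "(%x. \<nu> c (x \<bullet> x)) = (%x. c * b x)" by (simp add: b_def \<nu>_def fun_eq_iff)
 ultimately have "C2_fun (%x. c * b x) g H" by simp
 then show ?thesis
  by (rule that) (use c pos z bi in auto)
qed


section \<open>The weak Laplace equation\<close>

lemma continuous_on_extend_zero:
 fixes F :: "'a::euclidean_space => 'b::real_normed_vector"
 assumes "open U" "continuous_on U F" "compact K" "K \<subseteq> U" "!!x. x \<notin> K ==> F x = 0"
 shows "continuous_on UNIV F"
proof -
 have "continuous_on (- K) F"
  by (rule continuous_on_eq[of _ "%x. 0"]) (use assms in auto)
 then have "continuous_on (U \<union> - K) F"
  using assms by (intro continuous_on_open_Un) (auto intro: compact_imp_closed)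
 moreover have "U \<union> - K = UNIV" using assms(4) by auto
 ultimately show ?thesis by simp
qed

text \<open>Since \<open>(u \<times> a) \<times> e = (u \<bullet> e) a - (a \<bullet> e) u\<close>,
  this is the identity \<open>curl curl = grad div - Laplace\<close> with all derivatives moved to a
  test function of Hessian \<open>H\<close>.\<close>

lemma cross3_rows_trace:
 assumes "transpose H = H"
 shows "(\<Sum>j\<in>UNIV. cross3 (cross3 u (H $ j)) (axis j 1)) = H *v u - trace H *^ u"
proof -
 have s': "H $ i $ j = H $ j $ i" for i j
  using arg_cong[OF assms, of "%A. A $ i $ j"] by (simp add: transpose_def)
 note s = s'[of 1 2] s'[of 1 3] s'[of 2 3]
 show ?thesis
  by (simp add: sum_3 trace_def matrix_vector_mult_def vec_eq_iff forall_3 cross3_def axis_def s algebra_simps)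
qed

lemma cross3_sum_axis: "(\<Sum>j\<in>UNIV. cross3 ((g $ j * c) *^ u) (axis j 1)) = c *^ cross3 u g"
 by (simp add: sum_3 vec_eq_iff forall_3 cross3_def axis_def algebra_simps)

lemma weak_beltramiD:
 assumes "weak_beltrami U f u"
 shows "u \<in> borel_measurable borel" "compact K ==> K \<subseteq> U ==> integrable lborel (%x. indicator K x *^ u x)"
  "C1_test U \<phi> g ==> (LI x. cross3 (u x) (g x)) = (LI x. (\<phi> x * f x) *^ u x)"
  "C1_test U \<phi> g ==> (LI x. u x \<bullet> g x) = 0"
proof -
 note a = assms[unfolded weak_beltrami_def]
 show "u \<in> borel_measurable borel" by (rule conjunct1[OF a])
 show "compact K ==> K \<subseteq> U ==> integrable lborel (%x. indicator K x *^ u x)"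
  using conjunct1[OF conjunct2[OF a]] by simp
 show "C1_test U \<phi> g ==> (LI x. cross3 (u x) (g x)) = (LI x. (\<phi> x * f x) *^ u x)"
  "C1_test U \<phi> g ==> (LI x. u x \<bullet> g x) = 0"
  using conjunct2[OF conjunct2[OF a]] by simp_all
qed

text \<open>Weak form of \<open>Laplace u = u \<times> grad f - f^2 u\<close>, obtained by taking
  the curl of the equation. The right-hand side contains no derivative of \<open>u\<close>, which
  lets potentials gain regularity.\<close>

lemma weak_laplace:
 assumes W: "weak_beltrami U f u" and U: "open U" and f: "!!x. x \<in> U ==> (f has_derivative (%h. f' x \<bullet> h)) (at x)"
  and f': "continuous_on U f'"
  and C2: "C2_fun \<phi> g H" and K: "compact K" "K \<subseteq> U" "!!x. x \<notin> K ==> \<phi> x = 0"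
 shows "(LI x. trace (H x) *^ u x) = (LI x. \<phi> x *^ (cross3 (u x) (f' x) - (f x)\<^sup>2 *^ u x))"
proof -
 note C = C2_funD[OF C2]
 have [measurable]: "u \<in> borel_measurable borel" and iK: "integrable lborel (%x. indicator K x *^ u x)"
  using weak_beltramiD(1,2)[OF W] K by auto
 have E: "(LI x. cross3 (u x) (g x)) = (LI x. (\<phi> x * f x) *^ u x)" "(LI x. u x \<bullet> g x) = 0"
  if "C1_test U \<phi> g" for \<phi> g using weak_beltramiD(3,4)[OF W that] .
 have fc: "continuous_on U f"
  by (rule continuous_at_imp_continuous_on) (use f has_derivative_continuous in blast)
 have cl: "closed K" using K compact_imp_closed by blast
 have g0: "g x = 0" if "x \<notin> K" for x
 proof -
  have "(%h. g x \<bullet> h) = (%h. 0)" by (rule vanishing_derivative[OF cl K(3) C(1) that])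
  then have "g x \<bullet> g x = 0" by metis
  then show ?thesis by simp
 qed
 have H0: "H x = 0" if "x \<notin> K" for x
 proof -
  have "(%h. H x *v h) = (%h. 0)" by (rule vanishing_derivative[OF cl g0 C(2) that])
  then have "H x *v h = 0 *v h" for h using fun_cong[of "%h. H x *v h" "%h. 0" h] by simp
  then show ?thesis by (simp add: matrix_eq)
 qed
 have T: "C1_test U \<phi> g" unfolding C1_test_def using C K by blast
 have Tj: "C1_test U (%x. g x $ j) (%x. H x $ j)" for j
  unfolding C1_test_def
 proof (intro conjI allI exI[of _ K] impI)
  have "((%x. g x $ j) has_derivative (%h. (H x *v h) $ j)) (at x)" for x
   by (rule bounded_linear.has_derivative[OF bounded_linear_vec_nth C(2)])
  then show "((%x. g x $ j) has_derivative (%h. H x $ j \<bullet> h)) (at x)" for x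
   by (simp add: matrix_vector_mult_def inner_vec_def)
  show "continuous_on UNIV (%x. H x $ j)" by (intro continuous_intros C)
 qed (use K g0 in auto)
 have ic: "integrable lborel (%x. cross3 (u x) (k x))" if "continuous_on UNIV k" "!!x. x \<notin> K ==> k x = 0" for k
  by (rule integrable_bilinear_compact_support[OF bounded_bilinear.flip[OF bounded_bilinear_cross3] _ that(1) K(1) that(2) iK]) auto
 have isc: "integrable lborel (%x. k x *^ u x)" if "continuous_on UNIV k" "!!x. x \<notin> K ==> k x = 0" for k :: "_ => real"
  by (rule integrable_bilinear_compact_support[OF bounded_bilinear_scaleR _ that(1) K(1) that(2) iK]) auto
 have im: "integrable lborel (%x. H x *v u x)"
  by (rule integrable_bilinear_compact_support[OF _ _ C(3) K(1) H0 iK])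
    (auto simp: bilinear_conv_bounded_bilinear[symmetric] bilinear_def linear_iff matrix_vector_mult_add_rdistrib
     matrix_vector_right_distrib scaleR_matrix_vector_assoc matrix_vector_mult_scaleR)
 have bl: "bounded_linear (%w. cross3 w e)" for e
  by (rule bounded_bilinear.bounded_linear_left[OF bounded_bilinear_cross3])
 have c1: "continuous_on UNIV (%x. H x $ j)" for j by (intro continuous_intros C)
 have c2: "continuous_on UNIV (%x. g x $ j * f x)" for j
  by (rule continuous_on_extend_zero[OF U _ K(1,2)]) (use g0 in "auto intro!: continuous_intros fc continuous_on_subset[OF C(5)]")
 have c3: "continuous_on UNIV (%x. \<phi> x *^ f' x)"
  by (rule continuous_on_extend_zero[OF U _ K(1,2)]) (use K(3) in "auto intro!: continuous_intros f' continuous_on_subset[OF C(6)]")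
 have c4: "continuous_on UNIV (%x. f x *^ g x)"
  by (rule continuous_on_extend_zero[OF U _ K(1,2)]) (use g0 in "auto intro!: continuous_intros fc continuous_on_subset[OF C(5)]")
 have c5: "continuous_on UNIV (%x. \<phi> x * f x * f x)"
  by (rule continuous_on_extend_zero[OF U _ K(1,2)]) (use K(3) in "auto intro!: continuous_intros fc continuous_on_subset[OF C(6)]")
 have c6: "continuous_on UNIV (%x. trace (H x))"
  unfolding trace_def by (intro continuous_intros C)
 \<comment> \<open>The curl equation tested with the \<open>j\<close>-th partial derivative of
   \<open>\<phi>\<close>, crossed with the \<open>j\<close>-th unit vector and summed.\<close>
 have "(LI x. (\<Sum>j\<in>UNIV. cross3 (cross3 (u x) (H x $ j)) (axis j 1)))
  = (\<Sum>j\<in>UNIV. cross3 (LI x. cross3 (u x) (H x $ j)) (axis j 1))"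
 proof (subst Bochner_Integration.integral_sum)
  show "integrable lborel (%x. cross3 (cross3 (u x) (H x $ j)) (axis j 1))" for j
   by (rule integrable_bounded_linear[OF bl ic[OF c1]]) (use H0 in auto)
  show "(\<Sum>j\<in>UNIV. \<integral>x. cross3 (cross3 (u x) (H x $ j)) (axis j 1) \<partial>lborel)
   = (\<Sum>j\<in>UNIV. cross3 (LI x. cross3 (u x) (H x $ j)) (axis j 1))"
   by (intro sum.cong refl integral_bounded_linear[OF bl ic[OF c1]]) (use H0 in auto)
 qed
 also have "\<dots> = (\<Sum>j\<in>UNIV. cross3 (LI x. (g x $ j * f x) *^ u x) (axis j 1))"
  by (simp only: E(1)[OF Tj])
 also have "\<dots> = (LI x. (\<Sum>j\<in>UNIV. cross3 ((g x $ j * f x) *^ u x) (axis j 1)))"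
 proof (subst Bochner_Integration.integral_sum)
  show "integrable lborel (%x. cross3 ((g x $ j * f x) *^ u x) (axis j 1))" for j
   by (rule integrable_bounded_linear[OF bl isc[OF c2]]) (use g0 in auto)
  show "(\<Sum>j\<in>UNIV. cross3 (LI x. (g x $ j * f x) *^ u x) (axis j 1))
   = (\<Sum>j\<in>UNIV. \<integral>x. cross3 ((g x $ j * f x) *^ u x) (axis j 1) \<partial>lborel)"
   by (intro sum.cong refl integral_bounded_linear[OF bl isc[OF c2], symmetric]) (use g0 in auto)
 qed
 finally have 1: "(LI x. H x *v u x - trace (H x) *^ u x) = (LI x. f x *^ cross3 (u x) (g x))"
  by (simp only: cross3_rows_trace[OF C(4)] cross3_sum_axis)
 have it: "integrable lborel (%x. trace (H x) *^ u x)"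
  by (rule isc[OF c6]) (use H0 in "auto simp: trace_def")
 \<comment> \<open>The divergence equation tested with the partial derivatives of
   \<open>\<phi>\<close> removes the gradient of the divergence.\<close>
 have "(LI x. H x *v u x) $ i = (0::real^3) $ i" for i
 proof -
  have "(LI x. H x *v u x) $ i = (LI x. (H x *v u x) $ i)"
   by (rule integral_bounded_linear[OF bounded_linear_vec_nth im, symmetric])
  also have "\<dots> = (LI x. u x \<bullet> (H x $ i))"
   by (simp add: matrix_vector_mult_def inner_vec_def mult.commute)
  finally show ?thesis using E(2)[OF Tj] by simp
 qed
 then have "(LI x. H x *v u x) = 0" by (simp add: vec_eq_iff)
 then have 2: "- (LI x. trace (H x) *^ u x) = (LI x. f x *^ cross3 (u x) (g x))"
  using 1 im it by (simp add: Bochner_Integration.integral_diff)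
 have i4: "integrable lborel (%x. f x *^ cross3 (u x) (g x))"
  using ic[OF c4] g0 by (simp add: cross_mult_right)
 have i3: "integrable lborel (%x. \<phi> x *^ cross3 (u x) (f' x))"
  using ic[OF c3] K(3) by (simp add: cross_mult_right)
 have i5: "integrable lborel (%x. (\<phi> x * f x * f x) *^ u x)"
  by (rule isc[OF c5]) (use K(3) in auto)
 \<comment> \<open>Testing with \<open>\<phi> f\<close> brings in \<open>grad f\<close> and replaces
   the integral with \<open>g\<close> by terms without derivatives of \<open>\<phi>\<close>.\<close>
 have "(LI x. cross3 (u x) (\<phi> x *^ f' x + f x *^ g x)) = (LI x. (\<phi> x * f x * f x) *^ u x)"
  by (rule E(1)[OF C1_test_mult[OF T U f f']])
 then have "(LI x. \<phi> x *^ cross3 (u x) (f' x)) + (LI x. f x *^ cross3 (u x) (g x)) = (LI x. (\<phi> x * f x * f x) *^ u x)"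
  using i3 i4 by (simp add: cross_add_right cross_mult_right Bochner_Integration.integral_add)
 then have "(LI x. trace (H x) *^ u x) = (LI x. \<phi> x *^ cross3 (u x) (f' x)) - (LI x. (\<phi> x * f x * f x) *^ u x)"
  unfolding 2[symmetric] by (simp add: algebra_simps)
 also have "\<dots> = (LI x. \<phi> x *^ cross3 (u x) (f' x) - (\<phi> x * f x * f x) *^ u x)"
  using i3 i5 by (simp add: Bochner_Integration.integral_diff)
 finally show ?thesis by (simp add: scaleR_diff_right power2_eq_square mult.assoc)
qed

section \<open>Convolutions and cutoffs of class two\<close>

lemma conv_sum_left:
 assumes "finite I" "!!i. i \<in> I ==> integrable lborel (%z. k i (x - z) *^ (G z :: 'b::euclidean_space))"
 shows "conv (%y. \<Sum>i\<in>I. k i y * c i) G x = (\<Sum>i\<in>I. c i *^ conv (k i) G x)"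
proof -
 have "conv (%y. \<Sum>i\<in>I. k i y * c i) G x = (LI z. (\<Sum>i\<in>I. c i *^ (k i (x - z) *^ G z)))"
  unfolding conv_def by (simp add: scaleR_sum_left mult.commute)
 also have "\<dots> = (\<Sum>i\<in>I. \<integral>z. c i *^ (k i (x - z) *^ G z) \<partial>lborel)"
  by (intro Bochner_Integration.integral_sum integrable_scaleR_right assms)
 also have "\<dots> = (\<Sum>i\<in>I. c i *^ conv (k i) G x)"
  unfolding conv_def by (simp only: integral_scaleR_right)
 finally show ?thesis .
qed

lemma has_derivative_vecI:
 fixes F :: "real^3 => real^'n"
 assumes "!!i. ((%x. F x $ i) has_derivative (%h. D h $ i)) (at x)"
 shows "(F has_derivative D) (at x)"
proof -
 have "((%x. \<chi> i. F x $ i) has_derivative (%h. \<chi> i. D h $ i)) (at x)"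
  using assms by (subst has_derivative_componentwise_within) (auto simp: Basis_vec_def inner_axis)
 then show ?thesis by simp
qed

lemma C2_support:
 assumes "C2_fun k g H" "compact K" "!!x. x \<notin> K ==> k x = 0" "x \<notin> K"
 shows "g x = 0" "H x = 0"
proof -
 note C = C2_funD[OF assms(1)]
 have cl: "closed K" using assms compact_imp_closed by blast
 have g0: "g x = 0" if "x \<notin> K" for x
 proof -
  have "(%h. g x \<bullet> h) = (%h. 0)" by (rule vanishing_derivative[OF cl assms(3) C(1) that])
  then have "g x \<bullet> g x = 0" by metis
  then show ?thesis by simp
 qed
 have "(%h. H x *v h) = (%h. 0)" by (rule vanishing_derivative[OF cl g0 C(2) assms(4)])
 then have "H x *v h = 0 *v h" for h using fun_cong[of "%h. H x *v h" "%h. 0" h] by simp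
 then show "g x = 0" "H x = 0" using g0 assms(4) by (simp_all add: matrix_eq)
qed

lemma C2_fun_conv:
 fixes G :: "real^3 => real"
 assumes k: "C2_fun k g H" and K: "compact K" "!!x. x \<notin> K ==> k x = 0" and G: "integrable lborel G"
 shows "C2_fun (conv k G) (%x. \<chi> i. conv (%y. g y $ i) G x) (%x. \<chi> i j. conv (%y. H y $ i $ j) G x)"
proof -
 note C = C2_funD[OF k] and S = C2_support[OF k K]
 have gc: "continuous_on UNIV (%y. g y $ i)" for i by (intro continuous_intros C)
 have Hc: "continuous_on UNIV (%y. H y $ i $ j)" for i j by (intro continuous_intros C)
 have Hr: "continuous_on UNIV (%y. H y $ i)" for i by (intro continuous_intros C)
 have ig: "integrable lborel (%z. g (x - z) $ i *^ G z)" for x i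
  using conv_integrable[OF G gc K(1)] S by simp
 have iH: "integrable lborel (%z. H (x - z) $ i $ j *^ G z)" for x i j
  using conv_integrable[OF G Hc K(1)] S by simp
 have d1: "(conv k G has_derivative (%h. (\<chi> i. conv (%y. g y $ i) G x) \<bullet> h)) (at x)" for x
 proof -
  have "(conv k G has_derivative (%h. conv (%y. g y \<bullet> h) G x)) (at x)"
   by (rule conv_has_derivative[OF G C(1) C(5) K S(1)])
  moreover have "conv (%y. g y \<bullet> h) G x = (\<chi> i. conv (%y. g y $ i) G x) \<bullet> h" for h
   using conv_sum_left[of UNIV "%i y. g y $ i" x G "%i. h $ i"] ig
   by (simp add: inner_vec_def mult.commute)
  ultimately show ?thesis by simp
 qed
 have d2: "((%x. \<chi> i. conv (%y. g y $ i) G x) has_derivative (%h. (\<chi> i j. conv (%y. H y $ i $ j) G x) *v h)) (at x)" for x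
 proof (rule has_derivative_vecI)
  fix i
  have "((%x. g x $ i) has_derivative (%h. (H x *v h) $ i)) (at x)" for x
   by (rule bounded_linear.has_derivative[OF bounded_linear_vec_nth C(2)])
  then have "((%x. g x $ i) has_derivative (%h. H x $ i \<bullet> h)) (at x)" for x
   by (simp add: matrix_vector_mult_def inner_vec_def)
  then have "(conv (%y. g y $ i) G has_derivative (%h. conv (%y. H y $ i \<bullet> h) G x)) (at x)"
   by (rule conv_has_derivative[OF G _ Hr K(1)]) (use S in auto)
  moreover have "conv (%y. H y $ i \<bullet> h) G x = ((\<chi> i j. conv (%y. H y $ i $ j) G x) *v h) $ i" for h
   using conv_sum_left[of UNIV "%j y. H y $ i $ j" x G "%j. h $ j"] iH
   by (simp add: inner_vec_def matrix_vector_mult_def mult.commute)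
  ultimately show "((%x. (\<chi> i. conv (%y. g y $ i) G x) $ i) has_derivative
   (%h. ((\<chi> i j. conv (%y. H y $ i $ j) G x) *v h) $ i)) (at x)" by simp
 qed
 have "continuous_on UNIV (conv (%y. H y $ i $ j) G)" for i j
 proof -
  obtain B where "!!x. norm (H x $ i $ j) <= B"
   using continuous_compact_support(2)[OF Hc K(1), of i j] S by auto
  then show ?thesis using conv_continuous[OF G Hc, of i j B] by simp
 qed
 then have c: "continuous_on UNIV (%x. \<chi> i j. conv (%y. H y $ i $ j) G x)"
  by (intro continuous_on_vec_lambda) simp
 have "H y $ i $ j = H y $ j $ i" for y i j
  using arg_cong[OF C(4)[of y], of "%A. A $ i $ j"] by (simp add: transpose_def)
 then have "transpose (\<chi> i j. conv (%y. H y $ i $ j) G x) = (\<chi> i j. conv (%y. H y $ i $ j) G x)" for x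
  by (simp add: transpose_def)
 then show ?thesis unfolding C2_fun_def using d1 d2 c by blast
qed

text \<open>The indicator of the neighbourhood of radius \<open>2 d\<close> is smoothed at scale
  \<open>d\<close>: the result is 1 within distance \<open>d\<close> of \<open>K\<close> and 0
  beyond \<open>3 d\<close>. The margin \<delta> is recorded because the derivatives of the cutoff
  vanish there.\<close>

lemma C2_cutoff:
 fixes K V :: "(real^3) set"
 assumes K: "compact K" and V: "open V" "K \<subseteq> V"
 shows "\<exists>\<eta> g H \<delta> K'. C2_fun \<eta> g H \<and> (\<forall>x. 0 <= \<eta> x \<and> \<eta> x <= 1) \<and> compact K' \<and> K' \<subseteq> V \<and>
  (\<forall>x. x \<notin> K' --> \<eta> x = 0) \<and> \<delta> > 0 \<and> (\<forall>x. \<forall>z\<in>K. dist x z <= \<delta> --> \<eta> x = 1)"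
proof -
 obtain e where e: "e > 0" "(\<Union>x\<in>K. cball x e) \<subseteq> V"
  using compact_subset_open_imp_cball_epsilon_subset[OF K V] by auto
 define d where "d = e / 3"
 have d: "d > 0" "3 * d = e" using e by (auto simp: d_def)
 define B where "B r = {x + y |x y. x \<in> K \<and> y \<in> cball 0 r}" for r
 have B: "compact (B r)" for r unfolding B_def by (intro compact_sums K) auto
 have Bmem: "x \<in> B r \<longleftrightarrow> (\<exists>z\<in>K. dist x z <= r)" for x r
 proof
  assume "\<exists>z\<in>K. dist x z <= r"
  then obtain z where "z \<in> K" "dist x z <= r" by auto
  then have "x = z + (x - z)" "x - z \<in> cball 0 r" unfolding mem_cball_0 dist_norm by auto
  then show "x \<in> B r" unfolding B_def using \<open>z \<in> K\<close> by blast
 next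
  assume "x \<in> B r"
  then obtain z y where "z \<in> K" "norm y <= r" "x = z + y" unfolding B_def mem_cball_0 by auto
  then show "\<exists>z\<in>K. dist x z <= r" by (intro bexI[of _ z]) (auto simp: dist_norm)
 qed
 obtain k :: "real^3 => real" and g H where k: "C2_fun k g H" "!!x. k x >= 0" "!!x. norm x > d ==> k x = 0"
  "integrable lborel k" "(LI x. k x) = 1"
  using C2_kernel[OF d(1)] by metis
 have [measurable]: "B r \<in> sets borel" for r using B borel_compact by blast
 define G :: "real^3 => real" where "G = indicator (B (2*d))"
 have G: "integrable lborel G"
  unfolding G_def using emeasure_bounded_finite[OF compact_imp_bounded[OF B]] by simp
 have k0: "k x = 0" if "x \<notin> cball 0 d" for x using k(3) that by auto
 have i: "integrable lborel (%z. k (x - z) *^ G z)" for x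
  by (rule conv_integrable[OF G C2_funD(6)[OF k(1)] compact_cball k0])
 note u = conv_uniform[OF i k(4,5,2,3)]
 have r: "0 <= conv k G x \<and> conv k G x <= 1" for x
 proof -
  \<comment> \<open>\<open>G\<close> takes the values 0 and 1, so it stays within \<open>1/2\<close>
    of \<open>1/2\<close>; one average gives both bounds.\<close>
  have "norm (conv k G x - 1/2) <= 1/2" by (rule u) (auto simp: G_def indicator_def)
  then show ?thesis unfolding real_norm_def by linarith
 qed
 have z: "conv k G x = 0" if "x \<notin> B (3*d)" for x
 proof -
  have "norm (conv k G x - 0) <= 0"
  proof (rule u)
   fix z assume "dist x z <= d"
   have "z \<notin> B (2*d)"
   proof
    assume "z \<in> B (2*d)"
    then obtain y where "y \<in> K" "dist z y <= 2*d" using Bmem by auto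
    then have "dist x y <= 3*d" using \<open>dist x z <= d\<close> dist_triangle[of x y z] by linarith
    then show False using that Bmem \<open>y \<in> K\<close> by blast
   qed
   then show "norm (G z - 0) <= 0" by (simp add: G_def)
  qed
  then show ?thesis by simp
 qed
 have o: "conv k G x = 1" if "y \<in> K" "dist x y <= d" for x y
 proof -
  have "norm (conv k G x - 1) <= 0"
  proof (rule u)
   fix z assume "dist x z <= d"
   then have "dist z y <= 2 * d" using that dist_triangle[of z y x] by (simp add: dist_commute)
   then have "z \<in> B (2*d)" using Bmem that by blast
   then show "norm (G z - 1) <= 0" by (simp add: G_def)
  qed
  then show ?thesis by simp
 qed
 have "B (3*d) \<subseteq> V" using e d Bmem by (force simp: dist_commute)
 note S = this
 show ?thesis
 proof (intro exI conjI)
  show "C2_fun (conv k G) (%x. \<chi> i. conv (%y. g y $ i) G x) (%x. \<chi> i j. conv (%y. H y $ i $ j) G x)"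
   by (rule C2_fun_conv[OF k(1) compact_cball k0 G])
  show "\<forall>x. 0 <= conv k G x \<and> conv k G x <= 1" using r by simp
  show "compact (B (3*d))" by (rule B)
  show "B (3*d) \<subseteq> V" by (rule S)
  show "\<forall>x. x \<notin> B (3*d) --> conv k G x = 0" using z by simp
  show "d > 0" by (rule d(1))
  show "\<forall>x. \<forall>z\<in>K. dist x z <= d --> conv k G x = 1" using o by simp
 qed
qed


section \<open>Potential estimates\<close>

lemma integral_affine:
 fixes F :: "'a::euclidean_space => 'b::euclidean_space"
 assumes [measurable]: "F \<in> borel_measurable borel" and c: "c > (0::real)"
 shows "(LI x. F x) = c ^ DIM('a) *^ (LI x. F (c *^ x))"
proof -
 have "(LI x. F x) = (\<integral>x. F x \<partial>density (distr lborel borel (%x. 0 + c *^ x)) (%_. ennreal (c ^ DIM('a))))"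
  using lborel_affine[of c "0::'a"] c by (simp add: ennreal_power)
 also have "\<dots> = (\<integral>x. c ^ DIM('a) *^ F x \<partial>distr lborel borel (%x. 0 + c *^ x))"
  by (rule integral_density) (use c in auto)
 also have "\<dots> = (LI x. c ^ DIM('a) *^ F (c *^ x))"
  by (subst integral_distr) auto
 finally show ?thesis by simp
qed

text \<open>Dyadic decomposition: a point with \<open>2^-(j+1) < norm z \<le> 2^-j\<close> is paid
  for by the value \<open>4^(j+1)\<close> on the ball of radius \<open>2^-j\<close>, and the volumes
  \<open>8^-j\<close> beat the factors \<open>4^j\<close>. At \<open>z = 0\<close> the integrand is
  0 by the convention for division.\<close>

lemma inverse_square_integral_finite:
 "(\<integral>\<^sup>+z. indicator (cball 0 1) z * ennreal (1 / (norm (z::real^3))\<^sup>2) \<partial>lborel)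
   <= ennreal (8 * unit_ball_vol 3)"
proof -
 have [measurable]: "cball b s \<in> sets borel" for b :: "real^3" and s by (rule borel_closed) auto
 let ?V = "unit_ball_vol 3"
 let ?T = "%j z. ennreal (4 ^ Suc j) * indicator (cball (0::real^3) ((1/2)^j)) z"
 have "indicator (cball 0 1) z * ennreal (1 / (norm z)\<^sup>2) <= (\<Sum>j. ?T j z)" for z :: "real^3"
 proof (cases "norm z <= 1 \<and> z ~= 0")
  case True
  obtain n where "(1/2::real)^n < norm z" using real_arch_pow_inv[of "norm z" "1/2"] True by auto
  \<comment> \<open>The first dyadic radius below \<open>norm z\<close>. It is not the zeroth
    because \<open>norm z \<le> 1\<close>, so it has a predecessor \<open>j\<close>, the index of
    the smallest dyadic ball that contains \<open>z\<close>.\<close>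
  define m where "m = (LEAST n. (1/2::real)^n < norm z)"
  have m: "(1/2::real)^m < norm z" unfolding m_def by (rule LeastI) fact
  have "m ~= 0" using m True by (metis linorder_not_le power_0)
  then obtain j where j: "m = Suc j" using not0_implies_Suc by blast
  have "\<not> (1/2::real)^j < norm z" using j unfolding m_def by (metis lessI not_less_Least)
  then have "z \<in> cball 0 ((1/2)^j)" by simp
  have "((1/2::real)^m)\<^sup>2 <= (norm z)\<^sup>2" using m by (intro power_mono) auto
  then have "1 / (norm z)\<^sup>2 <= 1 / ((1/2::real)^m)\<^sup>2" using True by (intro divide_left_mono) auto
  also have "\<dots> = 4 ^ Suc j"
  proof -
   have "((1/2::real)^m)\<^sup>2 = (1/4)^m" by (metis power2_eq_square power_mult_distrib times_divide_times_eq mult_1 mult_2 numeral_Bit0 one_add_one)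
   then show ?thesis using j by (simp add: power_one_over)
  qed
  finally have "indicator (cball 0 1) z * ennreal (1 / (norm z)\<^sup>2) <= ?T j z"
   using True \<open>z \<in> cball 0 ((1/2)^j)\<close> by (simp add: ennreal_leI del: power_Suc)
  also have "\<dots> = (\<Sum>i\<in>{j}. ?T i z)" by (subst sum.insert) auto
  also have "\<dots> <= (\<Sum>j. ?T j z)" by (rule sum_le_suminf) auto
  finally show ?thesis .
 qed auto
 then have "(\<integral>\<^sup>+z. indicator (cball 0 1) z * ennreal (1 / (norm (z::real^3))\<^sup>2) \<partial>lborel) <= (\<integral>\<^sup>+z. (\<Sum>j. ?T j z) \<partial>lborel)"
  by (intro nn_integral_mono)
 also have "\<dots> = (\<Sum>j. \<integral>\<^sup>+z. ?T j z \<partial>lborel)" by (rule nn_integral_suminf) auto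
 also have "\<dots> = (\<Sum>j. ennreal (4 * ?V * (1/2)^j))"
 proof (rule suminf_cong)
  fix j
  have e: "(4::real)^Suc j * (?V * ((1/2)^j)^3) = 4 * ?V * (1/2)^j"
  proof -
   have "(4::real)^j * ((1/2)^j)^3 = (4 * (1/2)^3)^j" by (simp only: power_mult_distrib power_mult[symmetric] mult.commute)
   also have "\<dots> = (1/2)^j" by (simp add: power3_eq_cube)
   finally have *: "(4::real)^j * ((1/2)^j)^3 = (1/2)^j" .
   have "(4::real)^Suc j * (?V * ((1/2)^j)^3) = 4 * ?V * ((4::real)^j * ((1/2)^j)^3)" by (simp only: power_Suc mult_ac)
   then show ?thesis unfolding * .
  qed
  have "(\<integral>\<^sup>+z. ?T j z \<partial>lborel) = ennreal (4 ^ Suc j) * emeasure lborel (cball (0::real^3) ((1/2)^j))"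
   by (subst nn_integral_cmult) auto
  also have "\<dots> = ennreal (4 ^ Suc j) * ennreal (?V * ((1/2)^j)^3)"
   by (subst emeasure_cball) auto
  also have "\<dots> = ennreal ((4::real)^Suc j * (?V * ((1/2)^j)^3))"
   by (rule ennreal_mult[symmetric]) auto
  finally show "(\<integral>\<^sup>+z. ?T j z \<partial>lborel) = ennreal (4 * ?V * (1/2)^j)" unfolding e .
 qed
 also have "\<dots> = ennreal (8 * ?V)"
 proof (rule suminf_ennreal_eq)
  have "(%j. (1/2::real)^j) sums 2" using geometric_sums[of "1/2::real"] by simp
  from sums_mult[OF this, of "4 * ?V"] show "(%j. 4 * ?V * (1/2)^j) sums (8 * ?V)" by (simp add: mult_ac)
 qed auto
 finally show ?thesis .
qed

text \<open>The unit ball around \<open>x\<close> contributes a translate of the integral above;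
  elsewhere the kernel is at most 1 on a ball of finite measure. Neither part depends on
  \<open>x\<close>.\<close>

lemma inverse_square_potential_bound:
 fixes a :: "real^3"
 shows "\<exists>C\<ge>0. \<forall>x. (\<integral>\<^sup>+y. indicator (cball a r) y * ennreal (1 / (norm (x - y))\<^sup>2) \<partial>lborel) <= ennreal C"
proof -
 let ?F = "%z::real^3. indicator (cball 0 1) z * ennreal (1 / (norm z)\<^sup>2)"
 have [measurable]: "cball b s \<in> sets borel" for b :: "real^3" and s by (rule borel_closed) auto
 have fin: "emeasure lborel (cball a r) < \<infinity>" by (rule emeasure_bounded_finite) auto
 define m where "m = measure lborel (cball a r)"
 have m: "emeasure lborel (cball a r) = ennreal m" "m >= 0"
  using fin by (auto simp: m_def emeasure_eq_ennreal_measure)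
 have "(\<integral>\<^sup>+y. indicator (cball a r) y * ennreal (1 / (norm (x - y))\<^sup>2) \<partial>lborel) <= ennreal (8 * unit_ball_vol 3 + m)" for x
 proof -
  have "(\<integral>\<^sup>+y. indicator (cball a r) y * ennreal (1 / (norm (x - y))\<^sup>2) \<partial>lborel)
   <= (\<integral>\<^sup>+y. ?F (x - y) + indicator (cball a r) y \<partial>lborel)"
  proof (rule nn_integral_mono)
   fix y
   show "indicator (cball a r) y * ennreal (1 / (norm (x - y))\<^sup>2) <= ?F (x - y) + indicator (cball a r) y"
   proof (cases "norm (x - y) <= 1")
    case True
    then show ?thesis by (auto simp: indicator_def)
   next
    case False
    then have "1 <= (norm (x - y))\<^sup>2" by (intro one_le_power) auto
    then have "1 / (norm (x - y))\<^sup>2 <= 1" by (simp add: divide_le_eq_1)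
    then have "ennreal (1 / (norm (x - y))\<^sup>2) <= 1" using ennreal_leI by fastforce
    then show ?thesis using False by (auto simp: indicator_def)
   qed
  qed
  also have "\<dots> = (\<integral>\<^sup>+y. ?F (x - y) \<partial>lborel) + ennreal m"
   by (subst nn_integral_add) (auto simp: m)
  also have "(\<integral>\<^sup>+y. ?F (x - y) \<partial>lborel) = (\<integral>\<^sup>+z. ?F z \<partial>lborel)"
   by (rule nn_integral_reflect) simp
  also have "\<dots> + ennreal m <= ennreal (8 * unit_ball_vol 3) + ennreal m"
   by (intro add_right_mono inverse_square_integral_finite)
  also have "\<dots> = ennreal (8 * unit_ball_vol 3 + m)" using m by (simp add: ennreal_plus)
  finally show ?thesis .
 qed
 then show ?thesis using m by (intro exI[of _ "8 * unit_ball_vol 3 + m"]) auto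
qed

lemma inverse_le_inverse_square: "1 / t <= 1 + 1 / t\<^sup>2" if "t >= (0::real)"
proof (cases "t >= 1")
 case True
 then have "1 / t <= 1" by simp
 moreover have "1 / t\<^sup>2 >= 0" by simp
 ultimately show ?thesis by linarith
next
 case False
 show ?thesis
 proof (cases "t = 0")
  case nz: False
  then have "t\<^sup>2 <= t" using that False by (simp add: power2_eq_square mult_left_le)
  then have "1 / t <= 1 / t\<^sup>2" using that nz by (intro divide_left_mono) auto
  then show ?thesis by linarith
 qed auto
qed

lemma inverse_potential_bound:
 fixes a :: "real^3"
 shows "\<exists>C\<ge>0. \<forall>x. (\<integral>\<^sup>+y. indicator (cball a r) y * ennreal (1 / norm (x - y)) \<partial>lborel) <= ennreal C"
proof -
 have [measurable]: "cball b s \<in> sets borel" for b :: "real^3" and s by (rule borel_closed) auto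
 obtain C where C: "C >= 0" "!!x. (\<integral>\<^sup>+y. indicator (cball a r) y * ennreal (1 / (norm (x - y))\<^sup>2) \<partial>lborel) <= ennreal C"
  using inverse_square_potential_bound[of a r] by auto
 have fin: "emeasure lborel (cball a r) < \<infinity>" by (rule emeasure_bounded_finite) auto
 define m where "m = measure lborel (cball a r)"
 have m: "emeasure lborel (cball a r) = ennreal m" "m >= 0"
  using fin by (auto simp: m_def emeasure_eq_ennreal_measure)
 have "(\<integral>\<^sup>+y. indicator (cball a r) y * ennreal (1 / norm (x - y)) \<partial>lborel) <= ennreal (m + C)" for x
 proof -
  have "(\<integral>\<^sup>+y. indicator (cball a r) y * ennreal (1 / norm (x - y)) \<partial>lborel)
   <= (\<integral>\<^sup>+y. indicator (cball a r) y + indicator (cball a r) y * ennreal (1 / (norm (x - y))\<^sup>2) \<partial>lborel)"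
  proof (rule nn_integral_mono)
   fix y
   have "ennreal (1 / norm (x - y)) <= 1 + ennreal (1 / (norm (x - y))\<^sup>2)"
    using ennreal_leI[OF inverse_le_inverse_square[OF norm_ge_zero[of "x - y"]]]
    by (simp add: ennreal_plus ennreal_1[symmetric] del: ennreal_1)
   then show "indicator (cball a r) y * ennreal (1 / norm (x - y))
    <= indicator (cball a r) y + indicator (cball a r) y * ennreal (1 / (norm (x - y))\<^sup>2)"
    by (auto simp: indicator_def)
  qed
  also have "\<dots> = ennreal m + (\<integral>\<^sup>+y. indicator (cball a r) y * ennreal (1 / (norm (x - y))\<^sup>2) \<partial>lborel)"
   by (subst nn_integral_add) (auto simp: m)
  also have "\<dots> <= ennreal m + ennreal C" by (intro add_left_mono C)
  also have "\<dots> = ennreal (m + C)" using m C by (simp add: ennreal_plus)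
  finally show ?thesis .
 qed
 then show ?thesis using m C by (intro exI[of _ "m + C"]) auto
qed

section \<open>Functions annihilated by all test functions\<close>

text \<open>Continuous tent functions of the distance to \<open>C\<close> decrease to its
  indicator.\<close>

lemma integral_test_compact:
 fixes h :: "'a::euclidean_space => real"
 assumes h: "integrable lborel h" and B: "open B"
  and test: "!!\<psi> K. continuous_on UNIV \<psi> ==> compact K ==> K \<subseteq> B ==> (!!x. x \<notin> K ==> \<psi> x = 0) ==>
   (LI x. \<psi> x * h x) = 0"
  and C: "compact C" "C \<subseteq> B"
 shows "(LINT x:C|lborel. h x) = 0"
proof (cases "C = {}")
 case True
 then show ?thesis by (simp add: set_lebesgue_integral_def)
next
 case False
 have [measurable]: "h \<in> borel_measurable borel" "C \<in> sets borel" using h C borel_compact by auto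
 obtain e where e: "e > 0" "(\<Union>x\<in>C. cball x e) \<subseteq> B"
  using compact_subset_open_imp_cball_epsilon_subset[OF C(1) B C(2)] by auto
 define \<psi> where "\<psi> n x = max 0 (1 - real (Suc n) / e * infdist x C)" for n x
 define K where "K = {x + y |x y. x \<in> C \<and> y \<in> cball 0 e}"
 have K: "compact K" unfolding K_def by (intro compact_sums C) auto
 have "K \<subseteq> (\<Union>x\<in>C. cball x e)" by (force simp: K_def dist_norm)
 then have KB: "K \<subseteq> B" using e by blast
 have \<psi>c: "continuous_on UNIV (\<psi> n)" for n unfolding \<psi>_def by (intro continuous_intros)
 have \<psi>0: "\<psi> n x = 0" if "x \<notin> K" for n x
 proof -
  obtain z where z: "z \<in> C" "infdist x C = dist x z"
   using infdist_attains_inf[OF compact_imp_closed[OF C(1)] False] by metis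
  have "dist x z > e"
  proof (rule ccontr)
   assume "\<not> dist x z > e"
   then have "x - z \<in> cball 0 e" unfolding mem_cball_0 dist_norm by simp
   then have "z + (x - z) \<in> K" unfolding K_def using z by blast
   then show False using that by simp
  qed
  then have "1 <= infdist x C / e" using z e by simp
  also have "\<dots> <= real (Suc n) * (infdist x C / e)"
   using infdist_nonneg[of x C] e(1) mult_right_mono[of 1 "real (Suc n)" "infdist x C / e"] by simp
  finally show ?thesis by (simp add: \<psi>_def field_simps)
 qed
 have "(%n. \<integral>x. \<psi> n x * h x \<partial>lborel) \<longlonglongrightarrow> (LI x. indicator C x * h x)"
 proof (rule integral_dominated_convergence[where w="%x. norm (h x)"])
  have "(%n. \<psi> n x) \<longlonglongrightarrow> indicator C x" for x
  proof (cases "x \<in> C")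
   case True
   then show ?thesis by (simp add: \<psi>_def)
  next
   case nC: False
   then have p: "infdist x C > 0"
    using C(1) False compact_imp_closed in_closed_iff_infdist_zero infdist_nonneg by (metis less_eq_real_def)
   then obtain N where N: "real N > e / infdist x C" using reals_Archimedean2 by blast
   have "\<psi> n x = 0" if "n >= N" for n
   proof -
    have "e / infdist x C < real (Suc n)" using N that by linarith
    then have "1 < real (Suc n) / e * infdist x C" using p e(1) by (simp add: field_simps)
    then show ?thesis by (simp add: \<psi>_def)
   qed
   then have "\<forall>\<^sub>F n in sequentially. \<psi> n x = indicator C x"
    using nC by (auto simp: eventually_sequentially)
   then show ?thesis by (rule tendsto_eventually)
  qed
  then show "AE x in lborel. (%n. \<psi> n x * h x) \<longlonglongrightarrow> indicator C x * h x"
   by (intro always_eventually allI tendsto_mult tendsto_const)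
  have "\<bar>\<psi> n x\<bar> <= 1" for n x using e(1) infdist_nonneg[of x C] by (auto simp: \<psi>_def max_def)
  then show "AE x in lborel. norm (\<psi> n x * h x) <= norm (h x)" for n
   by (auto simp: abs_mult intro!: mult_left_le_one_le)
  show "(%x. \<psi> n x * h x) \<in> borel_measurable lborel" for n
   using borel_measurable_continuous_onI[OF \<psi>c] by simp
 qed (use h in auto)
 moreover have "(LI x. \<psi> n x * h x) = 0" for n
  by (rule test[OF \<psi>c K KB \<psi>0])
 ultimately have "(LI x. indicator C x * h x) = 0" by (simp add: LIMSEQ_const_iff)
 then show ?thesis by (simp add: set_lebesgue_integral_def)
qed

text \<open>The sets \<open>A\<close> for which the integral over \<open>A \<inter> C\<close> is
  zero form a Dynkin system that contains the closed sets, hence all Borel sets; so \<open>h\<close>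
  vanishes almost everywhere on each compact \<open>C\<close>, and countably many of these exhaust
  \<open>B\<close>.\<close>

lemma AE_zero_if_tests_vanish:
 fixes h :: "'a::euclidean_space => real"
 assumes h: "integrable lborel h" and B: "open B"
  and test: "!!\<psi> K. continuous_on UNIV \<psi> ==> compact K ==> K \<subseteq> B ==> (!!x. x \<notin> K ==> \<psi> x = 0) ==>
   (LI x. \<psi> x * h x) = 0"
 shows "AE x in lborel. x \<in> B --> h x = 0"
proof -
 have [measurable]: "h \<in> borel_measurable borel" using h by auto
 have si: "set_integrable lborel A h" if "A \<in> sets borel" for A
  unfolding set_integrable_def using that h by (intro integrable_mult_indicator) auto
 have *: "AE x in lborel. x \<in> C --> h x = 0" if C: "compact C" "C \<subseteq> B" for C
 proof -
  have [measurable]: "C \<in> sets borel" using C borel_compact by auto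
  have "(LINT x:A \<inter> C|lborel. h x) = 0" if "A \<in> sets borel" for A
  proof -
   have "Int_stable (Collect (closed :: 'a set => bool))" by (auto simp: Int_stable_def)
   moreover have "Collect closed \<subseteq> Pow (UNIV :: 'a set)" by auto
   moreover have "A \<in> sigma_sets UNIV (Collect closed)" using that by (simp add: borel_eq_closed)
   ultimately show ?thesis
   proof (induction A rule: sigma_sets_induct_disjoint[consumes 3])
    case (basic A)
    then have "compact (A \<inter> C)" using C by (simp add: closed_Int_compact)
    then show ?case by (intro integral_test_compact[OF h B test]) (use C in auto)
   next
    case empty
    then show ?case by (simp add: set_lebesgue_integral_def)
   next
    case (compl A)
    then have A[measurable]: "A \<in> sets borel" by (simp add: borel_eq_closed)
    have "(LINT x:A \<inter> C \<union> (UNIV - A) \<inter> C|lborel. h x) = (LINT x:A \<inter> C|lborel. h x) + (LINT x:(UNIV - A) \<inter> C|lborel. h x)"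
     by (intro set_integral_Un si) auto
    moreover have "A \<inter> C \<union> (UNIV - A) \<inter> C = C" by auto
    moreover have "(LINT x:C|lborel. h x) = 0" by (rule integral_test_compact[OF h B test C])
    ultimately show ?case using compl by simp
   next
    case (union A)
    then have A: "A i \<in> sets borel" for i by (simp add: borel_eq_closed range_subsetD)
    have "(LINT x:(\<Union>i. A i \<inter> C)|lborel. h x) = (\<Sum>i. LINT x:A i \<inter> C|lborel. h x)"
     by (rule lebesgue_integral_countable_add)
       (use A union(1) in "auto intro!: si simp: disjoint_family_on_def")
    then show ?case using union by simp
   qed
  qed
  then have "AE x in lborel. indicator C x * h x = 0"
   using si[of C] \<open>C \<in> sets borel\<close>
   by (intro density_unique_real) (auto simp: set_integrable_def set_lebesgue_integral_def indicator_inter_arith mult_ac)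
  then show ?thesis by eventually_elim (auto simp: indicator_def split: if_splits)
 qed
 obtain C where C: "!!n::nat. compact (C n)" "!!n. C n \<subseteq> B" "\<Union>(range C) = B"
  using open_Union_compact_subsets[OF B] by metis
 have "AE x in lborel. \<forall>n. x \<in> C n --> h x = 0"
  unfolding AE_all_countable using * C(1,2) by blast
 then show ?thesis by eventually_elim (use C(3) in auto)
qed

section \<open>The Laplacian of the truncated kernel as an approximate identity\<close>

lemma newton_lap_nonneg: "d > 0 ==> s >= 0 ==> newton_lap d s >= 0"
proof -
 assume a: "d > 0" "s >= 0"
 have "0 <= 15/2 * (1 - s/d\<^sup>2) / d^3" if "s < d\<^sup>2"
 proof -
  have "s / d\<^sup>2 <= 1" using a that by (simp add: divide_le_eq_1)
  then show ?thesis using a by (intro divide_nonneg_pos mult_nonneg_nonneg) auto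
 qed
 then show ?thesis by (auto simp: newton_lap_def)
qed

lemma newton_lap_continuous:
 assumes "d > 0"
 shows "continuous_on UNIV (%z::real^3. newton_lap d (z \<bullet> z))"
proof -
 have "continuous_on UNIV (%s. if d\<^sup>2 <= s then 0 else 15/2 * (1 - s/d\<^sup>2) / d^3)"
  by (rule continuous_on_glue) (use assms in "auto intro!: continuous_intros")
 then have "continuous_on UNIV (newton_lap d)" unfolding newton_lap_def[abs_def] .
 then show ?thesis by (rule continuous_on_compose2) (auto intro!: continuous_intros)
qed

lemma newton_lap_support:
 assumes "d > 0" "norm (z::real^3) > d"
 shows "newton_lap d (z \<bullet> z) = 0"
proof -
 have "d\<^sup>2 <= z \<bullet> z" using assms by (simp add: dot_square_norm power_mono)
 then show ?thesis by (simp add: newton_lap_def)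
qed

text \<open>The constant \<open>4 pi\<close>, given as the mass of the bump at \<open>d = 1\<close>.
  The bump scales like \<open>d^-3\<close>, so every \<open>d\<close> yields the same mass.\<close>

definition newton_mass :: real where
 "newton_mass = (LI z. newton_lap 1 ((z::real^3) \<bullet> z))"

lemma newton_lap_integral:
 assumes d: "d > 0"
 shows "integrable lborel (%z::real^3. newton_lap d (z \<bullet> z))" "(LI z. newton_lap d ((z::real^3) \<bullet> z)) = newton_mass"
proof -
 show "integrable lborel (%z::real^3. newton_lap d (z \<bullet> z))"
  by (rule continuous_compact_support(3)[OF newton_lap_continuous[OF d], of "cball 0 d"])
    (use newton_lap_support[OF d] in auto)
 have [measurable]: "(%z::real^3. newton_lap d (z \<bullet> z)) \<in> borel_measurable borel"
  by (rule borel_measurable_continuous_onI[OF newton_lap_continuous[OF d]])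
 have "newton_lap d (d\<^sup>2 * s) = newton_lap 1 s / d^3" for s
  using d by (simp add: newton_lap_def)
 then have "newton_lap d ((d *^ z) \<bullet> (d *^ z)) = newton_lap 1 (z \<bullet> z) / d^3" for z :: "real^3"
  by (simp add: power2_eq_square mult.assoc)
 then show "(LI z. newton_lap d ((z::real^3) \<bullet> z)) = newton_mass"
  using integral_affine[of "%z::real^3. newton_lap d (z \<bullet> z)" d] d by (simp add: newton_mass_def)
qed

lemma newton_mass_pos: "newton_mass > 0"
 unfolding newton_mass_def
 by (rule integral_continuous_pos[OF newton_lap_continuous newton_lap_integral(1), of 1 0])
   (auto intro: newton_lap_nonneg simp: newton_lap_def[of 1 0])

lemma conv_newton_lap:
 fixes \<psi> :: "real^3 => 'b::euclidean_space"
 assumes d: "d > 0" and \<psi>: "continuous_on UNIV \<psi>" and e: "!!z. dist x z <= d ==> norm (\<psi> z - c) <= e"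
 shows "norm (conv (%z. newton_lap d (z \<bullet> z)) \<psi> x - newton_mass *^ c) <= newton_mass * e"
proof -
 let ?k = "%z::real^3. inverse newton_mass * newton_lap d (z \<bullet> z)"
 note m = newton_mass_pos
 have kc: "continuous_on UNIV (%z. ?k (x - z) *^ \<psi> z)"
  by (intro continuous_intros \<psi> continuous_on_compose2[OF newton_lap_continuous[OF d]]) auto
 have ik: "integrable lborel (%z. ?k (x - z) *^ \<psi> z)"
  by (rule continuous_compact_support(3)[OF kc, of "cball x d"])
    (use newton_lap_support[OF d] in "auto simp: dist_norm")
 have "norm (conv ?k \<psi> x - c) <= e"
  by (rule conv_uniform[OF ik])
    (use m newton_lap_integral[OF d] newton_lap_nonneg[OF d] newton_lap_support[OF d] e in auto)
 moreover have "conv (%z. newton_lap d (z \<bullet> z)) \<psi> x = newton_mass *^ conv ?k \<psi> x"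
 proof -
  have *: "newton_mass * (inverse newton_mass * t) = t" for t using m by simp
  show ?thesis unfolding conv_def integral_scaleR_right[symmetric] scaleR_scaleR * ..
 qed
 ultimately show ?thesis
  using m by (simp flip: scaleR_diff_right)
qed

text \<open>If \<open>f\<close> is not integrable, neither is \<open>f x *^ c\<close> for nonzero
  \<open>c\<close>, and both integrals have the default value 0. This allows the inner integrals in
  Fubini's theorem to be rewritten at every point.\<close>

lemma integral_scaleR_left_any:
 fixes c :: "'b::euclidean_space"
 shows "(\<integral>x. f x *^ c \<partial>M) = (\<integral>x. f x \<partial>M) *^ c"
proof (cases "c = 0 \<or> integrable M f")
 case False
 have "\<not> integrable M (%x. f x *^ c)"
 proof
  assume "integrable M (%x. f x *^ c)"
  then have "integrable M (%x. inverse (c \<bullet> c) * ((f x *^ c) \<bullet> c))"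
   by (intro integrable_mult_right integrable_inner_left)
  moreover have "inverse (c \<bullet> c) * ((f x *^ c) \<bullet> c) = f x" for x using False by simp
  ultimately show False using False by simp
 qed
 then show ?thesis using False by (simp add: not_integrable_integral_eq)
qed auto

text \<open>The kernel is moved from the field to the test function. At single points
  \<open>x\<close> the convolution may take its default value; integrability on the product space
  controls the tested integral nevertheless.\<close>

lemma integral_conv_swap:
 fixes G :: "'a::euclidean_space => 'b::euclidean_space"
 assumes i: "integrable (lborel \<Otimes>\<^sub>M lborel) (%(x, y). (\<psi> x * k (x - y)) *^ G y)"
 shows "(LI x. \<psi> x *^ conv k G x) = (LI y. (LI x. \<psi> x * k (x - y)) *^ G y)"
  "(LI x. \<psi> x *^ conv k G x) = (\<integral>p. (\<psi> (fst p) * k (fst p - snd p)) *^ G (snd p) \<partial>(lborel \<Otimes>\<^sub>M lborel))"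
  "integrable lborel (%x. \<psi> x *^ conv k G x)"
proof -
 have *: "\<psi> x *^ conv k G x = (LI y. (\<psi> x * k (x - y)) *^ G y)" for x
  unfolding conv_def by (simp flip: integral_scaleR_right)
 have "(LI y. \<integral>x. (\<psi> x * k (x - y)) *^ G y \<partial>lborel) = (LI x. \<integral>y. (\<psi> x * k (x - y)) *^ G y \<partial>lborel)"
  by (rule lborel_pair.Fubini_integral[OF i])
 then show "(LI x. \<psi> x *^ conv k G x) = (LI y. (LI x. \<psi> x * k (x - y)) *^ G y)"
  unfolding * integral_scaleR_left_any by simp
 show "(LI x. \<psi> x *^ conv k G x) = (\<integral>p. (\<psi> (fst p) * k (fst p - snd p)) *^ G (snd p) \<partial>(lborel \<Otimes>\<^sub>M lborel))"
  unfolding * using lborel_pair.integral_fst'[of "%p. (\<psi> (fst p) * k (fst p - snd p)) *^ G (snd p)"] i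
  by (simp add: case_prod_beta')
 show "integrable lborel (%x. \<psi> x *^ conv k G x)"
  unfolding * using lborel_pair.integrable_fst'[OF i] by simp
qed


section \<open>Continuity of the solution\<close>

text \<open>Tonelli with the variable of \<open>w\<close> outside: the inner potential is bounded
  uniformly in \<open>y\<close>, so integrability of \<open>w\<close> suffices.\<close>

lemma integrable_product_kernel:
 fixes w :: "'a::euclidean_space => 'b::euclidean_space" and k :: "'a => real"
 assumes [measurable]: "\<psi> \<in> borel_measurable borel" "k \<in> borel_measurable borel" and w: "integrable lborel w"
  and C: "!!y. (\<integral>\<^sup>+x. ennreal (\<bar>\<psi> x\<bar> * \<bar>k (x - y)\<bar>) \<partial>lborel) <= ennreal C"
 shows "integrable (lborel \<Otimes>\<^sub>M lborel) (%(x, y). (\<psi> x * k (x - y)) *^ w y)"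
proof (rule integrableI_bounded)
 have [measurable]: "w \<in> borel_measurable borel" using w by auto
 have [measurable]: "(%p. k (fst p - snd p)) \<in> borel_measurable (lborel \<Otimes>\<^sub>M lborel)"
  by (rule measurable_compose[of "%p. fst p - snd p" _ borel]) simp_all
 show m: "(%(x, y). (\<psi> x * k (x - y)) *^ w y) \<in> borel_measurable (lborel \<Otimes>\<^sub>M lborel)"
  unfolding case_prod_beta by measurable
 have "(\<integral>\<^sup>+p. ennreal (norm (case p of (x, y) => (\<psi> x * k (x - y)) *^ w y)) \<partial>(lborel \<Otimes>\<^sub>M lborel))
  = (\<integral>\<^sup>+y. \<integral>\<^sup>+x. ennreal (norm ((\<psi> x * k (x - y)) *^ w y)) \<partial>lborel \<partial>lborel)"
  by (subst lborel_pair.nn_integral_snd[symmetric]) (use m in auto)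
 also have "\<dots> <= (\<integral>\<^sup>+y. ennreal (C * norm (w y)) \<partial>lborel)"
 proof (rule nn_integral_mono)
  fix y
  have "(\<integral>\<^sup>+x. ennreal (norm ((\<psi> x * k (x - y)) *^ w y)) \<partial>lborel)
   = (\<integral>\<^sup>+x. ennreal (\<bar>\<psi> x\<bar> * \<bar>k (x - y)\<bar>) * ennreal (norm (w y)) \<partial>lborel)"
   by (intro nn_integral_cong) (simp add: abs_mult ennreal_mult)
  also have "\<dots> = (\<integral>\<^sup>+x. ennreal (\<bar>\<psi> x\<bar> * \<bar>k (x - y)\<bar>) \<partial>lborel) * ennreal (norm (w y))"
   by (rule nn_integral_multc) measurable
  also have "\<dots> <= ennreal C * ennreal (norm (w y))" by (intro mult_right_mono C) auto
  also have "\<dots> = ennreal (C * norm (w y))" by (simp add: ennreal_mult'')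
  finally show "(\<integral>\<^sup>+x. ennreal (norm ((\<psi> x * k (x - y)) *^ w y)) \<partial>lborel) <= ennreal (C * norm (w y))" .
 qed
 also have "\<dots> < \<infinity>"
 proof -
  have "integrable lborel (%y. C * norm (w y))" using w by auto
  then have "(\<integral>\<^sup>+y. ennreal (norm (C * norm (w y))) \<partial>lborel) < \<infinity>" by (rule integrable_iff_bounded[THEN iffD1, THEN conjunct2])
  moreover have "(\<integral>\<^sup>+y. ennreal (C * norm (w y)) \<partial>lborel) <= (\<integral>\<^sup>+y. ennreal (norm (C * norm (w y))) \<partial>lborel)"
   by (intro nn_integral_mono ennreal_leI) auto
  ultimately show ?thesis by (rule order.strict_trans1[rotated])
 qed
 finally show "(\<integral>\<^sup>+p. ennreal (norm (case p of (x, y) => (\<psi> x * k (x - y)) *^ w y)) \<partial>(lborel \<Otimes>\<^sub>M lborel)) < \<infinity>" .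
qed

lemma integrable_bounded_kernel:
 fixes w :: "'a::euclidean_space => 'b::euclidean_space" and k :: "'a => real"
 assumes \<psi>: "integrable lborel \<psi>" and k: "k \<in> borel_measurable borel" and w: "integrable lborel w"
  and B: "!!z. \<bar>k z\<bar> <= B"
 shows "integrable (lborel \<Otimes>\<^sub>M lborel) (%(x, y). (\<psi> x * k (x - y)) *^ w y)"
proof (rule integrable_product_kernel[OF _ k w])
 show m: "\<psi> \<in> borel_measurable borel" using \<psi> by auto
 have B0: "B >= 0" using B[of 0] by linarith
 fix y
 have "(\<integral>\<^sup>+x. ennreal (\<bar>\<psi> x\<bar> * \<bar>k (x - y)\<bar>) \<partial>lborel) <= (\<integral>\<^sup>+x. ennreal (B * \<bar>\<psi> x\<bar>) \<partial>lborel)"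
  by (intro nn_integral_mono ennreal_leI) (use mult_right_mono[OF B abs_ge_zero] in "simp add: mult.commute")
 also have "\<dots> = ennreal (LI x. B * \<bar>\<psi> x\<bar>)"
  by (rule nn_integral_eq_integral) (use \<psi> B0 in auto)
 finally show "(\<integral>\<^sup>+x. ennreal (\<bar>\<psi> x\<bar> * \<bar>k (x - y)\<bar>) \<partial>lborel) <= ennreal (LI x. B * \<bar>\<psi> x\<bar>)" .
qed

lemma integrable_newton_kernel:
 fixes w :: "real^3 => 'b::euclidean_space"
 assumes \<psi>: "\<psi> \<in> borel_measurable borel" "!!x. \<bar>\<psi> x\<bar> <= B" "!!x. x \<notin> cball a r ==> \<psi> x = 0"
  and w: "integrable lborel w"
 shows "integrable (lborel \<Otimes>\<^sub>M lborel) (%(x, y). (\<psi> x * (1 / norm (x - y))) *^ w y)"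
proof -
 have B0: "B >= 0" using \<psi>(2)[of 0] by linarith
 have [measurable]: "cball a r \<in> sets borel" by (rule borel_closed) auto
 obtain C where C: "C >= 0" "!!x. (\<integral>\<^sup>+y. indicator (cball a r) y * ennreal (1 / norm (x - y)) \<partial>lborel) <= ennreal C"
  using inverse_potential_bound[of a r] by auto
 show ?thesis
 proof (rule integrable_product_kernel[where k="%z. 1 / norm z", OF \<psi>(1) _ w])
  fix y
  have "(\<integral>\<^sup>+x. ennreal (\<bar>\<psi> x\<bar> * \<bar>1 / norm (x - y)\<bar>) \<partial>lborel)
   <= (\<integral>\<^sup>+x. ennreal B * (indicator (cball a r) x * ennreal (1 / norm (y - x))) \<partial>lborel)"
  proof (rule nn_integral_mono)
   fix x
   show "ennreal (\<bar>\<psi> x\<bar> * \<bar>1 / norm (x - y)\<bar>) <= ennreal B * (indicator (cball a r) x * ennreal (1 / norm (y - x)))"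
   proof (cases "x \<in> cball a r")
    case True
    have "\<bar>\<psi> x\<bar> * \<bar>1 / norm (x - y)\<bar> <= B * (1 / norm (y - x))"
     using \<psi>(2)[of x] by (simp add: norm_minus_commute divide_right_mono)
    then have "ennreal (\<bar>\<psi> x\<bar> * \<bar>1 / norm (x - y)\<bar>) <= ennreal (B * (1 / norm (y - x)))" by (rule ennreal_leI)
    also have "\<dots> = ennreal B * ennreal (1 / norm (y - x))" using B0 by (rule ennreal_mult') 
    finally show ?thesis using True by simp
   qed (use \<psi>(3) in auto)
  qed
  also have "\<dots> = ennreal B * (\<integral>\<^sup>+x. indicator (cball a r) x * ennreal (1 / norm (y - x)) \<partial>lborel)"
   by (rule nn_integral_cmult) measurable
  also have "\<dots> <= ennreal B * ennreal C" by (intro mult_left_mono C) auto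
  also have "\<dots> = ennreal (B * C)" using B0 by (rule ennreal_mult'[symmetric])
  finally show "(\<integral>\<^sup>+x. ennreal (\<bar>\<psi> x\<bar> * \<bar>1 / norm (x - y)\<bar>) \<partial>lborel) <= ennreal (B * C)" .
 qed measurable
qed

section \<open>The Newtonian potential representation\<close>

lemma newton1_bound:
 assumes d: "d > 0"
 shows "\<bar>newton1 d ((z::real^3) \<bullet> z)\<bar> * norm z <= 2 / d\<^sup>2"
proof (cases "d\<^sup>2 <= z \<bullet> z")
 case True
 then have z: "norm z > 0" using d by auto
 have "newton1 d (z \<bullet> z) = - (1/2) * (1 / norm z ^ 3)"
  using True powr_half_square(2)[OF z] by (simp add: newton1_def dot_square_norm)
 then have "\<bar>newton1 d (z \<bullet> z)\<bar> * norm z = (1/2) * (1 / (norm z)\<^sup>2)"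
  using z by (simp add: power3_eq_cube power2_eq_square)
 also have "\<dots> <= (1/2) * (1 / d\<^sup>2)"
  using True d by (intro mult_left_mono divide_left_mono) (use z in "auto simp: dot_square_norm zero_less_mult_iff")
 also have "\<dots> <= 2 / d\<^sup>2" using d by (simp add: field_simps)
 finally show ?thesis .
next
 case False
 define s where "s = z \<bullet> z / d\<^sup>2"
 have s: "0 <= s" "s < 1" using False d by (auto simp: s_def)
 have "newton1 d (z \<bullet> z) = (-5/4 + 3/4 * s) / d^3" using False by (simp add: newton1_def s_def)
 then have "\<bar>newton1 d (z \<bullet> z)\<bar> = \<bar>-5/4 + 3/4 * s\<bar> / d^3" using d by (simp add: abs_divide)
 also have "\<dots> <= 2 / d^3" using s d by (intro divide_right_mono) auto
 finally have a: "\<bar>newton1 d (z \<bullet> z)\<bar> <= 2 / d^3" .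
 have "(norm z)\<^sup>2 < d\<^sup>2" using False by (simp add: dot_square_norm)
 then have "norm z <= d" using d by (simp add: power2_less_imp_less less_imp_le)
 then have "\<bar>newton1 d (z \<bullet> z)\<bar> * norm z <= 2 / d^3 * d" using a d by (intro mult_mono) auto
 also have "\<dots> = 2 / d\<^sup>2" using d by (simp add: power3_eq_cube power2_eq_square)
 finally show ?thesis .
qed

lemma group_rearrange: "- a + c = - b ==> a = b + (c::'a::ab_group_add)"
proof -
 assume "- a + c = - b"
 then have "a + b + (- a + c) = a + b + - b" by simp
 then show ?thesis by (simp add: algebra_simps)
qed

text \<open>\<open>weak_laplace\<close> for the product of the cutoff and the truncated Newtonian
  profile centred at \<open>x\<close>. The Laplacian of the profile yields an average of
  \<open>u\<close> near \<open>x\<close>; derivatives that fall on the cutoff are collected in the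
  last integral.\<close>

lemma newton_identity:
 assumes W: "weak_beltrami U f u" and U: "open U" and f: "!!x. x \<in> U ==> (f has_derivative (%h. f' x \<bullet> h)) (at x)"
  and f': "continuous_on U f'"
  and C2: "C2_fun \<eta> g H" and K: "compact K" "K \<subseteq> U" "!!x. x \<notin> K ==> \<eta> x = 0" and d: "d > 0"
 shows "(LI y. (\<eta> y * newton_lap d ((y - x) \<bullet> (y - x))) *^ u y)
  = (LI y. newton d ((y - x) \<bullet> (y - x)) *^ ((\<eta> y * f y * f y) *^ u y - cross3 (u y) (\<eta> y *^ f' y)))
  + (LI y. (newton d ((y - x) \<bullet> (y - x)) * trace (H y) + 4 * newton1 d ((y - x) \<bullet> (y - x)) * (g y \<bullet> (y - x))) *^ u y)"
proof -
 let ?s = "%y. (y - x) \<bullet> (y - x)"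
 let ?J = "%y. (4 * newton2 d (?s y)) *^ outer (y - x) (y - x) + (2 * newton1 d (?s y)) *^ mat 1"
 let ?k = "%y. (2 * newton1 d (?s y)) *^ (y - x)"
 note C = C2_funD[OF C2]
 have S: "g x = 0" "H x = 0" if "x \<notin> K" for x
  using C2_support[OF C2 K(1) _ that] K(3) by auto
 note N = C2_fun_newton[OF d, of x]
 note CN = C2_funD[OF N]
 have [measurable]: "u \<in> borel_measurable borel" and iK: "integrable lborel (%x. indicator K x *^ u x)"
  using weak_beltramiD(1,2)[OF W] K by auto
 have isc: "integrable lborel (%x. k x *^ u x)" if "continuous_on UNIV k" "!!x. x \<notin> K ==> k x = 0" for k :: "_ => real"
  by (rule integrable_bilinear_compact_support[OF bounded_bilinear_scaleR _ that(1) K(1) that(2) iK]) auto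
 \<comment> \<open>The factor 4 collects two mixed terms, each \<open>2 * newton1\<close> times
   \<open>g y \<bullet> (y - x)\<close>.\<close>
 have tr: "trace (\<eta> y *^ ?J y + newton d (?s y) *^ H y + outer (?k y) (g y) + outer (g y) (?k y))
  = - (\<eta> y * newton_lap d (?s y)) + (newton d (?s y) * trace (H y) + 4 * newton1 d (?s y) * (g y \<bullet> (y - x)))" for y
 proof -
  have t: "trace (?J y) = - newton_lap d (?s y)"
   using newton_laplacian[OF d, of "?s y"] unfolding trace_radial by (simp add: algebra_simps del: inner_diff_left inner_diff_right)
  have "trace (\<eta> y *^ ?J y + newton d (?s y) *^ H y + outer (?k y) (g y) + outer (g y) (?k y))
   = \<eta> y * trace (?J y) + newton d (?s y) * trace (H y) + ?k y \<bullet> g y + g y \<bullet> ?k y"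
   by (simp only: trace_add trace_scaleR trace_outer)
  moreover have "?k y \<bullet> g y = 2 * newton1 d (?s y) * (g y \<bullet> (y - x))" "g y \<bullet> ?k y = 2 * newton1 d (?s y) * (g y \<bullet> (y - x))"
   unfolding inner_scaleR_left inner_scaleR_right inner_commute[of "y - x" "g y"] by simp_all
  ultimately show ?thesis unfolding t by simp
 qed
 have sc: "continuous_on UNIV ?s" by (intro continuous_intros)
 have n1c: "continuous_on UNIV (%y. newton1 d (?s y))"
  by (rule continuous_on_compose2[OF _ sc]) (auto intro!: DERIV_continuous_on[OF has_field_derivative_at_within[OF newton1_derivative[OF d]]])
 have lc: "continuous_on UNIV (%y. newton_lap d (?s y))"
  by (rule continuous_on_compose2[OF newton_lap_continuous[OF d], of UNIV "%y. y - x"]) (auto intro!: continuous_intros)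
 have i1: "integrable lborel (%y. (\<eta> y * newton_lap d (?s y)) *^ u y)"
  by (rule isc) (use K(3) in "auto intro!: continuous_on_mult C lc")
 have i2: "integrable lborel (%y. (newton d (?s y) * trace (H y) + 4 * newton1 d (?s y) * (g y \<bullet> (y - x))) *^ u y)"
 proof (rule isc)
  show "continuous_on UNIV (%y. newton d (?s y) * trace (H y) + 4 * newton1 d (?s y) * (g y \<bullet> (y - x)))"
   unfolding trace_def by (intro continuous_intros CN(6) C n1c)
  show "newton d (?s y) * trace (H y) + 4 * newton1 d (?s y) * (g y \<bullet> (y - x)) = 0" if "y \<notin> K" for y
   using S[OF that] by (simp add: trace_def)
 qed
 have "(LI y. trace (\<eta> y *^ ?J y + newton d (?s y) *^ H y + outer (?k y) (g y) + outer (g y) (?k y)) *^ u y)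
  = (LI y. (\<eta> y * newton d (?s y)) *^ (cross3 (u y) (f' y) - (f y)\<^sup>2 *^ u y))"
  by (rule weak_laplace[OF W U f f' C2_fun_mult[OF C2 N] K(1,2)]) (use K(3) in auto)
 also have "(%y. (\<eta> y * newton d (?s y)) *^ (cross3 (u y) (f' y) - (f y)\<^sup>2 *^ u y))
  = (%y. - (newton d (?s y) *^ ((\<eta> y * f y * f y) *^ u y - cross3 (u y) (\<eta> y *^ f' y))))"
  by (simp add: fun_eq_iff cross_mult_right power2_eq_square scaleR_diff_right mult_ac)
 also have "(LI y. trace (\<eta> y *^ ?J y + newton d (?s y) *^ H y + outer (?k y) (g y) + outer (g y) (?k y)) *^ u y)
  = - (LI y. (\<eta> y * newton_lap d (?s y)) *^ u y)
   + (LI y. (newton d (?s y) * trace (H y) + 4 * newton1 d (?s y) * (g y \<bullet> (y - x))) *^ u y)"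
  unfolding tr scaleR_add_left scaleR_minus_left
  using i1 i2 by (simp add: Bochner_Integration.integral_add scaleR_add_left)
 finally show ?thesis unfolding Bochner_Integration.integral_minus by (rule group_rearrange)
qed

lemma continuous_component_bound:
 fixes k :: "'a::real_normed_vector => real"
 shows "\<bar>c * (z::real^3) $ i\<bar> <= \<bar>c\<bar> * norm z"
 by (simp add: abs_mult mult_left_mono component_le_norm_cart)

text \<open>The limit of \<open>newton_identity\<close> as \<open>d\<close> tends to 0. The density
  \<open>w\<close> is bounded pointwise by \<open>u\<close> and carries the singular kernel; all
  terms with derivatives of the cutoff stay at a distance from the inner ball and form the
  continuous remainder \<open>s\<close>. As \<open>u\<close> is only integrable, the limit is taken
  after testing and the result holds almost everywhere.\<close>

lemma newton_representation:
 fixes x0 :: "real^3"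
 assumes W: "weak_beltrami U f u" and U: "open U" and f: "!!x. x \<in> U ==> (f has_derivative (%h. f' x \<bullet> h)) (at x)"
  and f': "continuous_on U f'" and R: "R > 0" "cball x0 R \<subseteq> U"
 shows "\<exists>w s A. integrable lborel w \<and> A >= 0 \<and> (\<forall>y. norm (w y) <= A * norm (u y)) \<and> (\<forall>y. y \<notin> cball x0 R --> w y = 0) \<and>
  continuous_on UNIV s \<and>
  (AE x in lborel. x \<in> ball x0 (R/2) --> u x = conv (%z. 1 / norm z) w x + s x)"
proof -
 define K where "K = cball x0 (R/2)"
 have KR: "K \<subseteq> ball x0 R" using R by (auto simp: K_def)
 have "\<exists>\<eta> g H \<delta> K'. C2_fun \<eta> g H \<and> (\<forall>x. 0 <= \<eta> x \<and> \<eta> x <= 1) \<and> compact K' \<and> K' \<subseteq> ball x0 R \<and>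
  (\<forall>x. x \<notin> K' --> \<eta> x = 0) \<and> \<delta> > 0 \<and> (\<forall>x. \<forall>z\<in>K. dist x z <= \<delta> --> \<eta> x = 1)"
  by (rule C2_cutoff[OF _ open_ball KR]) (simp add: K_def)
 then obtain \<eta> g H \<delta> K' where *: "C2_fun \<eta> g H \<and> (\<forall>x. 0 <= \<eta> x \<and> \<eta> x <= 1) \<and> compact K' \<and> K' \<subseteq> ball x0 R \<and>
  (\<forall>x. x \<notin> K' --> \<eta> x = 0) \<and> \<delta> > 0 \<and> (\<forall>x. \<forall>z\<in>K. dist x z <= \<delta> --> \<eta> x = 1)"
  by (elim exE)
 then have C2: "C2_fun \<eta> g H" and K': "compact K'" "K' \<subseteq> ball x0 R" "!!x. x \<notin> K' ==> \<eta> x = 0" and \<delta>: "\<delta> > 0"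
  by simp_all
 have one: "!!x z. z \<in> K ==> dist x z <= \<delta> ==> \<eta> x = 1" using * by blast
 have K'U: "K' \<subseteq> U" using K'(2) R(2) ball_subset_cball by blast
 note C = C2_funD[OF C2]
 have S: "g x = 0" "H x = 0" if "x \<notin> K'" for x
  using C2_support[OF C2 K'(1) _ that] K'(3) by auto
 have fc: "continuous_on U f"
  by (rule continuous_at_imp_continuous_on) (use f has_derivative_continuous in blast)
 have um[measurable]: "u \<in> borel_measurable borel" and iK: "integrable lborel (%x. indicator K' x *^ u x)"
  using weak_beltramiD(1,2)[OF W] K'(1) K'U by auto
 have isc: "integrable lborel (%x. k x *^ u x)" if "continuous_on UNIV k" "!!x. x \<notin> K' ==> k x = 0" for k :: "_ => real"
  by (rule integrable_bilinear_compact_support[OF bounded_bilinear_scaleR um that(1) K'(1) that(2) iK])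
 have c3: "continuous_on UNIV (%x. \<eta> x *^ f' x)"
  by (rule continuous_on_extend_zero[OF U _ K'(1) K'U]) (use K'(3) in "auto intro!: continuous_intros f' continuous_on_subset[OF C(6)]")
 have c5: "continuous_on UNIV (%x. \<eta> x * f x * f x)"
  by (rule continuous_on_extend_zero[OF U _ K'(1) K'U]) (use K'(3) in "auto intro!: continuous_intros fc continuous_on_subset[OF C(6)]")
 define w0 where "w0 y = (\<eta> y * f y * f y) *^ u y - cross3 (u y) (\<eta> y *^ f' y)" for y
 have w0i: "integrable lborel w0"
 proof -
  have "integrable lborel (%y. cross3 (u y) (\<eta> y *^ f' y))"
   by (rule integrable_bilinear_compact_support[OF bounded_bilinear.flip[OF bounded_bilinear_cross3] um c3 K'(1) _ iK]) (use K'(3) in auto)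
  moreover have "integrable lborel (%y. (\<eta> y * f y * f y) *^ u y)" by (rule isc[OF c5]) (use K'(3) in auto)
  ultimately show ?thesis unfolding w0_def by (rule Bochner_Integration.integrable_diff[rotated])
 qed
 have [measurable]: "w0 \<in> borel_measurable borel" using w0i by auto
 have w0z: "w0 y = 0" if "y \<notin> K'" for y using K'(3)[OF that] by (simp add: w0_def)
 obtain B1 B2 where B: "B1 >= 0" "B2 >= 0" "!!y. \<bar>\<eta> y * f y * f y\<bar> <= B1" "!!y. norm (\<eta> y *^ f' y) <= B2"
 proof -
  obtain B1 where "B1 >= 0" "\<forall>y. norm (\<eta> y * f y * f y) <= B1"
   using continuous_compact_support(2)[OF c5 K'(1)] K'(3) by auto
  moreover obtain B2 where "B2 >= 0" "\<forall>y. norm (\<eta> y *^ f' y) <= B2"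
   using continuous_compact_support(2)[OF c3 K'(1)] K'(3) by auto
  ultimately show ?thesis using that by (simp only: real_norm_def)
 qed
 have w0b: "norm (w0 y) <= (B1 + B2) * norm (u y)" for y
 proof -
  have "norm (w0 y) <= norm ((\<eta> y * f y * f y) *^ u y) + norm (cross3 (u y) (\<eta> y *^ f' y))"
   unfolding w0_def by (rule norm_triangle_ineq4)
  also have "\<dots> <= B1 * norm (u y) + norm (u y) * B2"
   using mult_right_mono[OF B(3)[of y] norm_ge_zero[of "u y"]] norm_cross3_le[of "u y" "\<eta> y *^ f' y"]
    mult_left_mono[OF B(4)[of y] norm_ge_zero[of "u y"]] by (simp add: norm_scaleR del: abs_mult)
  finally show ?thesis by (simp add: algebra_simps)
 qed
 let ?N = "%d z::real^3. newton d (z \<bullet> z)"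
 let ?M = "%d z::real^3. newton_lap d (z \<bullet> z)"
 define G where "G y = \<eta> y *^ u y" for y
 have Gi: "integrable lborel G" unfolding G_def by (rule isc[OF C(6) K'(3)])
 have [measurable]: "G \<in> borel_measurable borel" using Gi by auto
 \<comment> \<open>The profile is frozen at the margin of the cutoff: within \<delta> of a point of
   \<open>K\<close> the factors \<open>g\<close> and \<open>H\<close> vanish, and farther away all
   profiles with \<open>d \<le> \<delta>\<close> coincide.\<close>
 define s0 where "s0 x = (LI y. (newton \<delta> ((y - x) \<bullet> (y - x)) * trace (H y) + 4 * newton1 \<delta> ((y - x) \<bullet> (y - x)) * (g y \<bullet> (y - x))) *^ u y)" for x
 have sym: "(y - x) \<bullet> (y - x) = (x - y) \<bullet> (x - y)" for x y :: "real^3"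
  by (simp add: inner_diff_left inner_diff_right inner_commute)
 have flat: "g y = 0 \<and> H y = 0" if "z \<in> K" "dist y z < \<delta>" for y z
 proof -
  have cl: "closed (- ball z \<delta>)" by (simp add: closed_Compl)
  have g0: "g v = 0" if v: "v \<notin> - ball z \<delta>" for v
  proof -
   have "((%y. \<eta> y - 1) has_derivative (%h. g v \<bullet> h)) (at v)"
    by (rule has_derivative_eq_rhs, rule has_derivative_diff[OF C(1) has_derivative_const]) simp
   moreover have "\<eta> y - 1 = 0" if "y \<notin> - ball z \<delta>" for y
    using one[OF \<open>z \<in> K\<close>, of y] that by (simp add: dist_commute less_imp_le)
   ultimately have "(%h. g v \<bullet> h) = (%h. 0)"
    using vanishing_derivative[OF cl, of "%y. \<eta> y - 1" "%h. g v \<bullet> h" v] v by blast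
   then have "g v \<bullet> g v = 0" by metis
   then show ?thesis by simp
  qed
  have y: "y \<notin> - ball z \<delta>" using that by (simp add: dist_commute)
  have "(%h. H y *v h) = (%h. 0)" by (rule vanishing_derivative[OF cl g0 C(2) y])
  then have "H y *v h = 0 *v h" for h using fun_cong[of "%h. H y *v h" "%h. 0" h] by simp
  then show ?thesis using g0[OF y] by (simp add: matrix_eq)
 qed
 \<comment> \<open>For \<open>x\<close> in the inner ball the remainder does not depend on
   \<open>d\<close>; only the two convolutions do.\<close>
 have key: "conv (?M d) G x = conv (?N d) w0 x + s0 x" if x: "x \<in> K" and d: "0 < d" "d <= \<delta>" for x d
 proof -
  have "(LI y. (\<eta> y * newton_lap d ((y - x) \<bullet> (y - x))) *^ u y)
  = (LI y. newton d ((y - x) \<bullet> (y - x)) *^ w0 y)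
  + (LI y. (newton d ((y - x) \<bullet> (y - x)) * trace (H y) + 4 * newton1 d ((y - x) \<bullet> (y - x)) * (g y \<bullet> (y - x))) *^ u y)"
   unfolding w0_def by (rule newton_identity[OF W U f f' C2 K'(1) K'U K'(3) d(1)])
  also have "(LI y. (\<eta> y * newton_lap d ((y - x) \<bullet> (y - x))) *^ u y) = conv (?M d) G x"
   unfolding conv_def G_def sym[of _ x] by (simp add: mult.commute)
  also have "(LI y. newton d ((y - x) \<bullet> (y - x)) *^ w0 y) = conv (?N d) w0 x"
   unfolding conv_def sym[of _ x] ..
  also have "(LI y. (newton d ((y - x) \<bullet> (y - x)) * trace (H y) + 4 * newton1 d ((y - x) \<bullet> (y - x)) * (g y \<bullet> (y - x))) *^ u y) = s0 x"
   unfolding s0_def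
  proof (rule Bochner_Integration.integral_cong[OF refl])
   fix y
   show "(newton d ((y - x) \<bullet> (y - x)) * trace (H y) + 4 * newton1 d ((y - x) \<bullet> (y - x)) * (g y \<bullet> (y - x))) *^ u y
    = (newton \<delta> ((y - x) \<bullet> (y - x)) * trace (H y) + 4 * newton1 \<delta> ((y - x) \<bullet> (y - x)) * (g y \<bullet> (y - x))) *^ u y"
   proof (cases "dist y x < \<delta>")
    case True
    then show ?thesis using flat[OF x True] by (simp add: trace_def)
   next
    case False
    then have "\<delta>\<^sup>2 <= (y - x) \<bullet> (y - x)" using \<delta> by (simp add: dot_square_norm dist_norm power_mono)
    moreover have "d\<^sup>2 <= \<delta>\<^sup>2" using d by (intro power_mono) auto
    ultimately show ?thesis by (simp add: newton_def newton1_def)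
   qed
  qed
  finally show ?thesis .
 qed
 have Nc: "continuous_on UNIV (?N d)" if "d > 0" for d
  using C2_funD(6)[OF C2_fun_newton[OF that, of 0]] by simp
 have N1c: "continuous_on UNIV (%z::real^3. newton1 d (z \<bullet> z))" if "d > 0" for d
  by (rule continuous_on_compose2[of UNIV "newton1 d"])
    (auto intro!: DERIV_continuous_on[OF has_field_derivative_at_within[OF newton1_derivative[OF that]]] continuous_intros)
 have s0c: "continuous_on UNIV s0"
 proof -
  \<comment> \<open>Splitting \<open>g y \<bullet> (y - x)\<close> into coordinates turns
    \<open>s0\<close> into a finite sum of convolutions with bounded continuous kernels.\<close>
  define u1 where "u1 y = trace (H y) *^ u y" for y
  define u2 where "u2 i y = (g y $ i) *^ u y" for i y
  define k2 where "k2 i z = - 4 * newton1 \<delta> (z \<bullet> z) * z $ i" for i and z :: "real^3"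
  have u1: "integrable lborel u1" unfolding u1_def
   by (rule isc) (use S in "auto simp: trace_def intro!: continuous_intros C")
  have u2: "integrable lborel (u2 i)" for i unfolding u2_def
   by (rule isc) (use S in "auto intro!: continuous_intros C")
  have k2c: "continuous_on UNIV (k2 i)" for i unfolding k2_def
   by (intro continuous_intros N1c[OF \<delta>])
  have k2b: "\<bar>k2 i z\<bar> <= 8 / \<delta>\<^sup>2" for i z
  proof -
   have "\<bar>k2 i z\<bar> <= 4 * (\<bar>newton1 \<delta> (z \<bullet> z)\<bar> * norm z)"
    using continuous_component_bound[of "- 4 * newton1 \<delta> (z \<bullet> z)" z i] unfolding k2_def by (simp add: abs_mult)
   then show ?thesis using newton1_bound[OF \<delta>, of z] by simp
  qed
  have Nb: "\<bar>?N \<delta> z\<bar> <= 2 / \<delta>" for z using newton_bounds(1,2)[OF \<delta>, of z] by simp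
  have "s0 x = conv (?N \<delta>) u1 x + (\<Sum>i\<in>UNIV. conv (k2 i) (u2 i) x)" for x
  proof -
   have m1: "integrable lborel (%y. ?N \<delta> (x - y) *^ u1 y)"
    by (rule integrable_bounded_scaleR[OF u1 _ Nb])
      (auto intro!: borel_measurable_continuous_onI continuous_on_compose2[OF Nc[OF \<delta>], of UNIV "%y. x - y"] continuous_intros)
   have m2: "integrable lborel (%y. k2 i (x - y) *^ u2 i y)" for i
    by (rule integrable_bounded_scaleR[OF u2 _ k2b])
      (auto intro!: borel_measurable_continuous_onI continuous_on_compose2[OF k2c, of UNIV "%y. x - y"] continuous_intros)
   have "s0 x = (LI y. ?N \<delta> (x - y) *^ u1 y + (\<Sum>i\<in>UNIV. k2 i (x - y) *^ u2 i y))"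
    unfolding s0_def
   proof (rule Bochner_Integration.integral_cong[OF refl])
    fix y
    have "4 * newton1 \<delta> ((y - x) \<bullet> (y - x)) * (g y \<bullet> (y - x)) = (\<Sum>i\<in>UNIV. k2 i (x - y) * g y $ i)"
    proof -
     define c where "c = newton1 \<delta> ((x - y) \<bullet> (x - y))"
     have "k2 i (x - y) = - 4 * c * (x $ i - y $ i)" for i by (simp add: k2_def c_def)
     then have "(\<Sum>i\<in>UNIV. k2 i (x - y) * g y $ i) = (\<Sum>i\<in>UNIV. (- 4 * c * (x $ i - y $ i)) * g y $ i)"
      by (simp only:)
     also have "\<dots> = 4 * c * (g y \<bullet> (y - x))"
      by (simp add: inner_vec_def sum_distrib_left algebra_simps)
     finally show ?thesis unfolding sym[of y x] c_def ..
    qed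
    then show "(newton \<delta> ((y - x) \<bullet> (y - x)) * trace (H y) + 4 * newton1 \<delta> ((y - x) \<bullet> (y - x)) * (g y \<bullet> (y - x))) *^ u y
     = ?N \<delta> (x - y) *^ u1 y + (\<Sum>i\<in>UNIV. k2 i (x - y) *^ u2 i y)"
     unfolding sym[of y x] by (simp add: u1_def u2_def scaleR_add_left scaleR_sum_left)
   qed
   also have "\<dots> = conv (?N \<delta>) u1 x + (\<Sum>i\<in>UNIV. conv (k2 i) (u2 i) x)"
    unfolding conv_def using m1 m2 by (simp add: Bochner_Integration.integral_add Bochner_Integration.integral_sum)
   finally show ?thesis .
  qed
  moreover have "continuous_on UNIV (%x. conv (?N \<delta>) u1 x + (\<Sum>i\<in>UNIV. conv (k2 i) (u2 i) x))"
   using conv_continuous[OF u1 Nc[OF \<delta>] Nb] conv_continuous[OF u2 k2c k2b]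
   by (intro continuous_on_add continuous_on_sum) auto
  ultimately show ?thesis by simp
 qed
 let ?P = "conv (%z. 1 / norm z) w0"
 let ?D = "%x. newton_mass *^ G x - ?P x - s0 x"
 have test: "(LI x. \<psi> x *^ ?D x) = 0" 
  if \<psi>: "continuous_on UNIV \<psi>" "compact L" "L \<subseteq> ball x0 (R/2)" "!!x. x \<notin> L ==> \<psi> x = 0" for \<psi> :: "real^3 => real" and L
 proof -
  have LK: "L \<subseteq> K" using \<psi>(3) by (auto simp: K_def)
  have \<psi>i: "integrable lborel \<psi>" by (rule continuous_compact_support(3)[OF \<psi>(1,2,4)])
  have [measurable]: "\<psi> \<in> borel_measurable borel" using \<psi>i by auto
  obtain B where B: "!!x. \<bar>\<psi> x\<bar> <= B" using continuous_compact_support(2)[OF \<psi>(1,2,4)] by auto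
  have B0: "B >= 0" using B[of 0] by linarith
  define d where "d n = \<delta> / real (Suc n)" for n
  have d: "d n > 0" "d n <= \<delta>" for n using \<delta> by (auto simp: d_def divide_le_eq mult_le_cancel_left1)
  have d0: "d \<longlonglongrightarrow> 0" unfolding d_def by (rule LIMSEQ_Suc[OF lim_const_over_n])
  have Mb: "\<exists>B. \<forall>z. \<bar>?M (d n) z\<bar> <= B" for n
   using continuous_compact_support(2)[OF newton_lap_continuous[OF d(1)[of n]], of "cball 0 (d n)"] newton_lap_support[OF d(1)[of n]] by auto
  have swapM: "(LI x. \<psi> x *^ conv (?M (d n)) G x) = (LI y. (LI x. \<psi> x * ?M (d n) (x - y)) *^ G y)"
   and intM: "integrable lborel (%x. \<psi> x *^ conv (?M (d n)) G x)" for n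
  proof -
   obtain B where "!!z. \<bar>?M (d n) z\<bar> <= B" using Mb by blast
   then have i: "integrable (lborel \<Otimes>\<^sub>M lborel) (%(x, y). (\<psi> x * ?M (d n) (x - y)) *^ G y)"
    by (intro integrable_bounded_kernel[OF \<psi>i _ Gi] borel_measurable_continuous_onI newton_lap_continuous[OF d(1)])
   show "(LI x. \<psi> x *^ conv (?M (d n)) G x) = (LI y. (LI x. \<psi> x * ?M (d n) (x - y)) *^ G y)"
    by (rule integral_conv_swap(1)[OF i])
   show "integrable lborel (%x. \<psi> x *^ conv (?M (d n)) G x)" by (rule integral_conv_swap(3)[OF i])
  qed
  have inner: "(LI x. \<psi> x * ?M (d n) (x - y)) = conv (?M (d n)) \<psi> y" for n y
   unfolding conv_def sym[of _ y] by (simp add: mult.commute)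
  \<comment> \<open>After Fubini the bump acts on the continuous function \<open>\<psi>\<close>,
    where it converges at every point.\<close>
  have lim1: "(%n. \<integral>x. \<psi> x *^ conv (?M (d n)) G x \<partial>lborel) \<longlonglongrightarrow> (LI y. (newton_mass *^ \<psi> y) *^ G y)"
   unfolding swapM inner
  proof (rule integral_dominated_convergence[where w="%y. (newton_mass * B) * norm (G y)"])
   have "(%n. conv (?M (d n)) \<psi> y) \<longlonglongrightarrow> newton_mass *^ \<psi> y" for y
   proof (rule metric_LIMSEQ_I)
    fix r :: real assume r: "r > 0"
    define e where "e = r / (2 * newton_mass)"
    have e: "e > 0" "newton_mass * e < r" using r newton_mass_pos by (auto simp: e_def)
    have "isCont \<psi> y" using \<psi>(1) continuous_on_eq_continuous_at by blast
    then obtain t where t: "t > 0" "!!z. dist z y < t ==> dist (\<psi> z) (\<psi> y) < e"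
     using e(1) unfolding continuous_at_eps_delta by metis
    obtain n0 where n0: "!!n. n >= n0 ==> d n < t"
     using order_tendstoD(2)[OF d0 t(1)] by (auto simp: eventually_sequentially)
    have "norm (conv (?M (d n)) \<psi> y - newton_mass *^ \<psi> y) <= newton_mass * e" if "n >= n0" for n
    proof (rule conv_newton_lap[OF d(1) \<psi>(1)])
     fix z assume "dist y z <= d n"
     then have "dist z y < t" using n0[OF that] by (simp add: dist_commute)
     then show "norm (\<psi> z - \<psi> y) <= e" using t(2)[of z] by (simp add: dist_norm)
    qed
    then show "\<exists>no. \<forall>n\<ge>no. dist (conv (?M (d n)) \<psi> y) (newton_mass *^ \<psi> y) < r"
     unfolding dist_norm using e(2) by (meson order.strict_trans1)
   qed
   then show "AE y in lborel. (%n. conv (?M (d n)) \<psi> y *^ G y) \<longlonglongrightarrow> (newton_mass *^ \<psi> y) *^ G y"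
    by (intro always_eventually allI tendsto_scaleR tendsto_const)
   have "\<bar>conv (?M (d n)) \<psi> y\<bar> <= newton_mass * B" for n y
    using conv_newton_lap[OF d(1) \<psi>(1), of y n 0 B] B by simp
   then show "AE y in lborel. norm (conv (?M (d n)) \<psi> y *^ G y) <= (newton_mass * B) * norm (G y)" for n
    by (auto intro!: mult_right_mono)
   have "conv (?M (d n)) \<psi> \<in> borel_measurable borel" for n
    using conv_continuous[OF \<psi>i newton_lap_continuous[OF d(1)]] Mb
    by (intro borel_measurable_continuous_onI) metis
   then show "(%y. conv (?M (d n)) \<psi> y *^ G y) \<in> borel_measurable lborel" for n
    by simp
  qed (use Gi in auto)
  have iN: "integrable (lborel \<Otimes>\<^sub>M lborel) (%(x, y). (\<psi> x * (1 / norm (x - y))) *^ w0 y)"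
  proof (rule integrable_newton_kernel[where a=x0 and r="R/2", OF _ B _ w0i])
   show "\<psi> x = 0" if "x \<notin> cball x0 (R/2)" for x using LK \<psi>(4) that unfolding K_def by blast
  qed simp
  \<comment> \<open>The value 0 at the origin matches \<open>1 / norm 0 = 0\<close>, so the bound
    \<open>2 / norm z\<close> and the pointwise limit hold at every \<open>z\<close>.\<close>
  define N' where "N' n z = (if z = 0 then 0 else ?N (d n) z)" for n z
  have [measurable]: "newton (d n) \<in> borel_measurable borel" for n
   by (rule borel_measurable_continuous_onI, rule DERIV_continuous_on, rule has_field_derivative_at_within, rule newton_derivative[OF d(1)])
  have N'm[measurable]: "N' n \<in> borel_measurable borel" for n unfolding N'_def[abs_def] by measurable
  have N'b: "\<bar>N' n z\<bar> <= 2 / norm z" for n z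
   using newton_bounds(1,3)[OF d(1)[of n], of z] by (auto simp: N'_def)
  have N'b2: "\<bar>N' n z\<bar> <= 2 / d n" for n z
   using newton_bounds(1,2)[OF d(1)[of n], of z] d(1)[of n] by (auto simp: N'_def)
  have convN': "conv (?N (d n)) w0 x = conv (N' n) w0 x" for n x
   unfolding conv_def
  proof (rule integral_cong_AE)
   have "AE y in lborel. y ~= x" by (rule AE_lborel_singleton)
   then show "AE y in lborel. ?N (d n) (x - y) *^ w0 y = N' n (x - y) *^ w0 y"
    by eventually_elim (auto simp: N'_def)
  qed measurable
  have iN': "integrable (lborel \<Otimes>\<^sub>M lborel) (%(x, y). (\<psi> x * N' n (x - y)) *^ w0 y)" for n
   by (rule integrable_bounded_kernel[OF \<psi>i N'm w0i N'b2])
  have [measurable]: "(%p. N' n (fst p - snd p)) \<in> borel_measurable (lborel \<Otimes>\<^sub>M lborel)" for n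
   by (rule measurable_compose[of "%p. fst p - snd p" _ borel]) simp_all
  have lim2: "(%n. \<integral>x. \<psi> x *^ conv (N' n) w0 x \<partial>lborel) \<longlonglongrightarrow> (LI x. \<psi> x *^ ?P x)"
   unfolding integral_conv_swap(2)[OF iN'] integral_conv_swap(2)[OF iN]
  proof (rule integral_dominated_convergence[where w="%p. 2 * norm ((\<psi> (fst p) * (1 / norm (fst p - snd p))) *^ w0 (snd p))"])
   have "(%n. N' n z) \<longlonglongrightarrow> 1 / norm z" for z
   proof (cases "z = 0")
    case False
    then have "\<forall>\<^sub>F n in sequentially. d n < norm z" using order_tendstoD(2)[OF d0] by simp
    then have "\<forall>\<^sub>F n in sequentially. N' n z = 1 / norm z"
     by eventually_elim (use False newton_bounds(4)[OF d(1)] in "auto simp: N'_def")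
    then show ?thesis by (rule tendsto_eventually)
   qed (simp add: N'_def)
   then show "AE p in lborel \<Otimes>\<^sub>M lborel. (%n. (\<psi> (fst p) * N' n (fst p - snd p)) *^ w0 (snd p)) \<longlonglongrightarrow> (\<psi> (fst p) * (1 / norm (fst p - snd p))) *^ w0 (snd p)"
    by (intro always_eventually allI tendsto_intros)
   have "norm ((\<psi> x * N' n (x - y)) *^ w0 y) <= 2 * norm ((\<psi> x * (1 / norm (x - y))) *^ w0 y)" for n x y
   proof -
    have "norm ((\<psi> x * N' n (x - y)) *^ w0 y) = (\<bar>\<psi> x\<bar> * norm (w0 y)) * \<bar>N' n (x - y)\<bar>" by (simp add: abs_mult)
    also have "\<dots> <= (\<bar>\<psi> x\<bar> * norm (w0 y)) * (2 / norm (x - y))" by (intro mult_left_mono N'b) auto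
    also have "\<dots> = 2 * norm ((\<psi> x * (1 / norm (x - y))) *^ w0 y)" by (simp add: abs_mult)
    finally show ?thesis .
   qed
   then show "AE p in lborel \<Otimes>\<^sub>M lborel. norm ((\<psi> (fst p) * N' n (fst p - snd p)) *^ w0 (snd p)) <= 2 * norm ((\<psi> (fst p) * (1 / norm (fst p - snd p))) *^ w0 (snd p))" for n
    by simp
   show "integrable (lborel \<Otimes>\<^sub>M lborel) (%p. 2 * norm ((\<psi> (fst p) * (1 / norm (fst p - snd p))) *^ w0 (snd p)))"
    using iN by (intro integrable_mult_right integrable_norm) (simp add: case_prod_beta')
  qed measurable
  have is0: "integrable lborel (%x. \<psi> x *^ s0 x)"
   by (rule continuous_compact_support(3)[of _ L]) (use \<psi> in "auto intro!: continuous_intros s0c")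
  have iGp: "integrable lborel (%y. (newton_mass *^ \<psi> y) *^ G y)"
   by (rule integrable_bounded_scaleR[OF Gi, where B="newton_mass * B"])
     (use B newton_mass_pos in "auto simp: abs_mult intro!: mult_left_mono")
  have eq: "(LI x. \<psi> x *^ conv (?M (d n)) G x) = (LI x. \<psi> x *^ conv (N' n) w0 x) + (LI x. \<psi> x *^ s0 x)" for n
  proof -
   have "\<psi> x *^ conv (?M (d n)) G x = \<psi> x *^ conv (N' n) w0 x + \<psi> x *^ s0 x" for x
   proof (cases "x \<in> K")
    case True
    show ?thesis using key[OF True d(1) d(2)] by (simp add: convN' scaleR_add_right)
   next
    case False
    then have "\<psi> x = 0" using LK \<psi>(4) by blast
    then show ?thesis by simp
   qed
   then show ?thesis using integral_conv_swap(3)[OF iN'] is0 by (simp add: Bochner_Integration.integral_add)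
  qed
  have "(LI y. (newton_mass *^ \<psi> y) *^ G y) = (LI x. \<psi> x *^ ?P x) + (LI x. \<psi> x *^ s0 x)"
   by (rule LIMSEQ_unique[OF lim1[unfolded eq]]) (intro tendsto_intros lim2)
  moreover have "\<psi> x *^ ?D x = (newton_mass *^ \<psi> x) *^ G x - \<psi> x *^ ?P x - \<psi> x *^ s0 x" for x
   by (simp add: scaleR_diff_right mult.commute)
  ultimately show ?thesis
   using iGp integral_conv_swap(3)[OF iN] is0 by (simp add: Bochner_Integration.integral_diff)
 qed
 have [measurable]: "cball x0 (R/2) \<in> sets borel" by (rule borel_closed) auto
 have iD: "integrable lborel (%x. indicator (cball x0 (R/2)) x *^ ?D x)"
 proof -
  have "integrable lborel (%x. indicator (cball x0 (R/2)) x *^ ?P x)"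
   by (rule integral_conv_swap(3)[OF integrable_newton_kernel[where a=x0 and r="R/2" and B=1, OF _ _ _ w0i]]) (auto simp: indicator_def)
  moreover have "integrable lborel (%x. indicator (cball x0 (R/2)) x *^ s0 x)"
   using borel_integrable_compact[OF compact_cball continuous_on_subset[OF s0c], of x0 "R/2"] by simp
  moreover have "integrable lborel (%x. indicator (cball x0 (R/2)) x *^ (newton_mass *^ G x))"
   by (rule integrable_mult_indicator) (use Gi in auto)
  ultimately show ?thesis unfolding scaleR_diff_right by (intro Bochner_Integration.integrable_diff)
 qed
 have "AE x in lborel. x \<in> ball x0 (R/2) --> (indicator (cball x0 (R/2)) x *^ ?D x) $ i = 0" for i
 proof (rule AE_zero_if_tests_vanish)
  show "integrable lborel (%x. (indicator (cball x0 (R/2)) x *^ ?D x) $ i)"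
   by (rule integrable_bounded_linear[OF bounded_linear_vec_nth iD])
  fix \<psi> :: "real^3 => real" and L
  assume \<psi>: "continuous_on UNIV \<psi>" "compact L" "L \<subseteq> ball x0 (R/2)" "!!x. x \<notin> L ==> \<psi> x = 0"
  obtain B where B: "!!x. \<bar>\<psi> x\<bar> <= B" using continuous_compact_support(2)[OF \<psi>(1,2,4)] by auto
  have eq: "\<psi> x *^ (indicator (cball x0 (R/2)) x *^ ?D x) = \<psi> x *^ ?D x" for x
   using \<psi>(3,4) by (cases "x \<in> L") (auto simp: indicator_def)
  have "integrable lborel (%x. \<psi> x *^ (indicator (cball x0 (R/2)) x *^ ?D x))"
   by (rule integrable_bounded_scaleR[OF iD _ B]) (use borel_measurable_continuous_onI[OF \<psi>(1)] in simp)
  then have i: "integrable lborel (%x. \<psi> x *^ ?D x)" unfolding eq .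
  have "(LI x. \<psi> x * (indicator (cball x0 (R/2)) x *^ ?D x) $ i) = (LI x. (\<psi> x *^ ?D x) $ i)"
  proof (rule Bochner_Integration.integral_cong[OF refl])
   show "\<psi> x * (indicator (cball x0 (R/2)) x *^ ?D x) $ i = (\<psi> x *^ ?D x) $ i" for x
    unfolding eq[symmetric] by simp
  qed
  also have "\<dots> = (LI x. \<psi> x *^ ?D x) $ i"
   by (rule integral_bounded_linear[OF bounded_linear_vec_nth i])
  also have "\<dots> = 0" using test[OF \<psi>] by simp
  finally show "(LI x. \<psi> x * (indicator (cball x0 (R/2)) x *^ ?D x) $ i) = 0" .
 qed auto
 then have "AE x in lborel. \<forall>i\<in>UNIV. x \<in> ball x0 (R/2) --> (indicator (cball x0 (R/2)) x *^ ?D x) $ i = 0"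
  by (subst AE_finite_all) auto
 then have AE: "AE x in lborel. x \<in> ball x0 (R/2) --> u x = conv (%z. 1 / norm z) (%y. w0 y /\<^sub>R newton_mass) x + s0 x /\<^sub>R newton_mass"
 proof eventually_elim
  case (elim x)
  show ?case
  proof
   assume x: "x \<in> ball x0 (R/2)"
   then have "?D x $ i = 0" for i using elim by (auto simp: indicator_def)
   then have "?D x = 0" by (simp add: vec_eq_iff)
   moreover have "\<eta> x = 1" using one[of x x] x \<delta> by (simp add: K_def)
   ultimately have "newton_mass *^ u x = ?P x + s0 x" by (simp add: G_def algebra_simps)
   moreover have "u x = (newton_mass *^ u x) /\<^sub>R newton_mass" using newton_mass_pos by simp
   ultimately have "u x = (?P x + s0 x) /\<^sub>R newton_mass" by simp
   moreover have "conv (%z. 1 / norm z) (%y. w0 y /\<^sub>R newton_mass) x = ?P x /\<^sub>R newton_mass"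
    unfolding conv_def integral_scaleR_right[symmetric] by (simp add: mult.commute)
   ultimately show "u x = conv (%z. 1 / norm z) (%y. w0 y /\<^sub>R newton_mass) x + s0 x /\<^sub>R newton_mass"
    by (simp add: scaleR_add_right)
  qed
 qed
 show ?thesis
 proof (intro exI conjI)
  show "integrable lborel (%y. w0 y /\<^sub>R newton_mass)" using w0i by (rule integrable_scaleR_right)
  show "(B1 + B2) / newton_mass >= 0" using B newton_mass_pos by simp
  show "\<forall>y. norm (w0 y /\<^sub>R newton_mass) <= (B1 + B2) / newton_mass * norm (u y)"
  proof
   fix y
   have "norm (w0 y /\<^sub>R newton_mass) = norm (w0 y) / newton_mass"
    using newton_mass_pos by (simp add: divide_inverse mult.commute)
   also have "\<dots> <= ((B1 + B2) * norm (u y)) / newton_mass"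
    using w0b newton_mass_pos by (intro divide_right_mono) auto
   finally show "norm (w0 y /\<^sub>R newton_mass) <= (B1 + B2) / newton_mass * norm (u y)" by simp
  qed
  show "\<forall>y. y \<notin> cball x0 R --> w0 y /\<^sub>R newton_mass = 0"
   using w0z K'(2) ball_subset_cball by (metis scale_zero_right subset_iff)
  show "continuous_on UNIV (%x. s0 x /\<^sub>R newton_mass)" by (intro continuous_intros s0c)
 qed (rule AE)
qed


section \<open>Local boundedness and continuity of the solution\<close>

lemma AE_locally:
 fixes U :: "'a::euclidean_space set"
 assumes "!!x. x \<in> U ==> \<exists>r>0. AE y in lborel. y \<in> ball x r --> P y"
 shows "AE y in lborel. y \<in> U --> P y"
proof -
 obtain r where r: "!!x. x \<in> U ==> r x > 0 \<and> (AE y in lborel. y \<in> ball x (r x) --> P y)"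
  using assms by metis
 let ?F = "(%x. ball x (r x)) ` U"
 obtain F' where F': "F' \<subseteq> ?F" "countable F'" "\<Union>F' = \<Union>?F"
  using Lindelof[of ?F] by auto
 have "AE y in lborel. \<forall>B\<in>F'. y \<in> B --> P y"
  unfolding AE_ball_countable[OF F'(2)] using F'(1) r by auto
 then show ?thesis
 proof eventually_elim
  case (elim y)
  show ?case
  proof
   assume "y \<in> U"
   then have "y \<in> \<Union>?F" using r by force
   then show "P y" using elim F'(3) by auto
  qed
 qed
qed

lemma continuous_AE_eq:
 fixes f g :: "'a::euclidean_space => 'b::real_normed_vector"
 assumes "open S" "continuous_on S f" "continuous_on S g" "AE x in lborel. x \<in> S --> f x = g x" "x \<in> S"
 shows "f x = g x"
proof (rule ccontr)
 assume ne: "f x ~= g x"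
 let ?D = "S \<inter> (%y. f y - g y) -` (- {0})"
 have o: "open ?D"
  by (rule continuous_open_preimage[OF continuous_on_diff[OF assms(2,3)] assms(1)]) auto
 have "AE y in lborel. y \<in> - ?D" using assms(4) by eventually_elim auto
 then have ae: "AE y in lebesgue. y \<in> - ?D" by (rule AE_completion)
 have "x \<in> - ?D"
  by (rule mem_closed_if_AE_lebesgue[OF _ ae]) (use o in "simp only: closed_Compl")
 then show False using ne assms(5) by auto
qed

text \<open>In the extended nonnegative reals the estimate holds at every \<open>x\<close>: where
  the integral diverges, the convolution has the default value 0.\<close>

lemma norm_conv_newton_le:
 fixes w :: "real^3 => real^3"
 assumes w: "integrable lborel w" and [measurable]: "u \<in> borel_measurable borel" and A: "A >= 0" "!!y. norm (w y) <= A * norm (u y)" "!!y. y \<notin> cball x0 R ==> w y = 0"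
 shows "ennreal (norm (conv (%z. 1 / norm z) w x))
  <= ennreal A * (\<integral>\<^sup>+y. indicator (cball x0 R) y * (ennreal (1 / norm (x - y)) * ennreal (norm (u y))) \<partial>lborel)"
proof -
 have "ennreal (norm (conv (%z. 1 / norm z) w x)) <= (\<integral>\<^sup>+y. ennreal (norm ((1 / norm (x - y)) *^ w y)) \<partial>lborel)"
 proof (cases "integrable lborel (%y. (1 / norm (x - y)) *^ w y)")
  case True
  then show ?thesis unfolding conv_def by (rule integral_norm_bound_ennreal)
 qed (simp add: conv_def not_integrable_integral_eq)
 also have "\<dots> <= (\<integral>\<^sup>+y. ennreal A * (indicator (cball x0 R) y * (ennreal (1 / norm (x - y)) * ennreal (norm (u y)))) \<partial>lborel)"
 proof (rule nn_integral_mono)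
  fix y
  show "ennreal (norm ((1 / norm (x - y)) *^ w y)) <= ennreal A * (indicator (cball x0 R) y * (ennreal (1 / norm (x - y)) * ennreal (norm (u y))))"
  proof (cases "y \<in> cball x0 R")
   case True
   have "norm ((1 / norm (x - y)) *^ w y) <= (1 / norm (x - y)) * (A * norm (u y))"
    using A(2)[of y] by (simp add: divide_right_mono)
   then have "ennreal (norm ((1 / norm (x - y)) *^ w y)) <= ennreal (A * ((1 / norm (x - y)) * norm (u y)))"
    by (intro ennreal_leI) (simp add: mult_ac)
   also have "\<dots> = ennreal A * (ennreal (1 / norm (x - y)) * ennreal (norm (u y)))"
    using A(1) by (simp add: ennreal_mult del: times_divide_eq_left times_divide_eq_right)
   finally show ?thesis using True by simp
  qed (use A(3) in auto)
 qed
 also have "\<dots> = ennreal A * (\<integral>\<^sup>+y. indicator (cball x0 R) y * (ennreal (1 / norm (x - y)) * ennreal (norm (u y))) \<partial>lborel)"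
 proof -
  have [measurable]: "cball x0 R \<in> sets borel" by (rule borel_closed) auto
  show ?thesis by (rule nn_integral_cmult) measurable
 qed
 finally show ?thesis .
qed

text \<open>The representation is inserted into itself. The product of the kernels
  \<open>1 / |x - y|\<close> and \<open>1 / |y - z|\<close> is at most the sum of their squares,
  whose integral over \<open>y\<close> is bounded. The iterated kernel is therefore bounded, and the
  local integral of \<open>|u|\<close> controls its essential supremum.\<close>

lemma weak_beltrami_locally_bounded:
 fixes x0 :: "real^3"
 assumes W: "weak_beltrami U f u" and U: "open U" and f: "!!x. x \<in> U ==> (f has_derivative (%h. f' x \<bullet> h)) (at x)"
  and f': "continuous_on U f'" and R: "R > 0" "cball x0 R \<subseteq> U"
 shows "\<exists>M\<ge>0. AE x in lborel. x \<in> ball x0 (R/8) --> norm (u x) <= M"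
proof -
 have [measurable]: "u \<in> borel_measurable borel" by (rule weak_beltramiD(1)[OF W])
 have [measurable]: "cball (a::real^3) r \<in> sets borel" for a r by (rule borel_closed) auto
 have "\<exists>w1 s1 A1. integrable lborel w1 \<and> A1 >= 0 \<and> (\<forall>y. norm (w1 y) <= A1 * norm (u y)) \<and> (\<forall>y. y \<notin> cball x0 R --> w1 y = 0) \<and>
  continuous_on UNIV s1 \<and> (AE x in lborel. x \<in> ball x0 (R/2) --> u x = conv (%z. 1 / norm z) w1 x + s1 x)"
  by (rule newton_representation[OF W U f f' R])
 then obtain w1 s1 A1 where *: "integrable lborel w1 \<and> A1 >= 0 \<and> (\<forall>y. norm (w1 y) <= A1 * norm (u y)) \<and> (\<forall>y. y \<notin> cball x0 R --> w1 y = 0) \<and>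
  continuous_on UNIV s1 \<and> (AE x in lborel. x \<in> ball x0 (R/2) --> u x = conv (%z. 1 / norm z) w1 x + s1 x)"
  by (elim exE)
 then have 1: "integrable lborel w1" "A1 >= 0" "!!y. norm (w1 y) <= A1 * norm (u y)" "!!y. y \<notin> cball x0 R ==> w1 y = 0"
  "continuous_on UNIV s1" "AE x in lborel. x \<in> ball x0 (R/2) --> u x = conv (%z. 1 / norm z) w1 x + s1 x" by auto
 \<comment> \<open>With radius \<open>R/4\<close> the density of the second representation lives in
   \<open>ball x0 (R/2)\<close>, where the first one is valid.\<close>
 have R4: "R/4 > 0" "cball x0 (R/4) \<subseteq> U" using R by (auto intro: order_trans[OF _ R(2)])
 have "\<exists>w2 s2 A2. integrable lborel w2 \<and> A2 >= 0 \<and> (\<forall>y. norm (w2 y) <= A2 * norm (u y)) \<and> (\<forall>y. y \<notin> cball x0 (R/4) --> w2 y = 0) \<and>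
  continuous_on UNIV s2 \<and> (AE x in lborel. x \<in> ball x0 (R/4/2) --> u x = conv (%z. 1 / norm z) w2 x + s2 x)"
  by (rule newton_representation[OF W U f f' R4])
 then obtain w2 s2 A2 where *: "integrable lborel w2 \<and> A2 >= 0 \<and> (\<forall>y. norm (w2 y) <= A2 * norm (u y)) \<and> (\<forall>y. y \<notin> cball x0 (R/4) --> w2 y = 0) \<and>
  continuous_on UNIV s2 \<and> (AE x in lborel. x \<in> ball x0 (R/4/2) --> u x = conv (%z. 1 / norm z) w2 x + s2 x)"
  by (elim exE)
 then have 2: "integrable lborel w2" "A2 >= 0" "!!y. norm (w2 y) <= A2 * norm (u y)" "!!y. y \<notin> cball x0 (R/4) ==> w2 y = 0"
  "continuous_on UNIV s2" "AE x in lborel. x \<in> ball x0 (R/8) --> u x = conv (%z. 1 / norm z) w2 x + s2 x" by auto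
 obtain S1 where S1: "S1 >= 0" "!!x. x \<in> cball x0 R ==> norm (s1 x) <= S1"
  using compact_continuous_bound[OF compact_cball continuous_on_subset[OF 1(5)]] by blast
 obtain S2 where S2: "S2 >= 0" "!!x. x \<in> cball x0 R ==> norm (s2 x) <= S2"
  using compact_continuous_bound[OF compact_cball continuous_on_subset[OF 2(5)]] by blast
 obtain C1 where C1: "C1 >= 0" "!!x. (\<integral>\<^sup>+y. indicator (cball x0 (R/4)) y * ennreal (1 / norm (x - y)) \<partial>lborel) <= ennreal C1"
  using inverse_potential_bound by blast
 obtain C2 where C2: "C2 >= 0" "!!x. (\<integral>\<^sup>+y. indicator (cball x0 (R/4)) y * ennreal (1 / (norm (x - y))\<^sup>2) \<partial>lborel) <= ennreal C2"
  using inverse_square_potential_bound by blast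
 have iu: "integrable lborel (%x. indicator (cball x0 R) x *^ u x)"
  by (rule weak_beltramiD(2)[OF W compact_cball R(2)])
 define l where "l = (LI x. norm (indicator (cball x0 R) x *^ u x))"
 have l: "(\<integral>\<^sup>+z. indicator (cball x0 R) z * ennreal (norm (u z)) \<partial>lborel) = ennreal l"
 proof -
  have "(\<integral>\<^sup>+z. ennreal (norm (indicator (cball x0 R) z *^ u z)) \<partial>lborel) = ennreal l"
   unfolding l_def by (rule nn_integral_eq_integral[OF integrable_norm[OF iu]]) simp
  moreover have "ennreal (norm (indicator (cball x0 R) z *^ u z)) = indicator (cball x0 R) z * ennreal (norm (u z))" for z
   by (auto simp: indicator_def)
  ultimately show ?thesis by simp
 qed
 have l0: "l >= 0" unfolding l_def by simp
 define I where "I y = (\<integral>\<^sup>+z. indicator (cball x0 R) z * (ennreal (1 / norm (y - z)) * ennreal (norm (u z))) \<partial>lborel)" for y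
 have [measurable]: "I \<in> borel_measurable borel" unfolding I_def[abs_def] by measurable
 have u1: "AE y in lborel. y \<in> ball x0 (R/2) --> ennreal (norm (u y)) <= ennreal A1 * I y + ennreal S1"
  using 1(6)
 proof eventually_elim
  case (elim y)
  show ?case
  proof
   assume y: "y \<in> ball x0 (R/2)"
   have "ennreal (norm (u y)) <= ennreal (norm (conv (%z. 1 / norm z) w1 y) + norm (s1 y))"
    using elim y by (intro ennreal_leI) (auto intro: norm_triangle_ineq)
   also have "\<dots> = ennreal (norm (conv (%z. 1 / norm z) w1 y)) + ennreal (norm (s1 y))" by (rule ennreal_plus) auto
   also have "\<dots> <= ennreal A1 * I y + ennreal S1"
    unfolding I_def using y R S1
    by (intro add_mono norm_conv_newton_le 1 ennreal_leI S1) auto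
   finally show "ennreal (norm (u y)) <= ennreal A1 * I y + ennreal S1" .
  qed
 qed
 \<comment> \<open>Tonelli puts the middle variable \<open>y\<close> inside; it is the variable that
   both kernels share.\<close>
 have T: "(\<integral>\<^sup>+y. indicator (cball x0 (R/4)) y * (ennreal (1 / norm (x - y)) * I y) \<partial>lborel) <= ennreal (2 * C2 * l)" for x
 proof -
  let ?F = "%y z. indicator (cball x0 (R/4)) y * ennreal (1 / norm (x - y)) * (indicator (cball x0 R) z * (ennreal (1 / norm (y - z)) * ennreal (norm (u z))))"
  have "(\<integral>\<^sup>+y. indicator (cball x0 (R/4)) y * (ennreal (1 / norm (x - y)) * I y) \<partial>lborel) = (\<integral>\<^sup>+y. \<integral>\<^sup>+z. ?F y z \<partial>lborel \<partial>lborel)"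
   unfolding I_def by (subst nn_integral_cmult) (auto simp: mult.assoc)
  also have "\<dots> = (\<integral>\<^sup>+z. \<integral>\<^sup>+y. ?F y z \<partial>lborel \<partial>lborel)"
   by (rule lborel_pair.Fubini'[symmetric]) measurable
  also have "\<dots> <= (\<integral>\<^sup>+z. ennreal (2 * C2) * (indicator (cball x0 R) z * ennreal (norm (u z))) \<partial>lborel)"
  proof (rule nn_integral_mono)
   fix z
   have "(\<integral>\<^sup>+y. ?F y z \<partial>lborel) <= (\<integral>\<^sup>+y. (indicator (cball x0 (R/4)) y * ennreal (1 / (norm (x - y))\<^sup>2) + indicator (cball x0 (R/4)) y * ennreal (1 / (norm (z - y))\<^sup>2))
     * (indicator (cball x0 R) z * ennreal (norm (u z))) \<partial>lborel)"
   proof (rule nn_integral_mono)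
    fix y
    have "(1 / norm (x - y)) * (1 / norm (y - z)) <= 1 / (norm (x - y))\<^sup>2 + 1 / (norm (z - y))\<^sup>2"
    proof -
     have "2 * a * b <= a\<^sup>2 + b\<^sup>2" for a b :: real using zero_le_power2[of "a - b"] by (simp add: power2_diff)
     from this[of "1 / norm (x - y)" "1 / norm (y - z)"] have "2 * ((1 / norm (x - y)) * (1 / norm (y - z))) <= (1 / norm (x - y))\<^sup>2 + (1 / norm (y - z))\<^sup>2"
      by (simp only: mult.assoc)
     moreover have "0 <= (1 / norm (x - y)) * (1 / norm (y - z))" by simp
     ultimately have "(1 / norm (x - y)) * (1 / norm (y - z)) <= (1 / norm (x - y))\<^sup>2 + (1 / norm (y - z))\<^sup>2" by linarith
     then show ?thesis by (simp add: power_divide norm_minus_commute)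
    qed
    then have "ennreal (1 / norm (x - y)) * ennreal (1 / norm (y - z)) <= ennreal (1 / (norm (x - y))\<^sup>2) + ennreal (1 / (norm (z - y))\<^sup>2)"
     by (subst ennreal_mult[symmetric], simp, simp, subst ennreal_plus[symmetric], simp, simp) (rule ennreal_leI)
    then have "(ennreal (1 / norm (x - y)) * ennreal (1 / norm (y - z))) * ennreal (norm (u z)) <= (ennreal (1 / (norm (x - y))\<^sup>2) + ennreal (1 / (norm (z - y))\<^sup>2)) * ennreal (norm (u z))"
     by (rule mult_right_mono) simp
    then show "?F y z <= (indicator (cball x0 (R/4)) y * ennreal (1 / (norm (x - y))\<^sup>2) + indicator (cball x0 (R/4)) y * ennreal (1 / (norm (z - y))\<^sup>2))
     * (indicator (cball x0 R) z * ennreal (norm (u z)))"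
     by (auto simp: indicator_def mult.assoc)
   qed
   also have "\<dots> = ((\<integral>\<^sup>+y. indicator (cball x0 (R/4)) y * ennreal (1 / (norm (x - y))\<^sup>2) \<partial>lborel) + (\<integral>\<^sup>+y. indicator (cball x0 (R/4)) y * ennreal (1 / (norm (z - y))\<^sup>2) \<partial>lborel))
     * (indicator (cball x0 R) z * ennreal (norm (u z)))"
   proof -
    let ?f = "%y. indicator (cball x0 (R/4)) y * ennreal (1 / (norm (x - y))\<^sup>2)"
    let ?g = "%y. indicator (cball x0 (R/4)) y * ennreal (1 / (norm (z - y))\<^sup>2)"
    let ?c = "indicator (cball x0 R) z * ennreal (norm (u z))"
    have "(\<integral>\<^sup>+y. (?f y + ?g y) * ?c \<partial>lborel) = (\<integral>\<^sup>+y. ?f y + ?g y \<partial>lborel) * ?c"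
     by (rule nn_integral_multc) measurable
    also have "(\<integral>\<^sup>+y. ?f y + ?g y \<partial>lborel) = (\<integral>\<^sup>+y. ?f y \<partial>lborel) + (\<integral>\<^sup>+y. ?g y \<partial>lborel)"
     by (rule nn_integral_add) measurable
    finally show ?thesis .
   qed
   also have "\<dots> <= (ennreal C2 + ennreal C2) * (indicator (cball x0 R) z * ennreal (norm (u z)))"
    by (intro mult_right_mono add_mono C2) auto
   also have "ennreal C2 + ennreal C2 = ennreal (2 * C2)" using C2(1) by (simp add: ennreal_plus[symmetric] del: ennreal_plus)
   finally show "(\<integral>\<^sup>+y. ?F y z \<partial>lborel) <= ennreal (2 * C2) * (indicator (cball x0 R) z * ennreal (norm (u z)))" .
  qed
  also have "\<dots> = ennreal (2 * C2) * ennreal l" by (subst nn_integral_cmult) (auto simp: l)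
  also have "\<dots> = ennreal (2 * C2 * l)" using C2(1) l0 by (simp add: ennreal_mult)
  finally show ?thesis .
 qed
 have J: "(\<integral>\<^sup>+y. indicator (cball x0 (R/4)) y * (ennreal (1 / norm (x - y)) * ennreal (norm (u y))) \<partial>lborel) <= ennreal (A1 * (2 * C2 * l) + S1 * C1)" for x
 proof -
  have "(\<integral>\<^sup>+y. indicator (cball x0 (R/4)) y * (ennreal (1 / norm (x - y)) * ennreal (norm (u y))) \<partial>lborel)
   <= (\<integral>\<^sup>+y. ennreal A1 * (indicator (cball x0 (R/4)) y * (ennreal (1 / norm (x - y)) * I y)) + ennreal S1 * (indicator (cball x0 (R/4)) y * ennreal (1 / norm (x - y))) \<partial>lborel)"
  proof (rule nn_integral_mono_AE)
   show "AE y in lborel. indicator (cball x0 (R/4)) y * (ennreal (1 / norm (x - y)) * ennreal (norm (u y)))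
    <= ennreal A1 * (indicator (cball x0 (R/4)) y * (ennreal (1 / norm (x - y)) * I y)) + ennreal S1 * (indicator (cball x0 (R/4)) y * ennreal (1 / norm (x - y)))"
    using u1
   proof eventually_elim
    case (elim y)
    show ?case
    proof (cases "y \<in> cball x0 (R/4)")
     case True
     then have "y \<in> ball x0 (R/2)" using R by auto
     then have "ennreal (1 / norm (x - y)) * ennreal (norm (u y)) <= ennreal (1 / norm (x - y)) * (ennreal A1 * I y + ennreal S1)"
      using elim by (intro mult_left_mono) auto
     then show ?thesis using True by (simp add: distrib_left mult_ac)
    qed simp
   qed
  qed
  also have "\<dots> = ennreal A1 * (\<integral>\<^sup>+y. indicator (cball x0 (R/4)) y * (ennreal (1 / norm (x - y)) * I y) \<partial>lborel)
    + ennreal S1 * (\<integral>\<^sup>+y. indicator (cball x0 (R/4)) y * ennreal (1 / norm (x - y)) \<partial>lborel)"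
  proof -
   let ?f = "%y. indicator (cball x0 (R/4)) y * (ennreal (1 / norm (x - y)) * I y)"
   let ?g = "%y. indicator (cball x0 (R/4)) y * ennreal (1 / norm (x - y))"
   have "(\<integral>\<^sup>+y. ennreal A1 * ?f y + ennreal S1 * ?g y \<partial>lborel) = (\<integral>\<^sup>+y. ennreal A1 * ?f y \<partial>lborel) + (\<integral>\<^sup>+y. ennreal S1 * ?g y \<partial>lborel)"
    by (rule nn_integral_add) measurable
   also have "(\<integral>\<^sup>+y. ennreal A1 * ?f y \<partial>lborel) = ennreal A1 * (\<integral>\<^sup>+y. ?f y \<partial>lborel)"
    by (rule nn_integral_cmult) measurable
   also have "(\<integral>\<^sup>+y. ennreal S1 * ?g y \<partial>lborel) = ennreal S1 * (\<integral>\<^sup>+y. ?g y \<partial>lborel)"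
    by (rule nn_integral_cmult) measurable
   finally show ?thesis .
  qed
  also have "\<dots> <= ennreal A1 * ennreal (2 * C2 * l) + ennreal S1 * ennreal C1"
   by (intro add_mono mult_left_mono T C1) auto
  also have "\<dots> = ennreal (A1 * (2 * C2 * l) + S1 * C1)"
   using 1(2) C1(1) C2(1) l0 S1(1) by (simp add: ennreal_mult[symmetric] ennreal_plus[symmetric] del: ennreal_plus)
  finally show ?thesis .
 qed
 define M where "M = A2 * (A1 * (2 * C2 * l) + S1 * C1) + S2"
 have M0: "M >= 0" "A1 * (2 * C2 * l) + S1 * C1 >= 0" using 1(2) 2(2) C1(1) C2(1) l0 S1(1) S2(1) by (auto simp: M_def)
 have "AE x in lborel. x \<in> ball x0 (R/8) --> norm (u x) <= M"
  using 2(6)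
 proof eventually_elim
  case (elim x)
  show ?case
  proof
   assume x: "x \<in> ball x0 (R/8)"
   have "ennreal (norm (u x)) <= ennreal (norm (conv (%z. 1 / norm z) w2 x) + norm (s2 x))"
    using elim x by (intro ennreal_leI) (auto intro: norm_triangle_ineq)
   also have "\<dots> = ennreal (norm (conv (%z. 1 / norm z) w2 x)) + ennreal (norm (s2 x))" by (rule ennreal_plus) auto
   also have "\<dots> <= ennreal A2 * (\<integral>\<^sup>+y. indicator (cball x0 (R/4)) y * (ennreal (1 / norm (x - y)) * ennreal (norm (u y))) \<partial>lborel) + ennreal S2"
    using x R S2 by (intro add_mono norm_conv_newton_le 2 ennreal_leI S2) auto
   also have "\<dots> <= ennreal A2 * ennreal (A1 * (2 * C2 * l) + S1 * C1) + ennreal S2"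
    by (intro add_mono mult_left_mono J) auto
   also have "\<dots> = ennreal M"
    using 2(2) S2(1) M0(2) unfolding M_def by (simp add: ennreal_mult[symmetric] ennreal_plus[symmetric] del: ennreal_plus)
   finally show "norm (u x) <= M" using M0(1) by (simp add: ennreal_le_iff)
  qed
 qed
 then show ?thesis using M0(1) by blast
qed

text \<open>For a bounded density the truncated potentials converge uniformly: the kernels differ
  only at distance \<open>|t| < d\<close>, and there by at most
  \<open>3 / |t| \<le> 3 d / |t|^2\<close>.\<close>

lemma newton_potential_continuous:
 fixes w :: "real^3 => 'b::euclidean_space"
 assumes w: "integrable lborel w" and B: "B >= 0" "AE y in lborel. norm (w y) <= B" and z: "!!y. y \<notin> cball x0 R ==> w y = 0"
 shows "continuous_on UNIV (conv (%z. 1 / norm z) w)"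
proof -
 have [measurable]: "w \<in> borel_measurable borel" using w by auto
 have [measurable]: "cball (a::real^3) r \<in> sets borel" for a r by (rule borel_closed) auto
 let ?N = "%d z::real^3. newton d (z \<bullet> z)"
 have Nc: "continuous_on UNIV (?N d)" if "d > 0" for d
  using C2_funD(6)[OF C2_fun_newton[OF that, of 0]] by simp
 obtain C where C: "C >= 0" "!!x. (\<integral>\<^sup>+y. indicator (cball x0 R) y * ennreal (1 / norm (x - y)) \<partial>lborel) <= ennreal C"
  using inverse_potential_bound by blast
 have i1: "integrable lborel (%y. (1 / norm (x - y)) *^ w y)" for x
 proof (rule integrableI_bounded)
  have "(\<integral>\<^sup>+y. ennreal (norm ((1 / norm (x - y)) *^ w y)) \<partial>lborel) <= (\<integral>\<^sup>+y. ennreal B * (indicator (cball x0 R) y * ennreal (1 / norm (x - y))) \<partial>lborel)"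
  proof (rule nn_integral_mono_AE)
   show "AE y in lborel. ennreal (norm ((1 / norm (x - y)) *^ w y)) <= ennreal B * (indicator (cball x0 R) y * ennreal (1 / norm (x - y)))"
    using B(2)
   proof eventually_elim
    case (elim y)
    show ?case
    proof (cases "y \<in> cball x0 R")
     case True
     have "ennreal (norm ((1 / norm (x - y)) *^ w y)) <= ennreal (B * (1 / norm (x - y)))"
      using elim by (intro ennreal_leI) (simp add: divide_right_mono)
     also have "\<dots> = ennreal B * ennreal (1 / norm (x - y))" using B(1) by (intro ennreal_mult) auto
     finally show ?thesis using True by simp
    qed (use z in auto)
   qed
  qed
  also have "\<dots> = ennreal B * (\<integral>\<^sup>+y. indicator (cball x0 R) y * ennreal (1 / norm (x - y)) \<partial>lborel)"
   by (rule nn_integral_cmult) measurable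
  also have "\<dots> <= ennreal B * ennreal C" by (intro mult_left_mono C) auto
  also have "\<dots> < \<infinity>" by (simp add: ennreal_mult_less_top)
  finally show "(\<integral>\<^sup>+y. ennreal (norm ((1 / norm (x - y)) *^ w y)) \<partial>lborel) < \<infinity>" .
 qed measurable
 have i2: "integrable lborel (%y. ?N d (x - y) *^ w y)" if d: "d > 0" for d x
 proof (rule integrable_bounded_scaleR[OF w])
  show "(%y. ?N d (x - y)) \<in> borel_measurable lborel"
  proof -
   have "continuous_on UNIV (%y. ?N d (x - y))"
    by (rule continuous_on_compose2[OF Nc[OF d], of UNIV "%y. x - y"]) (auto intro!: continuous_intros)
   from borel_measurable_continuous_onI[OF this] show ?thesis by simp
  qed
  show "\<bar>?N d (x - y)\<bar> <= 2 / d" for y using newton_bounds(1,2)[OF d, of "x - y"] by simp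
 qed
 have [measurable]: "newton d \<in> borel_measurable borel" if "d > 0" for d
  by (rule borel_measurable_continuous_onI, rule DERIV_continuous_on, rule has_field_derivative_at_within, rule newton_derivative[OF that])
 define V where "V = 8 * unit_ball_vol 3"
 have V0: "V >= 0" by (simp add: V_def)
 have est: "norm (conv (?N d) w x - conv (%z. 1 / norm z) w x) <= 3 * d * B * V" if d: "0 < d" "d <= 1" for d x
 proof -
  have "conv (?N d) w x - conv (%z. 1 / norm z) w x = (LI y. ?N d (x - y) *^ w y - (1 / norm (x - y)) *^ w y)"
   unfolding conv_def by (rule Bochner_Integration.integral_diff[symmetric, OF i2[OF d(1)] i1])
  then have "ennreal (norm (conv (?N d) w x - conv (%z. 1 / norm z) w x)) <= (\<integral>\<^sup>+y. ennreal (norm (?N d (x - y) *^ w y - (1 / norm (x - y)) *^ w y)) \<partial>lborel)"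
   using integral_norm_bound_ennreal[OF Bochner_Integration.integrable_diff[OF i2[OF d(1), of x] i1[of x]]] by simp
  also have "\<dots> <= (\<integral>\<^sup>+y. ennreal (3 * d * B) * (indicator (cball 0 1) (x - y) * ennreal (1 / (norm (x - y))\<^sup>2)) \<partial>lborel)"
  proof (rule nn_integral_mono_AE)
   have "AE y in lborel. y ~= x" by (rule AE_lborel_singleton)
   then show "AE y in lborel. ennreal (norm (?N d (x - y) *^ w y - (1 / norm (x - y)) *^ w y)) <= ennreal (3 * d * B) * (indicator (cball 0 1) (x - y) * ennreal (1 / (norm (x - y))\<^sup>2))"
    using B(2)
   proof eventually_elim
    case (elim y)
    define t where "t = x - y"
    have t: "t ~= 0" using elim by (simp add: t_def)
    have "norm (?N d t *^ w y - (1 / norm t) *^ w y) = \<bar>?N d t - 1 / norm t\<bar> * norm (w y)"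
     by (simp flip: scaleR_diff_left)
    show ?case
    proof (cases "d <= norm t")
     case True
     then show ?thesis using newton_bounds(4)[OF d(1), of t] by (simp add: t_def)
    next
     case False
     have "\<bar>?N d t - 1 / norm t\<bar> <= 3 / norm t"
      using newton_bounds(1)[OF d(1), of t] newton_bounds(3)[OF d(1) t] by (simp add: abs_le_iff)
     also have "3 / norm t = 3 * norm t * (1 / (norm t)\<^sup>2)" using t by (simp add: power2_eq_square)
     also have "\<dots> <= 3 * d * (1 / (norm t)\<^sup>2)" using False by (intro mult_right_mono) auto
     finally have "\<bar>?N d t - 1 / norm t\<bar> * norm (w y) <= 3 * d * (1 / (norm t)\<^sup>2) * B"
      using elim d by (intro mult_mono) auto
     then have "norm (?N d t *^ w y - (1 / norm t) *^ w y) <= (3 * d * B) * (1 / (norm t)\<^sup>2)"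
      by (simp flip: scaleR_diff_left add: mult_ac)
     then have "ennreal (norm (?N d t *^ w y - (1 / norm t) *^ w y)) <= ennreal ((3 * d * B) * (1 / (norm t)\<^sup>2))" by (rule ennreal_leI)
     also have "\<dots> = ennreal (3 * d * B) * ennreal (1 / (norm t)\<^sup>2)" using d B(1) by (intro ennreal_mult) auto
     finally show ?thesis using False d(2) by (simp add: t_def)
    qed
   qed
  qed
  also have "\<dots> = (\<integral>\<^sup>+t. ennreal (3 * d * B) * (indicator (cball 0 1) t * ennreal (1 / (norm (t::real^3))\<^sup>2)) \<partial>lborel)"
   by (rule nn_integral_reflect) measurable
  also have "\<dots> = ennreal (3 * d * B) * (\<integral>\<^sup>+t. indicator (cball 0 1) t * ennreal (1 / (norm (t::real^3))\<^sup>2) \<partial>lborel)"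
   by (rule nn_integral_cmult) measurable
  also have "\<dots> <= ennreal (3 * d * B) * ennreal V"
   unfolding V_def by (intro mult_left_mono inverse_square_integral_finite) auto
  also have "\<dots> = ennreal (3 * d * B * V)" using d B(1) V0 by (intro ennreal_mult[symmetric]) auto
  finally show ?thesis using d B(1) V0 by (simp add: ennreal_le_iff)
 qed
 show ?thesis
 proof (rule uniform_limit_theorem)
  show "\<forall>\<^sub>F n in sequentially. continuous_on UNIV (conv (?N (1 / real (Suc n))) w)"
  proof (intro always_eventually allI conv_continuous[OF w Nc])
   show "\<bar>?N (1 / real (Suc n)) z\<bar> <= 2 / (1 / real (Suc n))" for n z
    using newton_bounds(1,2)[of "1 / real (Suc n)" z] by simp
  qed simp
  show "uniform_limit UNIV (%n. conv (?N (1 / real (Suc n))) w) (conv (%z. 1 / norm z) w) sequentially"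
  proof (rule uniform_limitI)
   fix e :: real assume e: "e > 0"
   have "(%n. 3 * (1 / real (Suc n)) * B * V) \<longlonglongrightarrow> 3 * 0 * B * V"
    by (intro tendsto_intros LIMSEQ_Suc[OF lim_const_over_n])
   then have "\<forall>\<^sub>F n in sequentially. 3 * (1 / real (Suc n)) * B * V < e"
    using order_tendstoD(2) e by fastforce
   then show "\<forall>\<^sub>F n in sequentially. \<forall>x\<in>UNIV. dist (conv (?N (1 / real (Suc n))) w x) (conv (%z. 1 / norm z) w x) < e"
   proof eventually_elim
    case (elim n)
    have "1 / real (Suc n) > 0" "1 / real (Suc n) <= 1" by auto
    then have "norm (conv (?N (1 / real (Suc n))) w x - conv (%z. 1 / norm z) w x) < e" for x
     using est[of "1 / real (Suc n)" x] elim by linarith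
    then show ?case unfolding dist_norm by blast
   qed
  qed
 qed simp
qed

text \<open>Local continuous versions agree almost everywhere on overlaps, hence everywhere, and
  glue. The glued version inherits the weak equations because these see only integrals.\<close>

lemma weak_beltrami_continuous:
 assumes W: "weak_beltrami U f u" and U: "open U" and f: "!!x. x \<in> U ==> (f has_derivative (%h. f' x \<bullet> h)) (at x)"
  and f': "continuous_on U f'"
 shows "\<exists>v. weak_beltrami U f v \<and> continuous_on U v \<and> (AE x in lborel. x \<in> U --> u x = v x)"
proof -
 have um[measurable]: "u \<in> borel_measurable borel" by (rule weak_beltramiD(1)[OF W])
 have "\<forall>x0\<in>U. \<exists>p. fst p > 0 \<and> ball x0 (fst p) \<subseteq> U \<and> continuous_on UNIV (snd p) \<and> (AE x in lborel. x \<in> ball x0 (fst p) --> u x = snd p x)"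
 proof
  fix x0 assume x0: "x0 \<in> U"
  obtain R where R: "R > 0" "cball x0 R \<subseteq> U" using U x0 open_contains_cball by blast
  obtain M where M: "M >= 0" "AE x in lborel. x \<in> ball x0 (R/8) --> norm (u x) <= M"
   using weak_beltrami_locally_bounded[OF W U f f' R] by blast
  \<comment> \<open>Half the radius of the ball on which \<open>M\<close> bounds \<open>u\<close>,
    so that the density is bounded on its whole support.\<close>
  have R16: "R/16 > 0" "cball x0 (R/16) \<subseteq> U" using R by (auto intro: order_trans[OF _ R(2)])
  have "\<exists>w s A. integrable lborel w \<and> A >= 0 \<and> (\<forall>y. norm (w y) <= A * norm (u y)) \<and> (\<forall>y. y \<notin> cball x0 (R/16) --> w y = 0) \<and>
   continuous_on UNIV s \<and> (AE x in lborel. x \<in> ball x0 (R/16/2) --> u x = conv (%z. 1 / norm z) w x + s x)"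
   by (rule newton_representation[OF W U f f' R16])
  then obtain w s A where *: "integrable lborel w \<and> A >= 0 \<and> (\<forall>y. norm (w y) <= A * norm (u y)) \<and> (\<forall>y. y \<notin> cball x0 (R/16) --> w y = 0) \<and>
   continuous_on UNIV s \<and> (AE x in lborel. x \<in> ball x0 (R/16/2) --> u x = conv (%z. 1 / norm z) w x + s x)"
   by (elim exE)
  have "AE y in lborel. norm (w y) <= A * M"
   using M(2)
  proof eventually_elim
   case (elim y)
   show ?case
   proof (cases "y \<in> cball x0 (R/16)")
    case True
    then have "norm (u y) <= M" using elim R(1) by auto
    then have "A * norm (u y) <= A * M" using * by (intro mult_left_mono) auto
    then show ?thesis using * order_trans by blast
   qed (use * M(1) in auto)
  qed
  then have "continuous_on UNIV (conv (%z. 1 / norm z) w)"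
   using * M(1) by (intro newton_potential_continuous[of w "A * M" x0 "R/16"]) auto
  then have "continuous_on UNIV (%x. conv (%z. 1 / norm z) w x + s x)"
   using * by (intro continuous_on_add) auto
  moreover have "ball x0 (R/16/2) \<subseteq> U" using R16 by (auto intro: order_trans[OF _ R16(2)])
  moreover have "R/16/2 > 0" using R by simp
  ultimately show "\<exists>p. fst p > 0 \<and> ball x0 (fst p) \<subseteq> U \<and> continuous_on UNIV (snd p) \<and> (AE x in lborel. x \<in> ball x0 (fst p) --> u x = snd p x)"
   using * by (intro exI[of _ "(R/16/2, %x. conv (%z. 1 / norm z) w x + s x)"]) simp
 qed
 from bchoice[OF this] obtain p where p: "\<forall>x0\<in>U. fst (p x0) > 0 \<and> ball x0 (fst (p x0)) \<subseteq> U \<and> continuous_on UNIV (snd (p x0)) \<and> (AE x in lborel. x \<in> ball x0 (fst (p x0)) --> u x = snd (p x0) x)"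
  by blast
 define r where "r x = fst (p x)" for x
 define g where "g x = snd (p x)" for x
 have rg: "r x > 0" "ball x (r x) \<subseteq> U" "continuous_on UNIV (g x)" "AE y in lborel. y \<in> ball x (r x) --> u y = g x y" if "x \<in> U" for x
  using p that unfolding r_def g_def by auto
 \<comment> \<open>Each point takes the value of the version centred there; \<open>vg\<close> shows
   that the centre does not matter.\<close>
 define v where "v x = (if x \<in> U then g x x else 0)" for x
 have vg: "v y = g x y" if x: "x \<in> U" and y: "y \<in> ball x (r x)" for x y
 proof -
  have yU: "y \<in> U" using rg(2)[OF x] y by auto
  have "AE t in lborel. t \<in> ball x (r x) \<inter> ball y (r y) --> g y t = g x t"
   using rg(4)[OF x] rg(4)[OF yU] by eventually_elim auto
  then have "g y y = g x y"
   by (intro continuous_AE_eq[of "ball x (r x) \<inter> ball y (r y)"])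
     (use rg(1)[OF yU] y in "auto intro: continuous_on_subset[OF rg(3)[OF x]] continuous_on_subset[OF rg(3)[OF yU]]")
  then show ?thesis using yU by (simp add: v_def)
 qed
 have vc: "continuous_on U v"
 proof (rule continuous_at_imp_continuous_on, rule ballI)
  fix x assume x: "x \<in> U"
  have "continuous_on (ball x (r x)) v"
   by (rule continuous_on_eq[OF continuous_on_subset[OF rg(3)[OF x]]]) (use vg[OF x] in auto)
  then show "isCont v x" using rg(1)[OF x] by (simp add: continuous_on_eq_continuous_at)
 qed
 have AE: "AE x in lborel. x \<in> U --> u x = v x"
 proof (rule AE_locally)
  fix x assume x: "x \<in> U"
  have "AE y in lborel. y \<in> ball x (r x) --> u y = v y"
   using rg(4)[OF x] by eventually_elim (use vg[OF x] in auto)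
  then show "\<exists>r>0. AE y in lborel. y \<in> ball x r --> u y = v y" using rg(1)[OF x] by blast
 qed
 have "v = (%x. indicator U x *^ v x)" by (auto simp: v_def indicator_def)
 moreover have "(%x. indicator U x *^ v x) \<in> borel_measurable borel"
  by (rule borel_measurable_continuous_on_indicator) (use U vc in auto)
 ultimately have vm[measurable]: "v \<in> borel_measurable borel" by simp
 have h1: "\<forall>K. compact K \<and> K \<subseteq> U --> integrable lborel (%x. indicator K x *^ v x)"
 proof (intro allI impI)
  fix K assume K: "compact K \<and> K \<subseteq> U"
  then have [measurable]: "K \<in> sets borel" using borel_compact by auto
  show "integrable lborel (%x. indicator K x *^ v x)"
  proof (rule integrable_cong_AE_imp[OF weak_beltramiD(2)[OF W]])
   show "AE x in lborel. indicator K x *^ u x = indicator K x *^ v x"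
    using AE by eventually_elim (use K in "auto simp: indicator_def")
  qed (use K in auto)
 qed
 have h2: "(LI x. cross3 (v x) (g x)) = (LI x. (\<phi> x * f x) *^ v x)" "(LI x. v x \<bullet> g x) = 0"
  if T: "C1_test U \<phi> g" for \<phi> g
 proof -
  obtain K where K: "compact K" "K \<subseteq> U" "!!x. x \<notin> K ==> \<phi> x = 0" "!!x. x \<notin> K ==> g x = 0"
   and c: "continuous_on UNIV \<phi>" "continuous_on UNIV g"
   by (rule C1_testE[OF T]) (rule that)
  have fc: "continuous_on U f"
   by (rule continuous_at_imp_continuous_on) (use f has_derivative_continuous in blast)
  have [measurable]: "g \<in> borel_measurable borel" using c by (simp add: borel_measurable_continuous_onI)
  have [measurable]: "(%x. \<phi> x * f x) \<in> borel_measurable borel"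
   using continuous_on_cutoff[OF U fc c(1) K(1,2,3)] by (simp add: borel_measurable_continuous_onI)
  have [measurable]: "(%x. cross3 (w x) (g x)) \<in> borel_measurable borel" if "w \<in> borel_measurable borel" for w
   by (rule borel_measurable_bilinear[OF bounded_bilinear_cross3 that]) measurable
  have "(LI x. cross3 (v x) (g x)) = (LI x. cross3 (u x) (g x))"
  proof (rule integral_cong_AE)
   show "AE x in lborel. cross3 (v x) (g x) = cross3 (u x) (g x)"
    using AE
   proof eventually_elim
    case (elim x)
    then show ?case using K by (cases "x \<in> K") auto
   qed
  qed measurable
  also have "\<dots> = (LI x. (\<phi> x * f x) *^ u x)" by (rule weak_beltramiD(3)[OF W T])
  also have "\<dots> = (LI x. (\<phi> x * f x) *^ v x)"
  proof (rule integral_cong_AE)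
   show "AE x in lborel. (\<phi> x * f x) *^ u x = (\<phi> x * f x) *^ v x"
    using AE
   proof eventually_elim
    case (elim x)
    then show ?case using K by (cases "x \<in> K") auto
   qed
  qed measurable
  finally show "(LI x. cross3 (v x) (g x)) = (LI x. (\<phi> x * f x) *^ v x)" .
  have "(LI x. v x \<bullet> g x) = (LI x. u x \<bullet> g x)"
  proof (rule integral_cong_AE)
   show "AE x in lborel. v x \<bullet> g x = u x \<bullet> g x"
    using AE
   proof eventually_elim
    case (elim x)
    then show ?case using K by (cases "x \<in> K") auto
   qed
  qed measurable
  then show "(LI x. v x \<bullet> g x) = 0" using weak_beltramiD(4)[OF W T] by simp
 qed
 have "weak_beltrami U f v"
  unfolding weak_beltrami_def by (intro conjI vm h1 allI impI h2)
 then show ?thesis using vc AE by blast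
qed


section \<open>A Carleman inequality for the first-order system\<close>

text \<open>For a field \<open>w\<close> with derivative matrix \<open>J\<close> put \<open>E w = J x\<close> and \<open>A w = tr(J) x - J\<^sup>T x\<close>. Then
  \<open>E w + A w = x div w - x \<times> curl w\<close>. The operator \<open>A\<close> is symmetric, commutes with multiplication by
  radial functions, and commutes with dilations, whose generator is \<open>E\<close>.\<close>

definition sym_part :: "real^3 => real^3^3 => real^3" where
 "sym_part x J = trace J *^ x - transpose J *v x"

definition C1_field :: "(real^3 => real^3) => (real^3 => real^3^3) => (real^3) set => bool" where
 "C1_field w J K \<longleftrightarrow> (\<forall>x. (w has_derivative (%h. J x *v h)) (at x)) \<and> continuous_on UNIV J \<and>
   compact K \<and> (\<forall>x. x \<notin> K --> w x = 0)"

lemma C1_fieldD: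
 assumes "C1_field w J K"
 shows "(w has_derivative (%h. J x *v h)) (at x)" "continuous_on UNIV J" "compact K" "x \<notin> K ==> w x = 0"
  "continuous_on UNIV w" "x \<notin> K ==> J x = 0" "((%x. w x $ i) has_derivative (%h. J x $ i \<bullet> h)) (at x)"
proof -
 show d: "(w has_derivative (%h. J x *v h)) (at x)" "continuous_on UNIV J" "compact K" "x \<notin> K ==> w x = 0" for x
  using assms unfolding C1_field_def by auto
 show "continuous_on UNIV w"
  by (rule continuous_at_imp_continuous_on) (use d(1) has_derivative_continuous in blast)
 show "J x = 0" if "x \<notin> K"
 proof -
  have "(%h. J x *v h) = (%h. 0)"
   by (rule vanishing_derivative[OF compact_imp_closed[OF d(3)] d(4) d(1) that])
  then have "J x *v h = 0 *v h" for h using fun_cong[of "%h. J x *v h" "%h. 0" h] by simp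
  then show ?thesis by (simp add: matrix_eq)
 qed
 have "((%x. w x $ i) has_derivative (%h. (J x *v h) $ i)) (at x)"
  by (rule bounded_linear.has_derivative[OF bounded_linear_vec_nth d(1)])
 then show "((%x. w x $ i) has_derivative (%h. J x $ i \<bullet> h)) (at x)"
  by (simp add: matrix_vector_mult_def inner_vec_def)
qed

lemma continuous_on_sym_part:
 "continuous_on S a ==> continuous_on S J ==> continuous_on S (%x. sym_part (a x) (J x))"
 unfolding sym_part_def trace_def matrix_vector_mult_def transpose_def by (auto intro!: continuous_intros)

text \<open>By translation invariance the convolution of \<open>\<phi>\<close> with the indicator of
  a large ball is constant near 0; its derivative at 0 is the integral of the derivative of
  \<open>\<phi>\<close>.\<close>

lemma integral_gradient_zero:
 assumes \<phi>: "!!x. (\<phi> has_derivative (%h. g x \<bullet> h)) (at x)" "continuous_on UNIV g" "compact K" "!!x. x \<notin> K ==> \<phi> x = (0::real)"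
 shows "(LI x. g x \<bullet> e) = 0"
proof -
 have g0: "g x = 0" if "x \<notin> K" for x
 proof -
  have "(%h. g x \<bullet> h) = (%h. 0)"
   by (rule vanishing_derivative[OF compact_imp_closed[OF \<phi>(3)] \<phi>(4) \<phi>(1) that])
  then have "g x \<bullet> g x = 0" by metis
  then show ?thesis by simp
 qed
 have \<phi>c: "continuous_on UNIV \<phi>"
  by (rule continuous_at_imp_continuous_on) (use \<phi>(1) has_derivative_continuous in blast)
 obtain r where r: "r > 0" "!!x. x \<in> K ==> norm x <= r"
  using compact_imp_bounded[OF \<phi>(3)] unfolding bounded_pos by auto
 \<comment> \<open>The radius exceeds that of the support by 1, which leaves room for the shifts
   with \<open>norm x < 1\<close>.\<close>
 define G :: "'a => real" where "G = indicator (cball 0 (r + 1))"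
 have Gi: "integrable lborel G"
  unfolding G_def using emeasure_bounded_finite[of "cball (0::'a) (r+1)"] by simp
 have [measurable]: "\<phi> \<in> borel_measurable borel" "g \<in> borel_measurable borel" "G \<in> borel_measurable borel"
  using \<phi>c \<phi>(2) Gi by (auto simp: borel_measurable_continuous_onI)
 have "conv \<phi> G x = (LI z. \<phi> z)" if "norm x < 1" for x
 proof -
  have "conv \<phi> G x = (LI z. \<phi> z *^ G (x - z))" by (rule conv_reflect) auto
  also have "\<dots> = (LI z. \<phi> z)"
  proof (rule Bochner_Integration.integral_cong[OF refl])
   fix z
   show "\<phi> z *^ G (x - z) = \<phi> z"
   proof (cases "z \<in> K")
    case True
    then have "norm (x - z) <= r + 1" using r(2)[OF True] that norm_triangle_ineq4[of x z] by linarith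
    then show ?thesis by (simp add: G_def)
   qed (use \<phi>(4) in auto)
  qed
  finally show ?thesis .
 qed
 then have "((%x. \<integral>z. \<phi> z \<partial>lborel) has_derivative (%h. conv (%y. g y \<bullet> h) G 0)) (at 0)"
  by (intro has_derivative_transform_within_open[OF conv_has_derivative[OF Gi \<phi>(1,2,3,4) g0], of "ball 0 1"]) auto
 then have "(%h. conv (%y. g y \<bullet> h) G 0) = (%h. 0)"
  using has_derivative_unique has_derivative_const by blast
 then have "conv (%y. g y \<bullet> e) G 0 = 0" by metis
 moreover have "conv (%y. g y \<bullet> e) G 0 = (LI z. (g z \<bullet> e) *^ G (0 - z))" by (rule conv_reflect) auto
 moreover have "(%z. (g z \<bullet> e) *^ G (0 - z)) = (%z. g z \<bullet> e)"
 proof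
  show "(g z \<bullet> e) *^ G (0 - z) = g z \<bullet> e" for z
   using g0[of z] r(2)[of z] by (cases "z \<in> K") (auto simp: G_def)
 qed
 ultimately show ?thesis by (simp only:)
qed

text \<open>The difference of the two integrands is the divergence of
  \<open>(a \<bullet> x) b - (b \<bullet> x) a\<close>.\<close>

lemma sym_part_symmetric:
 assumes a: "C1_field a Ja K" and b: "C1_field b Jb L"
 shows "(LI x. a x \<bullet> sym_part x (Jb x)) = (LI x. sym_part x (Ja x) \<bullet> b x)"
proof -
 note A = C1_fieldD[OF a] and B = C1_fieldD[OF b]
 define G where "G i x = ((a x \<bullet> x) *^ Jb x $ i + b x $ i *^ (transpose (Ja x) *v x + a x))
   - ((b x \<bullet> x) *^ Ja x $ i + a x $ i *^ (transpose (Jb x) *v x + b x))" for i x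
 have ip: "((%x. c x \<bullet> x) has_derivative (%h. (transpose (J x) *v x + c x) \<bullet> h)) (at x)"
  if "(c has_derivative (%h. J x *v h)) (at x)" for c J and x :: "real^3"
  by (rule has_derivative_eq_rhs, rule has_derivative_inner[OF that has_derivative_ident])
    (simp add: fun_eq_iff inner_add_left dot_lmul_matrix inner_commute[of x])
 have d: "((%x. (a x \<bullet> x) * b x $ i - (b x \<bullet> x) * a x $ i) has_derivative (%h. G i x \<bullet> h)) (at x)" for i x
  by (rule has_derivative_eq_rhs, rule has_derivative_diff[OF has_derivative_mult[OF ip[OF A(1)] B(7)] has_derivative_mult[OF ip[OF B(1)] A(7)]])
    (simp add: fun_eq_iff G_def inner_add_left inner_diff_left algebra_simps)
 have Gc: "continuous_on UNIV (G i)" for i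
  unfolding G_def matrix_vector_mult_def transpose_def
  by (intro continuous_intros A B)
 have z: "(LI x. G i x \<bullet> axis i 1) = 0" for i
  by (rule integral_gradient_zero[OF d Gc A(3)]) (use A(4) in auto)
 have G0: "G i x = 0" if "x \<notin> K" for i x
 proof -
  have "transpose (Ja x) *v x = 0" using A(6)[OF that] by (simp add: vector_matrix_mult_def vec_eq_iff)
  then show ?thesis using A(4,6)[OF that] by (simp add: G_def)
 qed
 have Gi: "integrable lborel (%x. G i x \<bullet> axis i 1)" for i
  by (rule continuous_compact_support(3)[OF _ A(3)]) (use G0 Gc in "auto intro!: continuous_intros")
 have p: "(\<Sum>i\<in>UNIV. G i x \<bullet> axis i 1) = a x \<bullet> sym_part x (Jb x) - sym_part x (Ja x) \<bullet> b x" for x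
  by (simp add: axis_def G_def sym_part_def inner_axis trace_def matrix_vector_mult_def transpose_def inner_vec_def sum_3 algebra_simps)
 have "(LI x. (\<Sum>i\<in>UNIV. G i x \<bullet> axis i 1)) = 0"
  using z Gi by (simp add: Bochner_Integration.integral_sum)
 then have "(LI x. a x \<bullet> sym_part x (Jb x) - sym_part x (Ja x) \<bullet> b x) = 0" unfolding p .
 moreover have "integrable lborel (%x. a x \<bullet> sym_part x (Jb x))"
  by (rule continuous_compact_support(3)[OF _ A(3)]) (use A(4) in "auto intro!: continuous_intros continuous_on_sym_part A(5) B(2)")
 moreover have "integrable lborel (%x. sym_part x (Ja x) \<bullet> b x)"
  by (rule continuous_compact_support(3)[OF _ B(3)]) (use B(4) in "auto intro!: continuous_intros continuous_on_sym_part A(2) B(5)")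
 ultimately show ?thesis by (simp add: Bochner_Integration.integral_diff)
qed

lemma sym_part_add: "sym_part x (A + B) = sym_part x A + sym_part x B"
 by (simp add: sym_part_def trace_add transpose_add matrix_vector_mult_add_rdistrib scaleR_add_left)

lemma sym_part_scaleR: "sym_part x (c *^ A) = c *^ sym_part x A" "sym_part (c *^ x) A = c *^ sym_part x A"
 by (simp_all add: sym_part_def trace_scaleR transpose_scaleR scaleR_matrix_vector_assoc[symmetric] matrix_vector_mult_scaleR scaleR_diff_right mult.commute)

lemma C1_field_dilation:
 assumes w: "C1_field w J K" and s: "s > 0"
 shows "C1_field (%x. w (s *^ x)) (%x. s *^ J (s *^ x)) ((%x. x /\<^sub>R s) ` K)"
 unfolding C1_field_def
proof (intro conjI allI impI)
 note W = C1_fieldD[OF w]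
 show "((%x. w (s *^ x)) has_derivative (%h. (s *^ J (s *^ x)) *v h)) (at x)" for x
  by (rule has_derivative_eq_rhs, rule has_derivative_compose[where f="%x. s *^ x" and g=w, OF _ W(1)])
    (auto intro!: derivative_eq_intros simp: scaleR_matrix_vector_assoc[symmetric] matrix_vector_mult_scaleR)
 show "continuous_on UNIV (%x. s *^ J (s *^ x))"
  by (intro continuous_intros continuous_on_compose2[OF W(2)]) auto
 show "compact ((%x. x /\<^sub>R s) ` K)"
  by (rule compact_continuous_image[OF _ W(3)]) (intro continuous_intros)
 show "w (s *^ x) = 0" if "x \<notin> (%x. x /\<^sub>R s) ` K" for x
 proof (rule W(4))
  show "s *^ x \<notin> K"
  proof
   assume "s *^ x \<in> K"
   then have "(s *^ x) /\<^sub>R s \<in> (%x. x /\<^sub>R s) ` K" by (rule imageI)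
   then show False using that s by simp
  qed
 qed
qed

text \<open>The quadratic form \<open>b(w) = \<integral> w \<bullet> A w\<close> satisfies \<open>b(w\<^sub>s) = s\<^sup>-\<^sup>3 b(w)\<close> for the dilates \<open>w\<^sub>s = w(s \<cdot>)\<close>, and
  \<open>b(w\<^sub>s) - b(w) = \<integral> (w\<^sub>s - w) \<bullet> (A w\<^sub>s + A w)\<close> by symmetry; differentiate at \<open>s = 1\<close>.\<close>

lemma sym_part_dilation_identity:
 assumes w: "C1_field w J K"
 shows "2 * (LI x. (J x *v x) \<bullet> sym_part x (J x)) + 3 * (LI x. w x \<bullet> sym_part x (J x)) = 0"
proof -
 note W = C1_fieldD[OF w]
 let ?A = "%x. sym_part x (J x)"
 define b where "b = (LI x. w x \<bullet> ?A x)"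
 have Ac: "continuous_on UNIV ?A" by (intro continuous_on_sym_part continuous_intros W)
 have A0: "?A x = 0" if "x \<notin> K" for x using W(6)[OF that] by (simp add: sym_part_def trace_def transpose_def matrix_vector_mult_def vec_eq_iff)
 \<comment> \<open>Only factors above 1: the dilates are then supported in any centred ball that
   contains the support of \<open>w\<close>, which gives one dominating function.\<close>
 define s where "s n = 1 + 1 / real (Suc n)" for n
 have s: "s n > 0" "s n >= 1" "s n ~= 1" for n
 proof -
  have "1 / real (Suc n) > 0" by simp
  then show "s n > 0" "s n >= 1" "s n ~= 1" unfolding s_def by linarith+
 qed
 have s1: "s \<longlonglongrightarrow> 1" 
 proof -
  have "(%n. 1 + 1 / real (Suc n)) \<longlonglongrightarrow> 1 + 0" by (intro tendsto_intros LIMSEQ_Suc[OF lim_const_over_n])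
  then show ?thesis unfolding s_def by simp
 qed
 let ?w = "%n x. w (s n *^ x)" and ?As = "%n x. sym_part (s n *^ x) (J (s n *^ x))"
 have ws: "C1_field (?w n) (%x. s n *^ J (s n *^ x)) ((%x. x /\<^sub>R s n) ` K)" for n
  by (rule C1_field_dilation[OF w s(1)])
 have As: "sym_part x (s n *^ J (s n *^ x)) = ?As n x" for n x by (simp add: sym_part_scaleR)
 note WS = C1_fieldD[OF ws]
 have Asc: "continuous_on UNIV (?As n)" for n
  by (rule continuous_on_compose2[OF Ac, of UNIV "%x. s n *^ x"]) (auto intro!: continuous_intros)
 have i1: "integrable lborel (%x. ?w n x \<bullet> ?As n x)" "integrable lborel (%x. ?w n x \<bullet> ?A x)" for n
  by (rule continuous_compact_support(3)[OF _ WS(3)[of n]]; use WS(4)[of _ n] in "auto intro!: continuous_intros WS(5) Asc Ac")+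
 have i2: "integrable lborel (%x. w x \<bullet> ?As n x)" "integrable lborel (%x. w x \<bullet> ?A x)" for n
  by (rule continuous_compact_support(3)[OF _ W(3)]; use W(4) in "auto intro!: continuous_intros W(5) Asc Ac")+
 have bs: "(LI x. ?w n x \<bullet> ?As n x) = b / s n ^ 3" for n
 proof -
  have "(%x. w x \<bullet> ?A x) \<in> borel_measurable borel" using i2(2) by auto
  from integral_affine[OF this s(1)[of n]] show ?thesis using s(1)[of n] by (simp add: b_def)
 qed
 have sy: "(LI x. ?w n x \<bullet> ?A x) = (LI x. w x \<bullet> ?As n x)" for n
  using sym_part_symmetric[OF ws[of n] w] unfolding As by (simp add: inner_commute)
 \<comment> \<open>Thanks to \<open>sy\<close> the difference of the quadratic forms factors like a
   difference of squares. Only \<open>w\<close>, and not its Jacobian, is then differentiated in the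
   scale, as class one requires.\<close>
 have eq: "(LI x. ((?w n x - w x) /\<^sub>R (s n - 1)) \<bullet> (?As n x + ?A x)) = (b / s n ^ 3 - b) / (s n - 1)" for n
 proof -
  have "(LI x. ((?w n x - w x) /\<^sub>R (s n - 1)) \<bullet> (?As n x + ?A x))
   = inverse (s n - 1) * (LI x. (?w n x \<bullet> ?As n x + ?w n x \<bullet> ?A x) - (w x \<bullet> ?As n x + w x \<bullet> ?A x))"
   unfolding integral_mult_right_zero[symmetric]
   by (rule Bochner_Integration.integral_cong[OF refl]) (simp add: inner_diff_left inner_add_right algebra_simps)
  also have "(LI x. (?w n x \<bullet> ?As n x + ?w n x \<bullet> ?A x) - (w x \<bullet> ?As n x + w x \<bullet> ?A x)) = b / s n ^ 3 - b"
   using i1 i2 sy[of n] bs[of n] by (simp add: Bochner_Integration.integral_diff Bochner_Integration.integral_add b_def)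
  finally show ?thesis by (simp add: divide_inverse mult.commute)
 qed
 obtain r where r: "r > 0" "!!x. x \<in> K ==> norm x <= r"
  using compact_imp_bounded[OF W(3)] unfolding bounded_pos by auto
 have out: "w x = 0" "J x = 0" "?A x = 0" if "norm x > r" for x
  using that r(2)[of x] W(4,6)[of x] A0[of x] by fastforce+
 obtain BJ where BJ: "!!x h. norm (J x *v h) <= BJ * norm h" "BJ >= 0"
 proof -
  have "bounded_bilinear (%(A::real^3^3) (h::real^3). A *v h)"
   by (auto simp: bilinear_conv_bounded_bilinear[symmetric] bilinear_def linear_iff matrix_vector_mult_add_rdistrib
     matrix_vector_right_distrib scaleR_matrix_vector_assoc matrix_vector_mult_scaleR)
  then obtain C where C: "C >= 0" "!!(A::real^3^3) (h::real^3). norm (A *v h) <= norm A * norm h * C"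
   using bounded_bilinear.nonneg_bounded by blast
  obtain B where B: "B >= 0" "!!x. norm (J x) <= B" using continuous_compact_support(2)[OF W(2,3)] W(6) by auto
  have "norm (J x *v h) <= (B * C) * norm h" for x h
   using C(2)[of "J x" h] mult_right_mono[OF mult_right_mono[OF B(2)[of x] norm_ge_zero[of h]] C(1)] by (simp add: mult_ac)
  then show ?thesis using that B(1) C(1) by (metis mult_nonneg_nonneg)
 qed
 obtain BA where BA: "!!x. norm (?A x) <= BA" "BA >= 0"
  using continuous_compact_support(2)[OF Ac W(3)] A0 by auto
 have lip: "norm (w y - w x) <= BJ * norm (y - x)" for x y
  by (rule differentiable_bound[OF convex_UNIV, of w "%x h. J x *v h" BJ])
    (use BJ in "auto intro!: has_derivative_at_withinI[OF W(1)] onorm_bound")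
 have "(%n. \<integral>x. ((?w n x - w x) /\<^sub>R (s n - 1)) \<bullet> (?As n x + ?A x) \<partial>lborel) \<longlonglongrightarrow> (LI x. (J x *v x) \<bullet> (?A x + ?A x))"
 proof (rule integral_dominated_convergence[where w="%x. (BJ * r) * (2 * BA) * indicator (cball 0 r) x"])
  have "(%n. (?w n x - w x) /\<^sub>R (s n - 1)) \<longlonglongrightarrow> J x *v x" for x
  proof -
   have "((%t. w (t *^ x)) has_derivative (%t. J (1 *^ x) *v (t *^ x))) (at 1)"
    by (rule has_derivative_compose[where f="%t. t *^ x" and g=w, OF _ W(1)]) (auto intro!: derivative_eq_intros)
   then have v: "((%t. w (t *^ x)) has_derivative (%t. t *^ (J x *v x))) (at 1)"
    by (simp add: matrix_vector_mult_scaleR)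
   have "((%t. (w (t *^ x) - w x) /\<^sub>R (t - 1)) \<longlongrightarrow> J x *v x) (at 1)"
   proof (rule vec_tendstoI)
    fix i
    have "((%t. w (t *^ x) $ i) has_derivative (%t. (t *^ (J x *v x)) $ i)) (at 1)"
     by (rule bounded_linear.has_derivative[OF bounded_linear_vec_nth v])
    then have "((%t. w (t *^ x) $ i) has_real_derivative (J x *v x) $ i) (at 1)"
     by (simp add: has_field_derivative_def mult_commute_abs)
    then show "((%t. ((w (t *^ x) - w x) /\<^sub>R (t - 1)) $ i) \<longlongrightarrow> (J x *v x) $ i) (at 1)"
     unfolding has_field_derivative_iff by (simp add: divide_inverse mult.commute)
   qed
   moreover have "filterlim s (at 1) sequentially"
    unfolding filterlim_at using s1 s(3) by simp
   ultimately show ?thesis by (rule filterlim_compose)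
  qed
  moreover have "(%n. ?As n x) \<longlonglongrightarrow> ?A x" for x
  proof -
   have "isCont ?A (1 *^ x)" using Ac continuous_on_eq_continuous_at by blast
   moreover have "(%n. s n *^ x) \<longlonglongrightarrow> 1 *^ x" by (intro tendsto_intros s1)
   ultimately have "(%n. ?As n x) \<longlonglongrightarrow> sym_part (1 *^ x) (J (1 *^ x))" by (rule isCont_tendsto_compose)
   then show ?thesis by simp
  qed
  ultimately show "AE x in lborel. (%n. ((?w n x - w x) /\<^sub>R (s n - 1)) \<bullet> (?As n x + ?A x)) \<longlonglongrightarrow> (J x *v x) \<bullet> (?A x + ?A x)"
   by (intro always_eventually allI tendsto_inner tendsto_add tendsto_const)
  have "norm (((?w n x - w x) /\<^sub>R (s n - 1)) \<bullet> (?As n x + ?A x)) <= (BJ * r) * (2 * BA) * indicator (cball 0 r) x" for n x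
  proof (cases "norm x <= r")
   case True
   have "norm (?w n x - w x) <= BJ * norm ((s n - 1) *^ x)"
    using lip[of "s n *^ x" x] by (simp add: scaleR_diff_left)
   also have "\<dots> <= BJ * ((s n - 1) * r)" using True s(2)[of n] BJ(2) by (auto intro!: mult_left_mono)
   finally have "norm (?w n x - w x) / (s n - 1) <= BJ * r" using s(2,3)[of n] by (simp add: divide_le_eq mult_ac)
   then have 1: "norm ((?w n x - w x) /\<^sub>R (s n - 1)) <= BJ * r" using s(2)[of n] by (simp add: divide_inverse mult.commute)
   have 2: "norm (?As n x + ?A x) <= 2 * BA" using norm_triangle_ineq[of "?As n x" "?A x"] BA(1)[of x] BA(1)[of "s n *^ x"] by linarith
   have "norm (((?w n x - w x) /\<^sub>R (s n - 1)) \<bullet> (?As n x + ?A x)) <= norm ((?w n x - w x) /\<^sub>R (s n - 1)) * norm (?As n x + ?A x)"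
    by (simp only: real_norm_def Cauchy_Schwarz_ineq2)
   also have "\<dots> <= (BJ * r) * (2 * BA)" by (rule mult_mono[OF 1 2]) (use BJ r in auto)
   finally show ?thesis using True by simp
  next
   case False
   then have "norm (s n *^ x) > r" using s(2)[of n] mult_right_mono[of 1 "s n" "norm x"] by simp
   then show ?thesis using False out by simp
  qed
  then show "AE x in lborel. norm (((?w n x - w x) /\<^sub>R (s n - 1)) \<bullet> (?As n x + ?A x)) <= (BJ * r) * (2 * BA) * indicator (cball 0 r) x" for n
   by simp
  show "integrable lborel (%x. (BJ * r) * (2 * BA) * indicator (cball 0 r) (x::real^3))"
   using emeasure_bounded_finite[of "cball (0::real^3) r"] by simp
  show "(%x. ((?w n x - w x) /\<^sub>R (s n - 1)) \<bullet> (?As n x + ?A x)) \<in> borel_measurable lborel" for n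
  proof -
   have "continuous_on UNIV (%x. ((?w n x - w x) /\<^sub>R (s n - 1)) \<bullet> (?As n x + ?A x))"
    by (intro continuous_intros WS(5) W(5) Asc Ac)
   from borel_measurable_continuous_onI[OF this] show ?thesis by simp
  qed
  show "(%x. (J x *v x) \<bullet> (?A x + ?A x)) \<in> borel_measurable lborel"
  proof -
   have "continuous_on UNIV (%x. (J x *v x) \<bullet> (?A x + ?A x))"
    unfolding matrix_vector_mult_def by (intro continuous_intros W(2) Ac)
   from borel_measurable_continuous_onI[OF this] show ?thesis by simp
  qed
 qed
 \<comment> \<open>The other evaluation of the limit: the derivative of \<open>s^-3 b\<close> at
   \<open>s = 1\<close>.\<close>
 moreover have "(%n. (b / s n ^ 3 - b) / (s n - 1)) \<longlonglongrightarrow> - 3 * b"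
 proof -
  have "(b / t ^ 3 - b) / (t - 1) = - b * (1 + t + t\<^sup>2) / t ^ 3" if "t > 0" "t ~= 1" for t :: real
   using that by (simp add: divide_simps) (simp add: algebra_simps eval_nat_numeral)
  then have "(%n. (b / s n ^ 3 - b) / (s n - 1)) = (%n. - b * (1 + s n + (s n)\<^sup>2) / s n ^ 3)"
   using s by auto
  moreover have "(%n. - b * (1 + s n + (s n)\<^sup>2) / s n ^ 3) \<longlonglongrightarrow> - b * (1 + 1 + 1\<^sup>2) / 1 ^ 3"
   by (intro tendsto_intros s1) auto
  ultimately show ?thesis by (simp add: mult.commute)
 qed
 ultimately have "(LI x. (J x *v x) \<bullet> (?A x + ?A x)) = - 3 * b"
  unfolding eq by (rule LIMSEQ_unique)
 moreover have "(LI x. (J x *v x) \<bullet> (?A x + ?A x)) = 2 * (LI x. (J x *v x) \<bullet> ?A x)"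
 proof -
  have "v \<bullet> (a + a) = 2 * (v \<bullet> a)" for v a :: "real^3" by (simp only: inner_add_right mult_2)
  then show ?thesis by (simp only: integral_mult_right_zero)
 qed
 ultimately show ?thesis by (simp add: b_def)
qed


section \<open>The weighted estimate\<close>

lemma has_derivative_inverse_square:
 assumes "(x::real^3) ~= 0"
 shows "((%x. 1 / (x \<bullet> x)) has_derivative (%h. - 2 * (x \<bullet> h) / (x \<bullet> x)\<^sup>2)) (at x)"
proof -
 have s: "((%x. x \<bullet> x) has_derivative (%h. 2 * (x \<bullet> h))) (at x)"
  by (auto intro!: derivative_eq_intros simp: inner_commute)
 have "((%t. 1 / t) has_real_derivative - (1 / (x \<bullet> x)\<^sup>2)) (at (x \<bullet> x))"
  using assms by (auto intro!: derivative_eq_intros simp: power2_eq_square)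
 from DERIV_compose_FDERIV[OF this s] show ?thesis
  by (rule has_derivative_eq_rhs) (simp add: fun_eq_iff)
qed

text \<open>The weight is singular at 0, but \<open>v\<close> vanishes in a ball there, so the
  product and its Jacobian extend by zero.\<close>

lemma C1_field_weight:
 assumes v: "C1_field v J K" and \<rho>: "\<rho> > 0" "!!x. x \<in> ball 0 \<rho> ==> v x = 0"
 shows "C1_field (%x. exp (\<tau> / (x \<bullet> x)) *^ v x)
  (%x. exp (\<tau> / (x \<bullet> x)) *^ J x + outer (v x) ((- 2 * \<tau> * exp (\<tau> / (x \<bullet> x)) / (x \<bullet> x)\<^sup>2) *^ x)) K"
 unfolding C1_field_def
proof (intro conjI allI impI)
 note V = C1_fieldD[OF v]
 let ?W = "%x::real^3. exp (\<tau> / (x \<bullet> x))"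
 let ?D = "%x. ?W x *^ J x + outer (v x) ((- 2 * \<tau> * ?W x / (x \<bullet> x)\<^sup>2) *^ x)"
 have J0: "J x = 0" if "x \<in> ball 0 \<rho>" for x
 proof -
  have "(%h. J x *v h) = (%h. 0)"
   by (rule vanishing_derivative[of "- ball 0 \<rho>" v, OF _ _ V(1)]) (use that \<rho> in auto)
  then have "J x *v h = 0 *v h" for h using fun_cong[of "%h. J x *v h" "%h. 0" h] by simp
  then show ?thesis by (simp add: matrix_eq)
 qed
 have D0: "?D x = 0" if "x \<in> ball 0 \<rho>" for x using J0[OF that] \<rho>(2)[OF that] by (simp add: outer_def vec_eq_iff)
 show "((%x. ?W x *^ v x) has_derivative (%h. ?D x *v h)) (at x)" for x
 proof (cases "x = 0")
  case True
  have "((%x. ?W x *^ v x) has_derivative (%h. 0)) (at x)"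
   by (rule has_derivative_transform_within_open[of "%x. 0" _ _ _ "ball 0 \<rho>"]) (use True \<rho> in auto)
  then show ?thesis using D0[of x] True \<rho>(1) by simp
 next
  case False
  have "((%x. \<tau> * (1 / (x \<bullet> x))) has_derivative (%h. \<tau> * (- 2 * (x \<bullet> h) / (x \<bullet> x)\<^sup>2))) (at x)"
   by (rule has_derivative_mult_right[OF has_derivative_inverse_square[OF False]])
  then have e: "((%x. \<tau> / (x \<bullet> x)) has_derivative (%h. \<tau> * (- 2 * (x \<bullet> h) / (x \<bullet> x)\<^sup>2))) (at x)" by simp
  have W: "(?W has_derivative (%h. ?W x * (\<tau> * (- 2 * (x \<bullet> h) / (x \<bullet> x)\<^sup>2)))) (at x)"
   using DERIV_compose_FDERIV[OF DERIV_exp e] by (simp add: mult_ac)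
  show ?thesis
   by (rule has_derivative_eq_rhs, rule has_derivative_scaleR[OF W V(1)])
     (simp add: fun_eq_iff matrix_vector_mult_add_rdistrib outer_mult_vec scaleR_matrix_vector_assoc[symmetric] mult_ac)
 qed
 have "continuous_on (- {0}) ?D"
  by (intro continuous_on_add continuous_on_scaleR continuous_on_outer continuous_intros
    continuous_on_subset[OF V(2)] continuous_on_subset[OF V(5)]) auto
 moreover have "continuous_on (ball 0 \<rho>) ?D"
  by (rule continuous_on_eq[OF continuous_on_const[of _ 0]]) (use D0 in auto)
 ultimately have "continuous_on (- {0} \<union> ball 0 \<rho>) ?D"
  by (intro continuous_on_open_Un) auto
 moreover have "- {0} \<union> ball 0 \<rho> = (UNIV :: (real^3) set)" using \<rho>(1) by auto
 ultimately show "continuous_on UNIV ?D" by simp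
 show "compact K" by (rule V(3))
 show "?W x *^ v x = 0" if "x \<notin> K" for x using V(4)[OF that] by simp
qed

lemma sym_part_zero: "sym_part x 0 = 0"
 using sym_part_scaleR(1)[of x 0 0] by simp

lemma transpose_outer_mult: "transpose (outer a b) *v x = (a \<bullet> x) *^ b"
 unfolding transpose_outer by (rule outer_mult_vec)

text \<open>With \<open>w = W v\<close> one has \<open>W (E + A) v = (E + 3/2) w + (2 \<tau> |x|\<^sup>-\<^sup>2 - 3/2 + A) w\<close>, an antisymmetric operator plus a
  symmetric one, and the commutator of the two parts is \<open>4 \<tau> |x|\<^sup>-\<^sup>2\<close>.\<close>

lemma carleman_inequality:
 assumes v: "C1_field v J K" and \<rho>: "\<rho> > 0" "!!x. x \<in> ball 0 \<rho> ==> v x = 0"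
 shows "4 * \<tau> * (LI x. (exp (\<tau> / (x \<bullet> x)))\<^sup>2 * (norm (v x))\<^sup>2 / (x \<bullet> x))
  <= (LI x. (exp (\<tau> / (x \<bullet> x)))\<^sup>2 * (norm (sym_part x (J x) + J x *v x))\<^sup>2)"
proof -
 note V = C1_fieldD[OF v]
 let ?W = "%x::real^3. exp (\<tau> / (x \<bullet> x))"
 define w where "w x = ?W x *^ v x" for x
 define Jw where "Jw x = ?W x *^ J x + outer (v x) ((- 2 * \<tau> * ?W x / (x \<bullet> x)\<^sup>2) *^ x)" for x
 have cw: "C1_field w Jw K" unfolding w_def Jw_def by (rule C1_field_weight[OF v \<rho>])
 note Wf = C1_fieldD[OF cw]
 have w0: "w x = 0" if "x \<in> ball 0 \<rho>" for x using \<rho>(2)[OF that] by (simp add: w_def)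
 have Jw0: "Jw x = 0" if "x \<in> ball 0 \<rho>" for x
 proof -
  have "(%h. Jw x *v h) = (%h. 0)"
   by (rule vanishing_derivative[of "- ball 0 \<rho>" w, OF _ _ Wf(1)]) (use that w0 in auto)
  then have "Jw x *v h = 0 *v h" for h using fun_cong[of "%h. Jw x *v h" "%h. 0" h] by simp
  then show ?thesis by (simp add: matrix_eq)
 qed
 define g where "g x = 2 * \<tau> / (x \<bullet> x) - 3/2" for x :: "real^3"
 let ?E = "%x. Jw x *v x" and ?A = "%x. sym_part x (Jw x)"
 let ?M = "%x. sym_part x (J x) + J x *v x"
 \<comment> \<open>Conjugation with the weight changes \<open>E\<close> only: the extra Jacobian
   term has the form \<open>outer (v x) (c *^ x)\<close>, which \<open>sym_part x\<close>
   annihilates. The shift by \<open>3/2\<close> makes \<open>E + 3/2\<close> antisymmetric.\<close>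
 have key: "?W x *^ ?M x = (?E x + (3/2) *^ w x) + (g x *^ w x + ?A x)" if "x ~= 0" for x
 proof -
  have "?E x = ?W x *^ (J x *v x) - (2 * \<tau> / (x \<bullet> x)) *^ w x"
   using that by (simp add: Jw_def w_def matrix_vector_mult_add_rdistrib outer_mult_vec scaleR_matrix_vector_assoc[symmetric] power2_eq_square mult_ac)
  moreover have "sym_part x (outer (v x) (c *^ x)) = 0" for c
   unfolding sym_part_def transpose_outer_mult trace_outer by (simp add: inner_commute)
  then have "?A x = ?W x *^ sym_part x (J x)"
   unfolding Jw_def sym_part_add sym_part_scaleR(1) by (simp only: add_0_right)
  ultimately show ?thesis by (simp add: g_def algebra_simps)
 qed
 \<comment> \<open>The squares of both parts are dropped from the norm of the sum; the cross term
   alone carries the estimate.\<close>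
 have lower: "2 * ((?E x + (3/2) *^ w x) \<bullet> (g x *^ w x + ?A x)) <= (?W x)\<^sup>2 * (norm (?M x))\<^sup>2" for x
 proof (cases "x = 0")
  case True
  then have "w x = 0" "Jw x = 0" using w0 Jw0 \<rho>(1) by auto
  then show ?thesis by (simp add: sym_part_def trace_def transpose_def)
 next
  case False
  have ab: "2 * (a \<bullet> b) <= (norm (a + b))\<^sup>2" for a b :: "real^3"
   using zero_le_power2[of "norm a"] zero_le_power2[of "norm b"]
   by (simp add: power2_norm_eq_inner inner_add_left inner_add_right inner_commute)
  have "(norm (?W x *^ ?M x))\<^sup>2 = (?W x)\<^sup>2 * (norm (?M x))\<^sup>2" by (simp add: power_mult_distrib)
  then show ?thesis using ab[of "?E x + (3/2) *^ w x" "g x *^ w x + ?A x"] key[OF False] by simp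
 qed
 have cont: "continuous_on UNIV F" if "continuous_on (- {0}) F" "!!x. x \<in> ball 0 \<rho> ==> F x = 0" for F :: "real^3 => real"
 proof -
  have "continuous_on (ball 0 \<rho>) F"
   by (rule continuous_on_eq[OF continuous_on_const[of _ 0]]) (use that in auto)
  then have "continuous_on (- {0} \<union> ball 0 \<rho>) F" using that(1) by (intro continuous_on_open_Un) auto
  moreover have "- {0} \<union> ball 0 \<rho> = (UNIV :: (real^3) set)" using \<rho>(1) by auto
  ultimately show ?thesis by simp
 qed
 have integ: "integrable lborel F" if "continuous_on (- {0}) F" "!!x. x \<in> ball 0 \<rho> ==> F x = 0" "!!x. x \<notin> K ==> F x = 0" for F :: "real^3 => real"
  by (rule continuous_compact_support(3)[OF cont V(3)]) (use that in auto)
 have cw': "continuous_on S w" "continuous_on S ?E" "continuous_on S ?A" "continuous_on S v" "continuous_on S ?M" for S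
  by (rule continuous_on_subset[of UNIV]; (intro continuous_intros continuous_on_sym_part Wf V | simp add: matrix_vector_mult_def)+; fail)+
 have gc: "continuous_on (- {0}) g" unfolding g_def by (intro continuous_intros) auto
 have Wc: "continuous_on (- {0}) ?W" by (intro continuous_intros) auto
 have z1: "w x = 0" "?E x = 0" "?A x = 0" "v x = 0" "?M x = 0" if "x \<in> ball 0 \<rho>" for x
 proof -
  have "J x = 0"
  proof -
   have "(%h. J x *v h) = (%h. 0)"
    by (rule vanishing_derivative[of "- ball 0 \<rho>" v, OF _ _ V(1)]) (use that \<rho> in auto)
   then have "J x *v h = 0 *v h" for h using fun_cong[of "%h. J x *v h" "%h. 0" h] by simp
   then show ?thesis by (simp add: matrix_eq)
  qed
  then show "w x = 0" "?E x = 0" "?A x = 0" "v x = 0" "?M x = 0"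
   using w0[OF that] Jw0[OF that] \<rho>(2)[OF that] by (simp_all add: sym_part_zero)
 qed
 have z2: "w x = 0" "?E x = 0" "?A x = 0" "v x = 0" "?M x = 0" if "x \<notin> K" for x
  using Wf(4,6)[OF that] V(4,6)[OF that] by (simp_all add: sym_part_zero)
 have i1: "integrable lborel (%x. g x * (2 * (w x \<bullet> ?E x) + 3 * (w x \<bullet> w x)))"
  by (rule integ) (use z1 z2 in "auto intro!: continuous_intros gc cw'")
 have i2: "integrable lborel (%x. ?E x \<bullet> ?A x)" by (rule integ) (use z1 z2 in "auto intro!: continuous_intros gc cw'")
 have i3: "integrable lborel (%x. w x \<bullet> ?A x)" by (rule integ) (use z1 z2 in "auto intro!: continuous_intros gc cw'")
 have i4: "integrable lborel (%x. (?W x)\<^sup>2 * (norm (?M x))\<^sup>2)"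
  by (rule integ) (use z1 z2 in "auto intro!: continuous_intros Wc cw'")
 have i5: "integrable lborel (%x. (w x \<bullet> w x) / (x \<bullet> x))"
  by (rule integ) (use z1 z2 in "auto intro!: continuous_intros Wc cw'")
 \<comment> \<open>Divergence theorem for \<open>g |w|^2 x\<close>. The gain
   \<open>4 \<tau> / |x|^2\<close> is the derivative of \<open>- 2 \<tau> / |x|^2\<close> along
   \<open>x\<close>.\<close>
 have div: "(LI x. g x * (2 * (w x \<bullet> ?E x) + 3 * (w x \<bullet> w x))) = 4 * \<tau> * (LI x. (w x \<bullet> w x) / (x \<bullet> x))"
 proof -
  define \<Psi> where "\<Psi> x = g x * (w x \<bullet> w x)" for x
  define d where "d x = ((- 4 * \<tau>) * (w x \<bullet> w x) / (x \<bullet> x)\<^sup>2) *^ x + (2 * g x) *^ (transpose (Jw x) *v w x)" for x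
  have dz: "d x = 0" if "x \<in> ball 0 \<rho>" for x using w0[OF that] by (simp add: d_def)
  have \<Psi>z: "\<Psi> x = 0" if "x \<in> ball 0 \<rho>" for x using w0[OF that] by (simp add: \<Psi>_def)
  have dd: "(\<Psi> has_derivative (%h. d x \<bullet> h)) (at x)" for x
  proof (cases "x = 0")
   case True
   have "(\<Psi> has_derivative (%h. 0)) (at x)"
    by (rule has_derivative_transform_within_open[of "%x. 0" _ _ _ "ball 0 \<rho>"]) (use True \<rho> \<Psi>z in auto)
   then show ?thesis using dz[of x] True \<rho>(1) by simp
  next
   case False
   have "((%x. 2 * \<tau> * (1 / (x \<bullet> x)) - 3/2) has_derivative (%h. 2 * \<tau> * (- 2 * (x \<bullet> h) / (x \<bullet> x)\<^sup>2) - 0)) (at x)"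
    by (rule has_derivative_diff[OF has_derivative_mult_right[OF has_derivative_inverse_square[OF False]] has_derivative_const])
   then have gd: "(g has_derivative (%h. 2 * \<tau> * (- 2 * (x \<bullet> h) / (x \<bullet> x)\<^sup>2))) (at x)" by (simp add: g_def[abs_def])
   show ?thesis unfolding \<Psi>_def
    by (rule has_derivative_eq_rhs, rule has_derivative_mult[OF gd has_derivative_inner[OF Wf(1) Wf(1)]])
      (simp add: fun_eq_iff d_def inner_add_left dot_lmul_matrix inner_diff_left inner_commute[of "Jw x *v _" "w x"] mult_ac)
  qed
  have cd: "continuous_on (- {0}) d"
   unfolding d_def transpose_matrix_vector vector_matrix_mult_def
   by (intro continuous_intros gc cw' continuous_on_subset[OF Wf(2)]) auto
  have dc: "continuous_on UNIV (%x. d x $ i)" for i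
   by (rule cont) (use cd dz in "auto intro!: continuous_intros")
  have \<Psi>c: "continuous_on UNIV \<Psi>"
   by (rule continuous_at_imp_continuous_on) (use dd has_derivative_continuous in blast)
  have dv: "continuous_on UNIV d"
  proof -
   have "continuous_on UNIV (%x. \<chi> i. d x $ i)" by (intro continuous_on_vec_lambda dc)
   then show ?thesis by simp
  qed
  have D: "((%x. x $ i * \<Psi> x) has_derivative (%h. (x $ i *^ d x + \<Psi> x *^ axis i 1) \<bullet> h)) (at x)" for x i
  proof -
   have "((%x. x $ i) has_derivative (%h. h $ i)) (at x)"
    by (rule bounded_linear_imp_has_derivative[OF bounded_linear_vec_nth])
   from has_derivative_mult[OF this dd] show ?thesis
    by (rule has_derivative_eq_rhs) (simp add: fun_eq_iff inner_add_left inner_axis' mult.commute)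
  qed
  have Dc: "continuous_on UNIV (%x. x $ i *^ d x + \<Psi> x *^ axis i 1)" for i
   by (intro continuous_intros dv \<Psi>c)
  have K0: "\<Psi> x = 0" "d x = 0" if "x \<notin> K" for x using z2(1)[OF that] by (simp_all add: \<Psi>_def d_def)
  have zero: "(LI x. (x $ i *^ d x + \<Psi> x *^ axis i 1) \<bullet> axis i 1) = 0" for i
   by (rule integral_gradient_zero[OF D Dc V(3)]) (use K0 in auto)
  have iD: "integrable lborel (%x. (x $ i *^ d x + \<Psi> x *^ axis i 1) \<bullet> axis i 1)" for i
   by (rule continuous_compact_support(3)[OF _ V(3)]) (use K0 Dc in "auto intro!: continuous_intros dv \<Psi>c")
  have "(\<Sum>i\<in>UNIV. (x $ i *^ d x + \<Psi> x *^ axis i 1) \<bullet> axis i (1::real)) = d x \<bullet> x + 3 * \<Psi> x" for x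
  proof -
   have "(\<Sum>i\<in>UNIV. (x $ i *^ d x + \<Psi> x *^ axis i 1) \<bullet> axis i (1::real)) = (\<Sum>i\<in>UNIV. d x $ i * x $ i + \<Psi> x)"
    by (intro sum.cong refl) (simp add: inner_add_left inner_axis mult.commute)
   then show ?thesis by (simp add: sum.distrib inner_vec_def)
  qed
  moreover have "d x \<bullet> x + 3 * \<Psi> x = g x * (2 * (w x \<bullet> ?E x) + 3 * (w x \<bullet> w x)) - 4 * \<tau> * ((w x \<bullet> w x) / (x \<bullet> x))" for x
  proof (cases "x = 0")
   case True
   then show ?thesis using w0[of x] \<rho>(1) by (simp add: d_def \<Psi>_def)
  next
   case False
   then show ?thesis
    by (simp add: d_def \<Psi>_def inner_add_left dot_lmul_matrix power2_eq_square algebra_simps)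
  qed
  ultimately have pt: "(\<Sum>i\<in>UNIV. (x $ i *^ d x + \<Psi> x *^ axis i 1) \<bullet> axis i (1::real))
   = g x * (2 * (w x \<bullet> ?E x) + 3 * (w x \<bullet> w x)) - 4 * \<tau> * ((w x \<bullet> w x) / (x \<bullet> x))" for x by simp
  have "(LI x. (\<Sum>i\<in>UNIV. (x $ i *^ d x + \<Psi> x *^ axis i 1) \<bullet> axis i (1::real))) = 0"
   using zero iD by (subst Bochner_Integration.integral_sum) auto
  then have "(LI x. g x * (2 * (w x \<bullet> ?E x) + 3 * (w x \<bullet> w x)) - 4 * \<tau> * ((w x \<bullet> w x) / (x \<bullet> x))) = 0" unfolding pt .
  then show ?thesis using i1 integrable_mult_right[OF i5, of "4 * \<tau>"]
   by (simp only: Bochner_Integration.integral_diff integral_mult_right_zero)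
 qed
 have ex: "2 * ((?E x + (3/2) *^ w x) \<bullet> (g x *^ w x + ?A x))
  = g x * (2 * (w x \<bullet> ?E x) + 3 * (w x \<bullet> w x)) + (2 * (?E x \<bullet> ?A x) + 3 * (w x \<bullet> ?A x))" for x
  by (simp add: inner_add_left inner_add_right inner_commute[of "?E x" "w x"] algebra_simps)
 \<comment> \<open>The terms of \<open>ex\<close> without \<open>g\<close> integrate to zero by
   \<open>sym_part_dilation_identity\<close>.\<close>
 have "4 * \<tau> * (LI x. (w x \<bullet> w x) / (x \<bullet> x)) = (LI x. g x * (2 * (w x \<bullet> ?E x) + 3 * (w x \<bullet> w x)) + (2 * (?E x \<bullet> ?A x) + 3 * (w x \<bullet> ?A x)))"
 proof -
  have i6: "integrable lborel (%x. 2 * (?E x \<bullet> ?A x) + 3 * (w x \<bullet> ?A x))"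
   by (intro Bochner_Integration.integrable_add integrable_mult_right i2 i3)
  have "(LI x. 2 * (?E x \<bullet> ?A x) + 3 * (w x \<bullet> ?A x)) = 2 * (LI x. ?E x \<bullet> ?A x) + 3 * (LI x. w x \<bullet> ?A x)"
   by (subst Bochner_Integration.integral_add) (use i2 i3 in auto)
  also have "\<dots> = 0" by (rule sym_part_dilation_identity[OF cw])
  finally show ?thesis using div by (subst Bochner_Integration.integral_add[OF i1 i6]) simp
 qed
 also have "\<dots> <= (LI x. (?W x)\<^sup>2 * (norm (?M x))\<^sup>2)"
 proof (rule integral_mono[OF _ i4])
  show "integrable lborel (%x. g x * (2 * (w x \<bullet> ?E x) + 3 * (w x \<bullet> w x)) + (2 * (?E x \<bullet> ?A x) + 3 * (w x \<bullet> ?A x)))"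
   by (intro Bochner_Integration.integrable_add integrable_mult_right i1 i2 i3)
  show "g x * (2 * (w x \<bullet> ?E x) + 3 * (w x \<bullet> w x)) + (2 * (?E x \<bullet> ?A x) + 3 * (w x \<bullet> ?A x)) <= (?W x)\<^sup>2 * (norm (?M x))\<^sup>2" for x
   using lower[of x] unfolding ex .
 qed
 finally have "4 * \<tau> * (LI x. (w x \<bullet> w x) / (x \<bullet> x)) <= (LI x. (?W x)\<^sup>2 * (norm (?M x))\<^sup>2)" .
 moreover have "(w x \<bullet> w x) / (x \<bullet> x) = (?W x)\<^sup>2 * (norm (v x))\<^sup>2 / (x \<bullet> x)" for x
  unfolding w_def power2_norm_eq_inner by (simp add: power2_eq_square mult_ac)
 ultimately show ?thesis by simp
qed


section \<open>Unique continuation\<close>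

text \<open>Rows are components of the field, columns are directions. All derivatives sit on the
  kernel, so the matrix makes sense for an integrable field.\<close>

definition conv_jacobian :: "(real^3 => real^3) => (real^3 => real^3) => real^3 => real^3^3" where
 "conv_jacobian g u y = (\<chi> i j. conv (%z. g z $ j) u y $ i)"

lemma conv_field_derivative:
 assumes k: "C2_fun k g H" and K: "compact K" "!!x. x \<notin> K ==> k x = 0" and u: "integrable lborel u"
 shows "(conv k u has_derivative (%h. conv_jacobian g u y *v h)) (at y)" "continuous_on UNIV (conv_jacobian g u)"
proof -
 note C = C2_funD[OF k]
 have S: "g x = 0" if "x \<notin> K" for x using C2_support(1)[OF k K(1) _ that] K(2) by auto
 have gc: "continuous_on UNIV (%y. g y $ i)" for i by (intro continuous_intros C)
 have ig: "integrable lborel (%z. g (x - z) $ i *^ u z)" for x i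
  by (rule conv_integrable[OF u gc K(1)]) (use S in auto)
 have "(conv k u has_derivative (%h. conv (%y. g y \<bullet> h) u y)) (at y)"
  by (rule conv_has_derivative[OF u C(1) C(5) K S])
 moreover have "conv (%y. g y \<bullet> h) u y = conv_jacobian g u y *v h" for h
  using conv_sum_left[of UNIV "%i y. g y $ i" y u "%i. h $ i"] ig
  by (simp add: inner_vec_def conv_jacobian_def matrix_vector_mult_def vec_eq_iff mult.commute)
 ultimately show "(conv k u has_derivative (%h. conv_jacobian g u y *v h)) (at y)" by simp
 have "continuous_on UNIV (conv (%y. g y $ i) u)" for i
 proof -
  obtain B where "!!x. norm (g x $ i) <= B"
   using continuous_compact_support(2)[OF gc K(1), of i] S by auto
  then show ?thesis using conv_continuous[OF u gc, of i B] by simp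
 qed
 then show "continuous_on UNIV (conv_jacobian g u)"
  unfolding conv_jacobian_def by (intro continuous_on_vec_lambda continuous_on_component) simp
qed

text \<open>The mollified field satisfies the differential equations pointwise; the antisymmetric part of its
  Jacobian is cross multiplication by its curl.\<close>

lemma mollified_beltrami:
 assumes W: "weak_beltrami U f u" and k: "C2_fun k g H" and K: "compact K" "!!x. x \<notin> K ==> k x = 0"
  and B: "!!z. y - z \<in> K ==> z \<in> U \<and> u' z = u z" and u': "integrable lborel u'"
 shows "trace (conv_jacobian g u' y) = 0"
  "conv_jacobian g u' y *v a - transpose (conv_jacobian g u' y) *v a = cross3 (conv k (%z. f z *^ u' z) y) a"
proof -
 note C = C2_funD[OF k]
 have S: "g x = 0" if "x \<notin> K" for x using C2_support(1)[OF k K(1) _ that] K(2) by auto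
 have T: "C1_test U (%z. k (y - z)) (%z. - g (y - z))"
  unfolding C1_test_def
 proof (intro conjI allI)
  show "((%z. k (y - z)) has_derivative (%h. - g (y - z) \<bullet> h)) (at z)" for z
   by (rule has_derivative_eq_rhs, rule has_derivative_compose[where f="%z. y - z" and g=k, OF _ C(1)])
     (auto intro!: derivative_eq_intros)
  show "continuous_on UNIV (%z. - g (y - z))"
   by (intro continuous_intros continuous_on_compose2[OF C(5)]) auto
  have "compact ((%x. y - x) ` K)" by (rule compact_continuous_image[OF _ K(1)]) (intro continuous_intros)
  moreover have "(%x. y - x) ` K \<subseteq> U" using B by force
  moreover have "k (y - z) = 0" if "z \<notin> (%x. y - x) ` K" for z
  proof (rule K(2))
   show "y - z \<notin> K"
   proof
    assume "y - z \<in> K"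
    then have "y - (y - z) \<in> (%x. y - x) ` K" by (rule imageI)
    then show False using that by simp
   qed
  qed
  ultimately show "\<exists>K. compact K \<and> K \<subseteq> U \<and> (\<forall>x. x \<notin> K --> k (y - x) = 0)" by blast
 qed
 \<comment> \<open>\<open>u'\<close> is the truncation that makes the convolution integrable; it
   differs from \<open>u\<close> only where the kernel and its gradient vanish.\<close>
 have u0: "u z = u' z \<or> (k (y - z) = 0 \<and> g (y - z) = 0)" for z
  using B[of z] K(2)[of "y - z"] S[of "y - z"] by (cases "y - z \<in> K") auto
 have gc: "continuous_on UNIV (%y. g y $ i)" for i by (intro continuous_intros C)
 have ig: "integrable lborel (%z. g (y - z) $ j *^ u' z)" for j
  by (rule conv_integrable[OF u' gc K(1)]) (use S in auto)
 define p where "p i j = (LI z. g (y - z) $ j * u' z $ i)" for i j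
 have ip: "integrable lborel (%z. g (y - z) $ j * u' z $ i)" for i j
  using integrable_bounded_linear[OF bounded_linear_vec_nth ig[of j], of i] by (simp add: mult.assoc)
 have p: "conv_jacobian g u' y $ i $ j = p i j" for i j
  using integral_bounded_linear[OF bounded_linear_vec_nth ig[of j], of i]
  by (simp add: conv_jacobian_def p_def conv_def)
 have "(LI z. u z \<bullet> - g (y - z)) = 0" by (rule weak_beltramiD(4)[OF W T])
 moreover have "u z \<bullet> - g (y - z) = - (\<Sum>i\<in>UNIV. g (y - z) $ i * u' z $ i)" for z
  using u0[of z] by (auto simp: inner_vec_def mult.commute sum_negf)
 ultimately have "(\<Sum>i\<in>UNIV. p i i) = 0"
  using ip by (simp add: p_def Bochner_Integration.integral_sum)
 then show "trace (conv_jacobian g u' y) = 0" by (simp add: trace_def p)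
 define F where "F = conv k (%z. f z *^ u' z) y"
 have "(LI z. cross3 (u z) (- g (y - z))) = (LI z. (k (y - z) * f z) *^ u z)"
  by (rule weak_beltramiD(3)[OF W T])
 also have "(%z. (k (y - z) * f z) *^ u z) = (%z. k (y - z) *^ (f z *^ u' z))"
 proof
  show "(k (y - z) * f z) *^ u z = k (y - z) *^ (f z *^ u' z)" for z using u0[of z] by auto
 qed
 also have "(%z. cross3 (u z) (- g (y - z))) = (%z. - cross3 (u' z) (g (y - z)))"
 proof
  show "cross3 (u z) (- g (y - z)) = - cross3 (u' z) (g (y - z))" for z using u0[of z] by auto
 qed
 finally have F: "(LI z. - cross3 (u' z) (g (y - z))) = F" by (simp add: F_def conv_def)
 have ic: "integrable lborel (%z. - cross3 (u' z) (g (y - z)))"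
 proof -
  have [measurable]: "u' \<in> borel_measurable borel" using u' by auto
  have gc': "continuous_on UNIV (%z. g (y - z))" by (intro continuous_on_compose2[OF C(5)] continuous_intros) auto
  have "compact ((%x. y - x) ` K)" by (rule compact_continuous_image[OF _ K(1)]) (intro continuous_intros)
  then obtain Bg where Bg: "!!z. norm (g (y - z)) <= Bg" using continuous_compact_support(2)[OF C(5) K(1)] S by metis
  have [measurable]: "(%z. g (y - z)) \<in> borel_measurable borel" by (rule borel_measurable_continuous_onI[OF gc'])
  have "integrable lborel (%z. cross3 (u' z) (g (y - z)))"
  proof (rule Bochner_Integration.integrable_bound[OF integrable_scaleR_right[OF u', of Bg]])
   show "(%z. cross3 (u' z) (g (y - z))) \<in> borel_measurable lborel"
    using borel_measurable_bilinear[OF bounded_bilinear_cross3, of u' borel "%z. g (y - z)"] by simp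
   have "norm (cross3 (u' z) (g (y - z))) <= norm (Bg *^ u' z)" for z
   proof -
    have "norm (cross3 (u' z) (g (y - z))) <= norm (u' z) * Bg"
     using norm_cross3_le[of "u' z" "g (y - z)"] mult_left_mono[OF Bg[of z] norm_ge_zero[of "u' z"]] by linarith
    also have "\<dots> <= norm (Bg *^ u' z)" by (simp add: mult.commute mult_right_mono)
    finally show ?thesis .
   qed
   then show "AE z in lborel. norm (cross3 (u' z) (g (y - z))) <= norm (Bg *^ u' z)" by simp
  qed
  then show ?thesis by simp
 qed
 have Fi: "F $ i = (LI z. (- cross3 (u' z) (g (y - z))) $ i)" for i
  unfolding F[symmetric] by (rule integral_bounded_linear[OF bounded_linear_vec_nth ic, symmetric])
 have F1: "F $ 1 = p 3 2 - p 2 3" unfolding Fi p_def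
  by (subst Bochner_Integration.integral_diff[symmetric, OF ip ip]) (simp add: cross3_def mult.commute)
 have F2: "F $ 2 = p 1 3 - p 3 1" unfolding Fi p_def
  by (subst Bochner_Integration.integral_diff[symmetric, OF ip ip]) (simp add: cross3_def mult.commute)
 have F3: "F $ 3 = p 2 1 - p 1 2" unfolding Fi p_def
  by (subst Bochner_Integration.integral_diff[symmetric, OF ip ip]) (simp add: cross3_def mult.commute)
 show "conv_jacobian g u' y *v a - transpose (conv_jacobian g u' y) *v a = cross3 (conv k (%z. f z *^ u' z) y) a"
  unfolding F_def[symmetric]
  by (simp del: transpose_matrix_vector add: vec_eq_iff forall_3 matrix_vector_mult_def transpose_def sum_3 cross3_def p F1 F2 F3 algebra_simps)
qed

lemma conv_bound:
 assumes i: "integrable lborel (%z. k (x - z) *^ u z)"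
  and k: "!!x. k x >= 0" "integrable lborel k" "(LI x. k x) = 1" and B: "!!z. norm (u z) <= B"
 shows "norm (conv k u x) <= B"
proof -
 have "norm (conv k u x) <= (LI z. k (x - z) * B)"
  unfolding conv_def
 proof (rule Bochner_Integration.integral_norm_bound_integral[OF i])
  show "integrable lborel (%z. k (x - z) * B)" using integrable_reflect[OF k(2), of x] by simp
  show "norm (k (x - z) *^ u z) <= k (x - z) * B" for z using k(1)[of "x - z"] B[of z] by (simp add: mult_left_mono)
 qed
 also have "\<dots> = B" using integral_reflect[of k x] k(2,3) by simp
 finally show ?thesis .
qed

lemma mollifier_sequence:
 assumes e: "(e::real) > 0"
 shows "\<exists>k g H. \<forall>n::nat. C2_fun (k n) (g n) (H n) \<and> (\<forall>x. k n x >= 0) \<and> (\<forall>x. x \<notin> cball 0 (e / real (Suc n)) --> k n x = 0) \<and>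
  integrable lborel (k n) \<and> (LI x. k n x) = 1"
proof -
 have "\<forall>n. \<exists>p. C2_fun (fst p) (fst (snd p)) (snd (snd p)) \<and> (\<forall>x. fst p x >= 0) \<and> (\<forall>x. x \<notin> cball 0 (e / real (Suc n)) --> fst p x = 0) \<and>
  integrable lborel (fst p) \<and> (LI x. fst p x) = 1"
 proof
  fix n
  have "e / real (Suc n) > 0" using e by simp
  then show "\<exists>p. C2_fun (fst p) (fst (snd p)) (snd (snd p)) \<and> (\<forall>x. fst p x >= 0) \<and> (\<forall>x. x \<notin> cball 0 (e / real (Suc n)) --> fst p x = 0) \<and>
   integrable lborel (fst p) \<and> (LI x. fst p x) = 1"
  proof (rule C2_kernel)
   fix k :: "real^3 => real" and g H
   assume "C2_fun k g H" "!!x. k x >= 0" "!!x. norm x > e / real (Suc n) ==> k x = 0" "integrable lborel k" "(LI x. k x) = 1"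
   then show ?thesis by (intro exI[of _ "(k, g, H)"]) simp
  qed
 qed
 from choice[OF this] obtain p where p: "\<forall>n. C2_fun (fst (p n)) (fst (snd (p n))) (snd (snd (p n))) \<and> (\<forall>x. fst (p n) x >= 0) \<and>
  (\<forall>x. x \<notin> cball 0 (e / real (Suc n)) --> fst (p n) x = 0) \<and> integrable lborel (fst (p n)) \<and> (LI x. fst (p n) x) = 1" by blast
 show ?thesis
  by (rule exI[of _ "%n. fst (p n)"], rule exI[of _ "%n. fst (snd (p n))"], rule exI[of _ "%n. snd (snd (p n))"]) (rule p)
qed

lemma mollifier_limit:
 fixes u :: "real^3 => 'b::euclidean_space"
 assumes k: "!!n x. k n x >= 0" "!!n x. x \<notin> cball 0 (e / real (Suc n)) ==> k n x = 0" "!!n. integrable lborel (k n)" "!!n. (LI x. k n x) = 1"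
  and i: "!!n. integrable lborel (%z. k n (x - z) *^ u z)" and u: "isCont u x"
 shows "(%n. conv (k n) u x) \<longlonglongrightarrow> u x"
proof (rule metric_LIMSEQ_I)
 fix r :: real assume "r > 0"
 then obtain d where d: "d > 0" "!!y. dist y x < d ==> dist (u y) (u x) < r/2"
  using u unfolding continuous_at_eps_delta by (metis half_gt_zero)
 have "(%n. e / real (Suc n)) \<longlonglongrightarrow> 0" by (rule LIMSEQ_Suc[OF lim_const_over_n])
 from order_tendstoD(2)[OF this d(1)] obtain N where N: "!!n. n >= N ==> e / real (Suc n) < d"
  unfolding eventually_sequentially by blast
 have "norm (conv (k n) u x - u x) <= r/2" if "n >= N" for n
 proof (rule conv_uniform[OF i k(3,4,1)])
  show "k n z = 0" if "norm z > e / real (Suc n)" for z using k(2)[of z n] that by simp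
  show "norm (u z - u x) <= r/2" if "dist x z <= e / real (Suc n)" for z
   using d(2)[of z] N[OF \<open>n >= N\<close>] that by (simp add: dist_commute dist_norm less_imp_le norm_minus_commute)
 qed
 then show "\<exists>no. \<forall>n\<ge>no. dist (conv (k n) u x) (u x) < r"
  using \<open>r > 0\<close> by (intro exI[of _ N]) (force simp: dist_norm)
qed


lemma mollifier_sequenceE:
 assumes "(e::real) > 0"
 obtains k g H where "!!n::nat. C2_fun (k n) (g n) (H n)" "!!n x. k n x >= 0"
  "!!n x. x \<notin> cball 0 (e / real (Suc n)) ==> k n x = 0"
  "!!n. integrable lborel (k n)" "!!n. (LI x. k n x) = 1"
proof -
 from mollifier_sequence[OF assms] obtain k g H where
  "\<forall>n::nat. C2_fun (k n) (g n) (H n) \<and> (\<forall>x. k n x >= 0) \<and> (\<forall>x. x \<notin> cball 0 (e / real (Suc n)) --> k n x = 0) \<and>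
  integrable lborel (k n) \<and> (LI x. k n x) = 1" by (elim exE)
 then show thesis by (intro that[of k g H]) blast+
qed

section \<open>Propagation of zeros\<close>

text \<open>The Carleman inequality is applied to the mollified field, cut off inside the ball of
  radius \<open>R\<close>, and the mollification is removed with \<tau> fixed. The error from
  \<open>f u\<close> is absorbed by half of the left-hand side. The error from the cutoff lives at
  \<open>|x| > R1\<close>, where the weight is below its values inside, so letting \<tau> grow
  leaves no mass in the ball of radius \<open>R1\<close>.\<close>

lemma unique_continuation_ball:
 fixes u :: "real^3 => real^3"
 assumes W: "weak_beltrami U f u" and U: "open U" and f: "continuous_on U f" and u: "continuous_on U u"
  and R: "cball x0 R \<subseteq> U" "0 < r" "0 < R1" "R1 < R" and z: "!!x. x \<in> ball x0 r ==> u x = 0"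
  and x: "x \<in> ball x0 R1"
 shows "u x = 0"
proof -
 have R0: "R > 0" using R by linarith
 let ?B = "cball x0 R"
 define u' where "u' y = indicator ?B y *^ u y" for y
 define F' where "F' y = f y *^ u' y" for y
 have u'i: "integrable lborel u'" unfolding u'_def
  by (rule weak_beltramiD(2)[OF W compact_cball R(1)])
 have F'i: "integrable lborel F'"
 proof -
  have "integrable lborel (%y. indicator ?B y *^ (f y *^ u y))"
   by (rule borel_integrable_compact[OF compact_cball])
     (intro continuous_intros continuous_on_subset[OF f R(1)] continuous_on_subset[OF u R(1)])
  then show ?thesis unfolding F'_def u'_def by (simp add: mult.commute)
 qed
 obtain Mu where Mu: "Mu >= 0" "!!y. y \<in> ?B ==> norm (u y) <= Mu"
  using compact_continuous_bound[OF compact_cball continuous_on_subset[OF u R(1)]] by blast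
 obtain Mf where Mf: "Mf >= 0" "!!y. y \<in> ?B ==> \<bar>f y\<bar> <= Mf"
  using compact_continuous_bound[OF compact_cball continuous_on_subset[OF f R(1)]] unfolding real_norm_def by blast
 have u'b: "norm (u' y) <= Mu" for y using Mu by (auto simp: u'_def indicator_def)
 have F'b: "norm (F' y) <= Mf * Mu" for y
  using mult_mono[OF Mf(2) u'b Mf(1) norm_ge_zero, of y y] Mf(1) Mu(1) by (cases "y \<in> ?B") (auto simp: F'_def u'_def)
 have "\<exists>\<eta> g H \<delta> K'. C2_fun \<eta> g H \<and> (\<forall>x. 0 <= \<eta> x \<and> \<eta> x <= 1) \<and> compact K' \<and> K' \<subseteq> ball 0 R \<and>
  (\<forall>x. x \<notin> K' --> \<eta> x = 0) \<and> \<delta> > 0 \<and> (\<forall>x. \<forall>z\<in>cball 0 R1. dist x z <= \<delta> --> \<eta> x = 1)"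
  by (rule C2_cutoff) (use R(4) in auto)
 then obtain \<eta> g\<eta> H\<eta> \<delta> K' where cut: "C2_fun \<eta> g\<eta> H\<eta> \<and> (\<forall>x. 0 <= \<eta> x \<and> \<eta> x <= 1) \<and> compact K' \<and> K' \<subseteq> ball 0 R \<and>
  (\<forall>x. x \<notin> K' --> \<eta> x = 0) \<and> \<delta> > 0 \<and> (\<forall>x. \<forall>z\<in>cball 0 R1. dist x z <= \<delta> --> \<eta> x = 1)"
  by (elim exE)
 then have E: "C2_fun \<eta> g\<eta> H\<eta>" and \<eta>: "!!x. 0 <= \<eta> x" "!!x. \<eta> x <= 1" and K': "compact K'" "K' \<subseteq> ball 0 R" "!!x. x \<notin> K' ==> \<eta> x = 0"
  and \<delta>: "\<delta> > 0" by auto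
 have one: "\<eta> x = 1" if "x \<in> cball 0 R1" for x using cut that \<delta> by (metis dist_self less_imp_le)
 note C = C2_funD[OF E]
 have g0: "g\<eta> x = 0" if "x \<notin> K'" for x using C2_support(1)[OF E K'(1) _ that] K'(3) by auto
 have g1: "g\<eta> x = 0" if x: "x \<in> cball 0 R1" for x
 proof -
  have "(%h. g\<eta> x \<bullet> h) = (%h. 0)"
  proof (rule vanishing_derivative[of "- ball x \<delta>" "%y. \<eta> y - 1"])
   show "\<eta> y - 1 = 0" if "y \<notin> - ball x \<delta>" for y
    using cut x that by (auto simp: dist_commute intro!: bexI[of _ x] less_imp_le)
   show "((%y. \<eta> y - 1) has_derivative (%h. g\<eta> x \<bullet> h)) (at x)"
    by (rule has_derivative_eq_rhs, rule has_derivative_diff[OF C(1) has_derivative_const]) simp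
  qed (use \<delta> in auto)
  then have "g\<eta> x \<bullet> g\<eta> x = 0" by metis
  then show ?thesis by simp
 qed
 obtain G where G: "G >= 0" "!!x. norm (g\<eta> x) <= G" using continuous_compact_support(2)[OF C(5) K'(1) g0] by blast
 obtain e0 where e0: "e0 > 0" "(\<Union>x\<in>K'. cball x e0) \<subseteq> ball 0 R"
  using compact_subset_open_imp_cball_epsilon_subset[OF K'(1) open_ball K'(2)] by auto
 \<comment> \<open>Scale at most \<open>r/2\<close> keeps the mollified field zero on
   \<open>ball 0 (r/2)\<close>, as the singular weight demands; scale at most \<open>e0\<close>
   keeps the averages inside the ball where \<open>u'\<close> is \<open>u\<close>.\<close>
 define e where "e = min e0 (r/2)"
 have e: "e > 0" "e <= e0" "e <= r/2" using e0 R by (auto simp: e_def)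
 have en: "e / real (Suc n) <= e" for n using e(1) by (simp add: divide_le_eq mult_le_cancel_left1)
 obtain k g H where k: "!!n::nat. C2_fun (k n) (g n) (H n)" "!!n x. k n x >= 0" "!!n x. x \<notin> cball 0 (e / real (Suc n)) ==> k n x = 0"
   "!!n. integrable lborel (k n)" "!!n. (LI x. k n x) = 1"
  by (rule mollifier_sequenceE[OF e(1)]) (rule that)
 have ic: "integrable lborel (%z. k n (y - z) *^ v z)" if "integrable lborel v" for n y and v :: "real^3 => real^3"
  by (rule conv_integrable[OF that C2_funD(6)[OF k(1)] compact_cball k(3)])
 have cfd: "(conv (k n) v has_derivative (%h. conv_jacobian (g n) v y *v h)) (at y)" "continuous_on UNIV (conv_jacobian (g n) v)"
  if "integrable lborel v" for n v y
  by (rule conv_field_derivative[OF k(1) compact_cball k(3) that]; assumption)+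
 define V where "V n x = conv (k n) u' (x0 + x)" for n x
 define Fn where "Fn n x = conv (k n) F' (x0 + x)" for n x
 define Jn where "Jn n x = conv_jacobian (g n) u' (x0 + x)" for n x
 define Jv where "Jv n x = \<eta> x *^ Jn n x + outer (V n x) (g\<eta> x)" for n x
 have dV: "(V n has_derivative (%h. Jn n x *v h)) (at x)" for n x
  unfolding V_def Jn_def
  by (rule has_derivative_eq_rhs, rule has_derivative_compose[where f="%x. x0 + x", OF _ cfd(1)[OF u'i]])
    (auto intro!: derivative_eq_intros)
 have Jc: "continuous_on UNIV (Jn n)" for n unfolding Jn_def
  by (rule continuous_on_compose2[OF cfd(2)[OF u'i]]) (auto intro!: continuous_intros)
 have Vc: "continuous_on UNIV (V n)" for n
  by (rule continuous_at_imp_continuous_on) (use dV has_derivative_continuous in blast)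
 have Fc: "continuous_on UNIV (Fn n)" for n
 proof -
  have "continuous_on UNIV (conv (k n) F')"
   by (rule continuous_at_imp_continuous_on)
     (use cfd(1)[OF F'i] has_derivative_continuous in blast)
  then show ?thesis unfolding Fn_def by (rule continuous_on_compose2) (auto intro!: continuous_intros)
 qed
 have field: "C1_field (%x. \<eta> x *^ V n x) (Jv n) K'" for n
  unfolding C1_field_def
 proof (intro conjI allI impI)
  show "((%x. \<eta> x *^ V n x) has_derivative (%h. Jv n x *v h)) (at x)" for x
   by (rule has_derivative_eq_rhs, rule has_derivative_scaleR[OF C(1) dV])
     (simp add: fun_eq_iff Jv_def matrix_vector_mult_add_rdistrib outer_mult_vec scaleR_matrix_vector_assoc[symmetric])
  show "continuous_on UNIV (Jv n)" unfolding Jv_def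
   by (intro continuous_on_add continuous_on_scaleR continuous_on_outer C Jc Vc)
 qed (use K' in auto)
 have V0: "V n x = 0" if "x \<in> ball 0 (r/2)" for n x
 proof -
  have "k n (x0 + x - z) *^ u' z = 0" for z
  proof (cases "x0 + x - z \<in> cball 0 (e / real (Suc n))")
   case True
   then have "norm (x0 + x - z) <= r/2" using en[of n] e(3) by simp
   moreover have "norm x < r/2" using that by simp
   moreover have "norm (x0 - z) <= norm (x0 + x - z) + norm x" using norm_triangle_ineq4[of "x0 + x - z" x] by simp
   ultimately have "z \<in> ball x0 r" by (simp add: dist_norm)
   then show ?thesis using assms(9) by (simp add: u'_def)
  qed (use k(3) in auto)
  then have "(%z. k n (x0 + x - z) *^ u' z) = (%z. 0)" by (rule ext)
  then show ?thesis by (simp add: V_def conv_def)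
 qed
 \<comment> \<open>The terms in which the derivative falls on the cutoff; they vanish wherever
   \<open>\<eta>\<close> is locally constant.\<close>
 define Q where "Q x v = (v \<bullet> g\<eta> x) *^ x - (v \<bullet> x) *^ g\<eta> x + (g\<eta> x \<bullet> x) *^ v" for x v
 have M: "sym_part x (Jv n x) + Jv n x *v x = \<eta> x *^ cross3 (Fn n x) x + Q x (V n x)" for n x
 proof (cases "x \<in> K'")
  case False
  then have e: "\<eta> x = 0" "g\<eta> x = 0" using K'(3) g0 by auto
  then have "Jv n x = 0" by (simp add: Jv_def outer_def vec_eq_iff)
  then show ?thesis using e by (simp add: Q_def sym_part_zero)
 next
  case True
  have in_B: "z \<in> U \<and> u' z = u z" if "(x0 + x) - z \<in> cball 0 (e / real (Suc n))" for z
  proof -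
   have "norm (x0 + x - z) <= e0" using that en[of n] e(2) by simp
   then have "z - x0 \<in> cball x e0" by (simp add: dist_norm algebra_simps)
   then have "z - x0 \<in> ball 0 R" using e0(2) True by blast
   then have "z \<in> ?B" by (simp add: dist_norm norm_minus_commute)
   then show ?thesis using R(1) by (auto simp: u'_def)
  qed
  have t: "trace (Jn n x) = 0" unfolding Jn_def
   by (rule mollified_beltrami(1)[OF W k(1)[of n] compact_cball k(3)[of _ n] in_B u'i])
  have a: "Jn n x *v x - transpose (Jn n x) *v x = cross3 (Fn n x) x" unfolding Jn_def Fn_def F'_def
   by (rule mollified_beltrami(2)[OF W k(1)[of n] compact_cball k(3)[of _ n] in_B u'i])
  have "sym_part x (Jv n x) + Jv n x *v x = \<eta> x *^ (Jn n x *v x - transpose (Jn n x) *v x) + Q x (V n x)"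
   unfolding Jv_def sym_part_add sym_part_scaleR(1) matrix_vector_mult_add_rdistrib outer_mult_vec scaleR_matrix_vector_assoc[symmetric]
   by (simp add: sym_part_def t trace_outer transpose_outer_mult Q_def algebra_simps del: transpose_matrix_vector)
  then show ?thesis unfolding a .
 qed
 let ?W = "%\<tau> x::real^3. (exp (\<tau> / (x \<bullet> x)))\<^sup>2"
 define v where "v x = u (x0 + x)" for x
 have Vlim: "(%n. V n x) \<longlonglongrightarrow> v x" "(%n. Fn n x) \<longlonglongrightarrow> f (x0 + x) *^ v x" if "x \<in> ball 0 R" for x
 proof -
  have xb: "x0 + x \<in> ball x0 R" using that by (simp add: dist_norm)
  then have xU: "x0 + x \<in> U" using R(1) ball_subset_cball by blast
  have ev: "\<forall>\<^sub>F y in nhds (x0 + x). y \<in> ball x0 R" using xb open_ball eventually_nhds by blast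
  have "isCont u (x0 + x)" "isCont f (x0 + x)"
   using u f U xU by (simp_all add: continuous_on_eq_continuous_at)
  then have "isCont u' (x0 + x)" "isCont F' (x0 + x)"
  proof -
   assume a: "isCont u (x0 + x)" "isCont f (x0 + x)"
   have "\<forall>\<^sub>F y in nhds (x0 + x). u' y = u y" using ev by eventually_elim (simp add: u'_def)
   then show c: "isCont u' (x0 + x)" using a(1) isCont_cong by blast
   then show "isCont F' (x0 + x)" unfolding F'_def using a(2) by (intro continuous_intros)
  qed
  note c = this
  have "(%n. V n x) \<longlonglongrightarrow> u' (x0 + x)"
   unfolding V_def by (rule mollifier_limit[OF k(2,3,4,5) ic[OF u'i] c(1)])
  moreover have "(%n. Fn n x) \<longlonglongrightarrow> F' (x0 + x)"
   unfolding Fn_def by (rule mollifier_limit[OF k(2,3,4,5) ic[OF F'i] c(2)])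
  ultimately show "(%n. V n x) \<longlonglongrightarrow> v x" "(%n. Fn n x) \<longlonglongrightarrow> f (x0 + x) *^ v x"
   using xb by (simp_all add: v_def u'_def F'_def)
 qed
 have Vb: "norm (V n x) <= Mu" for n x unfolding V_def by (rule conv_bound[OF ic[OF u'i] k(2,4,5) u'b])
 have Fb: "norm (Fn n x) <= Mf * Mu" for n x unfolding Fn_def by (rule conv_bound[OF ic[OF F'i] k(2,4,5) F'b])
 have Qb: "norm (Q x w) <= 3 * G * norm x * norm w" for x w
 proof -
  have "norm (Q x w) <= \<bar>w \<bullet> g\<eta> x\<bar> * norm x + \<bar>w \<bullet> x\<bar> * norm (g\<eta> x) + \<bar>g\<eta> x \<bullet> x\<bar> * norm w"
   unfolding Q_def by (rule order_trans[OF norm_triangle_ineq] add_mono order_trans[OF norm_triangle_ineq4] order_refl | simp)+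
  also have "\<dots> <= (norm w * G) * norm x + (norm w * norm x) * G + (G * norm x) * norm w"
   by (intro add_mono mult_mono order_trans[OF Cauchy_Schwarz_ineq2] G) (auto intro!: mult_nonneg_nonneg G)
  finally show ?thesis by (simp add: algebra_simps)
 qed
 \<comment> \<open>Twice the square of the bound \<open>3 G R Mu\<close> for the cutoff
   terms.\<close>
 define D where "D = 18 * G\<^sup>2 * R\<^sup>2 * Mu\<^sup>2"
 define m where "m = measure lborel (cball (0::real^3) R)"
 define S where "S = (LI x. indicator (cball 0 R1) x * (norm (u' (x0 + x)))\<^sup>2)"
 have vb: "norm (v x) <= Mu" if "x \<in> ball 0 R" for x
 proof -
  have "x0 + x \<in> ?B" using that by (simp add: dist_norm)
  then show ?thesis using Mu(2) by (simp add: v_def)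
 qed
 have vz: "v x = 0" if "norm x < r" for x unfolding v_def by (rule z) (use that in "simp add: dist_norm")
 have indR: "integrable lborel (%x. Mu\<^sup>2 * indicator (cball (0::real^3) R) x :: real)"
  by (intro integrable_mult_right integrable_real_indicator) (use emeasure_bounded_finite[OF bounded_cball] in auto)
 have iS: "integrable lborel (%x. indicator (cball 0 R1) x * (norm (u' (x0 + x)))\<^sup>2)"
 proof (rule Bochner_Integration.integrable_bound[OF indR])
  have [measurable]: "u' \<in> borel_measurable borel" using u'i by auto
  show "(%x. indicator (cball 0 R1) x * (norm (u' (x0 + x)))\<^sup>2) \<in> borel_measurable lborel"
   using borel_closed[OF closed_cball[of "0::real^3" R1]] by measurable
  have "indicator (cball 0 R1) x * (norm (u' (x0 + x)))\<^sup>2 <= Mu\<^sup>2 * indicator (cball 0 R) x" for x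
   using R(4) power_mono[OF u'b[of "x0 + x"], of 2] by (auto simp: indicator_def)
  then show "AE x in lborel. norm (indicator (cball 0 R1) x * (norm (u' (x0 + x)))\<^sup>2) <= norm (Mu\<^sup>2 * indicator (cball (0::real^3) R) x)" by simp
 qed
 \<comment> \<open>The threshold on \<tau> gives
   \<open>2 |f|^2 |x|^2 |v|^2 \<le> 2 \<tau> |v|^2 / |x|^2\<close> on the ball, which is half of the
   left-hand side.\<close>
 have est: "2 * \<tau> / R\<^sup>2 * S <= D * m" if \<tau>: "\<tau> > 0" "\<tau> >= Mf\<^sup>2 * R ^ 4" for \<tau>
 proof -
  define L where "L n x = 4 * \<tau> * (?W \<tau> x * (norm (\<eta> x *^ V n x))\<^sup>2 / (x \<bullet> x))" for n x
  define N where "N n x = ?W \<tau> x * (norm (\<eta> x *^ cross3 (Fn n x) x + Q x (V n x)))\<^sup>2" for n x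
  define L' where "L' x = 4 * \<tau> * (?W \<tau> x * (norm (\<eta> x *^ v x))\<^sup>2 / (x \<bullet> x))" for x
  define N' where "N' x = ?W \<tau> x * (norm (\<eta> x *^ cross3 (f (x0 + x) *^ v x) x + Q x (v x)))\<^sup>2" for x
  have cont: "continuous_on UNIV T" if "continuous_on (- {0}) T" "!!x. x \<in> ball 0 (r/2) ==> T x = 0" for T :: "real^3 => real"
  proof -
   have "continuous_on (ball 0 (r/2)) T"
    by (rule continuous_on_eq[OF continuous_on_const[of _ 0]]) (use that in auto)
   then have "continuous_on (- {0} \<union> ball 0 (r/2)) T" using that(1) by (intro continuous_on_open_Un) auto
   moreover have "- {0} \<union> ball 0 (r/2) = (UNIV :: (real^3) set)" using R(2) by auto
   ultimately show ?thesis by simp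
  qed
  have F0: "N n x = 0" if "x \<in> ball 0 (r/2)" for n x
  proof -
   have "sym_part x (Jv n x) + Jv n x *v x = 0"
   proof -
    have "(%h. Jv n x *v h) = (%h. 0)"
     by (rule vanishing_derivative[of "- ball 0 (r/2)" "%x. \<eta> x *^ V n x", OF _ _ C1_fieldD(1)[OF field]]) (use that V0 in auto)
    then have "Jv n x *v h = 0 *v h" for h using fun_cong[of "%h. Jv n x *v h" "%h. 0" h] by simp
    then have "Jv n x = 0" by (simp add: matrix_eq)
    then show ?thesis by (simp add: sym_part_zero)
   qed
   then show ?thesis unfolding N_def M[symmetric] by simp
  qed
  have L0: "L n x = 0" if "x \<in> ball 0 (r/2)" for n x using V0[OF that] by (simp add: L_def)
  have cL: "continuous_on UNIV (L n)" for n
  proof (rule cont[OF _ L0])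
   show "continuous_on (- {0}) (L n)" unfolding L_def
    by (intro continuous_intros continuous_on_subset[OF C(6)] continuous_on_subset[OF Vc]) auto
  qed
  have cN: "continuous_on UNIV (N n)" for n
  proof (rule cont[OF _ F0])
   show "continuous_on (- {0}) (N n)" unfolding N_def Q_def
    by (intro continuous_intros continuous_on_cross continuous_on_subset[OF C(6)] continuous_on_subset[OF C(5)] continuous_on_subset[OF Vc] continuous_on_subset[OF Fc]) auto
  qed
  have K0: "L n x = 0" "N n x = 0" if "x \<notin> K'" for n x using K'(3)[OF that] g0[OF that] by (simp_all add: L_def N_def Q_def)
  have carl: "(LI x. L n x) <= (LI x. N n x)" for n
  proof -
   have "4 * \<tau> * (LI x. ?W \<tau> x * (norm (\<eta> x *^ V n x))\<^sup>2 / (x \<bullet> x)) <= (LI x. ?W \<tau> x * (norm (sym_part x (Jv n x) + Jv n x *v x))\<^sup>2)"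
    by (rule carleman_inequality[OF field, of "r/2"]) (use R V0 in auto)
   then show ?thesis unfolding L_def N_def M integral_mult_right_zero .
  qed
  \<comment> \<open>The weight is bounded outside \<open>ball 0 (r/2)\<close>, and inside all
    integrands vanish. The dominating constants may depend on \<tau> but not on
    \<open>n\<close>.\<close>
  define w where "w = (exp (4 * \<tau> / r\<^sup>2))\<^sup>2"
  have Wb: "?W \<tau> x <= w" if "x \<notin> ball 0 (r/2)" for x
  proof -
   have "r/2 <= norm x" using that by simp
   then have "(r/2)\<^sup>2 <= x \<bullet> x" using R(2) by (simp add: dot_square_norm power_mono)
   then have "\<tau> / (x \<bullet> x) <= \<tau> / (r/2)\<^sup>2" using \<tau>(1) R(2) by (intro divide_left_mono) (auto intro!: mult_pos_pos dest: order.strict_trans2[of 0 "(r/2)\<^sup>2"])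
   also have "\<dots> = 4 * \<tau> / r\<^sup>2" by (simp add: power_divide)
   finally show ?thesis unfolding w_def by (intro power_mono) auto
  qed
  define cN' where "cN' = w * (Mf * Mu * R + 3 * G * R * Mu)\<^sup>2"
  define cL' where "cL' = 4 * \<tau> * (w * Mu\<^sup>2 / (r/2)\<^sup>2)"
  have bN: "norm (N n x) <= cN' * indicator (cball 0 R) x" for n x
  proof (cases "x \<in> K' \<and> x \<notin> ball 0 (r/2)")
   case True
   then have xR: "norm x <= R" using K'(2) by force
   have "norm (\<eta> x *^ cross3 (Fn n x) x + Q x (V n x)) <= norm (\<eta> x *^ cross3 (Fn n x) x) + norm (Q x (V n x))" by (rule norm_triangle_ineq)
   also have "\<dots> <= 1 * (Mf * Mu * R) + 3 * G * R * Mu"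
   proof (intro add_mono)
    show "norm (\<eta> x *^ cross3 (Fn n x) x) <= 1 * (Mf * Mu * R)"
     unfolding norm_scaleR using \<eta>[of x] mult_mono[OF Fb xR _ norm_ge_zero] Mf(1) Mu(1) norm_cross3_le[of "Fn n x" x]
     by (intro mult_mono) (auto intro: order_trans)
    have "3 * G * norm x * norm (V n x) <= 3 * G * R * Mu" using xR Vb G(1) R0 by (intro mult_mono) auto
    then show "norm (Q x (V n x)) <= 3 * G * R * Mu" using Qb order_trans by blast
   qed
   finally have "(norm (\<eta> x *^ cross3 (Fn n x) x + Q x (V n x)))\<^sup>2 <= (Mf * Mu * R + 3 * G * R * Mu)\<^sup>2" by (intro power_mono) auto
   then have "N n x <= cN'" unfolding N_def cN'_def using Wb[of x] True by (intro mult_mono) (auto simp: w_def)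
   moreover have "N n x >= 0" by (simp add: N_def)
   ultimately show ?thesis using xR by simp
  next
   case False
   then have "N n x = 0" using K0 F0 by blast
   then show ?thesis by (simp add: cN'_def w_def)
  qed
  have bL: "norm (L n x) <= cL' * indicator (cball 0 R) x" for n x
  proof (cases "x \<in> K' \<and> x \<notin> ball 0 (r/2)")
   case True
   then have xR: "norm x <= R" using K'(2) by force
   have "r/2 <= norm x" using True by simp
   then have q: "(r/2)\<^sup>2 <= x \<bullet> x" using R(2) by (simp add: dot_square_norm power_mono)
   have "norm (\<eta> x *^ V n x) <= 1 * Mu" unfolding norm_scaleR using \<eta>[of x] Vb by (intro mult_mono) auto
   then have "(norm (\<eta> x *^ V n x))\<^sup>2 <= Mu\<^sup>2" by (intro power_mono) auto
   then have "?W \<tau> x * (norm (\<eta> x *^ V n x))\<^sup>2 <= w * Mu\<^sup>2" using Wb[of x] True by (intro mult_mono) (auto simp: w_def)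
   then have "?W \<tau> x * (norm (\<eta> x *^ V n x))\<^sup>2 / (x \<bullet> x) <= w * Mu\<^sup>2 / (r/2)\<^sup>2"
    using q R(2) by (intro frac_le) (auto simp: w_def)
   then have "L n x <= cL'" unfolding L_def cL'_def using \<tau>(1) by (intro mult_left_mono) auto
   moreover have "L n x >= 0" using \<tau>(1) by (simp add: L_def)
   ultimately show ?thesis using xR by simp
  next
   case False
   then have "L n x = 0" using K0 L0 by blast
   then show ?thesis using \<tau>(1) by (simp add: cL'_def w_def)
  qed
  have lim: "(%n. L n x) \<longlonglongrightarrow> L' x" "(%n. N n x) \<longlonglongrightarrow> N' x" for x
  proof -
   show "(%n. L n x) \<longlonglongrightarrow> L' x"
   proof (cases "x \<in> K'")
    case True
    then have "x \<in> ball 0 R" using K'(2) by blast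
    have "(%n. (?W \<tau> x / (x \<bullet> x)) * (norm (\<eta> x *^ V n x))\<^sup>2) \<longlonglongrightarrow> (?W \<tau> x / (x \<bullet> x)) * (norm (\<eta> x *^ v x))\<^sup>2"
     by (intro tendsto_intros Vlim) fact
    from tendsto_mult_left[OF this, of "4 * \<tau>"] show ?thesis unfolding L_def L'_def by simp
   qed (simp add: L_def L'_def K'(3))
   show "(%n. N n x) \<longlonglongrightarrow> N' x"
   proof (cases "x \<in> K'")
    case True
    then have "x \<in> ball 0 R" using K'(2) by blast
    then show ?thesis unfolding N_def N'_def Q_def
     by (intro tendsto_intros Vlim bounded_bilinear.tendsto[OF bounded_bilinear_cross3])
   qed (simp add: N_def N'_def K'(3) g0 Q_def)
  qed
  have ind: "integrable lborel (%x. c * indicator (cball 0 R) (x::real^3) :: real)" for c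
   using emeasure_bounded_finite[of "cball (0::real^3) R"] by simp
  have Lm[measurable]: "L n \<in> borel_measurable borel" and Nm[measurable]: "N n \<in> borel_measurable borel" for n
   using cL cN by (auto intro: borel_measurable_continuous_onI)
  have L'm: "L' \<in> borel_measurable borel" by (rule borel_measurable_LIMSEQ_real[OF lim(1)]) simp
  have N'm: "N' \<in> borel_measurable borel" by (rule borel_measurable_LIMSEQ_real[OF lim(2)]) simp
  have IL: "(%n. \<integral>x. L n x \<partial>lborel) \<longlonglongrightarrow> (LI x. L' x)" "integrable lborel L'"
   using integral_dominated_convergence[where f=L' and M=lborel and s=L and w="%x. cL' * indicator (cball 0 R) x"]
    integrable_dominated_convergence[where f=L' and M=lborel and s=L and w="%x. cL' * indicator (cball 0 R) x"]
    L'm ind lim(1) bL by simp_all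
  have IN: "(%n. \<integral>x. N n x \<partial>lborel) \<longlonglongrightarrow> (LI x. N' x)" "integrable lborel N'"
   using integral_dominated_convergence[where f=N' and M=lborel and s=N and w="%x. cN' * indicator (cball 0 R) x"]
    integrable_dominated_convergence[where f=N' and M=lborel and s=N and w="%x. cN' * indicator (cball 0 R) x"]
    N'm ind lim(2) bN by simp_all
  have le: "(LI x. L' x) <= (LI x. N' x)"
   by (rule LIMSEQ_le[OF IL(1) IN(1)]) (use carl in auto)
  \<comment> \<open>The squared weight at \<open>|x| = R1\<close>: a lower bound inside and an upper
    bound outside, so it cancels at the end.\<close>
  define w1 where "w1 = (exp (\<tau> / R1\<^sup>2))\<^sup>2"
  have w1: "w1 > 0" by (simp add: w1_def)
  have pt: "w1 * (2 * \<tau> / R\<^sup>2 * (indicator (cball 0 R1) x * (norm (u' (x0 + x)))\<^sup>2) - D * indicator (cball 0 R) x) <= L' x - N' x" for x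
  proof (cases "x \<in> K'")
   case False
   then have "x \<notin> cball 0 R1" using one[of x] K'(3)[of x] by auto
   moreover have "D >= 0" by (simp add: D_def)
   ultimately show ?thesis using False K'(3) g0 w1 by (simp add: L'_def N'_def Q_def mult_nonneg_nonneg)
  next
   case True
   then have xR: "x \<in> ball 0 R" using K'(2) by blast
   have v': "u' (x0 + x) = v x" using xR by (simp add: u'_def v_def dist_norm)
   show ?thesis
   proof (cases "norm x < r")
    case True
    have "D >= 0" by (simp add: D_def)
    then show ?thesis using vz[OF True] v' w1 by (simp add: L'_def N'_def Q_def mult_nonneg_nonneg)
   next
    case False
    then have nx: "norm x > 0" "x \<bullet> x > 0" using R(2) by auto
    have xx: "x \<bullet> x <= R\<^sup>2" using xR by (simp add: dot_square_norm power_mono)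
    define c where "c = (norm (\<eta> x *^ v x))\<^sup>2"
    have c0: "c >= 0" by (simp add: c_def)
    have fx: "\<bar>f (x0 + x)\<bar> <= Mf" by (rule Mf(2)) (use xR in "simp add: dist_norm")
    have n1: "(norm (\<eta> x *^ cross3 (f (x0 + x) *^ v x) x))\<^sup>2 <= Mf\<^sup>2 * R\<^sup>2 * c"
    proof -
     have "norm (\<eta> x *^ cross3 (f (x0 + x) *^ v x) x) = \<bar>f (x0 + x)\<bar> * norm (cross3 (\<eta> x *^ v x) x)"
      by (simp add: cross_mult_left abs_mult mult_ac)
     also have "\<dots> <= Mf * (norm (\<eta> x *^ v x) * R)"
      using fx Mf(1) xR by (intro mult_mono order_trans[OF norm_cross3_le] mult_left_mono) auto
     finally have "(norm (\<eta> x *^ cross3 (f (x0 + x) *^ v x) x))\<^sup>2 <= (Mf * (norm (\<eta> x *^ v x) * R))\<^sup>2" by (intro power_mono) auto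
     then show ?thesis by (simp only: c_def power_mult_distrib mult_ac)
    qed
    have n2: "Mf\<^sup>2 * R\<^sup>2 * c <= \<tau> * (c / (x \<bullet> x))"
    proof -
     have "Mf\<^sup>2 * R\<^sup>2 * (x \<bullet> x) <= Mf\<^sup>2 * R\<^sup>2 * R\<^sup>2" using xx by (intro mult_left_mono) auto
     also have "\<dots> = Mf\<^sup>2 * R ^ 4" by (simp add: power_def eval_nat_numeral)
     finally have "Mf\<^sup>2 * R\<^sup>2 * (x \<bullet> x) <= \<tau>" using \<tau>(2) by linarith
     then have "(Mf\<^sup>2 * R\<^sup>2 * (x \<bullet> x)) * c <= \<tau> * c" using c0 by (rule mult_right_mono)
     then show ?thesis using nx(2) by (simp add: pos_le_divide_eq mult_ac)
    qed
    have n3: "(norm (a + b))\<^sup>2 <= 2 * (norm a)\<^sup>2 + 2 * (norm b)\<^sup>2" for a b :: "real^3"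
    proof -
     have "(norm (a + b))\<^sup>2 <= (norm a + norm b)\<^sup>2" by (intro power_mono norm_triangle_ineq) auto
     moreover have "(norm a + norm b)\<^sup>2 <= 2 * (norm a)\<^sup>2 + 2 * (norm b)\<^sup>2"
      using zero_le_power2[of "norm a - norm b"] by (simp add: power2_diff power2_sum)
     ultimately show ?thesis by linarith
    qed
    have "(norm (\<eta> x *^ cross3 (f (x0 + x) *^ v x) x + Q x (v x)))\<^sup>2 <= 2 * \<tau> * (c / (x \<bullet> x)) + 2 * (norm (Q x (v x)))\<^sup>2"
     using n3[of "\<eta> x *^ cross3 (f (x0 + x) *^ v x) x" "Q x (v x)"] n1 n2 by linarith
    then have "?W \<tau> x * (norm (\<eta> x *^ cross3 (f (x0 + x) *^ v x) x + Q x (v x)))\<^sup>2 <= ?W \<tau> x * (2 * \<tau> * (c / (x \<bullet> x)) + 2 * (norm (Q x (v x)))\<^sup>2)"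
     by (intro mult_left_mono) auto
    then have low: "?W \<tau> x * (2 * \<tau> * (c / (x \<bullet> x)) - 2 * (norm (Q x (v x)))\<^sup>2) <= L' x - N' x"
    proof -
     define d where "d = c / (x \<bullet> x)"
     have "L' x = 4 * \<tau> * (?W \<tau> x * d)" by (simp add: L'_def c_def d_def)
     then show ?thesis using \<open>_ <= ?W \<tau> x * (2 * \<tau> * (c / (x \<bullet> x)) + _)\<close>
      unfolding N'_def d_def[symmetric] by (simp add: algebra_simps)
    qed
    show ?thesis
    proof (cases "norm x <= R1")
     case True
     then have e1: "\<eta> x = 1" "g\<eta> x = 0" using one g1 by auto
     have "x \<bullet> x <= R1\<^sup>2" using True by (simp add: dot_square_norm power_mono)
     then have "\<tau> / R1\<^sup>2 <= \<tau> / (x \<bullet> x)" using \<tau>(1) nx R(3) by (intro divide_left_mono) auto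
     then have W1: "w1 <= ?W \<tau> x" unfolding w1_def by (intro power_mono) auto
     have "c / R\<^sup>2 <= c / (x \<bullet> x)" using xx nx c0 R0 by (intro divide_left_mono) auto
     then have "w1 * (2 * \<tau> * (c / R\<^sup>2)) <= ?W \<tau> x * (2 * \<tau> * (c / (x \<bullet> x)))"
      using W1 \<tau>(1) c0 by (intro mult_mono mult_left_mono) auto
     moreover have "Q x (v x) = 0" using e1 by (simp add: Q_def)
     moreover have "D >= 0" by (simp add: D_def)
     then have "w1 * (2 * \<tau> / R\<^sup>2 * (norm (v x))\<^sup>2 - D) <= w1 * (2 * \<tau> * (c / R\<^sup>2))"
      using w1 e1 by (intro mult_left_mono) (auto simp: c_def)
     ultimately show ?thesis using low True xR v' by simp
    next
     case False
     then have "R1\<^sup>2 <= x \<bullet> x" using R(3) by (simp add: dot_square_norm power_mono)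
     then have "\<tau> / (x \<bullet> x) <= \<tau> / R1\<^sup>2" using \<tau>(1) nx R(3) by (intro divide_left_mono) auto
     then have W1: "?W \<tau> x <= w1" unfolding w1_def by (intro power_mono) auto
     have "3 * G * norm x * norm (v x) <= 3 * G * R * Mu" using xR vb[OF xR] G(1) R0 by (intro mult_mono) auto
     then have "norm (Q x (v x)) <= 3 * G * R * Mu" using Qb order_trans by blast
     then have "(norm (Q x (v x)))\<^sup>2 <= (3 * G * R * Mu)\<^sup>2" by (intro power_mono) auto
     then have q: "2 * (norm (Q x (v x)))\<^sup>2 <= D" by (simp add: D_def power_mult_distrib mult_ac)
     have "?W \<tau> x * (2 * (norm (Q x (v x)))\<^sup>2) <= w1 * D" using W1 q w1 by (intro mult_mono) auto
     moreover have "0 <= ?W \<tau> x * (2 * \<tau> * (c / (x \<bullet> x)))" using \<tau>(1) c0 nx by simp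
     ultimately have "- (w1 * D) <= L' x - N' x" using low by (simp add: right_diff_distrib)
     then show ?thesis using False xR by simp
    qed
   qed
  qed
  have "(LI x. w1 * (2 * \<tau> / R\<^sup>2 * (indicator (cball 0 R1) x * (norm (u' (x0 + x)))\<^sup>2) - D * indicator (cball 0 R) x)) <= (LI x. L' x - N' x)"
   by (intro integral_mono pt integrable_mult_right Bochner_Integration.integrable_diff iS ind IL(2) IN(2))
  also have "\<dots> <= 0" using le IL(2) IN(2) by (simp add: Bochner_Integration.integral_diff)
  finally have "w1 * (2 * \<tau> / R\<^sup>2 * S - D * m) <= 0"
   using iS ind[of D] ind[of 1] by (simp add: S_def m_def Bochner_Integration.integral_diff)
  then show ?thesis using w1 by (simp add: mult_le_0_iff)
 qed
 have S0: "S >= 0" unfolding S_def by (intro Bochner_Integration.integral_nonneg) auto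
 have "S = 0"
 proof (rule ccontr)
  assume "S ~= 0"
  then have S: "S > 0" using S0 by linarith
  \<comment> \<open>Large enough for \<open>est\<close>, and so large that its conclusion
    contradicts \<open>S > 0\<close>.\<close>
  define \<tau> where "\<tau> = max 1 (max (Mf\<^sup>2 * R ^ 4) (D * m * R\<^sup>2 / S))"
  have "\<tau> > 0" "\<tau> >= Mf\<^sup>2 * R ^ 4" "\<tau> >= D * m * R\<^sup>2 / S" by (auto simp: \<tau>_def)
  then have "D * m * R\<^sup>2 <= \<tau> * S" "2 * (\<tau> * S) <= D * m * R\<^sup>2"
   using est[of \<tau>] S R0 by (auto simp: pos_divide_le_eq mult_ac)
  moreover have "\<tau> * S > 0" using \<open>\<tau> > 0\<close> S by simp
  ultimately show False by linarith
 qed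
 then have "AE y in lborel. indicator (cball 0 R1) y * (norm (u' (x0 + y)))\<^sup>2 = 0"
  using integral_nonneg_eq_0_iff_AE[OF iS] unfolding S_def by simp
 then have ae: "AE y in lborel. y \<in> ball 0 R1 --> u (x0 + y) = 0"
 proof eventually_elim
  case (elim y)
  show ?case
  proof
   assume y: "y \<in> ball 0 R1"
   then have "y \<in> cball 0 R1" "x0 + y \<in> ?B" using R(4) by (auto simp: dist_norm)
   then show "u (x0 + y) = 0" using elim by (simp add: u'_def)
  qed
 qed
 have "continuous_on (ball 0 R1) (%y. u (x0 + y))"
 proof (rule continuous_on_compose2[OF u])
  show "(%y. x0 + y) ` ball 0 R1 \<subseteq> U" using R(1,4) by (auto simp: dist_norm subset_iff)
 qed (intro continuous_intros)
 from continuous_AE_eq[OF open_ball this continuous_on_const ae, of "x - x0"] show ?thesis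
  using x by (simp add: dist_norm norm_minus_commute)
qed


text \<open>The interior of the zero set is open and closed in \<open>U\<close>. Closedness works
  because the ball reached by \<open>unique_continuation_ball\<close> depends on the room inside
  \<open>U\<close> and not on the size of the initial zero ball.\<close>

lemma unique_continuation:
 fixes u :: "real^3 => real^3"
 assumes W: "weak_beltrami U f u" and U: "open U" "connected U" and f: "continuous_on U f" and u: "continuous_on U u"
  and a: "ball a r \<subseteq> U" "0 < r" "!!x. x \<in> ball a r ==> u x = 0" and x: "x \<in> U"
 shows "u x = 0"
proof -
 define Z where "Z = U \<inter> interior {x. u x = 0}"
 have Z: "open Z" unfolding Z_def using U by (intro open_Int open_interior)
 have "\<exists>e>0. ball y e \<subseteq> U - Z" if y: "y \<in> U - Z" for y
 proof -
  obtain e where e: "e > 0" "cball y e \<subseteq> U" using y U(1) open_contains_cball by blast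
  \<comment> \<open>Otherwise a zero ball around \<open>z\<close>, however small, would grow to
    \<open>ball z (e/2)\<close>, which contains \<open>ball y (e/4)\<close>.\<close>
  have "z \<in> U - Z" if z: "z \<in> ball y (e/4)" for z
  proof (rule ccontr)
   have "dist y z <= e" using z e(1) by (simp add: less_imp_le)
   then have "z \<in> U" using e(2) by (simp add: subset_iff)
   moreover assume "z \<notin> U - Z"
   ultimately have "z \<in> interior {x. u x = 0}" by (auto simp: Z_def)
   then obtain q where q: "q > 0" "ball z q \<subseteq> {x. u x = 0}" by (metis mem_interior)
   have "cball z (3*e/4) \<subseteq> cball y e"
   proof
    fix w assume "w \<in> cball z (3*e/4)"
    then show "w \<in> cball y e" using z dist_triangle[of y w z] by simp
   qed
   then have c: "cball z (3*e/4) \<subseteq> U" using e(2) by blast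
   have "u w = 0" if w: "w \<in> ball z (e/2)" for w
    by (rule unique_continuation_ball[OF W U(1) f u c q(1) _ _ _ w]) (use e q in auto)
   moreover have "ball y (e/4) \<subseteq> ball z (e/2)"
   proof
    fix w assume "w \<in> ball y (e/4)"
    then show "w \<in> ball z (e/2)" using z dist_triangle[of z w y] by (simp add: dist_commute)
   qed
   ultimately have "ball y (e/4) \<subseteq> {x. u x = 0}" by blast
   then have "y \<in> interior {x. u x = 0}" using e(1) by (metis mem_interior zero_less_divide_iff zero_less_numeral)
   then show False using y by (simp add: Z_def)
  qed
  then show ?thesis using e(1) by (intro exI[of _ "e/4"]) auto
 qed
 then have "open (U - Z)" by (simp add: open_contains_ball)
 from connectedD[OF U(2) Z this] have "Z \<inter> U = {} \<or> (U - Z) \<inter> U = {}" by (auto simp: Z_def)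
 moreover have "a \<in> Z"
 proof -
  have "ball a r \<subseteq> {x. u x = 0}" using a(3) by blast
  then have "a \<in> interior {x. u x = 0}" using a(2) by (metis mem_interior)
  then show ?thesis using a by (auto simp: Z_def)
 qed
 ultimately have "x \<in> Z" using x by (auto simp: Z_def)
 then show ?thesis using interior_subset by (auto simp: Z_def)
qed

section \<open>Orthogonality of the field and the gradient of \<open>f\<close>\<close>

lemma C2_fun_reflect:
 assumes "C2_fun k g H"
 shows "C2_fun (%z. k (y - z)) (%z. - g (y - z)) (%z. H (y - z))"
proof -
 note C = C2_funD[OF assms]
 show ?thesis
  unfolding C2_fun_def
 proof (intro conjI allI)
  show "((%z. k (y - z)) has_derivative (%h. - g (y - z) \<bullet> h)) (at z)" for z
   by (rule has_derivative_eq_rhs, rule has_derivative_compose[where f="%z. y - z" and g=k, OF _ C(1)])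
     (auto intro!: derivative_eq_intros)
  show "((%z. - g (y - z)) has_derivative (%h. H (y - z) *v h)) (at z)" for z
   by (rule has_derivative_eq_rhs, rule has_derivative_minus,
     rule has_derivative_compose[where f="%z. y - z" and g=g, OF _ C(2)])
     (auto intro!: derivative_eq_intros simp: fun_eq_iff matrix_vector_mult_def vec_eq_iff sum_negf)
  show "continuous_on UNIV (%z. H (y - z))"
   by (rule continuous_on_compose2[OF C(3)]) (auto intro!: continuous_intros)
 qed (rule C(4))
qed

text \<open>In weak form, \<open>div (f u) = div (curl u) = 0\<close>, while
  \<open>div (f u) = u \<bullet> grad f\<close> because \<open>div u = 0\<close>.\<close>

lemma beltrami_orthogonal_test:
 assumes W: "weak_beltrami U f u" and U: "open U" and f: "!!x. x \<in> U ==> (f has_derivative (%h. f' x \<bullet> h)) (at x)"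
  and f': "continuous_on U f'" and u: "continuous_on U u"
  and C2: "C2_fun \<phi> g H" and K: "compact K" "K \<subseteq> U" "!!x. x \<notin> K ==> \<phi> x = 0"
 shows "(LI x. \<phi> x * (u x \<bullet> f' x)) = 0"
proof -
 note C = C2_funD[OF C2]
 have fc: "continuous_on U f" 
  by (rule continuous_at_imp_continuous_on) (use f has_derivative_continuous in blast)
 have g0: "g x = 0" "H x = 0" if "x \<notin> K" for x using C2_support[OF C2 K(1) _ that] K(3) by auto
 have T: "C1_test U (%x. g x $ i) (%x. H x $ i)" for i
  unfolding C1_test_def
 proof (intro conjI allI exI[of _ K] impI K(1,2))
  show "((%x. g x $ i) has_derivative (%h. H x $ i \<bullet> h)) (at x)" for x
   using bounded_linear.has_derivative[OF bounded_linear_vec_nth C(2)] by (simp add: matrix_vector_mul_component)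
  show "continuous_on UNIV (%x. H x $ i)" by (intro continuous_intros C)
  show "x \<notin> K ==> g x $ i = 0" for x using g0 by simp
 qed
 have ic: "integrable lborel (%x. cross3 (u x) (H x $ i))" for i
 proof (rule continuous_compact_support(3)[OF continuous_on_extend_zero[OF U _ K(1,2)] K(1)])
  show "continuous_on U (%x. cross3 (u x) (H x $ i))"
   by (intro bounded_bilinear.continuous_on[OF bounded_bilinear_cross3] u continuous_intros continuous_on_subset[OF C(3)]) auto
 qed (simp_all add: g0 cross3_def vec_eq_iff forall_3)
 have ig: "integrable lborel (%x. (g x $ i * f x) *^ u x)" for i
 proof (rule continuous_compact_support(3)[OF continuous_on_extend_zero[OF U _ K(1,2)] K(1)])
  show "continuous_on U (%x. (g x $ i * f x) *^ u x)"
   by (intro u continuous_intros fc continuous_on_subset[OF C(5)]) auto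
 qed (simp_all add: g0)
 have igi: "integrable lborel (%x. ((g x $ i * f x) *^ u x) $ i)" for i
  by (rule integrable_bounded_linear[OF bounded_linear_vec_nth ig])
 have ici: "integrable lborel (%x. cross3 (u x) (H x $ i) $ i)" for i
  by (rule integrable_bounded_linear[OF bounded_linear_vec_nth ic])
 have eq: "(LI x. ((g x $ i * f x) *^ u x) $ i) = (LI x. cross3 (u x) (H x $ i) $ i)" for i
  unfolding integral_bounded_linear[OF bounded_linear_vec_nth ig] integral_bounded_linear[OF bounded_linear_vec_nth ic]
   weak_beltramiD(3)[OF W T] ..
 have "(LI x. f x * (u x \<bullet> g x)) = (LI x. (\<Sum>i\<in>UNIV. ((g x $ i * f x) *^ u x) $ i))"
  by (intro Bochner_Integration.integral_cong refl) (simp add: inner_vec_def sum_distrib_left mult_ac)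
 also have "\<dots> = (\<Sum>i\<in>UNIV. (LI x. ((g x $ i * f x) *^ u x) $ i))"
  by (rule Bochner_Integration.integral_sum[OF igi])
 also have "\<dots> = (LI x. (\<Sum>i\<in>UNIV. cross3 (u x) (H x $ i) $ i))"
  unfolding eq by (rule Bochner_Integration.integral_sum[symmetric, OF ici])
 \<comment> \<open>Symmetry of the Hessian; this is \<open>div curl = 0\<close> with the derivatives
   on the test function.\<close>
 also have "(%x. \<Sum>i\<in>UNIV. cross3 (u x) (H x $ i) $ i) = (%x. 0)"
 proof
  fix x
  have s: "H x $ i $ j = H x $ j $ i" for i j 
  proof -
   have "transpose (H x) $ i $ j = H x $ j $ i" by (simp add: transpose_def)
   then show ?thesis unfolding C(4) .
  qed
  show "(\<Sum>i\<in>UNIV. cross3 (u x) (H x $ i) $ i) = 0"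
   using s[of 1 2] s[of 1 3] s[of 2 3] by (simp add: sum_3 cross3_def)
 qed
 finally have 1: "(LI x. f x * (u x \<bullet> g x)) = 0" by simp
 have \<phi>T: "C1_test U \<phi> g" unfolding C1_test_def using C(1,5) K by blast
 have 2: "(LI x. u x \<bullet> (\<phi> x *^ f' x + f x *^ g x)) = 0"
  by (rule weak_beltramiD(4)[OF W C1_test_mult[OF \<phi>T U f f']])
 have i1: "integrable lborel (%x. \<phi> x * (u x \<bullet> f' x))"
 proof (rule continuous_compact_support(3)[OF continuous_on_extend_zero[OF U _ K(1,2)] K(1)])
  show "continuous_on U (%x. \<phi> x * (u x \<bullet> f' x))"
   by (intro u f' continuous_intros continuous_on_subset[OF C(6)]) auto
 qed (simp_all add: K)
 have i2: "integrable lborel (%x. f x * (u x \<bullet> g x))"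
 proof (rule continuous_compact_support(3)[OF continuous_on_extend_zero[OF U _ K(1,2)] K(1)])
  show "continuous_on U (%x. f x * (u x \<bullet> g x))"
   by (intro u fc continuous_intros continuous_on_subset[OF C(5)]) auto
 qed (simp_all add: g0)
 show ?thesis using 2 1 Bochner_Integration.integral_add[OF i1 i2] by (simp add: inner_add_right)
qed

lemma beltrami_orthogonal:
 assumes W: "weak_beltrami U f u" and U: "open U" and f: "!!x. x \<in> U ==> (f has_derivative (%h. f' x \<bullet> h)) (at x)"
  and f': "continuous_on U f'" and u: "continuous_on U u" and x: "x \<in> U"
 shows "u x \<bullet> f' x = 0"
proof -
 obtain e where e: "e > 0" "cball x e \<subseteq> U" using x U open_contains_cball by blast
 define h where "h y = indicator (cball x e) y * (u y \<bullet> f' y)" for y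
 have hi: "integrable lborel h"
 proof -
  have "integrable lborel (%y. indicator (cball x e) y *^ (u y \<bullet> f' y))"
   by (rule borel_integrable_compact[OF compact_cball])
     (intro continuous_intros continuous_on_subset[OF f' e(2)] continuous_on_subset[OF u e(2)])
  moreover have "h = (%y. indicator (cball x e) y *^ (u y \<bullet> f' y))" by (simp add: h_def fun_eq_iff)
  ultimately show ?thesis by simp
 qed
 obtain k g H where k: "!!n::nat. C2_fun (k n) (g n) (H n)" "!!n x. k n x >= 0" "!!n x. x \<notin> cball 0 (e / real (Suc n)) ==> k n x = 0"
   "!!n. integrable lborel (k n)" "!!n. (LI x. k n x) = 1"
  by (rule mollifier_sequenceE[OF e(1)]) (rule that)
 have en: "e / real (Suc n) <= e" for n using e(1) by (simp add: divide_le_eq mult_le_cancel_left1)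
 have k0: "k n (x - z) = 0" if "z \<notin> cball x e" for n z
 proof (rule k(3))
  have "norm (x - z) > e" using that by (simp add: dist_norm)
  then show "x - z \<notin> cball 0 (e / real (Suc n))" using en[of n] by (simp del: of_nat_Suc)
 qed
 have "conv (k n) h x = 0" for n
 proof -
  have "conv (k n) h x = (LI z. k n (x - z) * (u z \<bullet> f' z))"
   unfolding conv_def by (intro Bochner_Integration.integral_cong refl) (use k0 in "auto simp: h_def indicator_def")
  also have "\<dots> = 0"
   by (rule beltrami_orthogonal_test[OF W U f f' u C2_fun_reflect[OF k(1)] compact_cball e(2) k0])
  finally show ?thesis .
 qed
 moreover have "(%n. conv (k n) h x) \<longlonglongrightarrow> h x"
 proof (rule mollifier_limit[OF k(2,3,4,5)])
  show "integrable lborel (%z. k n (x - z) *^ h z)" for n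
   by (rule conv_integrable[OF hi C2_funD(6)[OF k(1)] compact_cball k(3)])
  have "\<forall>\<^sub>F y in nhds x. y \<in> ball x e" using e(1) by (intro eventually_nhds_in_open) auto
  then have "\<forall>\<^sub>F y in nhds x. h y = u y \<bullet> f' y"
   by eventually_elim (simp add: h_def)
  moreover have "isCont (%y. u y \<bullet> f' y) x"
   using u f' U x by (intro continuous_intros) (simp_all add: continuous_on_eq_continuous_at)
  ultimately show "isCont h x" using isCont_cong[of h "%y. u y \<bullet> f' y" x] by simp
 qed
 ultimately have "h x = 0" using LIMSEQ_unique[OF tendsto_const[of 0], of "h x"] by simp
 then show ?thesis using e(1) by (simp add: h_def)
qed

section \<open>Classical derivatives from the Hoelder class\<close>

lemma Holder_imp_continuous_on:
 fixes g :: "'a::euclidean_space => 'b::real_normed_vector"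
 assumes "open U" "0 < \<alpha>" "Ck_Holder_on 0 \<alpha> U g"
 shows "continuous_on U g"
proof (rule continuous_at_imp_continuous_on, rule ballI)
 fix x assume x: "x \<in> U"
 obtain e where e: "e > 0" "cball x e \<subseteq> U" using x assms(1) open_contains_cball by blast
 then obtain C where C: "!!y z. y \<in> cball x e ==> z \<in> cball x e ==> norm (g y - g z) <= C * dist y z powr \<alpha>"
  using assms(3) compact_cball unfolding Ck_Holder_on.simps Holder_cont_on_def by meson
 have "((%y. C * dist y x powr \<alpha>) \<longlongrightarrow> C * 0 powr \<alpha>) (at x)"
  by (intro tendsto_mult tendsto_const tendsto_powr2) (use assms(2) in "auto intro!: tendsto_eq_intros")
 then have l: "((%y. C * dist y x powr \<alpha>) \<longlongrightarrow> 0) (at x)" by simp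
 have ev: "\<forall>\<^sub>F y in at x. y \<in> ball x e" using e(1) by (intro eventually_at_in_open') auto
 have "\<forall>\<^sub>F y in at x. norm (g y - g x) <= C * dist y x powr \<alpha>"
  using ev by eventually_elim (use C[of _ x] e(1) in auto)
 from Lim_null_comparison[OF this l] show "isCont g x" unfolding isCont_def using LIM_zero_cancel by blast
qed

lemma has_derivative_gradient:
 fixes g :: "real^3 => real"
 assumes "g differentiable (at x)"
 shows "(g has_derivative (%h. (\<chi> i. pderiv_at (axis i 1) g x) \<bullet> h)) (at x)"
proof -
 let ?D = "frechet_derivative g (at x)"
 have D: "(g has_derivative ?D) (at x)" using assms by (simp only: frechet_derivative_works)
 interpret bounded_linear ?D by (rule has_derivative_bounded_linear[OF D])
 have "?D h = (\<chi> i. pderiv_at (axis i 1) g x) \<bullet> h" for h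
 proof -
  have "?D h = ?D (\<Sum>i\<in>UNIV. h $ i *^ axis i 1)"
   using basis_expansion[of h] by (simp add: scalar_mult_eq_scaleR)
  also have "\<dots> = (\<chi> i. pderiv_at (axis i 1) g x) \<bullet> h"
   by (simp add: sum scaleR inner_vec_def pderiv_at_def mult.commute)
  finally show ?thesis .
 qed
 then have "?D = (%h. (\<chi> i. pderiv_at (axis i 1) g x) \<bullet> h)" by (rule ext)
 with D show ?thesis by (rule subst[rotated])
qed

lemma C2_Holder_derivatives:
 fixes f :: "real^3 => real"
 assumes U: "open U" and \<alpha>: "0 < \<alpha>" and f: "Ck_Holder_on 2 \<alpha> U f"
 shows "\<exists>F. (\<forall>x\<in>U. (f has_derivative (%h. grad f x \<bullet> h)) (at x)) \<and>
  (\<forall>x\<in>U. (grad f has_derivative (%h. F x *v h)) (at x)) \<and> continuous_on U F"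
proof -
 let ?e = "%i::3. axis i (1::real)"
 have b: "?e i \<in> Basis" for i by (simp add: axis_in_Basis_iff)
 have f1: "f differentiable (at x)" if "x \<in> U" for x using f that by (simp add: eval_nat_numeral)
 have f2: "pderiv_at (?e i) f differentiable (at x)" if "x \<in> U" for x i
  using f that b[of i] by (simp add: eval_nat_numeral)
 have f3: "continuous_on U (pderiv_at (?e j) (pderiv_at (?e i) f))" for i j
 proof (rule Holder_imp_continuous_on[OF U \<alpha>])
  have "\<forall>e\<in>Basis. \<forall>e'\<in>Basis. Ck_Holder_on 0 \<alpha> U (pderiv_at e' (pderiv_at e f))"
   using f unfolding numeral_2_eq_2 Ck_Holder_on.simps(2) by blast
  then show "Ck_Holder_on 0 \<alpha> U (pderiv_at (?e j) (pderiv_at (?e i) f))" using b by blast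
 qed
 define F where "F x = (\<chi> i j. pderiv_at (?e j) (pderiv_at (?e i) f) x)" for x
 have "(grad f has_derivative (%h. F x *v h)) (at x)" if x: "x \<in> U" for x
 proof (rule has_derivative_vecI)
  show "((%x. grad f x $ i) has_derivative (%h. (F x *v h) $ i)) (at x)" for i
   using has_derivative_gradient[OF f2[OF x, of i]]
   by (simp add: grad_def F_def matrix_vector_mul_component)
 qed
 moreover have "(f has_derivative (%h. grad f x \<bullet> h)) (at x)" if "x \<in> U" for x
  using has_derivative_gradient[OF f1[OF that]] by (simp add: grad_def)
 moreover have "continuous_on U F" unfolding F_def by (intro continuous_on_vec_lambda f3)
 ultimately show ?thesis by blast
qed


section \<open>Inverting maps near a compact set\<close>

lemma norm_matrix_vector_le:
 fixes A :: "real^'n^'m"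
 shows "norm (A *v h) <= norm A * norm h"
proof -
 have "norm (A *v h) <= L2_set (%i. norm (A $ i) * norm h) UNIV"
  unfolding norm_vec_def[of "A *v h"]
  by (rule L2_set_mono) (auto simp: matrix_vector_mul_component Cauchy_Schwarz_ineq2)
 also have "\<dots> = norm A * norm h" by (simp add: norm_vec_def L2_set_left_distrib)
 finally show ?thesis .
qed

text \<open>Cramer's rule with the cofactors written as cross products of rows; continuity in the
  entries can then be read off.\<close>

definition inv3 :: "real^3^3 => real^3^3" where
 "inv3 A = (\<chi> i j. (if j = 1 then cross3 (A $ 2) (A $ 3) else if j = 2 then cross3 (A $ 3) (A $ 1)
  else cross3 (A $ 1) (A $ 2)) $ i / det A)"

lemma inv3:
 assumes "det A ~= 0"
 shows "A *v (inv3 A *v h) = h" "inv3 A *v (A *v h) = h"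
proof -
 have "A $ i \<bullet> cross3 (A $ 2) (A $ 3) = (if i = 1 then det A else 0)"
  "A $ i \<bullet> cross3 (A $ 3) (A $ 1) = (if i = 2 then det A else 0)"
  "A $ i \<bullet> cross3 (A $ 1) (A $ 2) = (if i = 3 then det A else 0)" for i
  using exhaust_3[of i] by (auto simp: det_3 cross3_def inner_vec_def sum_3 algebra_simps)
 then have "(\<Sum>k\<in>UNIV. A $ i $ k * inv3 A $ k $ j) = (if i = j then 1 else 0)" for i j
  using exhaust_3[of j] assms
  by (auto simp: inv3_def inner_vec_def sum_divide_distrib[symmetric] split: if_splits)
 then have 1: "A ** inv3 A = mat 1" by (simp add: matrix_matrix_mult_def mat_def vec_eq_iff)
 then have 2: "inv3 A ** A = mat 1" by (simp only: matrix_left_right_inverse)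
 show "A *v (inv3 A *v h) = h" using 1 by (simp add: matrix_vector_mul_assoc)
 show "inv3 A *v (A *v h) = h" using 2 by (simp add: matrix_vector_mul_assoc)
qed

lemma continuous_on_det3:
 "continuous_on S A ==> continuous_on S (%x. det (A x :: real^3^3))"
 unfolding det_3 by (intro continuous_intros)

lemma continuous_on_inv3:
 assumes "continuous_on S A" "!!x. x \<in> S ==> det (A x) ~= 0"
 shows "continuous_on S (%x. inv3 (A x))"
proof -
 have "continuous_on S (%x. (if j = 1 then cross3 (A x $ 2) (A x $ 3) else if j = 2 then cross3 (A x $ 3) (A x $ 1)
  else cross3 (A x $ 1) (A x $ 2)) $ i / det (A x))" for i j :: 3
  using assms by (cases "j = 1"; cases "j = 2")
   (auto intro!: continuous_intros bounded_bilinear.continuous_on[OF bounded_bilinear_cross3] continuous_on_det3)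
 then show ?thesis unfolding inv3_def by (intro continuous_on_vec_lambda)
qed

lemma det_nonzeroI:
 fixes A :: "real^3^3"
 assumes "!!h. A *v h = 0 ==> h = 0"
 shows "det A ~= 0"
 using assms matrix_left_invertible_ker[of A] invertible_left_inverse[of A] invertible_det_nz[of A] by blast

section \<open>Maps of class one with explicit Jacobians\<close>

text \<open>The derivative is taken in the full space even if \<open>S\<close> is not open, so that
  \<open>S\<close> may be compact.\<close>

definition C1_on :: "(real^3) set => (real^3 => real^3) => (real^3 => real^3^3) => bool" where
 "C1_on S F J \<longleftrightarrow> (\<forall>x\<in>S. (F has_derivative (%h. J x *v h)) (at x)) \<and> continuous_on S J"

lemma C1_onD:
 assumes "C1_on S F J"
 shows "x \<in> S ==> (F has_derivative (%h. J x *v h)) (at x)" "continuous_on S J" "continuous_on S F"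
  "x \<in> S ==> isCont F x"
proof -
 show d: "(F has_derivative (%h. J x *v h)) (at x)" if "x \<in> S" for x using assms that by (simp add: C1_on_def)
 show c: "isCont F x" if "x \<in> S" for x using has_derivative_continuous[OF d[OF that]] .
 show "continuous_on S J" using assms by (simp add: C1_on_def)
 show "continuous_on S F" using c continuous_at_imp_continuous_on by blast
qed

lemma C1_on_subset: "C1_on S F J ==> T \<subseteq> S ==> C1_on T F J"
 by (auto simp: C1_on_def intro: continuous_on_subset)

lemma matrix_mult_continuous:
 assumes "continuous_on S A" "continuous_on S B"
 shows "continuous_on S (%x. A x ** (B x :: real^3^3) :: real^3^3)"
 unfolding matrix_matrix_mult_def by (intro continuous_intros assms)

lemma matrix_vector_mult_continuous:
 assumes "continuous_on S A" "continuous_on S b"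
 shows "continuous_on S (%x. (A x :: real^3^3) *v b x)"
 unfolding matrix_vector_mult_def by (intro continuous_intros assms)

lemma C1_on_compose:
 assumes F: "C1_on S F J" and G: "C1_on T G L" and sub: "!!x. x \<in> S ==> F x \<in> T"
 shows "C1_on S (%x. G (F x)) (%x. L (F x) ** J x)"
 unfolding C1_on_def
proof (intro conjI ballI)
 show "((%x. G (F x)) has_derivative (%h. (L (F x) ** J x) *v h)) (at x)" if "x \<in> S" for x
  using has_derivative_compose[OF C1_onD(1)[OF F that] C1_onD(1)[OF G sub[OF that]]]
  by (simp add: matrix_vector_mul_assoc)
 show "continuous_on S (%x. L (F x) ** J x)"
  using sub by (intro matrix_mult_continuous C1_onD(2)[OF F] continuous_on_compose2[OF C1_onD(2)[OF G] C1_onD(3)[OF F]]) auto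
qed

lemma C1_on_add:
 assumes "C1_on S F J" "C1_on S G L"
 shows "C1_on S (%x. F x + G x) (%x. J x + L x)"
 unfolding C1_on_def
proof (intro conjI ballI)
 show "((%x. F x + G x) has_derivative (%h. (J x + L x) *v h)) (at x)" if "x \<in> S" for x
  using has_derivative_add[OF C1_onD(1)[OF assms(1) that] C1_onD(1)[OF assms(2) that]]
  unfolding matrix_vector_mult_add_rdistrib .
qed (intro continuous_on_add C1_onD(2)[OF assms(1)] C1_onD(2)[OF assms(2)])

lemma C1_on_scaleR:
 assumes a: "!!x. x \<in> S ==> (a has_derivative (%h. g x \<bullet> h)) (at x)" "continuous_on S g" and F: "C1_on S F J"
 shows "C1_on S (%x. a x *^ F x) (%x. a x *^ J x + outer (F x) (g x))"
 unfolding C1_on_def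
proof (intro conjI ballI)
 show "((%x. a x *^ F x) has_derivative (%h. (a x *^ J x + outer (F x) (g x)) *v h)) (at x)" if "x \<in> S" for x
  by (rule has_derivative_eq_rhs, rule has_derivative_scaleR[OF a(1)[OF that] C1_onD(1)[OF F that]])
    (simp add: fun_eq_iff matrix_vector_mult_add_rdistrib outer_mult_vec scaleR_matrix_vector_assoc[symmetric])
 have "continuous_on S a"
  by (rule continuous_at_imp_continuous_on) (use a(1) has_derivative_continuous in blast)
 then show "continuous_on S (%x. a x *^ J x + outer (F x) (g x))"
  by (intro continuous_on_add continuous_on_scaleR continuous_on_outer C1_onD[OF F] a(2))
qed

text \<open>The Jacobian of the radial projection to the unit sphere: the orthogonal projection onto
  the complement of \<open>z\<close>, divided by \<open>norm z\<close>.\<close>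

definition sgn_jacobian :: "real^3 => real^3^3" where
 "sgn_jacobian z = (1 / norm z) *^ mat 1 - (1 / norm z ^ 3) *^ outer z z"

lemma norm_has_derivative:
 fixes z :: "real^3"
 shows "z ~= 0 ==> (norm has_derivative (%h. sgn z \<bullet> h)) (at z)"
 using has_derivative_norm[of z] by (simp add: inner_commute)

lemma C1_on_sgn: "C1_on (- {0}) sgn sgn_jacobian"
proof -
 have d: "((%z. 1 / norm z) has_derivative (%h. (- (1 / norm z ^ 3) *^ z) \<bullet> h)) (at z)" if "z \<in> - {0}" for z :: "real^3"
 proof -
  have "norm z ~= 0" using that by simp
  then have "((%t. 1 / t) has_derivative (%h. - (1 / (norm z)\<^sup>2) * h)) (at (norm z))"
   by (auto intro!: derivative_eq_intros simp: field_simps power2_eq_square)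
  from has_derivative_compose[OF norm_has_derivative this] that show ?thesis
   by (rule_tac has_derivative_eq_rhs) (auto simp: fun_eq_iff sgn_div_norm power2_eq_square power3_eq_cube field_simps)
 qed
 have i: "C1_on (- {0}) (%z. z) (%z. mat 1 :: real^3^3)" by (simp add: C1_on_def)
 have c: "continuous_on (- {0}) (%z::real^3. - (1 / norm z ^ 3) *^ z)" by (intro continuous_intros) auto
 have "C1_on (- {0}) (%z::real^3. (1 / norm z) *^ z) (%z. (1 / norm z) *^ mat 1 + outer z (- (1 / norm z ^ 3) *^ z))"
  by (rule C1_on_scaleR[OF d c i])
 moreover have "(%z::real^3. (1 / norm z) *^ z) = sgn" by (simp add: fun_eq_iff sgn_div_norm divide_inverse)
 moreover have "(%z. (1 / norm z) *^ mat 1 + outer z (- (1 / norm z ^ 3) *^ z)) = sgn_jacobian"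
  by (simp add: fun_eq_iff sgn_jacobian_def outer_def vec_eq_iff)
 ultimately show ?thesis by simp
qed

lemma sgn_jacobian_mult: "sgn_jacobian z *v h = (1 / norm z) *^ h - ((z \<bullet> h) / norm z ^ 3) *^ z"
 unfolding sgn_jacobian_def
 by (simp add: matrix_vector_mult_diff_rdistrib scaleR_matrix_vector_assoc[symmetric] outer_mult_vec)

lemma C1_on_unique:
 assumes "C1_on S F J" "C1_on T G L" "open W" "x \<in> W" "x \<in> S" "x \<in> T" "!!y. y \<in> W ==> F y = G y"
 shows "J x = L x"
proof -
 have "(G has_derivative (%h. J x *v h)) (at x)"
  by (rule has_derivative_transform_within_open[OF C1_onD(1)[OF assms(1,5)] assms(3,4,7)])
 from has_derivative_unique[OF this C1_onD(1)[OF assms(2,6)]]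
 have "J x *v h = L x *v h" for h by metis
 then show ?thesis by (simp add: matrix_eq)
qed

text \<open>The matrix of the Frechet derivative does not depend on the local extension, so the
  local Jacobians all agree with it and continuity is inherited.\<close>

lemma C1_on_local:
 assumes S: "open S" and loc: "!!x. x \<in> S ==> \<exists>W G L. open W \<and> x \<in> W \<and> C1_on W G L \<and> (\<forall>y\<in>W. F y = G y)"
 shows "\<exists>J. C1_on S F J"
proof -
 define J where "J x = matrix (frechet_derivative F (at x))" for x
 have *: "\<exists>W. open W \<and> x \<in> W \<and> C1_on W F J" if x: "x \<in> S" for x
 proof -
  obtain W G L where W: "open W" "x \<in> W" "C1_on W G L" "!!y. y \<in> W ==> F y = G y" using loc[OF x] by blast
  have d: "(F has_derivative (%h. L y *v h)) (at y)" if "y \<in> W" for y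
   by (rule has_derivative_transform_within_open[OF C1_onD(1)[OF W(3) that] W(1) that]) (simp add: W(4))
  have J: "J y = L y" if "y \<in> W" for y
   unfolding J_def frechet_derivative_at[OF d[OF that], symmetric] by (rule matrix_of_matrix_vector_mul)
  have "C1_on W F J" unfolding C1_on_def
   using d J C1_onD(2)[OF W(3)] by (auto cong: continuous_on_cong)
  then show ?thesis using W by blast
 qed
 have "continuous_on S J"
 proof (rule continuous_at_imp_continuous_on, rule ballI)
  fix x assume "x \<in> S"
  then obtain W where "open W" "x \<in> W" "C1_on W F J" using * by blast
  then show "isCont J x" using C1_onD(2) continuous_on_eq_continuous_at by blast
 qed
 moreover have "(F has_derivative (%h. J x *v h)) (at x)" if "x \<in> S" for x using *[OF that] C1_onD(1) by blast
 ultimately show ?thesis unfolding C1_on_def by blast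
qed

lemma Ck_on_1_imp_C1_on:
 assumes "Ck_on 1 W G"
 shows "\<exists>L. C1_on W G L"
proof -
 define L where "L x = matrix (frechet_derivative G (at x))" for x
 have d: "(G has_derivative frechet_derivative G (at x)) (at x)" if "x \<in> W" for x
  using assms that by (simp add: frechet_derivative_works[symmetric])
 have "(G has_derivative (%h. L x *v h)) (at x)" if "x \<in> W" for x
  using d[OF that] matrix_works[of "frechet_derivative G (at x)"] has_derivative_linear[OF d[OF that]] by (simp add: L_def linear_matrix_vector_mul_eq)
 moreover have "continuous_on W L"
 proof -
  have "continuous_on W (%x. frechet_derivative G (at x) (axis j 1))" for j
   using assms by (simp add: pderiv_at_def[abs_def] axis_in_Basis_iff)
  then have "continuous_on W (%x. frechet_derivative G (at x) (axis j 1) $ i)" for i j by (intro continuous_intros)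
  then show ?thesis unfolding L_def matrix_def by (intro continuous_on_vec_lambda)
 qed
 ultimately show ?thesis unfolding C1_on_def by blast
qed

lemma C1_on_locally_injective:
 assumes F: "C1_on S F J" and S: "open S" "a \<in> S" and d: "det (J a) ~= 0"
 shows "\<exists>r>0. inj_on F (ball a r)"
proof (rule has_derivative_locally_injective[OF S(2,1), of "%h. inv3 (J a) *v h" "%x h. J x *v h" F])
 show "bounded_linear (%h. inv3 (J a) *v h)" by (rule matrix_vector_mul_bounded_linear)
 show "(%h. inv3 (J a) *v h) \<circ> (%h. J a *v h) = id" using inv3(2)[OF d] by (simp add: fun_eq_iff)
 show "(F has_derivative (%h. J x *v h)) (at x)" if "x \<in> S" for x by (rule C1_onD(1)[OF F that])
 show "\<exists>d>0. \<forall>x. dist a x < d --> onorm (%v. J x *v v - J a *v v) < e" if "e > 0" for e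
 proof -
  have "isCont J a" using C1_onD(2)[OF F] S continuous_on_eq_continuous_at by blast
  then obtain d where d: "d > 0" "!!x. dist x a < d ==> dist (J x) (J a) < e"
   using \<open>e > 0\<close> unfolding continuous_at_eps_delta by blast
  have "onorm (%v. J x *v v - J a *v v) < e" if "dist a x < d" for x
  proof -
   have "onorm (%v. J x *v v - J a *v v) <= norm (J x - J a)"
    by (rule onorm_le) (metis norm_matrix_vector_le matrix_vector_mult_diff_rdistrib)
   also have "\<dots> < e" using d(2)[of x] that by (simp add: dist_norm norm_minus_commute)
   finally show ?thesis .
  qed
  then show ?thesis using d(1) by blast
 qed
 show "\<exists>r>0. inj_on F (ball a r)" if "0 < r" "inj_on F (ball a r)" for r using that by blast
qed

text \<open>If every neighbourhood failed, pairs of distinct points with equal images would approach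
  \<open>K\<close>. Their limits have equal images and coincide by injectivity on \<open>K\<close>,
  against local injectivity at the limit.\<close>

lemma injective_near_compact:
 assumes F: "C1_on S F J" and S: "open S" and K: "compact K" "K \<subseteq> S" and i: "inj_on F K"
  and d: "!!x. x \<in> K ==> det (J x) ~= 0"
 shows "\<exists>N. open N \<and> K \<subseteq> N \<and> N \<subseteq> S \<and> inj_on F N"
proof (rule ccontr)
 assume no: "\<not> ?thesis"
 obtain e where e: "e > 0" "(\<Union>x\<in>K. cball x e) \<subseteq> S"
  using compact_subset_open_imp_cball_epsilon_subset[OF K(1) S K(2)] by auto
 define r where "r n = e / real (Suc n)" for n
 have r: "r n > 0" "r n <= e" for n using e(1) by (auto simp: r_def divide_le_eq mult_le_cancel_left1)
 have rl: "r \<longlonglongrightarrow> 0" unfolding r_def by (rule LIMSEQ_Suc[OF lim_const_over_n])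
 \<comment> \<open>In the quadruple the two middle entries are the offending points; the outer ones
   are points of \<open>K\<close> near them, kept because compactness applies to those.\<close>
 have "\<forall>n. \<exists>p. fst p \<in> K \<and> snd (snd (snd p)) \<in> K \<and> dist (fst p) (fst (snd p)) < r n \<and>
  dist (snd (snd (snd p))) (fst (snd (snd p))) < r n \<and> fst (snd p) ~= fst (snd (snd p)) \<and> F (fst (snd p)) = F (fst (snd (snd p)))"
 proof
  fix n
  let ?N = "\<Union>x\<in>K. ball x (r n)"
  have 1: "?N \<subseteq> S" using e(2) r(2)[of n] by (fastforce simp: subset_iff)
  have "open ?N" "K \<subseteq> ?N" using r(1)[of n] by auto
  then have "\<not> inj_on F ?N" using no 1 by blast
  then obtain x y where xy: "x \<in> ?N" "y \<in> ?N" "F x = F y" "x ~= y" unfolding inj_on_def by blast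
  then obtain z w where "z \<in> K" "dist z x < r n" "w \<in> K" "dist w y < r n" by auto
  then show "\<exists>p. fst p \<in> K \<and> snd (snd (snd p)) \<in> K \<and> dist (fst p) (fst (snd p)) < r n \<and>
   dist (snd (snd (snd p))) (fst (snd (snd p))) < r n \<and> fst (snd p) ~= fst (snd (snd p)) \<and> F (fst (snd p)) = F (fst (snd (snd p)))"
   using xy by (intro exI[of _ "(z, x, y, w)"]) simp
 qed
 then obtain p where "\<forall>n. fst (p n) \<in> K \<and> snd (snd (snd (p n))) \<in> K \<and> dist (fst (p n)) (fst (snd (p n))) < r n \<and>
  dist (snd (snd (snd (p n)))) (fst (snd (snd (p n)))) < r n \<and> fst (snd (p n)) ~= fst (snd (snd (p n))) \<and> F (fst (snd (p n))) = F (fst (snd (snd (p n))))"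
  by (rule choice[THEN exE])
 moreover define Z X Y T where "Z n = fst (p n)" "X n = fst (snd (p n))" "Y n = fst (snd (snd (p n)))" "T n = snd (snd (snd (p n)))" for n
 ultimately have p: "Z n \<in> K" "T n \<in> K" "dist (Z n) (X n) < r n" "dist (T n) (Y n) < r n" "X n ~= Y n" "F (X n) = F (Y n)" for n
  by auto
 have "seq_compact (K \<times> K)" using K(1) by (simp add: compact_Times compact_imp_seq_compact)
 then obtain l s where l: "l \<in> K \<times> K" "strict_mono s" "((%n. (Z n, T n)) \<circ> s) \<longlonglongrightarrow> l"
  using p(1,2) unfolding seq_compact_def by (metis (no_types, lifting) mem_Sigma_iff)
 obtain z t where zt: "l = (z, t)" by (cases l)
 have Zl: "(Z \<circ> s) \<longlonglongrightarrow> z" and Tl: "(T \<circ> s) \<longlonglongrightarrow> t"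
  using tendsto_fst[OF l(3)] tendsto_snd[OF l(3)] zt by (simp_all add: o_def)
 have rs: "(r \<circ> s) \<longlonglongrightarrow> 0" by (rule LIMSEQ_subseq_LIMSEQ[OF rl l(2)])
 have close: "B \<longlonglongrightarrow> b" if A: "A \<longlonglongrightarrow> b" and AB: "!!n. dist (A n) (B n) < (r \<circ> s) n" for A B :: "nat => real^3" and b
 proof -
  have "(%n. B n - A n) \<longlonglongrightarrow> 0"
   by (rule Lim_null_comparison[OF always_eventually rs]) (use AB in "auto simp: dist_norm norm_minus_commute less_imp_le")
  from tendsto_add[OF this A] show ?thesis by simp
 qed
 have Xl: "(X \<circ> s) \<longlonglongrightarrow> z" by (rule close[OF Zl]) (simp add: p)
 have Yl: "(Y \<circ> s) \<longlonglongrightarrow> t" by (rule close[OF Tl]) (simp add: p)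
 have z: "z \<in> K" "t \<in> K" using l(1) zt by auto
 have "(%n. F ((X \<circ> s) n)) \<longlonglongrightarrow> F z" "(%n. F ((Y \<circ> s) n)) \<longlonglongrightarrow> F t"
  using isCont_tendsto_compose[OF C1_onD(4)[OF F] Xl] isCont_tendsto_compose[OF C1_onD(4)[OF F] Yl] z K(2) by auto
 then have "F z = F t" using p(6) LIMSEQ_unique by (auto simp: o_def)
 then have tz: "t = z" using i z by (auto dest: inj_onD)
 obtain \<rho> where \<rho>: "\<rho> > 0" "inj_on F (ball z \<rho>)" using C1_on_locally_injective[OF F S _ d] z K(2) by blast
 have "\<forall>\<^sub>F n in sequentially. (X \<circ> s) n \<in> ball z \<rho>" "\<forall>\<^sub>F n in sequentially. (Y \<circ> s) n \<in> ball z \<rho>"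
  using topological_tendstoD[OF Xl open_ball, of z \<rho>] topological_tendstoD[OF Yl open_ball, of z \<rho>] \<rho>(1) tz by auto
 then have "\<forall>\<^sub>F n in sequentially. False"
  by eventually_elim (metis \<rho>(2) p(5,6) inj_onD comp_apply)
 then show False by simp
qed

text \<open>The inverse function theorem along a compact set; openness of the image is invariance of
  domain.\<close>

lemma inverse_near_compact:
 assumes F: "C1_on S F J" and S: "open S" and K: "compact K" "K \<subseteq> S" and i: "inj_on F K"
  and d: "!!x h. x \<in> K ==> J x *v h = 0 ==> h = 0"
 obtains N G L where "open N" "K \<subseteq> N" "N \<subseteq> S" "open (F ` N)" "!!x. x \<in> N ==> G (F x) = x" "C1_on (F ` N) G L"
  "!!x h. x \<in> N ==> J x *v (L (F x) *v h) = h" "!!x h. x \<in> N ==> L (F x) *v (J x *v h) = h"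
proof -
 have d': "det (J x) ~= 0" if "x \<in> K" for x using d[OF that] by (rule det_nonzeroI)
 obtain N0 where N0: "open N0" "K \<subseteq> N0" "N0 \<subseteq> S" "inj_on F N0" using injective_near_compact[OF F S K i d'] by blast
 \<comment> \<open>The determinant is nonzero on \<open>K\<close> only to begin with. Shrinking
   makes the inverse differentiable at every point of the image.\<close>
 define N where "N = N0 \<inter> {x \<in> S. det (J x) ~= 0}"
 have "{x \<in> S. det (J x) ~= 0} = S \<inter> (%x. det (J x)) -` (- {0})" by auto
 then have "open {x \<in> S. det (J x) ~= 0}"
  using continuous_open_preimage[OF continuous_on_det3[OF C1_onD(2)[OF F]] S, of "- {0}"] by auto
 then have N: "open N" "K \<subseteq> N" "N \<subseteq> S" using N0 K(2) d' by (auto simp: N_def)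
 have inj: "inj_on F N" using N0(4) by (rule inj_on_subset) (auto simp: N_def)
 have nz: "det (J x) ~= 0" if "x \<in> N" for x using that by (simp add: N_def)
 have c: "continuous_on N F" by (rule continuous_on_subset[OF C1_onD(3)[OF F] N(3)])
 define G where "G = inv_into N F"
 define L where "L y = inv3 (J (G y))" for y
 have G: "G (F x) = x" if "x \<in> N" for x unfolding G_def by (rule inv_into_f_f[OF inj that])
 have dG: "(G has_derivative (%h. L (F x) *v h)) (at (F x))" if x: "x \<in> N" for x
 proof (rule has_derivative_inverse_strong[OF N(1) x c G])
  show "(F has_derivative (%h. J x *v h)) (at x)" using C1_onD(1)[OF F] x N(3) by blast
  show "(%h. J x *v h) \<circ> (%h. L (F x) *v h) = id" using inv3(1)[OF nz[OF x]] by (simp add: fun_eq_iff L_def G[OF x])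
 qed
 have Gc: "continuous_on (F ` N) G"
  by (rule continuous_at_imp_continuous_on) (use dG has_derivative_continuous in blast)
 have "C1_on (F ` N) G L" unfolding C1_on_def
 proof (intro conjI)
  show "\<forall>y\<in>F ` N. (G has_derivative (%h. L y *v h)) (at y)" using dG by blast
  show "continuous_on (F ` N) L" unfolding L_def
   by (intro continuous_on_inv3 continuous_on_compose2[OF C1_onD(2)[OF F] Gc]) (use G nz N(3) in auto)
 qed
 moreover have "open (F ` N)" by (rule invariance_of_domain[OF c N(1) inj])
 moreover have "J x *v (L (F x) *v h) = h \<and> L (F x) *v (J x *v h) = h" if "x \<in> N" for x h
  using inv3[OF nz[OF that]] by (simp add: L_def G[OF that])
 ultimately show thesis using N G by (intro that[of N G L]) auto
qed


section \<open>A collar of the spherical level set\<close>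

lemma Ck_map_1E:
 fixes g :: "real^3 => real^3"
 assumes "Ck_map 1 S g" "x \<in> S"
 obtains W H L where "open W" "x \<in> W" "C1_on W H L" "!!y. y \<in> S ==> y \<in> W ==> H y = g y"
 using bspec[OF assms(1)[unfolded Ck_map_def] assms(2)]
proof (elim exE conjE)
 fix W H assume W: "open W" "x \<in> W" "Ck_on 1 W H" "\<forall>y\<in>S \<inter> W. H y = g y"
 from Ck_on_1_imp_C1_on[OF W(3)] obtain L where "C1_on W H L" by (elim exE)
 then show thesis using W by (intro that[of W H L]) auto
qed

text \<open>Composition with radial projection merges the local extensions into one map on an open
  set, which has a Jacobian in the usual sense.\<close>

lemma sphere_Ck_map_retraction:
 fixes h :: "real^3 => real^3"
 assumes "Ck_map 1 (sphere 0 1) h"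
 shows "\<exists>J. C1_on (- {0}) (%z. h (sgn z)) J"
proof (rule C1_on_local)
 fix x :: "real^3" assume x: "x \<in> - {0}"
 then have "sgn x \<in> sphere 0 1" by (simp add: norm_sgn)
 then obtain W H L where W: "open W" "sgn x \<in> W" "C1_on W H L"
  "!!y. y \<in> sphere 0 1 ==> y \<in> W ==> H y = h y"
  by (rule Ck_map_1E[OF assms]) (rule that)
 note L = W(3)
 define V where "V = - {0} \<inter> sgn -` W"
 have V: "open V" unfolding V_def
  by (rule continuous_open_preimage[OF C1_onD(3)[OF C1_on_sgn] _ W(1)]) auto
 have "C1_on V (%z. H (sgn z)) (%z. L (sgn z) ** sgn_jacobian z)"
  by (rule C1_on_compose[OF C1_on_subset[OF C1_on_sgn] L]) (auto simp: V_def)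
 moreover have "h (sgn y) = H (sgn y)" if "y \<in> V" for y
  using W(4)[of "sgn y"] that by (auto simp: V_def norm_sgn)
 ultimately show "\<exists>W G L. open W \<and> x \<in> W \<and> C1_on W G L \<and> (\<forall>y\<in>W. h (sgn y) = G y)"
  using V x W(2) by (intro exI[of _ V] exI) (auto simp: V_def)
qed (auto simp: open_Compl)

text \<open>Near \<open>S\<close> a point is described by an angle in the unit sphere and the value
  of \<open>f\<close>. The angle comes from inverting the normal collar \<open>Y0\<close>, whose
  shells need not be level sets; pairing the angle with the radius \<open>1 + f x - c\<close> gives
  \<open>\<Psi>\<close>, which carries level sets exactly to concentric spheres.\<close>

lemma level_collar:
 fixes f :: "real^3 => real"
 assumes U: "open U" and f: "!!x. x \<in> U ==> (f has_derivative (%h. f' x \<bullet> h)) (at x)" and f': "C1_on U f' Hf"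
  and S: "S \<subseteq> U" "!!x. x \<in> S ==> f x = c" "!!x. x \<in> S ==> f' x ~= 0"
  and diffeo: "Ck_diffeomorphic 1 S (sphere (0 :: real^3) 1)"
 shows "\<exists>\<delta> N \<Psi> J Y L. 0 < \<delta> \<and> \<delta> < 1 \<and> open N \<and> N \<subseteq> U \<and> C1_on N \<Psi> J \<and> C1_on {z. \<bar>norm z - 1\<bar> < \<delta>} Y L \<and>
  (\<forall>x\<in>N. \<bar>norm (\<Psi> x) - 1\<bar> < \<delta> \<and> Y (\<Psi> x) = x \<and> norm (\<Psi> x) = 1 + f x - c \<and> (\<forall>h. L (\<Psi> x) *v (J x *v h) = h)) \<and>
  (\<forall>z. \<bar>norm z - 1\<bar> < \<delta> --> Y z \<in> N \<and> \<Psi> (Y z) = z)"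
proof -
 obtain g h where gh: "Ck_map 1 S g" "Ck_map 1 (sphere 0 1) h" "homeomorphism S (sphere (0 :: real^3) 1) g h"
  using diffeo unfolding Ck_diffeomorphic_def by blast
 have hS: "h z \<in> S" "g (h z) = z" if "z \<in> sphere 0 1" for z using gh(3) that unfolding homeomorphism_def by auto
 have gS: "g x \<in> sphere 0 1" "h (g x) = x" if "x \<in> S" for x using gh(3) that unfolding homeomorphism_def by auto
 have Sc: "compact S"
 proof -
  have "S = h ` sphere 0 1" "continuous_on (sphere 0 1) h" using gh(3) unfolding homeomorphism_def by auto
  then show ?thesis using compact_continuous_image compact_sphere by blast
 qed
 define P where "P z = h (sgn z)" for z
 obtain DP where DP: "C1_on (- {0}) P DP" using sphere_Ck_map_retraction[OF gh(2)] unfolding P_def by blast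
 have sgn_sphere: "sgn z \<in> sphere 0 1" if "z ~= 0" for z :: "real^3" using that by (simp add: norm_sgn)
 have PS: "P z \<in> S" if "z ~= 0" for z using hS(1)[OF sgn_sphere[OF that]] by (simp add: P_def)
 have PU: "P z \<in> U" if "z ~= 0" for z using PS[OF that] S(1) by blast
 have Ph: "P z = h z" if "z \<in> sphere 0 1" for z using that by (simp add: P_def sgn_div_norm)
 \<comment> \<open>\<open>f\<close> is constant along \<open>P\<close>, so the gradient is normal to
   the image of the derivative.\<close>
 have fP: "f' (P z) \<bullet> (DP z *v k) = 0" if z: "z ~= 0" for z k
 proof -
  have "((%z. f (P z)) has_derivative (%k. f' (P z) \<bullet> (DP z *v k))) (at z)"
   by (rule has_derivative_compose[OF C1_onD(1)[OF DP] f[OF PU[OF z]]]) (use z in auto)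
  moreover have "((%z. f (P z)) has_derivative (%k. 0)) (at z)"
   by (rule has_derivative_transform_within_open[OF has_derivative_const[of c] open_Compl[OF closed_singleton[of 0]]])
     (use z S(2)[OF PS] in auto)
  ultimately have "(%k. f' (P z) \<bullet> (DP z *v k)) = (%k. 0)" by (rule has_derivative_unique)
  then show ?thesis by metis
 qed
 \<comment> \<open>For a local extension \<open>G\<close> of \<open>g\<close> the composition of
   \<open>G\<close> with \<open>P\<close> is radial projection, so the kernel of the derivative of
   \<open>P\<close> lies in the radial line.\<close>
 have DPker: "k = (z \<bullet> k) *^ z" if z: "z \<in> sphere 0 1" and k: "DP z *v k = 0" for z k
 proof -
  have z0: "z ~= 0" using z by auto
  have hz: "h z \<in> S" by (rule hS(1)[OF z])
  obtain W G GL where W: "open W" "h z \<in> W" "C1_on W G GL" "!!y. y \<in> S ==> y \<in> W ==> G y = g y"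
   by (rule Ck_map_1E[OF gh(1) hz]) (rule that)
  note GL = W(3)
  define V where "V = - {0} \<inter> P -` W"
  have V: "open V" unfolding V_def by (rule continuous_open_preimage[OF C1_onD(3)[OF DP] _ W(1)]) auto
  have zV: "z \<in> V" using z0 W(2) Ph[OF z] by (simp add: V_def)
  have 1: "C1_on V (%z. G (P z)) (%z. GL (P z) ** DP z)"
   by (rule C1_on_compose[OF C1_on_subset[OF DP] GL]) (auto simp: V_def)
  have "GL (P z) ** DP z = sgn_jacobian z"
  proof (rule C1_on_unique[OF 1 C1_on_sgn V zV zV])
   show "G (P y) = sgn y" if "y \<in> V" for y
    using that W(4)[of "P y"] PS[of y] hS(2)[OF sgn_sphere[of y]] by (auto simp: V_def P_def)
  qed (use z0 in auto)
  then have "sgn_jacobian z *v k = GL (P z) *v (DP z *v k)" by (metis matrix_vector_mul_assoc)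
  then show ?thesis using z by (simp add: k sgn_jacobian_mult)
 qed
 \<comment> \<open>The image of the sphere is moved along the gradient of \<open>f\<close>, the one
   direction missing from the image of the derivative of \<open>P\<close>.\<close>
 define Y0 where "Y0 z = P z + (norm z - 1) *^ f' (P z)" for z
 define J0 where "J0 z = DP z + ((norm z - 1) *^ (Hf (P z) ** DP z) + outer (f' (P z)) (sgn z))" for z
 have Y0: "C1_on (- {0}) Y0 J0" unfolding Y0_def J0_def
 proof (intro C1_on_add DP C1_on_scaleR C1_on_compose[OF DP f'])
  show "((%z. norm z - 1) has_derivative (%h. sgn z \<bullet> h)) (at z)" if "z \<in> - {0}" for z :: "real^3"
   using has_derivative_diff[OF norm_has_derivative has_derivative_const[of 1], of z] that by simp
  show "continuous_on (- {0}) (sgn :: real^3 => real^3)" by (rule C1_onD(3)[OF C1_on_sgn])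
 qed (use PU in auto)
 have J0: "J0 z *v k = DP z *v k + (z \<bullet> k) *^ f' (P z)" if "z \<in> sphere 0 1" for z k
  using that by (simp add: J0_def matrix_vector_mult_add_rdistrib outer_mult_vec sgn_div_norm)
 have f'P: "f' (P z) ~= 0" if "z \<in> sphere 0 1" for z using S(3)[OF PS[of z]] that by (cases "z = 0") auto
 have J0f: "f' (P z) \<bullet> (J0 z *v k) = (z \<bullet> k) * (f' (P z) \<bullet> f' (P z))" if z: "z \<in> sphere 0 1" for z k
 proof -
  have "z ~= 0" using z by (cases "z = 0") auto
  from fP[OF this, of k] show ?thesis unfolding J0[OF z] by (simp add: inner_add_right)
 qed
 have J0ker: "k = 0" if z: "z \<in> sphere 0 1" and k: "J0 z *v k = 0" for z k
 proof -
  have "z \<bullet> k = 0" using J0f[OF z, of k] k f'P[OF z] by simp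
  moreover from this have "DP z *v k = 0" using k by (simp add: J0[OF z])
  ultimately show ?thesis using DPker[OF z, of k] by simp
 qed
 have Y0h: "Y0 z = h z" if "z \<in> sphere 0 1" for z using that Ph[OF that] by (simp add: Y0_def)
 have inj0: "inj_on Y0 (sphere 0 1)" by (rule inj_on_inverseI[of _ g]) (simp add: Y0h hS)
 obtain N0 G0 L0 where N0: "open N0" "sphere 0 1 \<subseteq> N0" "N0 \<subseteq> - {0}" "open (Y0 ` N0)" "!!z. z \<in> N0 ==> G0 (Y0 z) = z"
   "C1_on (Y0 ` N0) G0 L0" "!!z k. z \<in> N0 ==> J0 z *v (L0 (Y0 z) *v k) = k"
 proof -
  have o: "open (- {0::real^3})" "sphere 0 1 \<subseteq> - {0::real^3}" by (auto simp: open_Compl)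
  show ?thesis
  proof (rule inverse_near_compact[OF Y0 o(1) compact_sphere o(2) inj0])
   show "k = 0" if "z \<in> sphere 0 1" "J0 z *v k = 0" for z k by (rule J0ker[OF that])
  qed (rule that)
 qed
 \<comment> \<open>Where the angle is defined and the radius is positive.\<close>
 define O1 where "O1 = U \<inter> Y0 ` N0 \<inter> {x \<in> U. 1 + f x - c > 0} \<inter> {x \<in> Y0 ` N0. G0 x ~= 0}"
 have fc: "continuous_on U f"
  by (rule continuous_at_imp_continuous_on) (use f has_derivative_continuous in blast)
 have "continuous_on U (%x. 1 + f x - c)" by (intro continuous_intros fc)
 from continuous_open_preimage[OF this U open_greaterThan[of 0]]
 have "open {x \<in> U. 1 + f x - c > 0}" by (simp add: vimage_def Int_def)
 moreover have "open {x \<in> Y0 ` N0. G0 x ~= 0}"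
  using continuous_open_preimage[OF C1_onD(3)[OF N0(6)] N0(4), of "- {0}"] by (auto simp: vimage_def Int_def open_Compl)
 ultimately have O1: "open O1" unfolding O1_def using U N0(4) by (intro open_Int)
 define \<Psi> where "\<Psi> x = (1 + f x - c) *^ sgn (G0 x)" for x
 define J where "J x = (1 + f x - c) *^ (sgn_jacobian (G0 x) ** L0 x) + outer (sgn (G0 x)) (f' x)" for x
 have \<Psi>: "C1_on O1 \<Psi> J" unfolding \<Psi>_def J_def
 proof (intro C1_on_scaleR C1_on_compose[OF C1_on_subset[OF N0(6)] C1_on_sgn])
  show "((%x. 1 + f x - c) has_derivative (%h. f' x \<bullet> h)) (at x)" if "x \<in> O1" for x
   using has_derivative_diff[OF has_derivative_add[OF has_derivative_const[of 1] f] has_derivative_const[of c], of x] that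
   by (simp add: O1_def)
  show "continuous_on O1 f'" by (rule continuous_on_subset[OF C1_onD(3)[OF f']]) (auto simp: O1_def)
 qed (auto simp: O1_def)
 have n\<Psi>: "norm (\<Psi> x) = 1 + f x - c" if "x \<in> O1" for x
  using that by (auto simp: \<Psi>_def O1_def norm_sgn)
 have xS: "x = Y0 (g x) \<and> g x \<in> N0 \<and> G0 x = g x" if "x \<in> S" for x
  using gS[OF that] Y0h[OF gS(1)[OF that]] N0(2) N0(5)[of "g x"] by auto
 have SO: "S \<subseteq> O1"
 proof
  fix x assume x: "x \<in> S"
  have "g x ~= 0" using gS(1)[OF x] by auto
  then show "x \<in> O1" using xS[OF x] S(1,2) x by (auto simp: O1_def)
 qed
 have \<Psi>S: "\<Psi> x = g x" if x: "x \<in> S" for x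
  using S(2)[OF x] xS[OF x] gS(1)[OF x] by (simp add: \<Psi>_def sgn_div_norm)
 have inj: "inj_on \<Psi> S" by (rule inj_on_inverseI[of _ h]) (simp add: \<Psi>S gS)
 \<comment> \<open>At points of \<open>S\<close> the radial part of \<open>J x *v k\<close> is
   \<open>f' x \<bullet> k\<close> and the rest is the angular part. If both vanish, the collar
   coordinates \<open>w\<close> of \<open>k\<close> are zero.\<close>
 have Jker: "k = 0" if x: "x \<in> S" and k: "J x *v k = 0" for x k
 proof -
  define z w where "z = g x" and "w = L0 x *v k"
  have z: "z \<in> sphere 0 1" "G0 x = z" "Y0 z = x" "z \<in> N0" using gS(1)[OF x] xS[OF x] by (auto simp: z_def)
  have zz: "z \<bullet> z = 1" using z(1) by (simp add: dot_square_norm)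
  have "J x *v k = (w - (z \<bullet> w) *^ z) + (f' x \<bullet> k) *^ z"
   using z(1) S(2)[OF x]
   by (simp add: J_def z(2) matrix_vector_mult_add_rdistrib outer_mult_vec sgn_div_norm w_def
     scaleR_matrix_vector_assoc[symmetric] matrix_vector_mul_assoc[symmetric] sgn_jacobian_mult)
  with k have e: "(w - (z \<bullet> w) *^ z) + (f' x \<bullet> k) *^ z = 0" by simp
  have "z \<bullet> ((w - (z \<bullet> w) *^ z) + (f' x \<bullet> k) *^ z) = f' x \<bullet> k" by (simp add: inner_add_right inner_diff_right zz)
  then have fk: "f' x \<bullet> k = 0" unfolding e by simp
  have kw: "k = J0 z *v w" using N0(7)[OF z(4), of k] z(3) by (simp add: w_def)
  have "P z = x" using z(3) Y0h[OF z(1)] Ph[OF z(1)] by simp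
  then have "(z \<bullet> w) * (f' x \<bullet> f' x) = 0" using J0f[OF z(1), of w] fk kw by simp
  then have "z \<bullet> w = 0" using S(3)[OF x] by simp
  then have "w = 0" using e fk by simp
  then show ?thesis using kw by simp
 qed
 obtain N1 Y L where N1: "open N1" "S \<subseteq> N1" "N1 \<subseteq> O1" "open (\<Psi> ` N1)" "!!x. x \<in> N1 ==> Y (\<Psi> x) = x"
   "C1_on (\<Psi> ` N1) Y L" "!!x k. x \<in> N1 ==> L (\<Psi> x) *v (J x *v k) = k"
 proof (rule inverse_near_compact[OF \<Psi> O1 Sc SO inj])
  show "k = 0" if "z \<in> S" "J z *v k = 0" for z k by (rule Jker[OF that])
 qed (rule that)
 have "sphere 0 1 \<subseteq> \<Psi> ` N1"
 proof
  fix z :: "real^3" assume z: "z \<in> sphere 0 1"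
  then have "z = \<Psi> (h z)" using \<Psi>S[OF hS(1)[OF z]] hS(2)[OF z] by simp
  then show "z \<in> \<Psi> ` N1" using hS(1)[OF z] N1(2) by blast
 qed
 then obtain e where e: "e > 0" "(\<Union>x\<in>sphere 0 1. cball x e) \<subseteq> \<Psi> ` N1"
  using compact_subset_open_imp_cball_epsilon_subset[OF compact_sphere N1(4)] by blast
 \<comment> \<open>The bound \<open>1/2\<close> keeps the shell away from the origin; the bound
   \<open>e\<close> puts it into the image of \<open>\<Psi>\<close>.\<close>
 define \<delta> where "\<delta> = min e (1/2)"
 have \<delta>: "0 < \<delta>" "\<delta> < 1" "\<delta> <= e" using e(1) by (auto simp: \<delta>_def)
 let ?A = "{z::real^3. \<bar>norm z - 1\<bar> < \<delta>}"
 have A: "?A \<subseteq> \<Psi> ` N1"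
 proof
  fix z assume z: "z \<in> ?A"
  then have z0: "z ~= 0" using \<delta> by auto
  have "sgn z - z = (1 / norm z - 1) *^ z" by (simp add: sgn_div_norm divide_inverse scaleR_diff_left)
  then have "norm (sgn z - z) = \<bar>(1 / norm z - 1) * norm z\<bar>" by (simp add: abs_mult)
  also have "(1 / norm z - 1) * norm z = 1 - norm z" using z0 by (simp add: left_diff_distrib)
  finally have "norm (sgn z - z) = \<bar>1 - norm z\<bar>" .
  then have "z \<in> cball (sgn z) e" using z \<delta> by (simp add: dist_norm)
  then show "z \<in> \<Psi> ` N1" using e(2) sgn_sphere[OF z0] by blast
 qed
 define N where "N = N1 \<inter> \<Psi> -` ?A"
 have "open ?A" by (intro open_Collect_less continuous_intros)
 then have N: "open N" unfolding N_def
  by (rule continuous_open_preimage[OF continuous_on_subset[OF C1_onD(3)[OF \<Psi>] N1(3)] N1(1)])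
 have in1: "\<bar>norm (\<Psi> x) - 1\<bar> < \<delta> \<and> Y (\<Psi> x) = x \<and> norm (\<Psi> x) = 1 + f x - c \<and> (\<forall>h. L (\<Psi> x) *v (J x *v h) = h)" if "x \<in> N" for x
  using that N1(5,7) n\<Psi>[of x] N1(3) by (auto simp: N_def)
 have in2: "Y z \<in> N \<and> \<Psi> (Y z) = z" if z: "\<bar>norm z - 1\<bar> < \<delta>" for z
 proof -
  obtain x where "x \<in> N1" "z = \<Psi> x" using A z by blast
  then show ?thesis using N1(5) z by (auto simp: N_def)
 qed
 have NU: "N \<subseteq> U" using N1(3) by (auto simp: N_def O1_def)
 have "C1_on N \<Psi> J" by (rule C1_on_subset[OF \<Psi>]) (use N1(3) in "auto simp: N_def")
 moreover have "C1_on ?A Y L" by (rule C1_on_subset[OF N1(6) A])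
 ultimately show ?thesis using \<delta> N NU in1 in2 by blast
qed


section \<open>Potentials of weakly closed fields\<close>

text \<open>Closedness for a field that is merely continuous: uniform limits of fields of class one
  whose Jacobians become symmetric. The Jacobians themselves need not stay bounded.\<close>

definition nearly_closed :: "(real^3) set => (real^3 => real^3) => bool" where
 "nearly_closed Q B \<longleftrightarrow> (\<forall>\<epsilon>>0. \<exists>b J. C1_on Q b J \<and> (\<forall>x\<in>Q. norm (b x - B x) <= \<epsilon>) \<and>
   (\<forall>x\<in>Q. \<forall>h k. \<bar>h \<bullet> (J x *v k) - k \<bullet> (J x *v h)\<bar> <= \<epsilon> * norm h * norm k))"

text \<open>The primitive of the Poincare lemma, the line integral of \<open>B\<close> from
  \<open>a\<close> to \<open>y\<close>.\<close>

definition radial_potential :: "real^3 => (real^3 => real^3) => real^3 => real" where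
 "radial_potential a B y = integral {0..1} (%t. B (a + t *^ (y - a)) \<bullet> (y - a))"

text \<open>For a symmetric Jacobian the gradient of the radial integral is \<open>b\<close>; in
  general the defect is governed by the antisymmetric part alone. The increment form has an error
  that does not involve the size of \<open>J\<close>, so it survives a uniform limit of
  \<open>b\<close>.\<close>

lemma radial_potential_increment:
 assumes b: "C1_on Q b J" and Q: "convex Q" "a \<in> Q" "z \<in> Q" "w \<in> Q"
  and anti: "!!x h k. x \<in> Q ==> \<bar>h \<bullet> (J x *v k) - k \<bullet> (J x *v h)\<bar> <= \<epsilon> * norm h * norm k" and \<epsilon>: "\<epsilon> >= 0"
  and R: "!!y. y \<in> Q ==> norm (y - a) <= R"
 shows "\<exists>y\<in>closed_segment z w. \<bar>radial_potential a b w - radial_potential a b z - b y \<bullet> (w - z)\<bar> <= \<epsilon> * norm (w - z) * R"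
proof -
 define d where "d = w - z"
 define y where "y s = z + s *^ d" for s
 define \<gamma> where "\<gamma> s t = a + t *^ (y s - a)" for s t
 have yQ: "y s \<in> Q" if "s \<in> {0..1}" for s
  using convexD_alt[OF Q(1,3,4), of s] that by (simp add: y_def d_def algebra_simps)
 have \<gamma>Q: "\<gamma> s t \<in> Q" if "s \<in> {0..1}" "t \<in> {0..1}" for s t
  using convexD_alt[OF Q(1,2) yQ[OF that(1)], of t] that(2) by (simp add: \<gamma>_def algebra_simps)
 \<comment> \<open>\<open>D\<close> is the derivative in \<open>s\<close> of the integrand,
   \<open>E\<close> below is the derivative in \<open>t\<close> of
   \<open>t * (b \<bullet> d)\<close>. They differ by \<open>t\<close> times the antisymmetric part
   of the Jacobian.\<close>
 define D where "D s t = (J (\<gamma> s t) *v (t *^ d)) \<bullet> (y s - a) + b (\<gamma> s t) \<bullet> d" for s t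
 define p where "p s = integral (cbox 0 1) (%t. b (\<gamma> s t) \<bullet> (y s - a))" for s
 have p: "radial_potential a b (y s) = p s" for s by (simp add: radial_potential_def p_def \<gamma>_def)
 have cb: "continuous_on {0..1} (%t. b (\<gamma> s t))" and cJ: "continuous_on {0..1} (%t. J (\<gamma> s t))" if "s \<in> {0..1}" for s
  using \<gamma>Q[OF that] unfolding \<gamma>_def
  by (auto intro!: continuous_on_compose2[OF C1_onD(3)[OF b]] continuous_on_compose2[OF C1_onD(2)[OF b]] continuous_intros)
 have cb2: "continuous_on ({0..1} \<times> {0..1}) (%(s, t). b (\<gamma> s t))" "continuous_on ({0..1} \<times> {0..1}) (%(s, t). J (\<gamma> s t))"
  using \<gamma>Q unfolding \<gamma>_def y_def case_prod_beta
  by (auto intro!: continuous_on_compose2[OF C1_onD(3)[OF b]] continuous_on_compose2[OF C1_onD(2)[OF b]] continuous_intros)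
 have ders: "((%s. b (\<gamma> s t) \<bullet> (y s - a)) has_vector_derivative D s t) (at s within {0..1})" if "s \<in> {0..1}" "t \<in> {0..1}" for s t
 proof -
  have 1: "((%s. \<gamma> s t) has_derivative (%h. h *^ t *^ d)) (at s within {0..1})"
   unfolding \<gamma>_def y_def by (auto intro!: derivative_eq_intros simp: fun_eq_iff scaleR_scaleR mult.commute)
  have 2: "((%s. b (\<gamma> s t)) has_derivative (%h. J (\<gamma> s t) *v (h *^ t *^ d))) (at s within {0..1})"
   by (rule has_derivative_compose[OF 1 C1_onD(1)[OF b \<gamma>Q[OF that]]])
  have 3: "((%s. y s - a) has_derivative (%h. h *^ d)) (at s within {0..1})"
   unfolding y_def by (auto intro!: derivative_eq_intros)
  show ?thesis unfolding has_vector_derivative_def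
   by (rule has_derivative_eq_rhs, rule has_derivative_inner[OF 2 3])
     (simp add: fun_eq_iff D_def matrix_vector_mult_scaleR algebra_simps inner_commute)
 qed
 have "(p has_vector_derivative integral (cbox 0 1) (D s)) (at s within {0..1})" if s: "s \<in> {0..1}" for s
  unfolding p_def
 proof (rule leibniz_rule_vector_derivative[where U="{0..1}" and fx=D])
  show "(%t. b (\<gamma> s t) \<bullet> (y s - a)) integrable_on cbox 0 1" if "s \<in> {0..1}" for s
   using cb[OF that] by (intro integrable_continuous continuous_intros) auto
  show "continuous_on ({0..1} \<times> cbox 0 1) (%(s, t). D s t)"
   using cb2 unfolding D_def case_prod_beta y_def
   by (auto intro!: continuous_intros matrix_vector_mult_continuous)
 qed (use ders s in auto)
 then have "\<exists>s\<in>{0<..<1}. p 1 - p 0 = (1 - 0) *^ integral (cbox 0 1) (D s)"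
  by (intro mvt_simple[where f'="%s h. h *^ integral (cbox 0 1) (D s)"]) (auto simp: has_vector_derivative_def)
 then obtain s where s0: "s \<in> {0<..<1}" "p 1 - p 0 = (1 - 0) *^ integral (cbox 0 1) (D s)" by (elim bexE)
 then have s: "s \<in> {0..1}" "p 1 - p 0 = integral (cbox 0 1) (D s)" by auto
 have Di: "(D s has_integral (p 1 - p 0)) (cbox 0 1)" unfolding s(2)
  using cb[OF s(1)] cJ[OF s(1)] unfolding D_def
  by (intro integrable_integral integrable_continuous continuous_intros matrix_vector_mult_continuous) auto
 define E where "E t = b (\<gamma> s t) \<bullet> d + t * ((J (\<gamma> s t) *v (y s - a)) \<bullet> d)" for t
 have "(E has_integral (1 * (b (\<gamma> s 1) \<bullet> d) - 0 * (b (\<gamma> s 0) \<bullet> d))) {0..1}"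
 proof (rule fundamental_theorem_of_calculus)
  show "((%t. t * (b (\<gamma> s t) \<bullet> d)) has_vector_derivative E t) (at t within {0..1})" if "t \<in> {0..1}" for t
  proof -
   have 1: "((%t. \<gamma> s t) has_derivative (%h. h *^ (y s - a))) (at t within {0..1})"
    unfolding \<gamma>_def by (auto intro!: derivative_eq_intros)
   have 2: "((%t. b (\<gamma> s t)) has_derivative (%h. J (\<gamma> s t) *v (h *^ (y s - a)))) (at t within {0..1})"
    by (rule has_derivative_compose[OF 1 C1_onD(1)[OF b \<gamma>Q[OF s(1) that]]])
   show ?thesis unfolding has_vector_derivative_def
    by (rule has_derivative_eq_rhs, rule has_derivative_mult[OF has_derivative_ident has_derivative_inner_left[OF 2]])
      (simp add: fun_eq_iff E_def matrix_vector_mult_scaleR algebra_simps)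
  qed
 qed simp
 then have Ei: "(E has_integral (b (y s) \<bullet> d)) (cbox 0 1)" by (simp add: \<gamma>_def)
 have "norm (p 1 - p 0 - b (y s) \<bullet> d) <= (\<epsilon> * norm d * R) * measure lborel (cbox 0 (1::real))"
 proof (rule has_integral_bound[OF _ has_integral_diff[OF Di Ei]])
  have R0: "R >= 0" using R[OF Q(2)] by simp
  then show "0 <= \<epsilon> * norm d * R" using \<epsilon> by simp
  show "norm (D s t - E t) <= \<epsilon> * norm d * R" if t: "t \<in> cbox 0 1" for t
  proof -
   have t': "t \<in> {0..1}" using t by simp
   have "norm (D s t - E t) = \<bar>t\<bar> * \<bar>(y s - a) \<bullet> (J (\<gamma> s t) *v d) - d \<bullet> (J (\<gamma> s t) *v (y s - a))\<bar>"
    by (simp add: D_def E_def matrix_vector_mult_scaleR inner_commute abs_mult[symmetric] right_diff_distrib)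
   also have "\<dots> <= 1 * (\<epsilon> * norm (y s - a) * norm d)"
    using t' by (intro mult_mono anti \<gamma>Q s(1)) auto
   also have "\<dots> <= \<epsilon> * R * norm d" using R[OF yQ[OF s(1)]] \<epsilon> by (simp add: mult_left_mono mult_right_mono)
   finally show ?thesis by (simp add: mult_ac)
  qed
 qed
 moreover have "y 1 = w" "y 0 = z" by (simp_all add: y_def d_def)
 moreover have "y s \<in> closed_segment z w"
  using s(1) by (auto simp: y_def d_def closed_segment_def algebra_simps intro!: exI[of _ s])
 ultimately show ?thesis using p[of 1] p[of 0] by (intro bexI[of _ "y s"]) (auto simp: d_def)
qed

text \<open>With \<open>z\<close> and \<open>w\<close> fixed the approximation parameter tends to 0,
  and the increment estimate passes from the fields \<open>b\<close> to the continuous field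
  \<open>B\<close>; continuity of \<open>B\<close> at \<open>z\<close> does the rest.\<close>

lemma nearly_closed_has_potential:
 assumes nc: "nearly_closed Q B" and Q: "convex Q" "compact Q" "a \<in> Q" and r: "r > 0" "ball z r \<subseteq> Q"
  and B: "continuous_on Q B"
 shows "(radial_potential a B has_derivative (%h. B z \<bullet> h)) (at z)"
 unfolding has_derivative_at_alt
proof (intro conjI allI impI)
 show "bounded_linear (%h. B z \<bullet> h)" by (rule bounded_linear_inner_right)
 fix e :: real assume e: "e > 0"
 obtain R where R: "R >= 0" "!!y. y \<in> Q ==> norm (y - a) <= R"
 proof -
  have "continuous_on Q (%y. y - a)" by (intro continuous_intros)
  from compact_continuous_bound[OF Q(2) this] that show ?thesis by auto
 qed
 have "isCont B z" using continuous_on_subset[OF B r(2)] r(1) by (simp add: continuous_on_eq_continuous_at)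
 then obtain d0 where d0: "d0 > 0" "!!y. dist y z < d0 ==> dist (B y) (B z) < e"
  using e unfolding continuous_at_eps_delta by blast
 define d where "d = min d0 r"
 have d: "d > 0" "d <= d0" "d <= r" using d0 r by (auto simp: d_def)
 have "norm (radial_potential a B w - radial_potential a B z - B z \<bullet> (w - z)) <= e * norm (w - z)" if w: "norm (w - z) < d" for w
 proof (rule field_le_epsilon)
  fix \<eta> :: real assume \<eta>: "\<eta> > 0"
  define n where "n = norm (w - z)"
  \<comment> \<open>The coefficients of \<open>\<epsilon>\<close>: two errors in the potential, the
    antisymmetric defect, and the replacement of \<open>b\<close> by \<open>B\<close>.\<close>
  define C where "C = 2 * R + n * R + n"
  have C: "C >= 0" using R(1) by (simp add: C_def n_def)
  define \<epsilon> where "\<epsilon> = \<eta> / (C + 1)"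
  have \<epsilon>: "\<epsilon> > 0" "\<epsilon> * C <= \<eta>" using \<eta> C by (auto simp: \<epsilon>_def field_simps)
  obtain b J where b: "C1_on Q b J" "!!x. x \<in> Q ==> norm (b x - B x) <= \<epsilon>"
   "!!x h k. x \<in> Q ==> \<bar>h \<bullet> (J x *v k) - k \<bullet> (J x *v h)\<bar> <= \<epsilon> * norm h * norm k"
   using nc \<epsilon>(1) unfolding nearly_closed_def by meson
  have zw: "z \<in> ball z r" "w \<in> ball z r" using w d r by (auto simp: dist_norm norm_minus_commute)
  then have zwQ: "z \<in> Q" "w \<in> Q" using r(2) by auto
  obtain y where y: "y \<in> closed_segment z w"
   "\<bar>radial_potential a b w - radial_potential a b z - b y \<bullet> (w - z)\<bar> <= \<epsilon> * norm (w - z) * R"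
   using radial_potential_increment[OF b(1) Q(1,3) zwQ b(3) _ R(2)] \<epsilon>(1) by (auto simp: less_imp_le)
  have pot: "\<bar>radial_potential a b x - radial_potential a B x\<bar> <= \<epsilon> * R" if x: "x \<in> Q" for x
  proof -
   have seg: "a + t *^ (x - a) \<in> Q" if "t \<in> {0..1}" for t
    using convexD_alt[OF Q(1,3) x, of t] that by (simp add: algebra_simps)
   have i: "(%t. T (a + t *^ (x - a)) \<bullet> (x - a)) integrable_on cbox 0 1" if "continuous_on Q T" for T
    by (intro integrable_continuous continuous_intros continuous_on_compose2[OF that]) (use seg in auto)
   have "norm (integral (cbox 0 1) (%t. b (a + t *^ (x - a)) \<bullet> (x - a)) - integral (cbox 0 1) (%t. B (a + t *^ (x - a)) \<bullet> (x - a)))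
    <= (\<epsilon> * R) * measure lborel (cbox 0 (1::real))"
   proof (rule has_integral_bound[OF _ has_integral_diff[OF integrable_integral[OF i[OF C1_onD(3)[OF b(1)]]] integrable_integral[OF i[OF B]]]])
    show "0 <= \<epsilon> * R" using \<epsilon> R by simp
    fix t :: real assume "t \<in> cbox 0 1"
    then have q: "a + t *^ (x - a) \<in> Q" using seg by simp
    have "\<bar>(b (a + t *^ (x - a)) - B (a + t *^ (x - a))) \<bullet> (x - a)\<bar> <= \<epsilon> * R"
     by (rule order_trans[OF Cauchy_Schwarz_ineq2]) (intro mult_mono b(2)[OF q] R(2)[OF x] norm_ge_zero less_imp_le[OF \<epsilon>(1)])
    then show "norm (b (a + t *^ (x - a)) \<bullet> (x - a) - B (a + t *^ (x - a)) \<bullet> (x - a)) <= \<epsilon> * R"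
     by (simp add: inner_diff_left)
   qed
   then show ?thesis by (simp add: radial_potential_def)
  qed
  have "closed_segment z w \<subseteq> ball z d" using w d(1) by (intro closed_segment_subset) (auto simp: dist_norm norm_minus_commute)
  then have yb: "y \<in> ball z d" using y(1) by blast
  then have yQ: "y \<in> Q" using r(2) d(3) by auto
  have "\<bar>(b y - B y) \<bullet> (w - z)\<bar> <= \<epsilon> * n"
   by (rule order_trans[OF Cauchy_Schwarz_ineq2]) (simp add: n_def mult_right_mono b(2)[OF yQ])
  moreover have "\<bar>(B y - B z) \<bullet> (w - z)\<bar> <= e * n"
   by (rule order_trans[OF Cauchy_Schwarz_ineq2])
     (use d0(2)[of y] yb d(2) in "auto simp: n_def dist_norm norm_minus_commute intro!: mult_right_mono")
  moreover have "B z \<bullet> (w - z) = b y \<bullet> (w - z) - (b y - B y) \<bullet> (w - z) - (B y - B z) \<bullet> (w - z)"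
   by (simp add: inner_diff_left)
  moreover have "\<epsilon> * C = 2 * (\<epsilon> * R) + \<epsilon> * norm (w - z) * R + \<epsilon> * n" by (simp add: C_def n_def algebra_simps)
  ultimately show "norm (radial_potential a B w - radial_potential a B z - B z \<bullet> (w - z)) <= e * norm (w - z) + \<eta>"
   using y(2) pot[OF zwQ(1)] pot[OF zwQ(2)] \<epsilon>(2) unfolding n_def real_norm_def by linarith
 qed
 then show "\<exists>d>0. \<forall>w. norm (w - z) < d --> norm (radial_potential a B w - radial_potential a B z - B z \<bullet> (w - z)) <= e * norm (w - z)"
  using d(1) by blast
qed

section \<open>Potentials on the punctured space\<close>

text \<open>The inequality describes the space without the closed ray opposite to \<open>e\<close>,
  because \<open>|y + |y| e|^2 = 2 |y| (|y| + y \<bullet> e)\<close>.\<close>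

lemma norm_plus_inner_pos_iff:
 fixes y e :: "real^3"
 assumes "norm e = 1"
 shows "norm y + y \<bullet> e > 0 \<longleftrightarrow> y ~= - (norm y *^ e)"
proof -
 have "\<bar>y \<bullet> e\<bar> <= norm y" using Cauchy_Schwarz_ineq2[of y e] assms by simp
 then have ge: "norm y + y \<bullet> e >= 0" by linarith
 have e: "e \<bullet> e = 1" using assms by (simp add: dot_square_norm)
 have "(y + norm y *^ e) \<bullet> (y + norm y *^ e) = 2 * norm y * (norm y + y \<bullet> e)"
 proof -
  have "y \<bullet> y = norm y * norm y" by (simp add: dot_square_norm power2_eq_square)
  moreover have "(y + c *^ e) \<bullet> (y + c *^ e) = y \<bullet> y + 2 * c * (y \<bullet> e) + c * c" for c
   by (simp add: inner_add_left inner_add_right e inner_commute algebra_simps)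
  ultimately show ?thesis by (simp add: algebra_simps)
 qed
 then have "y + norm y *^ e = 0 \<longleftrightarrow> norm y = 0 \<or> norm y + y \<bullet> e = 0"
  using inner_eq_zero_iff[of "y + norm y *^ e"] by simp
 moreover have "y + norm y *^ e = 0 \<longleftrightarrow> y = - (norm y *^ e)" by (simp only: eq_neg_iff_add_eq_0)
 moreover have "norm y = 0 ==> norm y + y \<bullet> e = 0" by simp
 ultimately have "norm y + y \<bullet> e = 0 \<longleftrightarrow> y = - (norm y *^ e)" by blast
 then show ?thesis using ge by (metis less_le)
qed

text \<open>The slit space is star-shaped about \<open>e\<close>, so the convex hull of
  \<open>e\<close> and a small ball around \<open>z\<close> is a compact convex set that avoids
  0.\<close>

lemma slit_space_potential:
 fixes e :: "real^3"
 assumes e: "norm e = 1" and B: "continuous_on (- {0}) B" and nc: "!!Q. compact Q ==> Q \<subseteq> - {0} ==> nearly_closed Q B"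
  and z: "norm z + z \<bullet> e > 0"
 shows "(radial_potential e B has_derivative (%h. B z \<bullet> h)) (at z)"
proof -
 let ?D = "{z. norm z + z \<bullet> e > 0}"
 note iff = norm_plus_inner_pos_iff[OF e]
 have star: "u *^ e + v *^ b \<in> ?D" if b: "b \<in> ?D" and uv: "u >= 0" "v >= 0" "u + v = 1" for u v b
 proof (rule ccontr)
  let ?y = "u *^ e + v *^ b"
  assume "?y \<notin> ?D"
  define n where "n = norm ?y"
  have n: "n >= 0" by (simp add: n_def)
  have "?y = - (n *^ e)" using iff[of ?y] \<open>?y \<notin> ?D\<close> by (simp add: n_def)
  then have "v *^ b = - (n *^ e) - u *^ e" by (simp add: eq_diff_eq add.commute)
  then have vb: "v *^ b = - ((n + u) *^ e)" by (simp add: scaleR_add_left)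
  have vn: "v * norm b = n + u" using arg_cong[OF vb, of norm] uv e n by simp
  then have "v *^ (b + norm b *^ e) = 0" using vb by (simp add: scaleR_add_right vn)
  then have "v = 0 \<or> b = - (norm b *^ e)" by (auto simp: eq_neg_iff_add_eq_0)
  then have "v = 0" using b iff[of b] by auto
  then show False using vn uv n by simp
 qed
 have "open ?D" by (intro open_Collect_less continuous_intros)
 then obtain r where r: "r > 0" "cball z r \<subseteq> ?D" using z open_contains_cball[of ?D] by auto
 define Q where "Q = convex hull (insert e (cball z r))"
 have "Q \<subseteq> ?D"
 proof
  fix x assume "x \<in> Q"
  then obtain u v b where "u >= 0" "v >= 0" "u + v = 1" "b \<in> cball z r" "x = u *^ e + v *^ b"
   using r(1) unfolding Q_def by (subst (asm) convex_hull_insert) (auto simp: hull_same convex_cball)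
  then show "x \<in> ?D" using star r(2) by blast
 qed
 then have Q0: "Q \<subseteq> - {0}" by auto
 have Q: "convex Q" "compact Q" "e \<in> Q" "ball z r \<subseteq> Q"
  unfolding Q_def using hull_subset[of "insert e (cball z r)" convex] ball_subset_cball[of z r]
  by (auto intro!: compact_convex_hull compact_insert)
 show ?thesis
  by (rule nearly_closed_has_potential[OF nc[OF Q(2) Q0] Q(1,2,3) r(1) Q(4) continuous_on_subset[OF B Q0]])
qed

text \<open>Two opposite slit spaces cover the punctured space. They overlap in the complement of a
  line, which is connected, so their potentials differ there by one constant. Connectedness is used
  through four half-spaces around the line.\<close>

lemma punctured_space_potential:
 assumes B: "continuous_on (- {0}) B" and nc: "!!Q. compact Q ==> Q \<subseteq> - {0} ==> nearly_closed Q B"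
 shows "\<exists>P. \<forall>z. z ~= 0 --> (P has_derivative (%h. B z \<bullet> h)) (at z)"
proof -
 define e :: "real^3" where "e = axis 3 1"
 have e: "norm e = 1" "norm (- e) = 1" by (simp_all add: e_def)
 define P1 P2 where "P1 = radial_potential e B" and "P2 = radial_potential (- e) B"
 define D1 D2 :: "(real^3) set" where "D1 = {z. norm z + z \<bullet> e > 0}" and "D2 = {z. norm z + z \<bullet> - e > 0}"
 have d1: "(P1 has_derivative (%h. B z \<bullet> h)) (at z)" if "z \<in> D1" for z
  unfolding P1_def by (rule slit_space_potential[OF e(1) B nc]) (use that in "auto simp: D1_def")
 have d2: "(P2 has_derivative (%h. B z \<bullet> h)) (at z)" if "z \<in> D2" for z
  unfolding P2_def by (rule slit_space_potential[OF e(2) B nc]) (use that in "auto simp: D2_def")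
 have opn: "open D1" "open D2" unfolding D1_def D2_def by (intro open_Collect_less continuous_intros)+
 define H where "H w = {x. 0 < w \<bullet> x}" for w :: "real^3"
 have H: "x \<in> D1 \<inter> D2" if "w \<bullet> e = 0" "x \<in> H w" for w x
 proof -
  have "x ~= c *^ e" for c using that by (auto simp: H_def)
  from this[of "- norm x"] this[of "norm x"] show ?thesis
   unfolding D1_def D2_def using norm_plus_inner_pos_iff[OF e(1), of x] norm_plus_inner_pos_iff[OF e(2), of x] by simp
 qed
 have const: "\<exists>c. \<forall>x\<in>H w. P1 x - P2 x = c" if w: "w \<bullet> e = 0" for w
 proof (rule has_derivative_zero_constant)
  show "convex (H w)" unfolding H_def by (rule convex_halfspace_gt)
  show "((%x. P1 x - P2 x) has_derivative (%h. 0)) (at x within H w)" if "x \<in> H w" for x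
   using has_derivative_diff[OF d1 d2, of x] H[OF w that] by (auto intro: has_derivative_at_withinI)
 qed
 let ?a = "axis 1 1 :: real^3" and ?b = "axis 2 1 :: real^3"
 have ortho: "?a \<bullet> e = 0" "?b \<bullet> e = 0" "- ?a \<bullet> e = 0" "- ?b \<bullet> e = 0" by (simp_all add: e_def inner_axis_axis)
 obtain c where c: "!!x. x \<in> H ?a ==> P1 x - P2 x = c" using const[OF ortho(1)] by blast
 \<comment> \<open>Two half-spaces that meet share the constant; it is passed on around the axis
   from \<open>?a\<close> to \<open>?b\<close> and \<open>- ?b\<close>, and from \<open>?b\<close>
   to \<open>- ?a\<close>.\<close>
 have same: "P1 x - P2 x = c" if w: "w \<bullet> e = 0" "v \<bullet> e = 0" and v: "!!x. x \<in> H v ==> P1 x - P2 x = c" and p: "p \<in> H v" "p \<in> H w" and x: "x \<in> H w" for w v p x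
  using const[OF w(1)] v p x by metis
 have cb: "P1 x - P2 x = c" if "x \<in> H ?b" for x
  by (rule same[OF ortho(2,1) c, of "?a + ?b"]) (use that in "auto simp: H_def inner_add_right inner_diff_right inner_axis_axis")
 have ca': "P1 x - P2 x = c" if "x \<in> H (- ?a)" for x
  by (rule same[OF ortho(3,2) cb, of "- ?a + ?b"]) (use that in "auto simp: H_def inner_add_right inner_diff_right inner_axis_axis")
 have cb': "P1 x - P2 x = c" if "x \<in> H (- ?b)" for x
  by (rule same[OF ortho(4,1) c, of "?a - ?b"]) (use that in "auto simp: H_def inner_add_right inner_diff_right inner_axis_axis")
 have eq: "P1 x = P2 x + c" if x: "x \<in> D1" "x \<in> D2" for x
 proof -
  have "x $ 1 ~= 0 \<or> x $ 2 ~= 0"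
  proof (rule ccontr)
   assume "\<not> ?thesis"
   then have xe: "x = (x $ 3) *^ e" by (simp add: e_def vec_eq_iff forall_3 axis_def)
   then have "norm x = \<bar>x $ 3\<bar>" using e(1) by (metis norm_scaleR mult.right_neutral)
   then have "x = norm x *^ e \<or> x = - (norm x *^ e)" using xe by (cases "x $ 3 >= 0") auto
   then show False using x norm_plus_inner_pos_iff[OF e(1), of x] norm_plus_inner_pos_iff[OF e(2), of x]
    unfolding D1_def D2_def by auto
  qed
  then have "x \<in> H ?a \<or> x \<in> H (- ?a) \<or> x \<in> H ?b \<or> x \<in> H (- ?b)" by (auto simp: H_def inner_axis')
  then show ?thesis using c cb ca' cb' by fastforce
 qed
 define P where "P z = (if z \<in> D1 then P1 z else P2 z + c)" for z
 have "(P has_derivative (%h. B z \<bullet> h)) (at z)" if z: "z ~= 0" for z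
 proof (cases "z \<in> D1")
  case True
  show ?thesis by (rule has_derivative_transform_within_open[OF d1[OF True] opn(1) True]) (simp add: P_def)
 next
  case False
  have "z \<in> D2"
  proof (rule ccontr)
   assume "z \<notin> D2"
   then have "\<not> norm z + z \<bullet> - e > 0" unfolding D2_def by blast
   moreover have "\<not> norm z + z \<bullet> e > 0" using False unfolding D1_def by blast
   ultimately have 1: "z = - (norm z *^ - e)" and 2: "z = - (norm z *^ e)"
    using norm_plus_inner_pos_iff[OF e(1), of z] norm_plus_inner_pos_iff[OF e(2), of z] by blast+
   have "z = norm z *^ e" using 1 by (simp only: scaleR_minus_right minus_minus)
   with 2 have "z = - z" by (metis (no_types))
   then show False using z by (simp add: vec_eq_iff)
  qed
  have "((%z. P2 z + c) has_derivative (%h. B z \<bullet> h)) (at z)"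
   using has_derivative_add[OF d2[OF \<open>z \<in> D2\<close>] has_derivative_const[of c]] by simp
  then show ?thesis
   by (rule has_derivative_transform_within_open[OF _ opn(2) \<open>z \<in> D2\<close>]) (use eq in "auto simp: P_def")
 qed
 then show ?thesis by blast
qed


section \<open>Pulling the field back along a map of class one\<close>

lemma compact_UN_cball:
 fixes K :: "'a::euclidean_space set"
 assumes "compact K"
 shows "compact (\<Union>x\<in>K. cball x r)"
proof -
 have "(\<Union>x\<in>K. cball x r) = {x + y | x y. x \<in> K \<and> y \<in> cball 0 r}" (is "?A = ?B")
 proof
  show "?A \<subseteq> ?B"
  proof
   fix z assume "z \<in> ?A"
   then obtain x where "x \<in> K" "dist x z <= r" by auto
   then show "z \<in> ?B" by (intro CollectI exI[of _ x] exI[of _ "z - x"]) (auto simp: dist_norm norm_minus_commute)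
  qed
 qed (auto simp: dist_norm)
 then show ?thesis using compact_sums[OF assms compact_cball[of 0 r]] by simp
qed

text \<open>Uniform continuity that reaches points near \<open>K\<close> but outside it, as
  mollification over balls requires.\<close>

lemma uniformly_near_compact:
 fixes F :: "'a::euclidean_space => 'b::real_normed_vector"
 assumes K: "compact K" "K \<subseteq> S" and S: "open S" and F: "continuous_on S F" and \<eta>: "\<eta> > 0"
 shows "\<exists>r>0. \<forall>x\<in>K. \<forall>y. dist x y <= r --> y \<in> S \<and> norm (F y - F x) <= \<eta>"
proof -
 obtain e where e: "e > 0" "(\<Union>x\<in>K. cball x e) \<subseteq> S"
  using compact_subset_open_imp_cball_epsilon_subset[OF K(1) S K(2)] by blast
 let ?Q = "\<Union>x\<in>K. cball x e"
 have "uniformly_continuous_on ?Q F"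
  by (rule compact_uniformly_continuous[OF continuous_on_subset[OF F e(2)] compact_UN_cball[OF K(1)]])
 then obtain d where d: "d > 0" "!!x y. x \<in> ?Q ==> y \<in> ?Q ==> dist y x < d ==> dist (F y) (F x) < \<eta>"
  unfolding uniformly_continuous_on_def using \<eta> by meson
 have "y \<in> S \<and> norm (F y - F x) <= \<eta>" if x: "x \<in> K" and y: "dist x y <= min e (d/2)" for x y
 proof -
  have "y \<in> ?Q" "x \<in> ?Q" using x y e(1) by (auto intro!: bexI[of _ x])
  moreover from this have "dist (F y) (F x) < \<eta>" using d(1) y by (intro d(2)) (auto simp: dist_commute)
  ultimately show ?thesis using subsetD[OF e(2)] by (simp add: dist_norm[of "F y"] less_imp_le)
 qed
 then show ?thesis using e(1) d(1) by (intro exI[of _ "min e (d/2)"]) auto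
qed

text \<open>For a field of class one the derivative moves from the kernel to the field, by
  integrating the gradient of \<open>k (x - z) * G z $ i\<close>.\<close>

lemma conv_jacobian_C1:
 assumes k: "C2_fun k g H" "!!x. x \<notin> cball 0 r ==> k x = 0" and G: "C1_on D G \<Gamma>" and D: "open D" "cball x r \<subseteq> D"
  and G': "integrable lborel G'" "!!z. z \<in> cball x r ==> G' z = G z"
 shows "conv_jacobian g G' x *v h = conv k (%z. indicator (cball x r) z *^ (\<Gamma> z *v h)) x"
proof -
 note C = C2_funD[OF k(1)]
 have k0: "k (x - z) = 0" "g (x - z) = 0" if z: "z \<notin> cball x r" for z
 proof -
  have "x - z \<notin> cball 0 r" using z by (simp add: dist_norm norm_minus_commute)
  then show "k (x - z) = 0" "g (x - z) = 0" using k(2) C2_support(1)[OF k(1) compact_cball k(2)] by blast+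
 qed
 have g0: "g z = 0" if "z \<notin> cball 0 r" for z by (rule C2_support(1)[OF k(1) compact_cball k(2) that])
 have eq: "(%h. conv (%y. g y \<bullet> h) G' x) = (%h. conv_jacobian g G' x *v h)"
 proof (rule has_derivative_unique)
  show "(conv k G' has_derivative (%h. conv (%y. g y \<bullet> h) G' x)) (at x)"
   by (rule conv_has_derivative[OF G'(1) C(1,5) compact_cball k(2) g0])
  show "(conv k G' has_derivative (%h. conv_jacobian g G' x *v h)) (at x)"
   by (rule conv_field_derivative(1)[OF k(1) compact_cball k(2) G'(1)])
 qed
 have cr: "continuous_on S (%z. k (x - z))" "continuous_on S (%z. g (x - z))" for S
  by (rule continuous_on_compose2[OF C(6)] continuous_on_compose2[OF C(5)]; auto intro!: continuous_intros)+
 have c\<Gamma>: "continuous_on D (%z. \<Gamma> z *v h)" by (intro matrix_vector_mult_continuous C1_onD(2)[OF G] continuous_intros)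
 have T: "C1_test D (%z. k (x - z)) (%z. - g (x - z))"
  unfolding C1_test_def using C2_funD(1,5)[OF C2_fun_reflect[OF k(1), of x]] D(2) k0 by (metis compact_cball)
 have i1: "integrable lborel (%z. k (x - z) *^ (\<Gamma> z *v h))"
  by (rule continuous_compact_support(3)[OF continuous_on_extend_zero[OF D(1) _ compact_cball D(2)] compact_cball[of x r]])
    (auto intro!: continuous_intros cr c\<Gamma> simp: k0)
 have i2: "integrable lborel (%z. (g (x - z) \<bullet> h) *^ G z)"
  by (rule continuous_compact_support(3)[OF continuous_on_extend_zero[OF D(1) _ compact_cball D(2)] compact_cball[of x r]])
    (auto intro!: continuous_intros cr C1_onD(3)[OF G] simp: k0)
 have "(LI z. (g (x - z) \<bullet> h) *^ G z) $ i = (LI z. k (x - z) *^ (\<Gamma> z *v h)) $ i" for i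
 proof -
  have d: "((%z. G z $ i) has_derivative (%h. \<Gamma> z $ i \<bullet> h)) (at z)" if "z \<in> D" for z
   using bounded_linear.has_derivative[OF bounded_linear_vec_nth C1_onD(1)[OF G that]] by (simp add: matrix_vector_mul_component)
  have c: "continuous_on D (%z. \<Gamma> z $ i)" by (intro continuous_intros C1_onD(2)[OF G])
  have "(LI z. (k (x - z) *^ \<Gamma> z $ i + G z $ i *^ - g (x - z)) \<bullet> h) = 0"
   by (rule C1_testE[OF C1_test_mult[OF T D(1) d c]]; assumption?) (rule integral_gradient_zero)
  moreover have "(k (x - z) *^ \<Gamma> z $ i + G z $ i *^ - g (x - z)) \<bullet> h
   = (k (x - z) *^ (\<Gamma> z *v h)) $ i - ((g (x - z) \<bullet> h) *^ G z) $ i" for z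
   by (simp add: inner_diff_left matrix_vector_mul_component)
  ultimately have "(LI z. (k (x - z) *^ (\<Gamma> z *v h)) $ i - ((g (x - z) \<bullet> h) *^ G z) $ i) = 0" by simp
  then show ?thesis
   using Bochner_Integration.integral_diff[OF integrable_bounded_linear[OF bounded_linear_vec_nth[of i] i1] integrable_bounded_linear[OF bounded_linear_vec_nth[of i] i2]]
   unfolding integral_bounded_linear[OF bounded_linear_vec_nth[of i] i1, symmetric] integral_bounded_linear[OF bounded_linear_vec_nth[of i] i2, symmetric]
   by simp
 qed
 then have "(LI z. (g (x - z) \<bullet> h) *^ G z) = (LI z. k (x - z) *^ (\<Gamma> z *v h))" by (simp add: vec_eq_iff)
 moreover have "(g (x - z) \<bullet> h) *^ G z = (g (x - z) \<bullet> h) *^ G' z" for z using G'(2) k0(2) by (cases "z \<in> cball x r") auto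
 moreover have "k (x - z) *^ (\<Gamma> z *v h) = k (x - z) *^ indicator (cball x r) z *^ (\<Gamma> z *v h)" for z
  using k0(1) by (cases "z \<in> cball x r") auto
 ultimately show ?thesis using fun_cong[OF eq, of h] by (simp add: conv_def)
qed

text \<open>The approximating field is the pullback of the mollified \<open>u\<close> along the
  mollified \<open>G\<close>. In the antisymmetric part of its Jacobian the second derivatives of
  the map cancel and the antisymmetric part of the field's Jacobian is a cross product with the
  mollified \<open>f u\<close>. What remains is close to \<open>f\<close> times the triple product
  in \<open>tri\<close>, which is zero.\<close>

lemma pullback_nearly_closed:
 assumes W: "weak_beltrami U f u" and U: "open U" and f: "continuous_on U f" and u: "continuous_on U u"
  and G: "C1_on D G \<Gamma>" and D: "open D" "!!z. z \<in> D ==> G z \<in> U"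
  and tri: "!!z h k. z \<in> D ==> (\<Gamma> z *v h) \<bullet> cross3 (u (G z)) (\<Gamma> z *v k) = 0"
  and Q: "compact Q" "Q \<subseteq> D"
 shows "nearly_closed Q (%z. transpose (\<Gamma> z) *v u (G z))"
 unfolding nearly_closed_def
proof (intro allI impI)
 fix \<epsilon> :: real assume \<epsilon>: "\<epsilon> > 0"
 define F where "F y = f y *^ u y" for y
 have F: "continuous_on U F" unfolding F_def by (intro continuous_intros f u)
 have GQ: "compact (G ` Q)" "G ` Q \<subseteq> U"
  using compact_continuous_image[OF continuous_on_subset[OF C1_onD(3)[OF G] Q(2)] Q(1)] D(2) Q(2) by auto
 obtain M1 where M1: "!!x. x \<in> Q ==> norm (\<Gamma> x) <= M1"
  using compact_continuous_bound[OF Q(1) continuous_on_subset[OF C1_onD(2)[OF G] Q(2)]] by blast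
 obtain M2 where M2: "!!y. y \<in> G ` Q ==> norm (u y) <= M2"
  using compact_continuous_bound[OF GQ(1) continuous_on_subset[OF u GQ(2)]] by blast
 obtain M3 where M3: "!!y. y \<in> G ` Q ==> norm (F y) <= M3"
  using compact_continuous_bound[OF GQ(1) continuous_on_subset[OF F GQ(2)]] by blast
 \<comment> \<open>The added 1 lets the mollified quantities, which are within
   \<open>\<eta> \<le> 1\<close> of the original ones, obey the same bound.\<close>
 define M where "M = max 0 (max M1 (max M2 M3)) + 1"
 have M: "M >= 1" and MQ: "!!x. x \<in> Q ==> norm (\<Gamma> x) + 1 <= M \<and> norm (u (G x)) + 1 <= M \<and> norm (F (G x)) + 1 <= M"
  using M1 M2 M3 unfolding M_def by (force simp: le_max_iff_disj)+
 \<comment> \<open>Three errors of size \<open>\<eta> M^2\<close> have to add up to at most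
   \<open>\<epsilon>\<close>.\<close>
 define \<eta> where "\<eta> = min 1 (\<epsilon> / (3 * M\<^sup>2))"
 have \<eta>: "\<eta> > 0" "\<eta> <= 1" "3 * \<eta> * M\<^sup>2 <= \<epsilon>" using \<epsilon> M by (auto simp: \<eta>_def min_def field_simps)
 obtain r1 where r1: "r1 > 0" "!!x y. x \<in> G ` Q ==> dist x y <= r1 ==> y \<in> U \<and> norm (u y - u x) <= \<eta>"
  using uniformly_near_compact[OF GQ U u \<eta>(1)] by blast
 obtain r2 where r2: "r2 > 0" "!!x y. x \<in> G ` Q ==> dist x y <= r2 ==> y \<in> U \<and> norm (F y - F x) <= \<eta>"
  using uniformly_near_compact[OF GQ U F \<eta>(1)] by blast
 \<comment> \<open>Halved because of two displacements: mollification moves \<open>G\<close> by at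
   most \<open>\<rho>\<close>, and \<open>u\<close> is averaged over radius
   \<open>\<rho>\<close>.\<close>
 define \<rho> where "\<rho> = min r1 r2 / 2"
 have \<rho>: "\<rho> > 0" "2 * \<rho> <= r1" "2 * \<rho> <= r2" using r1 r2 by (auto simp: \<rho>_def)
 obtain r3 where r3: "r3 > 0" "!!x y. x \<in> Q ==> dist x y <= r3 ==> y \<in> D \<and> norm (G y - G x) <= \<rho>"
  using uniformly_near_compact[OF Q D(1) C1_onD(3)[OF G] \<rho>(1)] by blast
 obtain r4 where r4: "r4 > 0" "!!x y. x \<in> Q ==> dist x y <= r4 ==> y \<in> D \<and> norm (\<Gamma> y - \<Gamma> x) <= \<eta>"
  using uniformly_near_compact[OF Q D(1) C1_onD(2)[OF G] \<eta>(1)] by blast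
 define r where "r = min r3 r4"
 have r: "r > 0" "r <= r3" "r <= r4" using r3 r4 by (auto simp: r_def)
 obtain k g H where k: "C2_fun k g H" "!!x. k x >= 0" "!!x. norm x > r ==> k x = 0" "integrable lborel k" "(LI x. k x) = 1"
  by (rule C2_kernel[OF r(1)]) (rule that)
 obtain k2 g2 H2 where k2: "C2_fun k2 g2 H2" "!!x. k2 x >= 0" "!!x. norm x > \<rho> ==> k2 x = 0" "integrable lborel k2" "(LI x. k2 x) = 1"
  by (rule C2_kernel[OF \<rho>(1)]) (rule that)
 have k0: "k x = 0" if "x \<notin> cball 0 r" for x using k(3) that by simp
 have k20: "k2 x = 0" if "x \<notin> cball 0 \<rho>" for x using k2(3) that by simp
 define G' where "G' z = indicator (\<Union>x\<in>Q. cball x r) z *^ G z" for z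
 define u' where "u' z = indicator (\<Union>x\<in>G ` Q. cball x (2*\<rho>)) z *^ u z" for z
 define F' where "F' z = f z *^ u' z" for z
 have NQ: "(\<Union>x\<in>Q. cball x r) \<subseteq> D" using r3(2) r(2) by fastforce
 have NU: "(\<Union>x\<in>G ` Q. cball x (2*\<rho>)) \<subseteq> U" using r1(2) \<rho>(2) by fastforce
 have G'i: "integrable lborel G'" unfolding G'_def
  by (rule borel_integrable_compact[OF compact_UN_cball[OF Q(1)] continuous_on_subset[OF C1_onD(3)[OF G] NQ]])
 have u'i: "integrable lborel u'" unfolding u'_def
  by (rule borel_integrable_compact[OF compact_UN_cball[OF GQ(1)] continuous_on_subset[OF u NU]])
 have F'e: "F' z = indicator (\<Union>x\<in>G ` Q. cball x (2*\<rho>)) z *^ F z" for z by (simp add: F'_def u'_def F_def)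
 have F'i: "integrable lborel F'" unfolding F'e[abs_def]
  by (rule borel_integrable_compact[OF compact_UN_cball[OF GQ(1)] continuous_on_subset[OF F NU]])
 define Gk where "Gk = conv k G'"
 define \<Gamma>k where "\<Gamma>k = conv_jacobian g G'"
 define uk where "uk = conv k2 u'"
 define Uk where "Uk = conv_jacobian g2 u'"
 define Fk where "Fk = conv k2 F'"
 have G'Q: "G' z = G z" if "x \<in> Q" "dist x z <= r" for x z using that by (auto simp: G'_def indicator_def)
 have u'Q: "u' z = u z \<and> F' z = F z" if "x \<in> Q" "dist (G x) z <= 2 * \<rho>" for x z using that by (auto simp: u'_def F'e indicator_def)
 have gk1: "norm (Gk x - G x) <= \<rho>" if x: "x \<in> Q" for x unfolding Gk_def
 proof (rule conv_uniform[OF conv_integrable[OF G'i C2_funD(6)[OF k(1)] compact_cball k0] k(4,5,2,3)])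
  show "norm (G' z - G x) <= \<rho>" if "dist x z <= r" for z using r3(2)[OF x, of z] r(2) G'Q[OF x that] that by simp
 qed
 have gk2: "norm (\<Gamma>k x *v h - \<Gamma> x *v h) <= \<eta> * norm h" if x: "x \<in> Q" for x h
 proof -
  have sub: "cball x r \<subseteq> D" using NQ x by blast
  have i: "integrable lborel (%z. indicator (cball x r) z *^ (\<Gamma> z *v h))"
   by (rule borel_integrable_compact[OF compact_cball])
     (intro matrix_vector_mult_continuous continuous_on_subset[OF C1_onD(2)[OF G] sub] continuous_intros)
  have eq: "\<Gamma>k x *v h = conv k (%z. indicator (cball x r) z *^ (\<Gamma> z *v h)) x" unfolding \<Gamma>k_def
   by (rule conv_jacobian_C1[OF k(1) k0 G D(1) sub G'i]) (use G'Q[OF x] in auto)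
  show ?thesis unfolding eq
  proof (rule conv_uniform[OF conv_integrable[OF i C2_funD(6)[OF k(1)] compact_cball k0] k(4,5,2,3)])
   fix z assume z: "dist x z <= r"
   have "norm ((\<Gamma> z - \<Gamma> x) *v h) <= \<eta> * norm h"
    by (rule order_trans[OF norm_matrix_vector_le]) (use r4(2)[OF x, of z] r(3) z in "auto intro!: mult_right_mono")
   then show "norm (indicator (cball x r) z *^ (\<Gamma> z *v h) - \<Gamma> x *v h) <= \<eta> * norm h"
    using z by (simp add: matrix_vector_mult_diff_rdistrib)
  qed
 qed
 have near: "dist (G x) z <= 2 * \<rho>" if x: "x \<in> Q" and z: "dist (Gk x) z <= \<rho>" for x z
  using gk1[OF x] z dist_triangle[of "G x" z "Gk x"] by (simp add: dist_norm norm_minus_commute)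
 have uk1: "norm (uk (Gk x) - u (G x)) <= \<eta>" if x: "x \<in> Q" for x unfolding uk_def
 proof (rule conv_uniform[OF conv_integrable[OF u'i C2_funD(6)[OF k2(1)] compact_cball k20] k2(4,5,2,3)])
  fix z assume "dist (Gk x) z <= \<rho>"
  from near[OF x this] show "norm (u' z - u (G x)) <= \<eta>" using u'Q[OF x] r1(2)[of "G x" z] x \<rho>(2) by auto
 qed
 have fk1: "norm (Fk (Gk x) - F (G x)) <= \<eta>" if x: "x \<in> Q" for x unfolding Fk_def
 proof (rule conv_uniform[OF conv_integrable[OF F'i C2_funD(6)[OF k2(1)] compact_cball k20] k2(4,5,2,3)])
  fix z assume "dist (Gk x) z <= \<rho>"
  from near[OF x this] show "norm (F' z - F (G x)) <= \<eta>" using u'Q[OF x] r2(2)[of "G x" z] x \<rho>(3) by auto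
 qed
 have anti: "Uk (Gk x) *v q - transpose (Uk (Gk x)) *v q = cross3 (Fk (Gk x)) q" if x: "x \<in> Q" for x q
  unfolding Uk_def Fk_def F'_def[abs_def]
 proof (rule mollified_beltrami(2)[OF W k2(1) compact_cball k20 _ u'i])
  fix z assume "Gk x - z \<in> cball 0 \<rho>"
  then have "dist (Gk x) z <= \<rho>" by (simp add: dist_norm norm_minus_commute)
  from near[OF x this] show "z \<in> U \<and> u' z = u z" using u'Q[OF x] r1(2)[of "G x" z] x \<rho>(2) by auto
 qed
 \<comment> \<open>The Hessian of the \<open>i\<close>-th component of \<open>Gk\<close>. Its
   symmetry makes the second derivatives cancel in \<open>hJ\<close>.\<close>
 define Hi where "Hi i x = (\<chi> j l. conv (%y. H y $ j $ l) (%z. G' z $ i) x)" for i x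
 have G'ii: "integrable lborel (%z. G' z $ i)" for i by (rule integrable_bounded_linear[OF bounded_linear_vec_nth G'i])
 have row: "C2_fun (conv k (%z. G' z $ i)) (%x. \<Gamma>k x $ i) (Hi i)" for i
 proof -
  have "\<Gamma>k x $ i = (\<chi> j. conv (%y. g y $ j) (%z. G' z $ i) x)" for x
  proof -
   have "g y = 0" if "y \<notin> cball 0 r" for y by (rule C2_support(1)[OF k(1) compact_cball k0 that])
   then have "g y $ j = 0" if "y \<notin> cball 0 r" for y j using that by simp
   moreover have "continuous_on UNIV (%y. g y $ j)" for j by (intro continuous_intros C2_funD(5)[OF k(1)])
   ultimately have "integrable lborel (%z. g (x - z) $ j *^ G' z)" for j by (intro conv_integrable[OF G'i _ compact_cball])
   from integral_bounded_linear[OF bounded_linear_vec_nth[of i] this] show ?thesis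
    by (simp add: \<Gamma>k_def conv_jacobian_def conv_def vec_eq_iff)
  qed
  then have "(%x. \<Gamma>k x $ i) = (%x. \<chi> j. conv (%y. g y $ j) (%z. G' z $ i) x)" by (rule ext)
  then show ?thesis unfolding Hi_def by (simp only:) (rule C2_fun_conv[OF k(1) compact_cball k0 G'ii])
 qed
 have rowC: "C1_on UNIV (%x. \<Gamma>k x $ i) (Hi i)" for i unfolding C1_on_def using C2_funD(2,3)[OF row] by blast
 define R where "R x = Uk (Gk x) ** \<Gamma>k x" for x
 have GkC: "C1_on UNIV Gk \<Gamma>k" and ukC: "C1_on UNIV uk Uk"
  unfolding C1_on_def Gk_def \<Gamma>k_def uk_def Uk_def
  using conv_field_derivative[OF k(1) compact_cball k0 G'i] conv_field_derivative[OF k2(1) compact_cball k20 u'i] by blast+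
 have RC: "C1_on UNIV (%x. uk (Gk x)) R" unfolding R_def by (rule C1_on_compose[OF GkC ukC]) simp
 have trm: "C1_on UNIV (%x. uk (Gk x) $ i *^ \<Gamma>k x $ i) (%x. uk (Gk x) $ i *^ Hi i x + outer (\<Gamma>k x $ i) (R x $ i))" for i
 proof (rule C1_on_scaleR[OF _ _ rowC])
  show "((%x. uk (Gk x) $ i) has_derivative (%h. R x $ i \<bullet> h)) (at x)" for x
   using bounded_linear.has_derivative[OF bounded_linear_vec_nth C1_onD(1)[OF RC UNIV_I]] by (simp add: matrix_vector_mul_component)
  show "continuous_on UNIV (%x. R x $ i)" by (intro continuous_intros C1_onD(2)[OF RC])
 qed
 \<comment> \<open>The vector \<open>transpose (\<Gamma>k x) *v uk (Gk x)\<close>, written as a sum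
   over rows so that the product rule applies to each summand.\<close>
 define b where "b x = uk (Gk x) $ 1 *^ \<Gamma>k x $ 1 + (uk (Gk x) $ 2 *^ \<Gamma>k x $ 2 + uk (Gk x) $ 3 *^ \<Gamma>k x $ 3)" for x
 define Jb where "Jb x = (uk (Gk x) $ 1 *^ Hi 1 x + outer (\<Gamma>k x $ 1) (R x $ 1)) +
  ((uk (Gk x) $ 2 *^ Hi 2 x + outer (\<Gamma>k x $ 2) (R x $ 2)) + (uk (Gk x) $ 3 *^ Hi 3 x + outer (\<Gamma>k x $ 3) (R x $ 3)))" for x
 have b: "C1_on UNIV b Jb" unfolding b_def Jb_def by (intro C1_on_add trm)
 have dot3: "p \<bullet> q = p $ 1 * q $ 1 + (p $ 2 * q $ 2 + p $ 3 * q $ 3)" for p q :: "real^3"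
  by (simp add: inner_vec_def sum_3)
 have bv: "v \<bullet> b x = (\<Gamma>k x *v v) \<bullet> uk (Gk x)" for v x
  unfolding dot3[of "\<Gamma>k x *v v" "uk (Gk x)"] b_def
  by (simp add: inner_add_right matrix_vector_mul_component inner_commute mult.commute)
 have hJ: "h \<bullet> (Jb x *v l) - l \<bullet> (Jb x *v h) = (\<Gamma>k x *v h) \<bullet> (R x *v l) - (\<Gamma>k x *v l) \<bullet> (R x *v h)" for h l x
 proof -
  have s: "h \<bullet> (Hi i x *v l) = l \<bullet> (Hi i x *v h)" for i
   using dot_lmul_matrix[of h "Hi i x" l] C2_funD(4)[OF row, of i x] transpose_matrix_vector[of "Hi i x" h] by (simp add: inner_commute)
  show ?thesis
   unfolding dot3[of "\<Gamma>k x *v h" "R x *v l"] dot3[of "\<Gamma>k x *v l" "R x *v h"]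
   by (simp add: Jb_def matrix_vector_mult_add_rdistrib scaleR_matrix_vector_assoc[symmetric] outer_mult_vec inner_add_right s
    matrix_vector_mul_component inner_commute[of _ "\<Gamma>k x $ _"] mult.commute)
 qed
 show "\<exists>b J. C1_on Q b J \<and> (\<forall>x\<in>Q. norm (b x - transpose (\<Gamma> x) *v u (G x)) <= \<epsilon>) \<and>
   (\<forall>x\<in>Q. \<forall>h k. \<bar>h \<bullet> (J x *v k) - k \<bullet> (J x *v h)\<bar> <= \<epsilon> * norm h * norm k)"
 proof (intro exI conjI ballI allI)
  show "C1_on Q b Jb" by (rule C1_on_subset[OF b]) simp
  fix x assume x: "x \<in> Q"
  have nG: "norm (\<Gamma> x *v h) <= M * norm h" for h
   by (rule order_trans[OF norm_matrix_vector_le]) (use MQ[OF x] in "auto intro!: mult_right_mono")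
  have nGk: "norm (\<Gamma>k x *v h) <= M * norm h" for h
  proof -
   have "norm (\<Gamma> x *v h) <= (M - 1) * norm h"
    by (rule order_trans[OF norm_matrix_vector_le]) (use MQ[OF x] in "auto intro!: mult_right_mono")
   moreover have "norm (\<Gamma>k x *v h) <= norm (\<Gamma>k x *v h - \<Gamma> x *v h) + norm (\<Gamma> x *v h)"
    using norm_triangle_ineq[of "\<Gamma>k x *v h - \<Gamma> x *v h" "\<Gamma> x *v h"] by simp
   moreover have "\<eta> * norm h <= 1 * norm h" using \<eta>(2) by (intro mult_right_mono) auto
   ultimately show ?thesis using gk2[OF x, of h] by (simp add: algebra_simps)
  qed
  have nuk: "norm (uk (Gk x)) <= M"
   using uk1[OF x] \<eta>(2) MQ[OF x] norm_triangle_ineq[of "uk (Gk x) - u (G x)" "u (G x)"] by simp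
  have nF: "norm (F (G x)) <= M" using MQ[OF x] by linarith
  have nFk: "norm (Fk (Gk x)) <= M"
   using fk1[OF x] \<eta>(2) MQ[OF x] norm_triangle_ineq[of "Fk (Gk x) - F (G x)" "F (G x)"] by simp
  have MM: "M <= M\<^sup>2" using M by (simp add: power2_eq_square)
  define v where "v = b x - transpose (\<Gamma> x) *v u (G x)"
  have "v \<bullet> v = (\<Gamma>k x *v v - \<Gamma> x *v v) \<bullet> uk (Gk x) + (\<Gamma> x *v v) \<bullet> (uk (Gk x) - u (G x))"
  proof -
   have "v \<bullet> (transpose (\<Gamma> x) *v u (G x)) = (\<Gamma> x *v v) \<bullet> u (G x)"
    using dot_lmul_matrix[of "u (G x)" "\<Gamma> x" v] transpose_matrix_vector[of "\<Gamma> x" "u (G x)"] by (simp add: inner_commute)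
   moreover have "v \<bullet> v = v \<bullet> b x - v \<bullet> (transpose (\<Gamma> x) *v u (G x))" by (subst (2) v_def) (simp only: inner_diff_right)
   ultimately show ?thesis using bv[of v x] by (simp add: inner_diff_left inner_diff_right)
  qed
  also have "\<dots> <= (\<eta> * norm v) * M + (M * norm v) * \<eta>"
   by (intro add_mono order_trans[OF norm_cauchy_schwarz] mult_mono gk2[OF x] nuk nG uk1[OF x]) (use \<eta> M in auto)
  finally have "norm v * norm v <= (2 * \<eta> * M) * norm v" by (simp add: dot_square_norm power2_eq_square algebra_simps)
  then have "norm v <= 2 * \<eta> * M" using \<eta>(1) M by (cases "norm v = 0") auto
  also have "\<dots> <= 3 * \<eta> * M\<^sup>2" using MM \<eta>(1) M by (intro mult_mono) auto
  finally show "norm (b x - transpose (\<Gamma> x) *v u (G x)) <= \<epsilon>" using \<eta>(3) by (simp add: v_def)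
  fix h l
  define p q p' q' where "p = \<Gamma>k x *v h" "q = \<Gamma>k x *v l" "p' = \<Gamma> x *v h" "q' = \<Gamma> x *v l"
  note pq = p_q_p'_q'_def
  have "h \<bullet> (Jb x *v l) - l \<bullet> (Jb x *v h) = p \<bullet> (Uk (Gk x) *v q) - q \<bullet> (Uk (Gk x) *v p)"
   unfolding hJ pq R_def by (simp add: matrix_vector_mul_assoc)
  also have "\<dots> = p \<bullet> (Uk (Gk x) *v q - transpose (Uk (Gk x)) *v q)"
   using dot_lmul_matrix[of q "Uk (Gk x)" p] transpose_matrix_vector[of "Uk (Gk x)" q] by (simp add: inner_diff_right inner_commute)
  also have "\<dots> = p \<bullet> cross3 (Fk (Gk x)) q" unfolding anti[OF x] ..
  \<comment> \<open>One factor is exchanged at a time; the product of the three limits vanishes by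
    \<open>tri\<close>.\<close>
  also have "\<dots> = (p - p') \<bullet> cross3 (Fk (Gk x)) q + p' \<bullet> cross3 (Fk (Gk x) - F (G x)) q + p' \<bullet> cross3 (F (G x)) (q - q')"
  proof -
   have "p' \<bullet> cross3 (F (G x)) q' = 0" using tri[of x h l] Q(2) x by (simp add: pq F_def cross_mult_left subset_iff)
   then show ?thesis by (simp add: inner_diff_left left_diff_distrib right_diff_distrib Cross3.left_diff_distrib Cross3.right_diff_distrib inner_diff_right)
  qed
  finally have eq: "h \<bullet> (Jb x *v l) - l \<bullet> (Jb x *v h) = \<dots>" .
  have t: "\<bar>a \<bullet> cross3 c d\<bar> <= \<eta> * M\<^sup>2 * norm h * norm l" if "norm a * (norm c * norm d) <= \<eta> * M\<^sup>2 * norm h * norm l" for a c d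
   by (rule order_trans[OF Cauchy_Schwarz_ineq2 order_trans[OF mult_left_mono[OF norm_cross3_le] that]]) simp
  have "\<bar>(p - p') \<bullet> cross3 (Fk (Gk x)) q\<bar> <= \<eta> * M\<^sup>2 * norm h * norm l"
  proof (rule t)
   have "norm (p - p') * (norm (Fk (Gk x)) * norm q) <= (\<eta> * norm h) * (M * (M * norm l))"
    unfolding pq by (intro mult_mono gk2[OF x] nFk nGk) (use \<eta> M in auto)
   then show "norm (p - p') * (norm (Fk (Gk x)) * norm q) <= \<eta> * M\<^sup>2 * norm h * norm l" by (simp add: power2_eq_square mult_ac)
  qed
  moreover have "\<bar>p' \<bullet> cross3 (Fk (Gk x) - F (G x)) q\<bar> <= \<eta> * M\<^sup>2 * norm h * norm l"
  proof (rule t)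
   have "norm p' * (norm (Fk (Gk x) - F (G x)) * norm q) <= (M * norm h) * (\<eta> * (M * norm l))"
    unfolding pq by (intro mult_mono fk1[OF x] nG nGk) (use \<eta> M in auto)
   then show "norm p' * (norm (Fk (Gk x) - F (G x)) * norm q) <= \<eta> * M\<^sup>2 * norm h * norm l" by (simp add: power2_eq_square mult_ac)
  qed
  moreover have "\<bar>p' \<bullet> cross3 (F (G x)) (q - q')\<bar> <= \<eta> * M\<^sup>2 * norm h * norm l"
  proof (rule t)
   have "norm p' * (norm (F (G x)) * norm (q - q')) <= (M * norm h) * (M * (\<eta> * norm l))"
    unfolding pq by (intro mult_mono gk2[OF x] nG nF) (use \<eta> M in auto)
   then show "norm p' * (norm (F (G x)) * norm (q - q')) <= \<eta> * M\<^sup>2 * norm h * norm l" by (simp add: power2_eq_square mult_ac)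
  qed
  ultimately have "\<bar>h \<bullet> (Jb x *v l) - l \<bullet> (Jb x *v h)\<bar> <= (3 * \<eta> * M\<^sup>2) * (norm h * norm l)"
   unfolding eq by (simp add: mult_ac)
  also have "\<dots> <= \<epsilon> * (norm h * norm l)" using \<eta>(3) by (intro mult_right_mono) auto
  finally show "\<bar>h \<bullet> (Jb x *v l) - l \<bullet> (Jb x *v h)\<bar> <= \<epsilon> * norm h * norm l" by (simp add: mult_ac)
 qed
qed


section \<open>Vanishing of the field near the spherical level set\<close>

text \<open>A step of class one made of two parabolas, \<open>2 t^2\<close> up to \<open>1/2\<close>
  and \<open>1 - 2 (1 - t)^2\<close> from there to 1.\<close>

definition smoothstep :: "real => real" where
 "smoothstep t = 2 * (pos_part t)\<^sup>2 - 4 * (pos_part (t - 1/2))\<^sup>2 + 2 * (pos_part (t - 1))\<^sup>2"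

definition smoothstep' :: "real => real" where
 "smoothstep' t = 4 * pos_part t - 8 * pos_part (t - 1/2) + 4 * pos_part (t - 1)"

lemma smoothstep_derivative: "(smoothstep has_real_derivative smoothstep' t) (at t)"
proof -
 have p0: "((%t. (pos_part t)\<^sup>2) has_real_derivative 2 * pos_part t) (at t)" for t
  using pos_part_power_derivative[of 1 t] by (simp add: numeral_2_eq_2)
 have p: "((%t. (pos_part (t - a))\<^sup>2) has_real_derivative 2 * pos_part (t - a) * 1) (at t)" for a t
  by (rule DERIV_chain2[OF p0]) (auto intro!: derivative_eq_intros)
 show ?thesis unfolding smoothstep_def[abs_def] smoothstep'_def
  by (rule derivative_eq_intros p p0 refl)+ (simp add: algebra_simps)
qed

lemma smoothstep:
 "t <= 0 ==> smoothstep t = 0" "1 <= t ==> smoothstep t = 1" "s <= t ==> smoothstep s <= smoothstep t"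
 "0 <= smoothstep t" "smoothstep t <= 1" "continuous_on S smoothstep'"
proof -
 show 1: "smoothstep t = 0" if "t <= 0" for t using that by (simp add: smoothstep_def pos_part_def)
 show 2: "smoothstep t = 1" if "1 <= t" for t
  using that by (simp add: smoothstep_def pos_part_def power2_eq_square algebra_simps)
 show 3: "smoothstep s <= smoothstep t" if "s <= t" for s t
  by (rule DERIV_nonneg_imp_nondecreasing[OF that]) (use smoothstep_derivative in "force simp: smoothstep'_def pos_part_def max_def")
 show "0 <= smoothstep t" using 1[of "min t 0"] 3[of "min t 0" t] by simp
 show "smoothstep t <= 1" using 2[of "max t 1"] 3[of t "max t 1"] by simp
 show "continuous_on S smoothstep'" unfolding smoothstep'_def[abs_def] pos_part_def by (intro continuous_intros)
qed

lemma coplanar_triple_product: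
 fixes n p q r :: "real^3"
 assumes "n ~= 0" "n \<bullet> p = 0" "n \<bullet> q = 0" "n \<bullet> r = 0"
 shows "p \<bullet> cross3 q r = 0"
proof (rule ccontr)
 let ?A = "vector [p, q, r] :: real^3^3"
 assume "p \<bullet> cross3 q r ~= 0"
 then have "det ?A ~= 0" by (simp add: dot_cross_det)
 moreover have "?A *v n = 0" using assms by (simp add: vec_eq_iff forall_3 matrix_vector_mul_component vector_3 inner_commute)
 ultimately show False using inv3(2)[of ?A n] assms(1) by simp
qed

text \<open>A single potential gives zero flux of \<open>u\<close> against its tangential gradient
  only when the level is frozen. Cutting the collar into many thin shells, each with its own frozen
  level, makes the sum of these fluxes differ from the integral of \<open>|u|^2\<close> by the
  oscillation of \<open>F\<close> across a shell.\<close>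

lemma collar_vanishing:
 assumes W: "weak_beltrami U f u" and U: "open U" and f: "!!x. x \<in> U ==> (f has_derivative (%h. f' x \<bullet> h)) (at x)"
  and f': "continuous_on U f'" and u: "continuous_on U u" and \<delta>: "0 < \<delta>" "\<delta> < 1" and N: "open N" "N \<subseteq> U"
  and \<Psi>: "C1_on N \<Psi> J" and Y: "C1_on {z. \<bar>norm z - 1\<bar> < \<delta>} Y L"
  and inN: "!!x. x \<in> N ==> \<bar>norm (\<Psi> x) - 1\<bar> < \<delta> \<and> Y (\<Psi> x) = x \<and> norm (\<Psi> x) = 1 + f x - c \<and> (\<forall>h. L (\<Psi> x) *v (J x *v h) = h)"
  and inA: "!!z. \<bar>norm z - 1\<bar> < \<delta> ==> Y z \<in> N \<and> \<Psi> (Y z) = z"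
 shows "\<exists>a r. r > 0 \<and> ball a r \<subseteq> U \<and> (\<forall>x\<in>ball a r. u x = 0)"
proof -
 define A where "A = {z::real^3. \<bar>norm z - 1\<bar> < \<delta>}"
 have Aop: "open A" unfolding A_def by (intro open_Collect_less continuous_intros)
 note YA = Y[folded A_def]
 have fc: "continuous_on U f"
  by (rule continuous_at_imp_continuous_on) (use f has_derivative_continuous in blast)
 have orth: "u x \<bullet> f' x = 0" if "x \<in> U" for x by (rule beltrami_orthogonal[OF W U f f' u that])
 have \<Psi>0: "\<Psi> x ~= 0" if "x \<in> N" for x using inN[OF that] \<delta> by auto
 have \<Psi>A: "\<Psi> x \<in> A" and in2: "Y (\<Psi> x) = x" and in4: "L (\<Psi> x) *v (J x *v h) = h" if "x \<in> N" for x h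
  using inN[OF that] unfolding A_def by blast+
 have fY: "f (Y z) = c + norm z - 1" if "z \<in> A" for z using inA[of z] inN[of "Y z"] that by (simp add: A_def)
 have YU: "Y z \<in> U" if "z \<in> A" for z using inA[of z] that N by (auto simp: A_def)
 have dfY: "f' (Y z) \<bullet> (L z *v h) = sgn z \<bullet> h" if z: "z \<in> A" for z h
 proof -
  have z0: "z ~= 0" using z \<delta> by (auto simp: A_def)
  have "((%z. f (Y z)) has_derivative (%h. f' (Y z) \<bullet> (L z *v h))) (at z)"
   by (rule has_derivative_compose[OF C1_onD(1)[OF YA z] f[OF YU[OF z]]])
  moreover have "((%z. f (Y z)) has_derivative (%h. sgn z \<bullet> h)) (at z)"
  proof (rule has_derivative_transform_within_open[OF _ Aop z])
   show "((%z. (c - 1) + norm z) has_derivative (%h. sgn z \<bullet> h)) (at z)"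
    using has_derivative_add[OF has_derivative_const[of "c - 1"] norm_has_derivative[OF z0]] by simp
  qed (simp add: fY)
  ultimately have "(%h. f' (Y z) \<bullet> (L z *v h)) = (%h. sgn z \<bullet> h)" by (rule has_derivative_unique)
  then show ?thesis by metis
 qed
 have f'0: "f' (Y z) ~= 0" if z: "z \<in> A" for z
 proof
  assume "f' (Y z) = 0"
  then have "norm z = 0" using dfY[OF z, of z] by (simp add: sgn_div_norm dot_square_norm power2_eq_square)
  then show False using z \<delta> by (auto simp: A_def)
 qed
 have sA: "s *^ sgn z \<in> A" if "\<bar>s - 1\<bar> < \<delta>" "z ~= 0" for s z
  using that \<delta> by (simp add: A_def norm_sgn)
 \<comment> \<open>\<open>G s\<close> sends a point radially to the level \<open>s\<close>, and
   \<open>F s x\<close> pairs the transported vector \<open>u x\<close> with the field found there.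
   At \<open>s = norm (\<Psi> x)\<close> nothing is moved and \<open>F\<close> is
   \<open>|u x|^2\<close>.\<close>
 define G where "G s z = Y (s *^ sgn z)" for s z
 define \<Gamma> where "\<Gamma> s z = L (s *^ sgn z) ** (s *^ sgn_jacobian z)" for s z
 define F where "F s x = (\<Gamma> s (\<Psi> x) *v (J x *v u x)) \<bullet> u (G s (\<Psi> x))" for s x
 have G: "C1_on (- {0}) (G s) (\<Gamma> s)" if s: "\<bar>s - 1\<bar> < \<delta>" for s
  unfolding G_def \<Gamma>_def
 proof (rule C1_on_compose[OF _ YA sA[OF s]])
  show "C1_on (- {0}) (%z. s *^ sgn z) (%z. s *^ sgn_jacobian z)"
   unfolding C1_on_def scaleR_matrix_vector_assoc[symmetric]
   using C1_on_sgn by (auto simp: C1_on_def intro!: has_derivative_scaleR_right continuous_intros)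
 qed auto
 have GU: "G s z \<in> U" if "\<bar>s - 1\<bar> < \<delta>" "z \<in> - {0}" for s z using YU[OF sA[of s z]] that by (simp add: G_def)
 \<comment> \<open>On one level the pulled-back field is closed: \<open>u\<close> and the image of
   \<open>\<Gamma> s z\<close> are tangent to the level set, so the triple product with the curl
   \<open>f u\<close> is zero.\<close>
 have potential: "\<exists>P. \<forall>z. z ~= 0 --> (P has_derivative (%h. (transpose (\<Gamma> s z) *v u (G s z)) \<bullet> h)) (at z)" if s: "\<bar>s - 1\<bar> < \<delta>" for s
 proof (rule punctured_space_potential)
  have c: "continuous_on (- {0}) (%z. transpose (\<Gamma> s z))"
   unfolding transpose_def by (intro continuous_intros C1_onD(2)[OF G[OF s]])
  show "continuous_on (- {0}) (%z. transpose (\<Gamma> s z) *v u (G s z))"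
   by (intro matrix_vector_mult_continuous c continuous_on_compose2[OF u C1_onD(3)[OF G[OF s]]]) (use GU[OF s] in auto)
  show "nearly_closed Q (%z. transpose (\<Gamma> s z) *v u (G s z))" if Q: "compact Q" "Q \<subseteq> - {0}" for Q
  proof (rule pullback_nearly_closed[OF W U fc u G[OF s] _ GU[OF s] _ Q])
   fix z h k assume z: "z \<in> - {0::real^3}"
   have zA: "s *^ sgn z \<in> A" using sA[OF s] z by simp
   have t: "f' (G s z) \<bullet> (\<Gamma> s z *v h) = 0" for h
   proof -
    have z0: "norm z > 0" using z by simp
    have "sgn z \<bullet> (sgn_jacobian z *v h) = 0"
     using z0 by (simp add: sgn_jacobian_mult sgn_div_norm inner_diff_right dot_square_norm power2_eq_square power3_eq_cube)
      (simp add: field_simps)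
    moreover have "sgn (sgn z) = sgn z" using z0 by (simp add: sgn_div_norm[of "sgn z"] norm_sgn)
    ultimately show ?thesis unfolding G_def \<Gamma>_def matrix_vector_mul_assoc[symmetric] dfY[OF zA]
     by (simp add: scaleR_matrix_vector_assoc[symmetric] sgn_scaleR)
   qed
   show "(\<Gamma> s z *v h) \<bullet> cross3 (u (G s z)) (\<Gamma> s z *v k) = 0"
    by (rule coplanar_triple_product[OF f'0[OF zA, folded G_def] t _ t])
      (use orth[OF GU[OF s z]] in "simp add: inner_commute")
  qed (auto simp: open_Compl)
 qed
 have Jn: "sgn (\<Psi> x) \<bullet> (J x *v h) = f' x \<bullet> h" if x: "x \<in> N" for x h
  using dfY[OF \<Psi>A[OF x], of "J x *v h"] by (simp add: in2[OF x] in4[OF x])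
 define C where "C l h = Y ` {z::real^3. l <= norm z \<and> norm z <= h}" for l h
 have shell: "{z::real^3. l <= norm z \<and> norm z <= h} \<subseteq> A" if "1 - \<delta> < l" "h < 1 + \<delta>" for l h
  using that by (auto simp: A_def)
 have C: "compact (C l h)" "C l h \<subseteq> N" if lh: "1 - \<delta> < l" "h < 1 + \<delta>" for l h
 proof -
  have "closed {z::real^3. l <= norm z \<and> norm z <= h}" by (intro closed_Collect_conj closed_Collect_le continuous_intros)
  moreover have "bounded {z::real^3. l <= norm z \<and> norm z <= h}" by (auto simp: bounded_iff)
  ultimately have "compact {z::real^3. l <= norm z \<and> norm z <= h}" by (simp add: compact_eq_bounded_closed)
  then show "compact (C l h)" unfolding C_def
   by (intro compact_continuous_image continuous_on_subset[OF C1_onD(3)[OF YA] shell[OF lh]])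
  show "C l h \<subseteq> N" using inA shell[OF lh] by (auto simp: C_def A_def)
 qed
 have memC: "x \<in> C l h" if "x \<in> N" "l <= norm (\<Psi> x)" "norm (\<Psi> x) <= h" for x l h
  using that inN[OF that(1)] unfolding C_def by (intro image_eqI[of _ _ "\<Psi> x"]) auto
 \<comment> \<open>The divergence equation tested with
   \<open>\<kappa> (norm (\<Psi> x)) * P (\<Psi> x)\<close>. The gradient of the first factor points
   along \<open>grad f\<close> and is orthogonal to \<open>u\<close>; the rest is the
   integrand.\<close>
 have flux: "(LI x. (if x \<in> N then \<kappa> (norm (\<Psi> x)) * F s x else 0)) = 0"
  if s: "\<bar>s - 1\<bar> < \<delta>" and lh: "1 - \<delta> < l" "h < 1 + \<delta>" and \<kappa>: "!!t. (\<kappa> has_real_derivative \<kappa>' t) (at t)" "continuous_on UNIV \<kappa>'"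
   "!!t. \<not> (l <= t \<and> t <= h) ==> \<kappa> t = 0" for s l h \<kappa> \<kappa>'
 proof -
  from potential[OF s] obtain P where P: "\<forall>z. z ~= 0 --> (P has_derivative (%h. (transpose (\<Gamma> s z) *v u (G s z)) \<bullet> h)) (at z)" by (elim exE)
  define B where "B z = transpose (\<Gamma> s z) *v u (G s z)" for z
  note Cl = C[OF lh]
  define \<phi> where "\<phi> x = (if x \<in> N then \<kappa> (norm (\<Psi> x)) * P (\<Psi> x) else 0)" for x
  define g where "g x = (if x \<in> N then (P (\<Psi> x) * \<kappa>' (norm (\<Psi> x))) *^ f' x + \<kappa> (norm (\<Psi> x)) *^ (transpose (J x) *v B (\<Psi> x)) else 0)" for x
  have \<phi>0: "\<phi> x = 0" if "x \<notin> C l h" for x using memC[of x l h] that \<kappa>(3) by (auto simp: \<phi>_def)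
  have dN: "(\<phi> has_derivative (%h. g x \<bullet> h)) (at x)" if x: "x \<in> N" for x
  proof (rule has_derivative_transform_within_open[OF _ N(1) x])
   have xU: "x \<in> U" using x N by blast
   have "((%x. P (\<Psi> x)) has_derivative (%h. B (\<Psi> x) \<bullet> (J x *v h))) (at x)"
    unfolding B_def by (rule has_derivative_compose[OF C1_onD(1)[OF \<Psi> x]]) (use P \<Psi>0[OF x] in blast)
   moreover have "((%x. \<kappa> (1 + f x - c)) has_derivative (%h. (f' x \<bullet> h) * \<kappa>' (1 + f x - c))) (at x)"
   proof (rule has_derivative_eq_rhs, rule has_derivative_compose[of "%x. 1 + f x - c"])
    show "((%x. 1 + f x - c) has_derivative (%h. f' x \<bullet> h)) (at x)"
     using has_derivative_diff[OF has_derivative_add[OF has_derivative_const[of 1] f[OF xU]] has_derivative_const[of c]] by simp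
    show "(\<kappa> has_derivative (%t. \<kappa>' (1 + f x - c) * t)) (at (1 + f x - c))"
     using \<kappa>(1) by (simp add: has_field_derivative_def)
   qed (simp add: mult.commute)
   ultimately show "((%x. \<kappa> (1 + f x - c) * P (\<Psi> x)) has_derivative (%h. g x \<bullet> h)) (at x)"
    using inN[OF x] x dot_lmul_matrix[of "B (\<Psi> x)" "J x"]
    by (rule_tac has_derivative_eq_rhs, rule_tac has_derivative_mult) (auto simp: g_def fun_eq_iff inner_add_left mult_ac)
   show "\<kappa> (1 + f y - c) * P (\<Psi> y) = \<phi> y" if "y \<in> N" for y using inN[OF that] that by (simp add: \<phi>_def)
  qed
  have g0: "g x = 0" if xC: "x \<notin> C l h" for x
  proof (cases "x \<in> N")
   case True
   have "(%h. g x \<bullet> h) = (%h. 0)"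
    by (rule vanishing_derivative[OF compact_imp_closed[OF Cl(1)] \<phi>0 dN[OF True] xC])
   then have "g x \<bullet> g x = 0" by metis
   then show ?thesis by simp
  qed (simp add: g_def)
  have d: "(\<phi> has_derivative (%h. g x \<bullet> h)) (at x)" for x
  proof (cases "x \<in> N")
   case False
   then have xC: "x \<in> - C l h" using Cl(2) by blast
   have "(\<phi> has_derivative (%h. 0)) (at x)"
    by (rule has_derivative_transform_within_open[OF has_derivative_const[of 0] open_Compl[OF compact_imp_closed[OF Cl(1)]] xC]) (simp add: \<phi>0)
   then show ?thesis using g0 xC by simp
  qed (rule dN)
  have cB: "continuous_on N (%x. B (\<Psi> x))"
  proof (rule continuous_on_compose2[OF _ C1_onD(3)[OF \<Psi>], of "- {0}"])
   have "continuous_on (- {0}) (%z. transpose (\<Gamma> s z))"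
    unfolding transpose_def by (intro continuous_intros C1_onD(2)[OF G[OF s]])
   then show "continuous_on (- {0}) B" unfolding B_def
    by (intro matrix_vector_mult_continuous continuous_on_compose2[OF u C1_onD(3)[OF G[OF s]]]) (use GU[OF s] in auto)
  qed (use \<Psi>0 in auto)
  have cP: "continuous_on N (%x. P (\<Psi> x))"
  proof (rule continuous_on_compose2[OF _ C1_onD(3)[OF \<Psi>], of "- {0}"])
   show "continuous_on (- {0}) P"
    by (rule continuous_at_imp_continuous_on) (use P has_derivative_continuous in blast)
  qed (use \<Psi>0 in auto)
  have cJ: "continuous_on N (%x. transpose (J x))" unfolding transpose_def by (intro continuous_intros C1_onD(2)[OF \<Psi>])
  have c\<kappa>: "continuous_on UNIV \<kappa>" by (rule continuous_at_imp_continuous_on) (use \<kappa>(1) DERIV_isCont in blast)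
  have "continuous_on N (%x. (P (\<Psi> x) * \<kappa>' (norm (\<Psi> x))) *^ f' x + \<kappa> (norm (\<Psi> x)) *^ (transpose (J x) *v B (\<Psi> x)))"
   by (intro continuous_on_add continuous_on_scaleR continuous_on_mult matrix_vector_mult_continuous cP cJ cB continuous_on_subset[OF f' N(2)]
    continuous_on_compose2[OF \<kappa>(2)] continuous_on_compose2[OF c\<kappa>] continuous_on_norm C1_onD(3)[OF \<Psi>]) auto
  then have gN: "continuous_on N g" by (rule continuous_on_eq) (simp add: g_def)
  have "C1_test U \<phi> g" unfolding C1_test_def
   using d continuous_on_extend_zero[OF N(1) gN Cl g0] Cl N(2) \<phi>0 by (metis subset_trans)
  from weak_beltramiD(4)[OF W this] have "(LI x. u x \<bullet> g x) = 0" .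
  moreover have "u x \<bullet> g x = (if x \<in> N then \<kappa> (norm (\<Psi> x)) * F s x else 0)" for x
  proof (cases "x \<in> N")
   case True
   have "u x \<bullet> (transpose (J x) *v B (\<Psi> x)) = F s x"
    using dot_lmul_matrix[of "B (\<Psi> x)" "J x" "u x"] dot_lmul_matrix[of "u (G s (\<Psi> x))" "\<Gamma> s (\<Psi> x)" "J x *v u x"]
    by (simp add: F_def B_def inner_commute)
   then show ?thesis using True orth[of x] N(2) by (auto simp: g_def inner_add_right simp del: transpose_matrix_vector)
  qed (simp add: g_def)
  ultimately show ?thesis by simp
 qed
 have Fs: "F (norm (\<Psi> x)) x = (norm (u x))\<^sup>2" if x: "x \<in> N" for x
 proof -
  let ?z = "\<Psi> x"
  have e: "norm ?z *^ sgn ?z = ?z" using \<Psi>0[OF x] by (simp add: sgn_div_norm)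
  have "sgn ?z \<bullet> (J x *v u x) = 0" using Jn[OF x, of "u x"] orth[of x] x N(2) by (auto simp: inner_commute)
  then have "?z \<bullet> (J x *v u x) = 0" using e by (metis inner_scaleR_left mult_zero_right)
  then have "norm ?z *^ (sgn_jacobian ?z *v (J x *v u x)) = J x *v u x" using \<Psi>0[OF x] by (simp add: sgn_jacobian_mult)
  then have "\<Gamma> (norm ?z) ?z *v (J x *v u x) = u x"
   by (simp add: in4[OF x] \<Gamma>_def e matrix_vector_mul_assoc[symmetric] scaleR_matrix_vector_assoc[symmetric])
  then show ?thesis by (simp add: in2[OF x] F_def G_def e dot_square_norm)
 qed
 have Fc: "continuous_on ({s. \<bar>s - 1\<bar> < \<delta>} \<times> N) (%(s, x). F s x)"
 proof -
  let ?D = "{s. \<bar>s - 1\<bar> < \<delta>} \<times> N"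
  have c\<Psi>: "continuous_on ?D (%p. \<Psi> (snd p))" "continuous_on ?D (%p. J (snd p))" "continuous_on ?D (%p. u (snd p))"
   by (rule continuous_on_compose2[OF C1_onD(3)[OF \<Psi>]] continuous_on_compose2[OF C1_onD(2)[OF \<Psi>]] continuous_on_compose2[OF u];
     use N(2) in "auto intro!: continuous_intros")+
  have cs: "continuous_on ?D (%p. sgn (\<Psi> (snd p)))" "continuous_on ?D (%p. sgn_jacobian (\<Psi> (snd p)))"
   by (rule continuous_on_compose2[OF C1_onD(3)[OF C1_on_sgn] c\<Psi>(1)] continuous_on_compose2[OF C1_onD(2)[OF C1_on_sgn] c\<Psi>(1)];
     use \<Psi>0 in auto)+
  have cz: "continuous_on ?D (%p. fst p *^ sgn (\<Psi> (snd p)))" by (intro continuous_intros cs)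
  have sub: "fst p *^ sgn (\<Psi> (snd p)) \<in> A" if "p \<in> ?D" for p using sA \<Psi>0 that by auto
  have cL: "continuous_on ?D (%p. L (fst p *^ sgn (\<Psi> (snd p))))" and cY: "continuous_on ?D (%p. Y (fst p *^ sgn (\<Psi> (snd p))))"
   by (rule continuous_on_compose2[OF C1_onD(2)[OF YA] cz] continuous_on_compose2[OF C1_onD(3)[OF YA] cz]; use sub in auto)+
  have cu: "continuous_on ?D (%p. u (Y (fst p *^ sgn (\<Psi> (snd p)))))"
   by (rule continuous_on_compose2[OF u cY]) (use sub YU in auto)
  show ?thesis unfolding case_prod_beta F_def \<Gamma>_def G_def
   by (intro continuous_on_inner matrix_vector_mult_continuous matrix_mult_continuous continuous_on_scaleR cL cs cu c\<Psi> continuous_on_fst continuous_on_id)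
 qed
 have Fcs: "continuous_on N (F s)" if "\<bar>s - 1\<bar> < \<delta>" for s
 proof -
  have "continuous_on N (%x. (s, x))" by (intro continuous_intros)
  from continuous_on_compose2[OF Fc this] that show ?thesis by auto
 qed
 \<comment> \<open>The cutoffs live in the shell of half width \<open>\<delta>/2\<close>, and the
   conclusion is drawn in \<open>C'\<close> of half width \<open>\<delta>/4\<close>, where they add
   up to 1.\<close>
 define l h where "l = 1 - \<delta>/2" and "h = 1 + \<delta>/2"
 have lh: "1 - \<delta> < l" "h < 1 + \<delta>" "l < h" using \<delta> by (auto simp: l_def h_def)
 note Cl = C[OF lh(1,2)]
 define C' where "C' = C (1 - \<delta>/4) (1 + \<delta>/4)"
 have C': "compact C'" "C' \<subseteq> N" unfolding C'_def by (rule C; use \<delta> in simp)+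
 define q where "q x = indicator C' x *^ (norm (u x))\<^sup>2" for x
 have qi: "integrable lborel q" unfolding q_def
  by (rule borel_integrable_compact[OF C'(1)]) (intro continuous_intros continuous_on_subset[OF u] order_trans[OF C'(2) N(2)])
 define V where "V = measure lborel (C l h)"
 have Vi: "integrable lborel (%x. e * indicator (C l h) x :: real)" for e
  by (intro integrable_mult_right integrable_real_indicator) (use Cl(1) emeasure_compact_finite[of "C l h"] in "auto intro: borel_compact")
 \<comment> \<open>The measure \<open>V\<close> is fixed while \<open>e\<close> is arbitrary, so the
   integral of \<open>q\<close> must be zero.\<close>
 have est: "(LI x. q x) <= e * V" if e: "e > 0" for e
 proof -
  have "{l..h} \<times> C l h \<subseteq> {s. \<bar>s - 1\<bar> < \<delta>} \<times> N" using Cl(2) \<delta> by (auto simp: l_def h_def)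
  then have "uniformly_continuous_on ({l..h} \<times> C l h) (%(s, x). F s x)"
   by (intro compact_uniformly_continuous continuous_on_subset[OF Fc] compact_Times compact_Icc Cl(1))
  then obtain d where d: "d > 0" "!!p p'. p \<in> {l..h} \<times> C l h ==> p' \<in> {l..h} \<times> C l h ==> dist p' p < d ==>
    dist (case p' of (s, x) => F s x) (case p of (s, x) => F s x) < e"
   unfolding uniformly_continuous_on_def using e by meson
  have dF: "\<bar>F s x - F t x\<bar> <= e" if "x \<in> C l h" "s \<in> {l..h}" "t \<in> {l..h}" "\<bar>s - t\<bar> < d" for x s t
   using d(2)[of "(t, x)" "(s, x)"] that by (auto simp: dist_Pair_Pair dist_real_def)
  \<comment> \<open>Makes the width \<open>w\<close> smaller than the modulus \<open>d\<close> of
    uniform continuity and no larger than the gap \<open>\<delta>/4\<close> between the two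
    shells.\<close>
  obtain n :: nat where n: "real n > \<delta> / min d (\<delta>/4)" using reals_Archimedean2 by blast
  \<comment> \<open>There are \<open>n\<close> overlapping cutoffs, each of length
    \<open>2 w\<close>; together they span \<open>n + 1\<close> intervals of length
    \<open>w\<close>, exactly from \<open>l\<close> to \<open>h\<close>.\<close>
  define w where "w = \<delta> / real (n + 1)"
  have w0: "w > 0" using \<delta> by (simp add: w_def)
  have "\<delta> < real n * min d (\<delta>/4)" using n d(1) \<delta>(1) by (simp add: pos_divide_less_eq)
  also have "\<dots> <= real (n + 1) * min d (\<delta>/4)" using d(1) \<delta>(1) by (intro mult_right_mono) auto
  finally have fin: "\<delta> < real (n + 1) * min d (\<delta>/4)" .
  define m where "m = min d (\<delta>/4)"
  have "w < m" using fin unfolding m_def[symmetric] by (simp add: w_def pos_divide_less_eq mult.commute)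
  then have w: "w < d" "w <= \<delta>/4" by (auto simp: m_def)
  have nw: "l + real (n + 1) * w = h" by (simp add: w_def l_def h_def)
  define \<theta> where "\<theta> t i = smoothstep ((t - l) / w - real i)" for t i
  define \<kappa> where "\<kappa> i t = \<theta> t i - \<theta> t (Suc i)" for i t
  define \<kappa>' where "\<kappa>' i t = (smoothstep' ((t - l) / w - real i) - smoothstep' ((t - l) / w - real (Suc i))) / w" for i t
  define S where "S i = l + real (Suc i) * w" for i
  have \<kappa>0: "\<kappa> i t >= 0" for i t unfolding \<kappa>_def \<theta>_def using smoothstep(3) by simp
  have \<kappa>s: "l + real i * w <= t \<and> t <= l + (real i + 2) * w" if "\<kappa> i t ~= 0" for i t
  proof (rule ccontr)
   assume "\<not> ?thesis"
   then have "t < l + real i * w \<or> t > l + (real i + 2) * w" by auto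
   then have "(t - l) / w <= real i \<or> (t - l) / w >= real i + 2" using w0 by (auto simp: pos_divide_le_eq pos_le_divide_eq algebra_simps)
   then have "\<kappa> i t = 0" by (auto simp: \<kappa>_def \<theta>_def smoothstep(1,2))
   then show False using that by simp
  qed
  have iw: "(real i + 2) * w <= real (n + 1) * w" "real i * w >= 0" if "i < n" for i
   using that w0 by (auto intro!: mult_right_mono)
  have \<kappa>lh: "\<kappa> i t = 0" if "i < n" "\<not> (l <= t \<and> t <= h)" for i t
   using \<kappa>s[of i t] iw[OF that(1)] that(2) nw by linarith
  have Si: "S i \<in> {l..h}" "\<bar>S i - 1\<bar> < \<delta>" if "i < n" for i
  proof -
   have "real (Suc i) * w <= real (n + 1) * w" using that w0 by (intro mult_right_mono) auto
   then have "S i <= h" using nw unfolding S_def by linarith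
   moreover have "l <= S i" using w0 by (simp add: S_def)
   ultimately show "S i \<in> {l..h}" by simp
   then show "\<bar>S i - 1\<bar> < \<delta>" using \<delta> by (auto simp: l_def h_def)
  qed
  have \<kappa>d: "(\<kappa> i has_real_derivative \<kappa>' i t) (at t)" for i t
  proof -
   have "((%t. \<theta> t j) has_real_derivative smoothstep' ((t - l) / w - real j) * (1 / w)) (at t)" for j
    unfolding \<theta>_def by (rule DERIV_chain2[OF smoothstep_derivative]) (use w0 in "auto intro!: derivative_eq_intros")
   from DERIV_diff[OF this[of i] this[of "Suc i"]] show ?thesis
    unfolding \<kappa>_def[abs_def] \<kappa>'_def by (simp add: diff_divide_distrib)
  qed
  have \<kappa>c: "continuous_on UNIV (\<kappa>' i)" for i unfolding \<kappa>'_def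
   by (intro continuous_intros continuous_on_compose2[OF smoothstep(6)[of UNIV]]) (use w0 in auto)
  define I where "I i x = (if x \<in> N then \<kappa> i (norm (\<Psi> x)) * F (S i) x else 0)" for i x
  have I0: "I i x = 0" if "i < n" "x \<notin> C l h" for i x using memC[of x l h] \<kappa>lh[OF that(1)] that by (auto simp: I_def)
  have Ii: "integrable lborel (I i)" if i: "i < n" for i
  proof (rule continuous_compact_support(3)[OF continuous_on_extend_zero[OF N(1) _ Cl] Cl(1)])
   have c: "continuous_on UNIV (\<kappa> i)" by (rule continuous_at_imp_continuous_on) (use \<kappa>d DERIV_isCont in blast)
   have "continuous_on N (%x. norm (\<Psi> x))" by (intro continuous_on_norm C1_onD(3)[OF \<Psi>])
   from continuous_on_compose2[OF c this subset_UNIV] Fcs[OF Si(2)[OF i]]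
   have "continuous_on N (%x. \<kappa> i (norm (\<Psi> x)) * F (S i) x)" by (rule continuous_on_mult)
   then show "continuous_on N (I i)" by (rule continuous_on_eq) (simp add: I_def)
  qed (use I0 i in auto)
  have int0: "(LI x. (\<Sum>i<n. I i x)) = 0"
  proof -
   have "(LI x. (\<Sum>i<n. I i x)) = (\<Sum>i<n. \<integral>x. I i x \<partial>lborel)"
    by (rule Bochner_Integration.integral_sum) (use Ii in auto)
   also have "\<dots> = 0" unfolding I_def
    by (intro sum.neutral ballI flux[OF Si(2) lh(1,2) \<kappa>d \<kappa>c]) (use \<kappa>lh in auto)
   finally show ?thesis .
  qed
  \<comment> \<open>Where a cutoff is active, its frozen level is within \<open>w\<close> of the
    true one, so \<open>F\<close> is at least \<open>|u|^2 - e\<close>. The telescoped sum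
    \<open>T\<close> lies between 0 and 1 and equals 1 on \<open>C'\<close>.\<close>
  have pt: "q x - e * indicator (C l h) x <= (\<Sum>i<n. I i x)" for x
  proof (cases "x \<in> C l h")
   case False
   then have "x \<notin> C'" unfolding C'_def C_def using \<delta> by (auto simp: l_def h_def)
   then show ?thesis using False I0 by (simp add: q_def)
  next
   case True
   then have x: "x \<in> N" using Cl(2) by blast
   let ?t = "norm (\<Psi> x)"
   have t: "?t \<in> {l..h}" using True inA shell[OF lh(1,2)] by (auto simp: C_def A_def)
   define T where "T = (\<Sum>i<n. \<kappa> i ?t)"
   have Tt: "T = \<theta> ?t 0 - \<theta> ?t n" unfolding T_def \<kappa>_def by (rule sum_lessThan_telescope')
   have T1: "T <= 1" unfolding Tt \<theta>_def
    using smoothstep(5)[of "(?t - l) / w - real 0"] smoothstep(4)[of "(?t - l) / w - real n"] by linarith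
   have T0: "T >= 0" unfolding T_def by (intro sum_nonneg \<kappa>0)
   have "\<kappa> i ?t * ((norm (u x))\<^sup>2 - e) <= I i x" if i: "i < n" for i
   proof (cases "\<kappa> i ?t = 0")
    case False
    from \<kappa>s[OF this] have "\<bar>S i - ?t\<bar> <= w" by (auto simp: S_def algebra_simps abs_le_iff)
    then have "\<bar>F (S i) x - F ?t x\<bar> <= e" using w(1) by (intro dF[OF True Si(1)[OF i] t]) auto
    then have "(norm (u x))\<^sup>2 - e <= F (S i) x" unfolding Fs[OF x] by linarith
    then show ?thesis using \<kappa>0 x by (simp add: I_def mult_left_mono)
   qed (use x in "simp add: I_def")
   then have "(\<Sum>i<n. \<kappa> i ?t * ((norm (u x))\<^sup>2 - e)) <= (\<Sum>i<n. I i x)" by (intro sum_mono) auto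
   then have 1: "T * ((norm (u x))\<^sup>2 - e) <= (\<Sum>i<n. I i x)" by (simp add: T_def sum_distrib_right)
   have 2: "q x <= T * (norm (u x))\<^sup>2"
   proof (cases "x \<in> C'")
    case c: True
    then have "1 - \<delta>/4 <= ?t" "?t <= 1 + \<delta>/4" using inA shell[of "1 - \<delta>/4" "1 + \<delta>/4"] \<delta> by (auto simp: C'_def C_def A_def)
    then have a: "l + w <= ?t" "?t <= h - w" using w by (auto simp: l_def h_def)
    have "(?t - l) / w >= 1" using a w0 by (simp add: pos_le_divide_eq)
    moreover have "?t - l <= real n * w" using a(2) nw by (simp add: algebra_simps)
    then have "(?t - l) / w <= real n" using w0 by (simp add: pos_divide_le_eq)
    ultimately have "T = 1" unfolding Tt \<theta>_def by (simp add: smoothstep(1,2))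
    then show ?thesis using c by (simp add: q_def)
   qed (use T0 in "simp add: q_def")
   have "T * e <= e" using T1 e by (simp add: mult_le_cancel_right2)
   then show ?thesis using 1 2 True by (simp add: right_diff_distrib)
  qed
  have "(LI x. q x - e * indicator (C l h) x) <= (LI x. (\<Sum>i<n. I i x))"
   by (intro integral_mono pt Bochner_Integration.integrable_diff Bochner_Integration.integrable_sum Vi qi) (use Ii in auto)
  then show ?thesis unfolding int0
   using Vi[of e] qi Cl(1) by (simp add: Bochner_Integration.integral_diff V_def)
 qed
 have q0: "(LI x. q x) = 0"
 proof (rule antisym)
  show "(LI x. q x) <= 0"
  proof (rule field_le_epsilon)
   fix \<eta> :: real assume "\<eta> > 0"
   have V: "V >= 0" by (simp add: V_def)
   have "(LI x. q x) <= \<eta> / (V + 1) * V" by (rule est) (use \<open>\<eta> > 0\<close> V in auto)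
   also have "\<dots> <= \<eta>" using \<open>\<eta> > 0\<close> V by (simp add: field_simps)
   finally show "(LI x. q x) <= 0 + \<eta>" by simp
  qed
 qed (auto simp: q_def intro!: Bochner_Integration.integral_nonneg)
 have q_ae: "AE x in lborel. q x = 0"
  using integral_nonneg_eq_0_iff_AE[OF qi] q0 by (auto simp: q_def)
 define O1 where "O1 = N \<inter> \<Psi> -` {z. \<bar>norm z - 1\<bar> < \<delta>/4}"
 have O1: "open O1" unfolding O1_def
  by (rule continuous_open_preimage[OF C1_onD(3)[OF \<Psi>] N(1)]) (intro open_Collect_less continuous_intros)
 have O1C: "x \<in> C'" if "x \<in> O1" for x
 proof -
  have "x \<in> N" "\<bar>norm (\<Psi> x) - 1\<bar> < \<delta>/4" using that unfolding O1_def by blast+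
  then show ?thesis unfolding C'_def by (intro memC) linarith+
 qed
 from q_ae have ae: "AE x in lborel. x \<in> O1 --> u x = 0"
  by eventually_elim (auto simp: q_def dest: O1C)
 have O1U: "O1 \<subseteq> U" using N(2) by (auto simp: O1_def)
 have z: "u x = 0" if "x \<in> O1" for x
  by (rule continuous_AE_eq[OF O1 continuous_on_subset[OF u O1U] continuous_on_const ae that])
 let ?a = "axis 1 1 :: real^3"
 have "Y ?a \<in> O1" using inA[of ?a] \<delta> by (simp add: O1_def)
 then obtain r where "r > 0" "ball (Y ?a) r \<subseteq> O1" using O1 open_contains_ball by blast
 then show ?thesis using z O1U by blast
qed


text \<open>The equations determine \<open>u\<close> up to null sets; hence one clause holds almost
  everywhere and the other pointwise for a continuous field.\<close>

theorem theorem1p2: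
  fixes U S :: "(real^3) set"
    and f :: "real^3 \<Rightarrow> real"
    and u :: "real^3 \<Rightarrow> real^3"
    and \<alpha> c :: real
  assumes "open U" and "connected U"
    and "0 < \<alpha>" and "\<alpha> < 1" and "Ck_Holder_on 2 \<alpha> U f"
    and "regular_level_set U f c"
    and "S \<in> components (level_set U f c)"
    and "Ck_diffeomorphic 1 S (sphere (0 :: real^3) 1)"
    and "locally_integrable_on u U"
    and "has_curl_on u (\<lambda>x. f x *\<^sub>R u x) U"
    and "has_div_on u (\<lambda>x. 0) U"
  shows "(AE x in lebesgue_on U. u x = 0) \<and> (continuous_on U u \<longrightarrow> (\<forall>x\<in>U. u x = 0))"
proof -
 note U = \<open>open U\<close>
 obtain Hf where "(\<forall>x\<in>U. (f has_derivative (%h. grad f x \<bullet> h)) (at x)) \<and>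
  (\<forall>x\<in>U. (grad f has_derivative (%h. Hf x *v h)) (at x)) \<and> continuous_on U Hf"
  using C2_Holder_derivatives[OF U assms(3,5)] by (elim exE)
 then have f: "!!x. x \<in> U ==> (f has_derivative (%h. grad f x \<bullet> h)) (at x)" and Hf: "C1_on U (grad f) Hf"
  unfolding C1_on_def by blast+
 note f' = C1_onD(3)[OF Hf]
 have fc: "continuous_on U f"
  by (rule continuous_at_imp_continuous_on) (use f has_derivative_continuous in blast)
 obtain u1 where u1: "weak_beltrami U f u1" "AE x in lebesgue. x \<in> U --> u x = u1 x"
  by (rule weak_beltramiI[OF U fc assms(9-11)]) (rule that)
 have "\<exists>v. weak_beltrami U f v \<and> continuous_on U v \<and> (AE x in lborel. x \<in> U --> u1 x = v x)"
  by (rule weak_beltrami_continuous[OF u1(1) U f f'])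
 then obtain v where v: "weak_beltrami U f v" "continuous_on U v" "AE x in lborel. x \<in> U --> u1 x = v x"
  by (elim exE conjE)
 have S: "S \<subseteq> U" "!!x. x \<in> S ==> f x = c" "!!x. x \<in> S ==> grad f x ~= 0"
  using in_components_subset[OF assms(7)] assms(6) unfolding level_set_def regular_level_set_def by blast+
 have "\<exists>\<delta> N \<Psi> J Y L. 0 < \<delta> \<and> \<delta> < 1 \<and> open N \<and> N \<subseteq> U \<and> C1_on N \<Psi> J \<and> C1_on {z. \<bar>norm z - 1\<bar> < \<delta>} Y L \<and>
  (\<forall>x\<in>N. \<bar>norm (\<Psi> x) - 1\<bar> < \<delta> \<and> Y (\<Psi> x) = x \<and> norm (\<Psi> x) = 1 + f x - c \<and> (\<forall>h. L (\<Psi> x) *v (J x *v h) = h)) \<and>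
  (\<forall>z. \<bar>norm z - 1\<bar> < \<delta> --> Y z \<in> N \<and> \<Psi> (Y z) = z)"
  by (rule level_collar[OF U f Hf S assms(8)])
 then obtain \<delta> N \<Psi> J Y L where collar: "0 < \<delta>" "\<delta> < 1" "open N" "N \<subseteq> U" "C1_on N \<Psi> J" "C1_on {z. \<bar>norm z - 1\<bar> < \<delta>} Y L"
  "\<forall>x\<in>N. \<bar>norm (\<Psi> x) - 1\<bar> < \<delta> \<and> Y (\<Psi> x) = x \<and> norm (\<Psi> x) = 1 + f x - c \<and> (\<forall>h. L (\<Psi> x) *v (J x *v h) = h)"
  "\<forall>z. \<bar>norm z - 1\<bar> < \<delta> --> Y z \<in> N \<and> \<Psi> (Y z) = z"
  by (elim exE conjE)
 have "\<exists>a r. r > 0 \<and> ball a r \<subseteq> U \<and> (\<forall>x\<in>ball a r. v x = 0)"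
  by (rule collar_vanishing[OF v(1) U f f' v(2) collar(1-6) bspec[OF collar(7)] collar(8)[rule_format]])
 then obtain a r where ar: "r > 0" "ball a r \<subseteq> U" "\<forall>x\<in>ball a r. v x = 0" by (elim exE conjE)
 have v0: "v x = 0" if "x \<in> U" for x
  by (rule unique_continuation[OF v(1) U assms(2) fc v(2) ar(2,1) bspec[OF ar(3)] that])
 have "AE x in lborel. x \<in> U --> u x = u1 x" using u1(2) by (simp only: AE_completion_iff)
 with v(3) have ae: "AE x in lborel. x \<in> U --> u x = 0"
  by eventually_elim (use v0 in auto)
 have "AE x in lebesgue_on U. u x = 0"
 proof (subst AE_restrict_space_iff)
  show "U \<inter> space lebesgue \<in> sets lebesgue" using U by (simp add: borel_open)
  show "AE x in lebesgue. x \<in> U --> u x = 0" using ae by (simp only: AE_completion_iff)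
 qed
 moreover have "u x = 0" if "continuous_on U u" "x \<in> U" for x
  by (rule continuous_AE_eq[OF U that(1) continuous_on_const ae that(2)])
 ultimately show ?thesis by blast
qed

end
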